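(* Let $\kappa>0$, $\beta\in(0,1)$ and $\alpha\in(\beta,1]$ be constants. Suppose $\lambda_j=j^{-\kappa}$ for $j=1,\dots,N$, that $p,n,N\to\infty$ with $p\le N$, $p/N\to\alpha$ and $n/N\to\beta$, and that there is no noise ($\sigma^2=0$). For $z\le 0$ let $m_\kappa(z)$ be the smallest positive solution $m$ of $$-z=\frac1m-\frac1\beta\int_{\alpha^{-\kappa}}^\infty\frac{1}{\kappa\,t^{1/\kappa}(1+t\,m)}\,dt,$$ and let $m_\kappa'$ denote the derivative of $m_\kappa$. Then $m_\kappa$ and $m_\kappa'$ are well-defined and positive at $z=0$. Moreover, $$\mathbb E_\theta[\mathrm{Error}]\ \xrightarrow{\ \mathrm p\ }\ \mathcal R_\kappa(\alpha):=N^{1-\kappa}\left(\frac{\beta}{m_\kappa(0)}+\int_\alpha^1t^{-\kappa}\,dt\cdot\frac{m_\kappa'(0)}{m_\kappa(0)^2}\right).$$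
   Context: Data model. For each $N$, let $\Sigma=\mathrm{diag}(\lambda_1,\dots,\lambda_N)$ with $\lambda_1>\dots>\lambda_N>0$. The data $(x_1,y_1),\dots,(x_n,y_n)\in\mathbb R^N\times\mathbb R$ are i.i.d. (given $\theta$) with $x_i\sim\mathcal N(0,\Sigma)$ and $y_i=x_i^\top\theta+w_i$, where the $w_i$ are i.i.d. $\mathcal N(0,\sigma^2)$, independent of the $x_i$. The coefficient vector $\theta\in\mathbb R^N$ is random, independent of everything else, with $\mathbb E[\theta]=0$ and $\mathbb E[\theta\theta^\top]=I$. Estimator. Let $X=[x_1|\cdots|x_n]^\top\in\mathbb R^{n\times N}$, $y=(y_1,\dots,y_n)^\top$. For $1\le p\le N$, let $X_P\in\mathbb R^{n\times p}$ be the first $p$ columns of $X$; for a vector $v\in\mathbb R^N$, $v_P\in\mathbb R^p$ denotes its first $p$ entries and $v_{P^c}$ its last $N-p$ entries. The estimator $\hat\theta\in\mathbb R^N$ is defined by $\hat\theta_P=(X_P^\top X_P)^{-1}X_P^\top y$ if $p\le n$, $\hat\theta_P=X_P^\top(X_PX_P^\top)^{-1}y$ if $p>n$, and $\hat\theta_{P^c}=0$ (the inverses exist almost surely). Error. $\mathrm{Error}:=\mathbb E_{x,y}[(y-x^\top\hat\theta)^2]$, where $(x,y)$ is an independent copy of $(x_1,y_1)$ (with the same $\theta$). $\mathbb E_\theta[\mathrm{Error}]$ is the expectation over $\theta$ conditional on $X$ (here there is no noise), so it is a random variable depending on $X$. Convergence notation. $A\xrightarrow{\mathrm p}B$ means $A=B+o_{\mathrm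 p}(B)$ as $n,p,N\to\infty$ (i.e. $A/B\to1$ in probability). Since $m_\kappa$ is defined for $z\le0$, $m_\kappa'(0)$ may be read as the one-sided derivative at $0$. The function $m_\kappa$ depends on $\alpha$ and $\beta$. *)

theory Defs
  imports "HOL-Probability.Probability" "Jordan_Normal_Form.Gauss_Jordan_Elimination"
begin

text \<open>
  A vector in \<open>\<real>\<^sup>N\<close> is a function in \<open>{..<N} \<rightarrow>\<^sub>E UNIV\<close>, the carrier of the finite product
  measure \<open>euc N\<close>.  All indices start at 0, so entry \<open>j\<close> here is entry \<open>j + 1\<close> in the usual
  one-based numbering.
\<close>

abbreviation euc :: "nat \<Rightarrow> (nat \<Rightarrow> real) measure" where
  "euc N \<equiv> Pi\<^sub>M {..<N} (\<lambda>_. borel)"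

text \<open>
  The second parameter is the standard deviation; the degenerate case has to be singled out
  because \<^term>\<open>normal_density mu 0\<close> is not a probability density.
\<close>

definition normal_law :: "real \<Rightarrow> real \<Rightarrow> real measure" where
  "normal_law mu sd =
     (if sd = 0 then return borel mu else density lborel (normal_density mu sd))"

text \<open>The centred Gaussian law with covariance matrix \<open>diag(lam 0, \<dots>, lam (N - 1))\<close>.\<close>

definition gauss_diag :: "nat \<Rightarrow> (nat \<Rightarrow> real) \<Rightarrow> (nat \<Rightarrow> real) measure" where
  "gauss_diag N lam = Pi\<^sub>M {..<N} (\<lambda>j. normal_law 0 (sqrt (lam j)))"

definition design_rv ::
    "nat \<Rightarrow> (nat \<Rightarrow> 'a \<Rightarrow> nat \<Rightarrow> real) \<Rightarrow> 'a \<Rightarrow> nat \<Rightarrow> nat \<Rightarrow> real" where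
  "design_rv n x \<omega> = (\<lambda>i\<in>{..<n}. x i \<omega>)"

definition noise_rv :: "nat \<Rightarrow> (nat \<Rightarrow> 'a \<Rightarrow> real) \<Rightarrow> 'a \<Rightarrow> nat \<Rightarrow> real" where
  "noise_rv n w \<omega> = (\<lambda>i\<in>{..<n}. w i \<omega>)"

text \<open>\<^const>\<open>prob_space.indep_var\<close> requires both variables to have the same type.\<close>

definition (in prob_space) indep_pair ::
    "'b measure \<Rightarrow> ('a \<Rightarrow> 'b) \<Rightarrow> 'c measure \<Rightarrow> ('a \<Rightarrow> 'c) \<Rightarrow> bool" where
  "indep_pair S X T Y \<longleftrightarrow>
     random_variable S X \<and> random_variable T Y \<and>
     indep_set {X -` A \<inter> space M | A. A \<in> sets S} {Y -` B \<inter> space M | B. B \<in> sets T}"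

locale pcr_model = prob_space M
  for M :: "'a measure" +
  fixes N n :: nat
    and lam :: "nat \<Rightarrow> real"
    and sd :: real
    and x :: "nat \<Rightarrow> 'a \<Rightarrow> nat \<Rightarrow> real"
    and w :: "nat \<Rightarrow> 'a \<Rightarrow> real"
    and theta :: "'a \<Rightarrow> nat \<Rightarrow> real"
  assumes lam_pos: "\<And>j. j < N \<Longrightarrow> 0 < lam j"
    and lam_decreasing: "\<And>i j. i < j \<Longrightarrow> j < N \<Longrightarrow> lam j < lam i"
    and sd_nonneg: "0 \<le> sd"
    and x_indep: "indep_vars (\<lambda>_. euc N) x {..<n}"
    and x_law: "\<And>i. i < n \<Longrightarrow> distr M (euc N) (x i) = gauss_diag N lam"
    and w_indep: "indep_vars (\<lambda>_. borel) w {..<n}"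
    and w_law: "\<And>i. i < n \<Longrightarrow> distr M borel (w i) = normal_law 0 sd"
    and x_w_indep:
      "indep_pair (Pi\<^sub>M {..<n} (\<lambda>_. euc N)) (design_rv n x) (Pi\<^sub>M {..<n} (\<lambda>_. borel)) (noise_rv n w)"
    and theta_indep:
      "indep_pair (euc N) theta
         (Pi\<^sub>M {..<n} (\<lambda>_. euc N) \<Otimes>\<^sub>M Pi\<^sub>M {..<n} (\<lambda>_. borel))
         (\<lambda>\<omega>. (design_rv n x \<omega>, noise_rv n w \<omega>))"
    and theta_mean: "\<And>j. j < N \<Longrightarrow> has_bochner_integral M (\<lambda>\<omega>. theta \<omega> j) 0"
    and theta_cov: "\<And>i j. i < N \<Longrightarrow> j < N \<Longrightarrow>
      has_bochner_integral M (\<lambda>\<omega>. theta \<omega> i * theta \<omega> j) (if i = j then 1 else 0)"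

definition inner_N :: "nat \<Rightarrow> (nat \<Rightarrow> real) \<Rightarrow> (nat \<Rightarrow> real) \<Rightarrow> real" where
  "inner_N N u v = (\<Sum>j<N. u j * v j)"

definition response ::
    "nat \<Rightarrow> (nat \<Rightarrow> 'a \<Rightarrow> nat \<Rightarrow> real) \<Rightarrow> (nat \<Rightarrow> 'a \<Rightarrow> real) \<Rightarrow> ('a \<Rightarrow> nat \<Rightarrow> real)
      \<Rightarrow> 'a \<Rightarrow> nat \<Rightarrow> real" where
  "response N x w theta \<omega> i = inner_N N (x i \<omega>) (theta \<omega>) + w i \<omega>"

text \<open>The value on singular matrices is immaterial: they occur below with probability 0 only.\<close>

definition inv_mat :: "real Matrix.mat \<Rightarrow> real Matrix.mat" where
  "inv_mat A = (case mat_inverse A of Some B \<Rightarrow> B | None \<Rightarrow> 0\<^sub>m (dim_row A) (dim_row A))"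

definition ls_coef :: "nat \<Rightarrow> nat \<Rightarrow> real Matrix.mat \<Rightarrow> real Matrix.vec \<Rightarrow> real Matrix.vec" where
  "ls_coef n p A b =
     (if p \<le> n then (inv_mat (transpose_mat A * A) * transpose_mat A) *\<^sub>v b
      else (transpose_mat A * inv_mat (A * transpose_mat A)) *\<^sub>v b)"

text \<open>\<open>X\<close> is the full design; only its first \<open>p\<close> columns enter.\<close>

definition pcr_estimator ::
    "nat \<Rightarrow> nat \<Rightarrow> (nat \<Rightarrow> nat \<Rightarrow> real) \<Rightarrow> (nat \<Rightarrow> real) \<Rightarrow> nat \<Rightarrow> real" where
  "pcr_estimator n p X y j =
     (if j < p then vec_index (ls_coef n p (Matrix.mat n p (\<lambda>(i, j). X i j)) (Matrix.vec n y)) j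
      else 0)"

text \<open>
  The mean squared error of the predictor \<open>t'\<close> on a fresh pair \<open>(x, x \<bullet> t + w)\<close>, with \<open>t\<close>
  and \<open>t'\<close> held fixed.
\<close>

definition prediction_error ::
    "nat \<Rightarrow> (nat \<Rightarrow> real) \<Rightarrow> real \<Rightarrow> (nat \<Rightarrow> real) \<Rightarrow> (nat \<Rightarrow> real) \<Rightarrow> real" where
  "prediction_error N lam sd t t' =
     (\<integral>(x, w). ((inner_N N x t + w) - inner_N N x t')\<^sup>2
        \<partial>(gauss_diag N lam \<Otimes>\<^sub>M normal_law 0 sd))"

definition pcr_error ::
    "nat \<Rightarrow> nat \<Rightarrow> nat \<Rightarrow> (nat \<Rightarrow> real) \<Rightarrow> real \<Rightarrow> (nat \<Rightarrow> 'a \<Rightarrow> nat \<Rightarrow> real)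
      \<Rightarrow> (nat \<Rightarrow> 'a \<Rightarrow> real) \<Rightarrow> ('a \<Rightarrow> nat \<Rightarrow> real) \<Rightarrow> 'a \<Rightarrow> real" where
  "pcr_error N n p lam sd x w theta \<omega> =
     prediction_error N lam sd (theta \<omega>)
       (pcr_estimator n p (\<lambda>i. x i \<omega>) (response N x w theta \<omega>))"

text \<open>
  The error conditional on the sigma-algebra generated by the design.  For a nonnegative
  measurable function, \<^const>\<open>real_cond_exp\<close> is the conditional expectation in the extended
  sense, so the error need not have a finite unconditional mean.
\<close>

definition expected_error ::
    "'a measure \<Rightarrow> nat \<Rightarrow> nat \<Rightarrow> nat \<Rightarrow> (nat \<Rightarrow> real) \<Rightarrow> real \<Rightarrow> (nat \<Rightarrow> 'a \<Rightarrow> nat \<Rightarrow> real)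
      \<Rightarrow> (nat \<Rightarrow> 'a \<Rightarrow> real) \<Rightarrow> ('a \<Rightarrow> nat \<Rightarrow> real) \<Rightarrow> 'a \<Rightarrow> real" where
  "expected_error M N n p lam sd x w theta =
     real_cond_exp M
       (vimage_algebra (space M) (design_rv n x) (Pi\<^sub>M {..<n} (\<lambda>_. euc N)))
       (pcr_error N n p lam sd x w theta)"

definition m_kappa_eq :: "real \<Rightarrow> real \<Rightarrow> real \<Rightarrow> real \<Rightarrow> real \<Rightarrow> bool" where
  "m_kappa_eq \<kappa> \<alpha> \<beta> z m \<longleftrightarrow>
     - z = 1 / m - 1 / \<beta> *
       (LINT t:{\<alpha> powr (- \<kappa>)..}|lborel. 1 / (\<kappa> * t powr (1 / \<kappa>) * (1 + t * m)))"

definition is_m_kappa :: "real \<Rightarrow> real \<Rightarrow> real \<Rightarrow> real \<Rightarrow> real \<Rightarrow> bool" where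
  "is_m_kappa \<kappa> \<alpha> \<beta> z m \<longleftrightarrow>
     0 < m \<and> m_kappa_eq \<kappa> \<alpha> \<beta> z m \<and> (\<forall>m'. 0 < m' \<and> m_kappa_eq \<kappa> \<alpha> \<beta> z m' \<longrightarrow> m \<le> m')"

definition m_kappa :: "real \<Rightarrow> real \<Rightarrow> real \<Rightarrow> real \<Rightarrow> real" where
  "m_kappa \<kappa> \<alpha> \<beta> z = (THE m. is_m_kappa \<kappa> \<alpha> \<beta> z m)"

text \<open>\<^const>\<open>m_kappa\<close> is meaningful on \<open>{..0}\<close>, hence the one-sided derivative at 0.\<close>

definition m_kappa_deriv :: "real \<Rightarrow> real \<Rightarrow> real \<Rightarrow> real \<Rightarrow> real" where
  "m_kappa_deriv \<kappa> \<alpha> \<beta> z = vector_derivative (m_kappa \<kappa> \<alpha> \<beta>) (at z within {..0})"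

definition risk_limit :: "real \<Rightarrow> real \<Rightarrow> real \<Rightarrow> nat \<Rightarrow> real" where
  "risk_limit \<kappa> \<alpha> \<beta> N =
     real N powr (1 - \<kappa>) *
       (\<beta> / m_kappa \<kappa> \<alpha> \<beta> 0
        + (LINT t:{\<alpha>..1}|lborel. t powr (- \<kappa>))
          * (m_kappa_deriv \<kappa> \<alpha> \<beta> 0 / (m_kappa \<kappa> \<alpha> \<beta> 0)\<^sup>2))"

text \<open>
  Equivalence in probability, \<open>A k / B k \<rightarrow> 1\<close>, where each \<open>A k\<close> lives on its own probability
  space \<open>M k\<close>.
\<close>

definition equiv_in_prob ::
    "(nat \<Rightarrow> 'a measure) \<Rightarrow> (nat \<Rightarrow> 'a \<Rightarrow> real) \<Rightarrow> (nat \<Rightarrow> real) \<Rightarrow> bool" where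
  "equiv_in_prob M A B \<longleftrightarrow>
     (\<forall>\<epsilon>>0. (\<lambda>k. measure (M k) {\<omega> \<in> space (M k). \<bar>A k \<omega> / B k - 1\<bar> > \<epsilon>}) \<longlonglongrightarrow> 0)"

end

theory Submission
  imports Defs "Jordan_Normal_Form.Determinant"
begin

text \<open>For \<open>n < p\<close> and no noise the estimator is \<open>\<Pi> \<theta>\<close> with \<open>\<Pi>\<close> depending on the design only, so the error
  averaged over \<open>\<theta>\<close> is a function of the design.  Up to the factor \<open>N powr (1 - \<kappa>)\<close> it equals
  \<open>(1 / N) * (\<Sum>j<p. w j * (1 - w j * y j j)) + (1 / N) * (\<Sum>j\<in>{p..<N}. w j * (1 + z j \<bullet> B (z j)))\<close>, where
  \<open>w j = ((j + 1) / N) powr - \<kappa>\<close>, the \<open>z j\<close> are standard Gaussian columns, \<open>R\<close> is the inverse of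
  \<open>(\<Sum>j<p. w j * z j (z j)\<^sup>T)\<close>, \<open>y j l = z j \<bullet> R (z l)\<close> and \<open>B = R (\<Sum>i<p. (w i)\<^sup>2 * z i (z i)\<^sup>T) R\<close>.

  With a small ridge \<open>\<rho>\<close> added, Gaussian integration by parts bounds the mean of \<open>tr R\<close> and of
  \<open>tr R\<^sup>2\<close> uniformly in \<open>\<rho>\<close>.  Replacing \<open>R\<close> by the resolvent without column \<open>j\<close> (Sherman--Morrison)
  turns \<open>y j j\<close> into \<open>q / (1 + w j * q)\<close> with a quadratic form \<open>q\<close> close to its conditional mean,
  the trace; hence \<open>tr R\<close> nearly solves \<open>n = (\<Sum>j<p. w j * u / (1 + w j * u))\<close> and converges to the
  solution \<open>m_kappa 0\<close> of the limiting equation.  The trace of \<open>B\<close> is minus the derivative of \<open>tr R\<close>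
  in the direction \<open>(w j)\<^sup>2\<close> of the weights.  As \<open>tr R\<close> is convex in the weights, convergence of the
  traces for all nearby weights forces convergence of this derivative.  The columns \<open>j \<ge> p\<close> are
  independent of \<open>B\<close>, so their quadratic forms average to \<open>tr B\<close>.  Since the bounds do not depend on
  \<open>\<rho>\<close>, the ridge may tend to 0 arbitrarily fast along the sequence.\<close>

section \<open>Resolvents of weighted Gram matrices\<close>

text \<open>Two obstacles shape the proof: the smallest eigenvalue of the Gram matrix has no
  convenient lower bound, and the weights \<open>w j\<close> are unbounded near
  \<open>j = 0\<close>. Against the first, only means are used. The surplus \<open>p - n\<close> is
  of order \<open>N\<close>, and integration by parts turns it into bounds of order 1 for the mean
  of \<open>tr R\<close> and of order \<open>1 / N\<close> for that of the squared Frobenius norm,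
  which drives all error terms. The ridge makes the entries of \<open>R\<close> bounded, so that
  every integration by parts is legitimate. Against the second, the columns with
  \<open>(j + 1) / N < e\<close> form a head of at most \<open>e * N\<close> columns, treated by
  bounds that do not involve the size of the weight: \<open>w * u / (1 + w * u) \<le> 1\<close>,
  \<open>w / (1 + w * q) \<le> 1 / q\<close>,
  \<open>w\<^sup>2 * r / (1 + w * q)\<^sup>2 \<le> r / q\<^sup>2\<close>. Since a tangent of a
  convex function lies below it, upper bounds for the perturbed traces suffice: lowered weights
  bound \<open>tr B\<close> from above, raised weights from below. The ridge is chosen last, because
  the passage to ridge 0 holds for each problem size separately and comes without a rate.\<close>

abbreviation ip :: "nat \<Rightarrow> (nat \<Rightarrow> real) \<Rightarrow> (nat \<Rightarrow> real) \<Rightarrow> real" where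
  "ip \<equiv> inner_N"

text \<open>Matrices are plain functions because measurability, derivatives and continuity are all
  needed entry by entry. Only entries with indices below \<open>n\<close> matter.\<close>

definition mv :: "nat \<Rightarrow> (nat \<Rightarrow> nat \<Rightarrow> real) \<Rightarrow> (nat \<Rightarrow> real) \<Rightarrow> nat \<Rightarrow> real" where
  "mv n A v a = (\<Sum>b<n. A a b * v b)"

definition psd :: "nat \<Rightarrow> (nat \<Rightarrow> nat \<Rightarrow> real) \<Rightarrow> bool" where
  "psd n A \<longleftrightarrow> (\<forall>a<n. \<forall>b<n. A a b = A b a) \<and> (\<forall>v. 0 \<le> ip n v (mv n A v))"

definition trc :: "nat \<Rightarrow> (nat \<Rightarrow> nat \<Rightarrow> real) \<Rightarrow> real" where
  "trc n A = (\<Sum>a<n. A a a)"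

definition frob :: "nat \<Rightarrow> (nat \<Rightarrow> nat \<Rightarrow> real) \<Rightarrow> real" where
  "frob n A = (\<Sum>a<n. \<Sum>b<n. (A a b)\<^sup>2)"

lemma ip_commute: "ip n u v = ip n v u"
  by (simp add: inner_N_def mult.commute)

lemma ip_add_right: "ip n u (\<lambda>a. v a + w a) = ip n u v + ip n u w"
  by (simp add: inner_N_def algebra_simps sum.distrib)

lemma ip_diff_right: "ip n u (\<lambda>a. v a - w a) = ip n u v - ip n u w"
  by (simp add: inner_N_def algebra_simps sum_subtractf)

lemma ip_scale_right: "ip n u (\<lambda>a. c * v a) = c * ip n u v"
  by (simp add: inner_N_def sum_distrib_left algebra_simps)

lemma ip_add_left: "ip n (\<lambda>a. v a + w a) u = ip n v u + ip n w u"
  by (metis ip_commute ip_add_right)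

lemma ip_diff_left: "ip n (\<lambda>a. v a - w a) u = ip n v u - ip n w u"
  by (metis ip_commute ip_diff_right)

lemma ip_scale_left: "ip n (\<lambda>a. c * v a) u = c * ip n v u"
  by (metis ip_commute ip_scale_right)

lemma ip_nonneg: "0 \<le> ip n u u"
  by (simp add: inner_N_def sum_nonneg)

lemma ip_cong: "(\<And>a. a < n \<Longrightarrow> u a = u' a) \<Longrightarrow> (\<And>a. a < n \<Longrightarrow> v a = v' a) \<Longrightarrow> ip n u v = ip n u' v'"
  by (simp add: inner_N_def)

lemma ip_unit: "a < n \<Longrightarrow> ip n (\<lambda>b. if a = b then 1 else 0) u = u a"
  by (simp add: inner_N_def if_distrib if_distribR sum.delta cong: if_cong)

lemma mv_add: "mv n A (\<lambda>a. v a + w a) = (\<lambda>a. mv n A v a + mv n A w a)"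
  by (simp add: mv_def fun_eq_iff algebra_simps sum.distrib)

lemma mv_scale: "mv n A (\<lambda>a. c * v a) = (\<lambda>a. c * mv n A v a)"
  by (simp add: mv_def fun_eq_iff algebra_simps sum_distrib_left)

lemma mv_diff: "mv n A (\<lambda>a. v a - w a) = (\<lambda>a. mv n A v a - mv n A w a)"
  by (simp add: mv_def fun_eq_iff algebra_simps sum_subtractf)

lemma mv_unit: "a < n \<Longrightarrow> mv n A (\<lambda>b. if a = b then 1 else 0) = (\<lambda>c. A c a)"
  by (simp add: mv_def fun_eq_iff if_distrib sum.delta cong: if_cong)

lemma mv_cong: "(\<And>b. b < n \<Longrightarrow> v b = v' b) \<Longrightarrow> mv n A v = mv n A v'"
  by (simp add: mv_def fun_eq_iff)

section \<open>Positive semidefinite forms\<close>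

lemma psd_sym: "psd n A \<Longrightarrow> a < n \<Longrightarrow> b < n \<Longrightarrow> A a b = A b a"
  by (simp add: psd_def)

lemma psd_nonneg: "psd n A \<Longrightarrow> 0 \<le> ip n v (mv n A v)"
  by (simp add: psd_def)

lemma ip_mv_sym:
  assumes "\<And>a b. a < n \<Longrightarrow> b < n \<Longrightarrow> A a b = A b a"
  shows "ip n u (mv n A v) = ip n (mv n A u) v"
proof -
  have "ip n u (mv n A v) = (\<Sum>a<n. \<Sum>b<n. u a * (A a b * v b))"
    by (simp add: inner_N_def mv_def sum_distrib_left)
  also have "\<dots> = (\<Sum>b<n. \<Sum>a<n. u a * (A a b * v b))" by (rule sum.swap)
  also have "\<dots> = (\<Sum>b<n. \<Sum>a<n. A b a * u a * v b)"
    by (intro sum.cong refl) (simp add: assms mult_ac)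
  finally show ?thesis by (simp add: inner_N_def mv_def sum_distrib_right)
qed

lemma psd_ip_mv: "psd n A \<Longrightarrow> ip n u (mv n A v) = ip n (mv n A u) v"
  by (rule ip_mv_sym) (rule psd_sym)

lemma quadratic_nonneg_disc:
  fixes a b c :: real
  assumes "\<And>t. 0 \<le> a + 2 * t * b + t\<^sup>2 * c" "0 \<le> c"
  shows "b\<^sup>2 \<le> a * c"
proof (cases "c = 0")
  case True
  have "b = 0"
  proof (rule ccontr)
    assume b: "b \<noteq> 0"
    \<comment> \<open>At this argument the affine function takes the value
      \<open>-1\<close>.\<close>
    have "0 \<le> a + 2 * (- (a + 1) / (2 * b)) * b" using assms(1)[of "- (a + 1) / (2 * b)"] True by simp
    with b show False by (simp add: field_simps)
  qed
  then show ?thesis using True by simp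
next
  case False
  with assms have c: "c > 0" by simp
  \<comment> \<open>The minimiser of the quadratic.\<close>
  have "0 \<le> a + 2 * (- b / c) * b + (- b / c)\<^sup>2 * c" by (rule assms)
  also have "\<dots> = (a * c - b\<^sup>2) / c" using c by (simp add: field_simps power2_eq_square)
  finally show ?thesis using c by (simp add: zero_le_divide_iff)
qed

lemma psd_cauchy:
  assumes "psd n A"
  shows "(ip n u (mv n A v))\<^sup>2 \<le> ip n u (mv n A u) * ip n v (mv n A v)"
proof (rule quadratic_nonneg_disc)
  fix t
  have "0 \<le> ip n (\<lambda>a. u a + t * v a) (mv n A (\<lambda>a. u a + t * v a))"
    by (rule psd_nonneg[OF assms])
  also have "\<dots> = ip n u (mv n A u) + t * ip n u (mv n A v) + (t * ip n v (mv n A u) + t * (t * ip n v (mv n A v)))"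
    by (simp add: mv_add mv_scale ip_add_right ip_add_left ip_scale_right ip_scale_left algebra_simps)
  also have "ip n v (mv n A u) = ip n u (mv n A v)"
    by (metis assms ip_commute psd_ip_mv)
  finally show "0 \<le> ip n u (mv n A u) + 2 * t * ip n u (mv n A v) + t\<^sup>2 * ip n v (mv n A v)"
    by (simp add: algebra_simps power2_eq_square)
qed (rule psd_nonneg[OF assms])

text \<open>Cauchy-Schwarz with a basis vector as first argument; summed over \<open>a\<close> it
  bounds the norm of \<open>A v\<close> by the trace.\<close>

lemma psd_entry_mv:
  assumes "psd n A" "a < n"
  shows "(mv n A v a)\<^sup>2 \<le> A a a * ip n v (mv n A v)"
proof -
  have "(ip n (\<lambda>b. if a = b then 1 else 0) (mv n A v))\<^sup>2
      \<le> ip n (\<lambda>b. if a = b then 1 else 0) (mv n A (\<lambda>b. if a = b then 1 else 0)) * ip n v (mv n A v)"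
    by (rule psd_cauchy[OF assms(1)])
  then show ?thesis using assms(2) by (simp add: ip_unit mv_unit)
qed

lemma psd_diag_nonneg: "psd n A \<Longrightarrow> a < n \<Longrightarrow> 0 \<le> A a a"
  using psd_nonneg[of n A "\<lambda>b. if a = b then 1 else 0"] by (simp add: ip_unit mv_unit)

lemma psd_entry_sq: "psd n A \<Longrightarrow> a < n \<Longrightarrow> b < n \<Longrightarrow> (A a b)\<^sup>2 \<le> A a a * A b b"
  using psd_entry_mv[of n A a "\<lambda>c. if b = c then 1 else 0"] by (simp add: ip_unit mv_unit)

lemma trc_nonneg: "psd n A \<Longrightarrow> 0 \<le> trc n A"
  unfolding trc_def by (rule sum_nonneg) (simp add: psd_diag_nonneg)

lemma frob_nonneg: "0 \<le> frob n A"
  unfolding frob_def by (intro sum_nonneg) simp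

lemma psd_diag_le_trc: assumes "psd n A" "a < n" shows "A a a \<le> trc n A"
  unfolding trc_def by (rule member_le_sum[of a]) (use assms psd_diag_nonneg[OF assms(1)] in auto)

lemma frob_le_trc: assumes "psd n A" shows "frob n A \<le> (trc n A)\<^sup>2"
proof -
  have "frob n A \<le> (\<Sum>a<n. \<Sum>b<n. A a a * A b b)"
    unfolding frob_def by (intro sum_mono) (simp add: psd_entry_sq[OF assms])
  also have "\<dots> = (trc n A)\<^sup>2" by (simp add: trc_def power2_eq_square sum_product)
  finally show ?thesis .
qed

lemma psd_entry_le_trc: assumes "psd n A" "a < n" "b < n" shows "\<bar>A a b\<bar> \<le> trc n A"
proof -
  have "(A a b)\<^sup>2 \<le> A a a * A b b" by (rule psd_entry_sq[OF assms])
  also have "\<dots> \<le> trc n A * trc n A"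
    by (intro mult_mono psd_diag_le_trc psd_diag_nonneg[OF assms(1)] trc_nonneg assms)
  finally show ?thesis
    by (metis abs_le_square_iff abs_of_nonneg assms(1) power2_eq_square trc_nonneg)
qed

text \<open>The trace stands in for the largest eigenvalue. Applied to an eigenvector of a ridge
  resolvent, the estimate becomes a lower bound for the trace.\<close>

lemma mv_norm_le:
  assumes "psd n A"
  shows "ip n (mv n A v) (mv n A v) \<le> trc n A * ip n v (mv n A v)"
proof -
  have "ip n (mv n A v) (mv n A v) \<le> (\<Sum>a<n. A a a * ip n v (mv n A v))"
    unfolding inner_N_def[of n "mv n A v" "mv n A v"]
    using psd_entry_mv[OF assms] by (intro sum_mono) (simp add: power2_eq_square)
  then show ?thesis by (simp add: trc_def sum_distrib_right)
qed

text \<open>\<open>R\<close> is the inverse of the \<open>n \<times> n\<close> matrix \<open>\<rho> I + (\<Sum>j\<in>J. w j * z j (z j)\<^sup>T)\<close>, extended by 0.\<close>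

definition is_res :: "nat \<Rightarrow> real \<Rightarrow> (nat \<Rightarrow> real) \<Rightarrow> nat set \<Rightarrow> (nat \<Rightarrow> nat \<Rightarrow> real)
    \<Rightarrow> (nat \<Rightarrow> nat \<Rightarrow> real) \<Rightarrow> bool" where
  "is_res n \<rho> w J z R \<longleftrightarrow>
     (\<forall>a<n. \<forall>b<n. R a b = R b a) \<and>
     (\<forall>a b. a \<ge> n \<or> b \<ge> n \<longrightarrow> R a b = 0) \<and>
     (\<forall>a<n. \<forall>b<n. \<rho> * R a b + (\<Sum>j\<in>J. w j * z j a * mv n R (z j) b) = (if a = b then 1 else 0))"

text \<open>The bilinear form of the matrix that \<open>is_res\<close> inverts. Resolvents are
  compared through it instead of by matrix algebra: \<open>gform_res\<close> says that the form and
  \<open>R\<close> are inverse to each other.\<close>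

definition gform :: "nat \<Rightarrow> real \<Rightarrow> (nat \<Rightarrow> real) \<Rightarrow> nat set \<Rightarrow> (nat \<Rightarrow> nat \<Rightarrow> real)
    \<Rightarrow> (nat \<Rightarrow> real) \<Rightarrow> (nat \<Rightarrow> real) \<Rightarrow> real" where
  "gform n \<rho> w J z x y = \<rho> * ip n x y + (\<Sum>j\<in>J. w j * ip n (z j) x * ip n (z j) y)"

lemma is_res_sym: "is_res n \<rho> w J z R \<Longrightarrow> a < n \<Longrightarrow> b < n \<Longrightarrow> R a b = R b a"
  by (simp add: is_res_def)

lemma is_res_mv:
  assumes R: "is_res n \<rho> w J z R" and a: "a < n"
  shows "\<rho> * mv n R v a + (\<Sum>j\<in>J. w j * z j a * ip n (z j) (mv n R v)) = v a"
proof -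
  have "v a = (\<Sum>b<n. (if a = b then 1 else 0) * v b)"
    using a by (simp add: if_distrib sum.delta if_distribR cong: if_cong)
  also have "\<dots> = (\<Sum>b<n. (\<rho> * R a b + (\<Sum>j\<in>J. w j * z j a * mv n R (z j) b)) * v b)"
    using R a by (intro sum.cong) (auto simp: is_res_def)
  also have "\<dots> = \<rho> * mv n R v a + (\<Sum>b<n. \<Sum>j\<in>J. w j * z j a * mv n R (z j) b * v b)"
    by (simp add: algebra_simps sum.distrib sum_distrib_left sum_distrib_right mv_def)
  also have "(\<Sum>b<n. \<Sum>j\<in>J. w j * z j a * mv n R (z j) b * v b)
      = (\<Sum>j\<in>J. w j * z j a * ip n (mv n R (z j)) v)"
    by (subst sum.swap) (simp add: inner_N_def sum_distrib_left mult_ac)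
  also have "\<dots> = (\<Sum>j\<in>J. w j * z j a * ip n (z j) (mv n R v))"
    using ip_mv_sym[of n R] is_res_sym[OF R] by simp
  finally show ?thesis by simp
qed

lemma gform_res:
  assumes R: "is_res n \<rho> w J z R"
  shows "gform n \<rho> w J z x (mv n R v) = ip n x v"
proof -
  have "ip n x v = (\<Sum>a<n. x a * (\<rho> * mv n R v a + (\<Sum>j\<in>J. w j * z j a * ip n (z j) (mv n R v))))"
    unfolding inner_N_def[of n x v] using is_res_mv[OF R] by (intro sum.cong) auto
  also have "\<dots> = \<rho> * ip n x (mv n R v) + (\<Sum>a<n. \<Sum>j\<in>J. x a * (w j * z j a * ip n (z j) (mv n R v)))"
    by (simp add: distrib_left sum.distrib sum_distrib_left inner_N_def[of n x] mult_ac)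
  also have "(\<Sum>a<n. \<Sum>j\<in>J. x a * (w j * z j a * ip n (z j) (mv n R v)))
      = (\<Sum>j\<in>J. w j * ip n (z j) x * ip n (z j) (mv n R v))"
    by (subst sum.swap) (simp add: inner_N_def[of n "z _" x] sum_distrib_left sum_distrib_right mult_ac)
  finally show ?thesis by (simp add: gform_def)
qed

lemma gform_commute: "gform n \<rho> w J z x y = gform n \<rho> w J z y x"
  by (simp add: gform_def ip_commute mult_ac)

lemma gform_nonneg: "0 \<le> \<rho> \<Longrightarrow> (\<And>j. j \<in> J \<Longrightarrow> 0 \<le> w j) \<Longrightarrow> 0 \<le> gform n \<rho> w J z x x"
  unfolding gform_def mult.assoc
  by (intro add_nonneg_nonneg mult_nonneg_nonneg[of _ "_ * _"] sum_nonneg mult_nonneg_nonneg[of \<rho>] ip_nonneg)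
     auto

text \<open>The value of \<open>R\<close> at \<open>v\<close> is the value of the form at
  \<open>R v\<close>.\<close>

lemma is_res_psd:
  assumes R: "is_res n \<rho> w J z R" and "0 \<le> \<rho>" "\<And>j. j \<in> J \<Longrightarrow> 0 \<le> w j"
  shows "psd n R"
proof -
  have "0 \<le> ip n v (mv n R v)" for v
    using gform_nonneg[of \<rho> J w n z "mv n R v"] assms gform_res[OF R, of "mv n R v" v]
    by (simp add: ip_commute)
  then show ?thesis using is_res_sym[OF R] by (auto simp: psd_def)
qed

lemma gform_diff:
  "gform n \<rho> w J z (\<lambda>a. x a - y a) (\<lambda>a. x a - y a)
    = gform n \<rho> w J z x x - 2 * gform n \<rho> w J z x y + gform n \<rho> w J z y y"
  by (simp add: gform_def ip_diff_left ip_diff_right ip_commute[of n y x] algebra_simps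
      sum.distrib sum_subtractf sum_distrib_left)

text \<open>The diagonal entries of an inverse are a supremum of affine functions of the matrix.\<close>

lemma res_diag_ge:
  assumes R: "is_res n \<rho> w J z R" and "0 \<le> \<rho>" "\<And>j. j \<in> J \<Longrightarrow> 0 \<le> w j" and a: "a < n"
  shows "2 * x a - gform n \<rho> w J z x x \<le> R a a"
proof -
  define u where "u = mv n R (\<lambda>b. if a = b then 1 else 0)"
  have u: "u = (\<lambda>c. R c a)" using a by (simp add: u_def mv_unit)
  have e: "gform n \<rho> w J z y u = y a" for y
    unfolding u_def gform_res[OF R] using a by (subst ip_commute) (simp add: ip_unit)
  have "0 \<le> gform n \<rho> w J z (\<lambda>b. x b - u b) (\<lambda>b. x b - u b)"
    by (rule gform_nonneg) (use assms in auto)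
  then show ?thesis by (simp add: gform_diff e) (simp add: u)
qed

lemma res_col_gform:
  assumes R: "is_res n \<rho> w J z R" and a: "a < n"
  shows "gform n \<rho> w J z y (\<lambda>c. R c a) = y a"
  using gform_res[OF R, of y "\<lambda>b. if a = b then 1 else 0"] a
  by (simp add: mv_unit ip_commute[of n y] ip_unit)

lemma res_col_ip:
  assumes R: "is_res n \<rho> w J z R" and a: "a < n"
  shows "ip n v (\<lambda>c. R c a) = mv n R v a"
  unfolding inner_N_def mv_def using is_res_sym[OF R] a by (intro sum.cong) auto

text \<open>Column \<open>a\<close> of one matrix and column \<open>b\<close> of the other, put into
  the form, can be evaluated from either side. The argument covers ridge 0, that is, the inverse
  Gram matrix.\<close>

lemma is_res_unique:
  assumes R: "is_res n \<rho> w J z R" and R': "is_res n \<rho> w J z R'"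
  shows "R = R'"
proof (intro ext)
  fix a b
  show "R a b = R' a b"
  proof (cases "a < n \<and> b < n")
    case True
    have "gform n \<rho> w J z (\<lambda>c. R c a) (\<lambda>c. R' c b) = R b a"
      using res_col_gform[OF R', of b] True by simp
    moreover have "gform n \<rho> w J z (\<lambda>c. R c a) (\<lambda>c. R' c b) = R' a b"
      using res_col_gform[OF R, of a] True gform_commute by metis
    ultimately show ?thesis using is_res_sym[OF R] True by auto
  qed (use R R' in \<open>auto simp: is_res_def not_less\<close>)
qed

text \<open>The Sherman-Morrison formula: the inverse of \<open>B + c x x^T\<close> when
  \<open>A\<close> is the inverse of \<open>B\<close>.\<close>

definition sm :: "nat \<Rightarrow> (nat \<Rightarrow> nat \<Rightarrow> real) \<Rightarrow> real \<Rightarrow> (nat \<Rightarrow> real) \<Rightarrow> nat \<Rightarrow> nat \<Rightarrow> real" where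
  "sm n A c x a b = A a b - c * mv n A x a * mv n A x b / (1 + c * ip n x (mv n A x))"

lemma mv_sm:
  assumes "\<And>a b. a < n \<Longrightarrow> b < n \<Longrightarrow> A a b = A b a"
  shows "mv n (sm n A c x) v b
    = mv n A v b - c * mv n A x b * ip n x (mv n A v) / (1 + c * ip n x (mv n A x))"
proof -
  have "mv n (sm n A c x) v b
      = mv n A v b - (\<Sum>d<n. c * mv n A x b * (mv n A x d * v d) / (1 + c * ip n x (mv n A x)))"
    by (simp add: mv_def[of n "sm n A c x"] sm_def algebra_simps sum_subtractf mv_def[of n A v])
  also have "(\<Sum>d<n. c * mv n A x b * (mv n A x d * v d) / (1 + c * ip n x (mv n A x)))
      = c * mv n A x b * ip n (mv n A x) v / (1 + c * ip n x (mv n A x))"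
    by (simp add: inner_N_def[of n "mv n A x"] sum_distrib_left sum_divide_distrib)
  also have "ip n (mv n A x) v = ip n x (mv n A v)"
    using ip_mv_sym[of n A] assms by simp
  finally show ?thesis .
qed

text \<open>Checking the Sherman-Morrison formula directly also yields existence of resolvents, by
  induction over the columns from a multiple of the identity.\<close>

lemma is_res_insert:
  assumes A: "is_res n \<rho> w J z A" and psd: "psd n A" and j: "j \<notin> J" "finite J" and w: "0 \<le> w j"
  shows "is_res n \<rho> w (insert j J) z (sm n A (w j) (z j))"
proof -
  define x c where "x = z j" and "c = w j"
  define D where "D = 1 + c * ip n x (mv n A x)"
  have D: "D > 0" using psd_nonneg[OF psd, of x] w by (simp add: D_def c_def add_pos_nonneg)
  have sy: "\<And>a b. a < n \<Longrightarrow> b < n \<Longrightarrow> A a b = A b a" by (rule is_res_sym[OF A])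
  let ?R = "sm n A c x"
  have mvR: "mv n ?R v b = mv n A v b - c * mv n A x b * ip n x (mv n A v) / D" for v b
    using mv_sm[OF sy, where v=v and b=b] by (simp add: D_def)
  have main: "\<rho> * ?R a b + (\<Sum>i\<in>insert j J. w i * z i a * mv n ?R (z i) b) = (if a = b then 1 else 0)"
    if ab: "a < n" "b < n" for a b
  proof -
    have "(\<Sum>i\<in>J. w i * z i a * mv n ?R (z i) b)
        = (\<Sum>i\<in>J. w i * z i a * mv n A (z i) b - (c * mv n A x b / D) * (w i * z i a * ip n (z i) (mv n A x)))"
      using ip_mv_sym[OF sy] by (intro sum.cong refl) (simp add: mvR algebra_simps ip_commute)
    also have "\<dots> = (\<Sum>i\<in>J. w i * z i a * mv n A (z i) b)
        - (c * mv n A x b / D) * (\<Sum>i\<in>J. w i * z i a * ip n (z i) (mv n A x))"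
      by (simp add: sum_subtractf sum_distrib_left)
    also have "(\<Sum>i\<in>J. w i * z i a * ip n (z i) (mv n A x)) = x a - \<rho> * mv n A x a"
      using is_res_mv[OF A ab(1), of x] by simp
    also have "(\<Sum>i\<in>J. w i * z i a * mv n A (z i) b) = (if a = b then 1 else 0) - \<rho> * A a b"
    proof -
      have "\<rho> * A a b + (\<Sum>i\<in>J. w i * z i a * mv n A (z i) b) = (if a = b then 1 else 0)"
        using A ab unfolding is_res_def by blast
      then show ?thesis by linarith
    qed
    finally have s: "(\<Sum>i\<in>J. w i * z i a * mv n ?R (z i) b)
        = (if a = b then 1 else 0) - \<rho> * A a b - (c * mv n A x b / D) * (x a - \<rho> * mv n A x a)" .
    \<comment> \<open>On its own update vector the new matrix is a rescaling of the old one: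
      \<open>1 - c * q / (1 + c * q) = 1 / (1 + c * q)\<close>, where \<open>q\<close> is the form
      of \<open>A\<close> at \<open>x\<close>.\<close>
    have "mv n ?R x b = mv n A x b / D"
      using D unfolding mvR by (simp add: D_def field_simps)
    then have "(\<Sum>i\<in>insert j J. w i * z i a * mv n ?R (z i) b)
        = c * x a * (mv n A x b / D) + (\<Sum>i\<in>J. w i * z i a * mv n ?R (z i) b)"
      using j by (simp add: x_def c_def)
    then show ?thesis unfolding s using D
      by (simp add: sm_def D_def[symmetric] field_simps)
  qed
  have zero: "A a b = 0" if "a \<ge> n \<or> b \<ge> n" for a b using A that by (auto simp: is_res_def)
  then have zmv: "mv n A x a = 0" if "a \<ge> n" for a using that by (simp add: mv_def)
  have "is_res n \<rho> w (insert j J) z ?R"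
    unfolding is_res_def
  proof (intro conjI allI impI)
    fix a b assume "a < n" "b < n"
    then show "?R a b = ?R b a" using sy by (simp add: sm_def mult_ac)
  next
    fix a b assume "a \<ge> n \<or> b \<ge> n"
    then show "?R a b = 0" using zero zmv by (auto simp: sm_def)
  next
    fix a b assume "a < n" "b < n"
    then show "\<rho> * ?R a b + (\<Sum>i\<in>insert j J. w i * z i a * mv n ?R (z i) b) = (if a = b then 1 else 0)"
      by (rule main)
  qed
  then show ?thesis by (simp add: x_def c_def)
qed

lemma is_res_empty:
  "\<rho> > 0 \<Longrightarrow> is_res n \<rho> w {} z (\<lambda>a b. if a < n \<and> a = b then 1 / \<rho> else 0)"
  by (auto simp: is_res_def)

text \<open>A choice that \<open>is_res_unique\<close> pins down. Existence comes from
  \<open>res_ex\<close>, for positive ridge and nonnegative weights.\<close>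

definition res :: "nat \<Rightarrow> real \<Rightarrow> (nat \<Rightarrow> real) \<Rightarrow> nat set \<Rightarrow> (nat \<Rightarrow> nat \<Rightarrow> real) \<Rightarrow> nat \<Rightarrow> nat \<Rightarrow> real" where
  "res n \<rho> w J z = (SOME R. is_res n \<rho> w J z R)"

lemma res_ex:
  assumes "finite J" "0 < \<rho>" "\<And>j. j \<in> J \<Longrightarrow> 0 \<le> w j"
  shows "\<exists>R. is_res n \<rho> w J z R"
  using assms
proof (induction J rule: finite_induct)
  case empty
  then show ?case using is_res_empty by blast
next
  case (insert j J)
  then obtain A where A: "is_res n \<rho> w J z A" by auto
  have "psd n A" by (rule is_res_psd[OF A]) (use insert in auto)
  then show ?case using is_res_insert[OF A, of j] insert by auto
qed

lemma res_is_res: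
  assumes "finite J" "0 < \<rho>" "\<And>j. j \<in> J \<Longrightarrow> 0 \<le> w j"
  shows "is_res n \<rho> w J z (res n \<rho> w J z)"
  unfolding res_def using res_ex[OF assms] by (rule someI_ex)

lemma res_psd:
  assumes "finite J" "0 < \<rho>" "\<And>j. j \<in> J \<Longrightarrow> 0 \<le> w j"
  shows "psd n (res n \<rho> w J z)"
  by (rule is_res_psd[OF res_is_res]) (use assms in auto)

lemma res_insert:
  assumes "finite J" "0 < \<rho>" "\<And>i. i \<in> insert j J \<Longrightarrow> 0 \<le> w i" "j \<notin> J"
  shows "res n \<rho> w (insert j J) z = sm n (res n \<rho> w J z) (w j) (z j)"
  by (rule is_res_unique[OF res_is_res is_res_insert])
     (use assms in \<open>auto intro!: res_is_res res_psd\<close>)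

lemma res_empty: "0 < \<rho> \<Longrightarrow> res n \<rho> w {} z = (\<lambda>a b. if a < n \<and> a = b then 1 / \<rho> else 0)"
  by (rule is_res_unique[OF res_is_res is_res_empty]) auto

text \<open>Columns outside \<open>J\<close> have no influence. In this form independence of a
  column enters: what does not change with the column is a constant in the integration by
  parts.\<close>

lemma res_cong:
  assumes "\<And>j a. j \<in> J \<Longrightarrow> a < n \<Longrightarrow> z j a = z' j a"
  shows "res n \<rho> w J z = res n \<rho> w J z'"
proof -
  have "mv n R (z j) = mv n R (z' j)" if "j \<in> J" for j R by (rule mv_cong) (use assms that in auto)
  then have "is_res n \<rho> w J z R = is_res n \<rho> w J z' R" for R
    unfolding is_res_def using assms by (simp cong: sum.cong)
  then show ?thesis by (simp add: res_def)
qed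

text \<open>The defining equation of \<open>R\<close> contracted with a free matrix
  \<open>Mx\<close>. The identity, \<open>R\<close> and the square of \<open>R\<close> give
  \<open>res_trace1\<close>, \<open>res_trace2\<close> and \<open>res_trace3\<close>.\<close>

lemma is_res_trace_identity:
  assumes R: "is_res n \<rho> w J z R"
  shows "\<rho> * (\<Sum>a<n. \<Sum>b<n. Mx a b * R a b) + (\<Sum>j\<in>J. w j * ip n (z j) (mv n Mx (mv n R (z j)))) = trc n Mx"
proof -
  have "trc n Mx = (\<Sum>a<n. \<Sum>b<n. Mx a b * (if a = b then 1 else 0))"
    by (simp add: trc_def if_distrib sum.delta cong: if_cong)
  also have "\<dots> = (\<Sum>a<n. \<Sum>b<n. Mx a b * (\<rho> * R a b + (\<Sum>j\<in>J. w j * z j a * mv n R (z j) b)))"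
    using R by (intro sum.cong refl) (auto simp: is_res_def)
  also have "\<dots> = \<rho> * (\<Sum>a<n. \<Sum>b<n. Mx a b * R a b)
      + (\<Sum>a<n. \<Sum>b<n. \<Sum>j\<in>J. Mx a b * (w j * z j a * mv n R (z j) b))"
    by (simp add: distrib_left sum.distrib sum_distrib_left mult_ac)
  also have "(\<Sum>a<n. \<Sum>b<n. \<Sum>j\<in>J. Mx a b * (w j * z j a * mv n R (z j) b))
      = (\<Sum>a<n. \<Sum>j\<in>J. \<Sum>b<n. Mx a b * (w j * z j a * mv n R (z j) b))"
    by (rule sum.cong[OF refl sum.swap])
  also have "\<dots> = (\<Sum>j\<in>J. \<Sum>a<n. \<Sum>b<n. Mx a b * (w j * z j a * mv n R (z j) b))"
    by (rule sum.swap)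
  also have "\<dots> = (\<Sum>j\<in>J. w j * ip n (z j) (mv n Mx (mv n R (z j))))"
    by (simp add: inner_N_def mv_def[of n Mx] sum_distrib_left mult_ac)
  finally show ?thesis by simp
qed

lemma res_trace1:
  assumes R: "is_res n \<rho> w J z R"
  shows "(\<Sum>j\<in>J. w j * ip n (z j) (mv n R (z j))) = real n - \<rho> * trc n R"
proof -
  let ?I = "\<lambda>a b::nat. if a = b then 1 else (0::real)"
  have "ip n u (mv n ?I v) = ip n u v" for u v
    by (rule ip_cong) (auto simp: mv_def if_distrib if_distribR sum.delta cong: if_cong)
  then show ?thesis using is_res_trace_identity[OF R, of ?I]
    by (simp add: trc_def if_distrib if_distribR sum.delta cong: if_cong)
qed

lemma res_trace2:
  assumes R: "is_res n \<rho> w J z R"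
  shows "(\<Sum>j\<in>J. w j * ip n (mv n R (z j)) (mv n R (z j))) = trc n R - \<rho> * frob n R"
  using is_res_trace_identity[OF R, of R] ip_mv_sym[of n R] is_res_sym[OF R]
  by (simp add: frob_def power2_eq_square)

lemma res_trace3:
  assumes R: "is_res n \<rho> w J z R" and "0 \<le> \<rho>" "\<And>j. j \<in> J \<Longrightarrow> 0 \<le> w j"
  shows "(\<Sum>j\<in>J. w j * ip n (mv n R (z j)) (mv n R (mv n R (z j)))) \<le> frob n R"
proof -
  \<comment> \<open>\<open>?S\<close> is the square of \<open>R\<close>. The dropped term is
    \<open>\<rho>\<close> times the trace of the cube of \<open>R\<close>, a sum of values of the
    form of \<open>R\<close> at its own columns, hence nonnegative.\<close>
  let ?S = "\<lambda>a b. mv n R (\<lambda>c. R c b) a"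
  have P: "psd n R" by (rule is_res_psd[OF R]) (use assms in auto)
  have S: "mv n ?S v = mv n R (mv n R v)" for v
  proof
    fix a
    have "mv n ?S v a = (\<Sum>b<n. \<Sum>c<n. R a c * R c b * v b)" by (simp add: mv_def sum_distrib_right)
    also have "\<dots> = (\<Sum>c<n. \<Sum>b<n. R a c * R c b * v b)" by (rule sum.swap)
    finally show "mv n ?S v a = mv n R (mv n R v) a" by (simp add: mv_def sum_distrib_left mult_ac)
  qed
  have "(\<Sum>a<n. \<Sum>b<n. ?S a b * R a b) = (\<Sum>b<n. ip n (\<lambda>c. R c b) (mv n R (\<lambda>c. R c b)))"
    by (subst sum.swap) (simp add: inner_N_def mult_ac)
  also have "\<dots> \<ge> 0" by (intro sum_nonneg psd_nonneg[OF P])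
  finally have pos: "0 \<le> \<rho> * (\<Sum>a<n. \<Sum>b<n. ?S a b * R a b)" using assms by simp
  have "trc n ?S = frob n R"
    unfolding trc_def frob_def mv_def using is_res_sym[OF R]
    by (intro sum.cong refl) (auto simp: power2_eq_square)
  then show ?thesis
    using is_res_trace_identity[OF R, of ?S] pos by (simp add: S psd_ip_mv[OF P])
qed

lemma res_col_frob:
  assumes R: "is_res n \<rho> w J z R"
  shows "(\<Sum>a<n. (ip n v (\<lambda>c. R c a))\<^sup>2) = ip n (mv n R v) (mv n R v)"
  unfolding inner_N_def[of n "mv n R v"]
  by (intro sum.cong refl) (simp add: res_col_ip[OF R] power2_eq_square)

text \<open>The tangent inequality for the trace of an inverse. Column \<open>a\<close> of
  \<open>R\<close> is the optimal test vector for the weights \<open>w\<close>, so inserting it into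
  \<open>res_diag_ge\<close> for \<open>w'\<close> leaves exactly the linear term; the sum over
  \<open>a\<close> produces the squared norms.\<close>

lemma trc_res_convex:
  assumes R: "is_res n \<rho> w J z R" and R': "is_res n \<rho> w' J z R'"
    and "0 \<le> \<rho>" "\<And>j. j \<in> J \<Longrightarrow> 0 \<le> w' j"
  shows "trc n R - (\<Sum>j\<in>J. (w' j - w j) * ip n (mv n R (z j)) (mv n R (z j))) \<le> trc n R'"
proof -
  have e: "2 * R a a - gform n \<rho> w' J z (\<lambda>c. R c a) (\<lambda>c. R c a)
     = R a a - (\<Sum>j\<in>J. (w' j - w j) * (ip n (z j) (\<lambda>c. R c a))\<^sup>2)" if "a < n" for a
  proof -
    have "gform n \<rho> w' J z (\<lambda>c. R c a) (\<lambda>c. R c a)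
        = gform n \<rho> w J z (\<lambda>c. R c a) (\<lambda>c. R c a) + (\<Sum>j\<in>J. (w' j - w j) * (ip n (z j) (\<lambda>c. R c a))\<^sup>2)"
      by (simp add: gform_def algebra_simps power2_eq_square sum_subtractf)
    then show ?thesis using res_col_gform[OF R that] by simp
  qed
  have "(\<Sum>a<n. R a a - (\<Sum>j\<in>J. (w' j - w j) * (ip n (z j) (\<lambda>c. R c a))\<^sup>2)) \<le> trc n R'"
    unfolding trc_def
  proof (intro sum_mono)
    fix a assume "a \<in> {..<n}"
    then have a: "a < n" by simp
    show "R a a - (\<Sum>j\<in>J. (w' j - w j) * (ip n (z j) (\<lambda>c. R c a))\<^sup>2) \<le> R' a a"
      unfolding e[OF a, symmetric]
      by (rule res_diag_ge[OF R' assms(3,4) a]) auto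
  qed
  also have "(\<Sum>a<n. R a a - (\<Sum>j\<in>J. (w' j - w j) * (ip n (z j) (\<lambda>c. R c a))\<^sup>2))
     = trc n R - (\<Sum>j\<in>J. (w' j - w j) * ip n (mv n R (z j)) (mv n R (z j)))"
    by (simp add: sum_subtractf trc_def sum.swap[of _ J] sum_distrib_left[symmetric] res_col_frob[OF R])
  finally show ?thesis by simp
qed

text \<open>The resolvent identity \<open>R0 - R = \<rho> R0 R\<close>, obtained by pairing a column
  of each matrix in the form.\<close>

lemma res_perturb:
  assumes R: "is_res n \<rho> w J z R" and R0: "is_res n 0 w J z R0" and ab: "a < n" "b < n"
  shows "R0 a b - R a b = \<rho> * ip n (\<lambda>c. R0 c a) (\<lambda>c. R c b)"
proof -
  have "gform n \<rho> w J z (\<lambda>c. R0 c a) (\<lambda>c. R c b)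
      = \<rho> * ip n (\<lambda>c. R0 c a) (\<lambda>c. R c b) + gform n 0 w J z (\<lambda>c. R c b) (\<lambda>c. R0 c a)"
    by (simp add: gform_def mult_ac)
  then have "R0 b a = \<rho> * ip n (\<lambda>c. R0 c a) (\<lambda>c. R c b) + R a b"
    unfolding res_col_gform[OF R ab(2)] res_col_gform[OF R0 ab(1)] .
  then show ?thesis using is_res_sym[OF R0 ab] by simp
qed

text \<open>A column of the ridge resolvent serves as test vector for the problem with ridge 0,
  whose form is smaller.\<close>

lemma trc_res_le0:
  assumes R: "is_res n \<rho> w J z R" and R0: "is_res n 0 w J z R0"
    and "0 \<le> \<rho>" "\<And>j. j \<in> J \<Longrightarrow> 0 \<le> w j"
  shows "trc n R \<le> trc n R0"
  unfolding trc_def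
proof (intro sum_mono)
  fix a assume "a \<in> {..<n}"
  then have a: "a < n" by simp
  have "2 * R a a - gform n 0 w J z (\<lambda>c. R c a) (\<lambda>c. R c a) \<le> R0 a a"
    by (rule res_diag_ge[OF R0 _ _ a, where x="\<lambda>c. R c a"]) (use assms in auto)
  moreover have "gform n 0 w J z (\<lambda>c. R c a) (\<lambda>c. R c a) \<le> gform n \<rho> w J z (\<lambda>c. R c a) (\<lambda>c. R c a)"
    using assms ip_nonneg by (simp add: gform_def)
  ultimately show "R a a \<le> R0 a a" using res_col_gform[OF R a, of "\<lambda>c. R c a"] by simp
qed

text \<open>The entries of both matrices are at most the trace of \<open>R0\<close>, so the
  resolvent identity bounds the difference by \<open>\<rho>\<close> times a constant of the given
  array.\<close>

lemma res_tendsto0: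
  assumes R: "\<And>m. is_res n (\<rho> m) w J z (R m)" and R0: "is_res n 0 w J z R0"
    and "\<And>m. 0 \<le> \<rho> m" "\<rho> \<longlonglongrightarrow> 0" "\<And>j. j \<in> J \<Longrightarrow> 0 \<le> w j"
  shows "(\<lambda>m. R m a b) \<longlonglongrightarrow> R0 a b"
proof (cases "a < n \<and> b < n")
  case True
  have P0: "psd n R0" by (rule is_res_psd[OF R0]) (use assms in auto)
  have P: "psd n (R m)" for m by (rule is_res_psd[OF R]) (use assms in auto)
  have bd: "norm (R0 a b - R m a b) \<le> \<rho> m * (real n * (trc n R0 * trc n R0))" for m
  proof -
    have "\<bar>ip n (\<lambda>c. R0 c a) (\<lambda>c. R m c b)\<bar> \<le> (\<Sum>c<n. \<bar>R0 c a * R m c b\<bar>)"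
      unfolding inner_N_def by (rule sum_abs)
    also have "\<dots> \<le> (\<Sum>c<n. trc n R0 * trc n R0)"
    proof (intro sum_mono)
      fix c assume "c \<in> {..<n}"
      then have "\<bar>R0 c a\<bar> \<le> trc n R0" "\<bar>R m c b\<bar> \<le> trc n R0"
        using psd_entry_le_trc[OF P0, of c a] psd_entry_le_trc[OF P, of c b m]
          trc_res_le0[OF R R0, of m] True assms by (auto intro: order_trans)
      then show "\<bar>R0 c a * R m c b\<bar> \<le> trc n R0 * trc n R0"
        unfolding abs_mult by (intro mult_mono) (auto intro: trc_nonneg[OF P0])
    qed
    finally show ?thesis
      using res_perturb[OF R R0, of a b m] True assms(3)[of m] by (simp add: abs_mult mult_left_mono)
  qed
  have "(\<lambda>m. \<rho> m * (real n * (trc n R0 * trc n R0))) \<longlonglongrightarrow> 0"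
    by (rule tendsto_mult_left_zero[OF assms(4)])
  then have "(\<lambda>m. R0 a b - R m a b) \<longlonglongrightarrow> 0"
    by (rule Lim_null_comparison[rotated]) (use bd in simp)
  then have "(\<lambda>m. R0 a b - (R0 a b - R m a b)) \<longlonglongrightarrow> R0 a b - 0" by (intro tendsto_intros)
  then show ?thesis by simp
next
  case False
  then have "R m a b = 0" "R0 a b = 0" for m using R[of m] R0 by (auto simp: is_res_def not_less)
  then show ?thesis by simp
qed

section \<open>Scalar quantities under a rank-one update\<close>

context
  fixes n :: nat and A :: "nat \<Rightarrow> nat \<Rightarrow> real" and c :: real and x :: "nat \<Rightarrow> real"
  assumes psdA: "psd n A" and c0: "0 \<le> c"
begin

lemma sm_denom: "0 < 1 + c * ip n x (mv n A x)"
  using psd_nonneg[OF psdA, of x] c0 by (simp add: add_pos_nonneg)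

lemma mv_sm_self: "mv n (sm n A c x) x b = mv n A x b / (1 + c * ip n x (mv n A x))"
  using sm_denom by (subst mv_sm) (auto simp: psd_sym[OF psdA] field_simps)

lemma ip_mv_sm_self: "ip n x (mv n (sm n A c x) x) = ip n x (mv n A x) / (1 + c * ip n x (mv n A x))"
  by (simp add: inner_N_def[of n x "mv n (sm n A c x) x"] mv_sm_self)
     (simp add: inner_N_def[of n x "mv n A x"] sum_divide_distrib)

lemma norm_mv_sm_self: "ip n (mv n (sm n A c x) x) (mv n (sm n A c x) x)
    = ip n (mv n A x) (mv n A x) / (1 + c * ip n x (mv n A x))\<^sup>2"
  by (simp add: inner_N_def[of n "mv n (sm n A c x) x"] mv_sm_self)
     (simp add: inner_N_def[of n "mv n A x" "mv n A x"] sum_divide_distrib power2_eq_square)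

lemma trc_sm: "trc n (sm n A c x) = trc n A - c * ip n (mv n A x) (mv n A x) / (1 + c * ip n x (mv n A x))"
  by (simp add: trc_def sm_def sum_subtractf inner_N_def[of n "mv n A x" "mv n A x"]
      sum_distrib_left sum_divide_distrib mult_ac)

lemma trc_sm_le: "trc n (sm n A c x) \<le> trc n A"
  unfolding trc_sm using sm_denom c0 ip_nonneg[of n "mv n A x"] by simp

end

section \<open>Gaussian integration by parts\<close>

abbreviation stdn :: "real measure" where
  "stdn \<equiv> density lborel std_normal_density"

abbreviation gpm :: "'i set \<Rightarrow> ('i \<Rightarrow> real) measure" where
  "gpm I \<equiv> Pi\<^sub>M I (\<lambda>_. stdn)"

lemma sets_gpm [measurable_cong]: "sets (gpm I) = sets (Pi\<^sub>M I (\<lambda>_. borel))"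
  by (rule sets_PiM_cong) auto

lemma space_gpm: "space (gpm I) = I \<rightarrow>\<^sub>E UNIV"
  by (simp add: space_PiM)

interpretation stdn: prob_space stdn
  by (rule prob_space_normal_density) simp

interpretation gprod: product_sigma_finite "\<lambda>_::'i. stdn"
  by standard

lemma prob_space_gpm: "prob_space (gpm I)"
  by (rule prob_space_PiM) (rule stdn.prob_space_axioms)

lemma abs_le_one_plus_sq: "\<bar>t :: real\<bar> \<le> 1 + t\<^sup>2"
proof -
  have "0 \<le> (\<bar>t\<bar> - 1)\<^sup>2 + \<bar>t\<bar>\<^sup>2" by simp
  then show ?thesis by (simp add: power2_diff)
qed

lemma integrable_stdn_poly:
  "integrable stdn (\<lambda>t. (1 + t\<^sup>2) ^ k)"
proof -
  have "integrable lborel (\<lambda>t. \<Sum>i\<le>k. of_nat (k choose i) * (std_normal_density t * t ^ (2 * i)))"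
    by (intro Bochner_Integration.integrable_sum integrable_mult_right integrable_std_normal_moment)
  also have "(\<lambda>t. \<Sum>i\<le>k. of_nat (k choose i) * (std_normal_density t * t ^ (2 * i)))
      = (\<lambda>t. std_normal_density t *\<^sub>R (1 + t\<^sup>2) ^ k)"
    by (rule ext) (subst add.commute, subst binomial_ring,
        simp add: sum_distrib_left power_mult[symmetric] mult_ac)
  finally show ?thesis by (subst integrable_density) auto
qed

text \<open>With \<open>u = (1 + t\<^sup>2) / 2\<close> the function is a multiple of
  \<open>u ^ k / exp u\<close>.\<close>

lemma poly_gauss_decay: "((\<lambda>t. (1 + t\<^sup>2) ^ k * std_normal_density t) \<longlongrightarrow> 0) at_infinity"
proof -
  have lim: "((\<lambda>u::real. u ^ k / exp u) \<longlongrightarrow> 0) at_top" by (rule tendsto_power_div_exp_0)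
  have "filterlim (\<lambda>t::real. norm t) at_top at_infinity" by (rule filterlim_norm_at_top)
  then have "filterlim (\<lambda>t::real. (norm t) ^ 2) at_top at_infinity"
    by (rule filterlim_pow_at_top[rotated]) simp
  then have "filterlim (\<lambda>t::real. (1 + t\<^sup>2) / 2) at_top at_infinity"
    by (intro filterlim_at_top_mult_tendsto_pos[where c="1/2", OF tendsto_const, simplified])
       (auto intro: filterlim_tendsto_add_at_top)
  then have "((\<lambda>t::real. ((1 + t\<^sup>2) / 2) ^ k / exp ((1 + t\<^sup>2) / 2)) \<longlongrightarrow> 0) at_infinity"
    by (rule filterlim_compose[OF lim])
  then have lim: "((\<lambda>t::real. (2 ^ k * exp (1/2) / sqrt (2 * pi)) * (((1 + t\<^sup>2) / 2) ^ k / exp ((1 + t\<^sup>2) / 2)))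
      \<longlongrightarrow> 0) at_infinity"
    by (rule tendsto_mult_right_zero)
  have eq: "(2 ^ k * exp (1/2) / sqrt (2 * pi)) * (((1 + t\<^sup>2) / 2) ^ k / exp ((1 + t\<^sup>2) / 2))
      = (1 + t\<^sup>2) ^ k * std_normal_density t" for t :: real
  proof -
    have e: "exp (- t\<^sup>2 / 2) = exp (1/2) / exp ((1 + t\<^sup>2) / 2)"
      by (simp add: exp_diff[symmetric] add_divide_distrib)
    show ?thesis unfolding std_normal_density_def e by (simp add: power_divide)
  qed
  show ?thesis using lim unfolding eq .
qed

lemma stdn_dominated:
  assumes [measurable]: "F \<in> borel_measurable borel" and "\<And>t. \<bar>F t\<bar> \<le> C * (1 + t\<^sup>2) ^ k"
  shows "integrable stdn F"
  by (rule Bochner_Integration.integrable_bound[OF integrable_mult_right[OF integrable_stdn_poly[of k], of C]])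
     (use assms in \<open>auto simp: abs_mult intro!: AE_I2 order_trans[OF assms(2)] mult_right_mono\<close>)

text \<open>The density satisfies \<open>phi' = - t * phi\<close>, so \<open>F' t - t * F t\<close>
  times the density is the derivative of \<open>F\<close> times the density, which vanishes at both
  infinities.\<close>

lemma stein_1d:
  assumes D: "\<And>t. (F has_real_derivative F' t) (at t)" and cont: "\<And>t. isCont F' t"
    and b: "\<And>t. \<bar>F t\<bar> \<le> C * (1 + t\<^sup>2) ^ k" and b': "\<And>t. \<bar>F' t\<bar> \<le> C' * (1 + t\<^sup>2) ^ k'"
  shows "(\<integral>t. t * F t \<partial>stdn) = (\<integral>t. F' t \<partial>stdn)"
proof -
  have contF: "isCont F t" for t using D DERIV_isCont by blast
  have [measurable]: "F \<in> borel_measurable borel" "F' \<in> borel_measurable borel"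
    using contF cont by (auto intro!: borel_measurable_continuous_onI simp: continuous_on_eq_continuous_at)
  have i1: "integrable stdn F'" by (rule stdn_dominated[OF _ b']) simp
  have i2: "integrable stdn (\<lambda>t. t * F t)"
  proof (rule stdn_dominated)
    fix t :: real
    have "\<bar>t\<bar> \<le> 1 + t\<^sup>2" by (rule abs_le_one_plus_sq)
    then have "\<bar>t * F t\<bar> \<le> (1 + t\<^sup>2) * (C * (1 + t\<^sup>2) ^ k)"
      unfolding abs_mult by (intro mult_mono b) auto
    then show "\<bar>t * F t\<bar> \<le> C * (1 + t\<^sup>2) ^ Suc k" by (simp add: mult_ac)
  qed simp
  define h where "h t = F t * std_normal_density t" for t
  define h' where "h' t = std_normal_density t * (F' t - t * F t)" for t
  have dphi: "(std_normal_density has_real_derivative - t * std_normal_density t) (at t)" for t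
    unfolding std_normal_density_def by (auto intro!: derivative_eq_intros simp: field_simps power2_eq_square)
  have hd: "(h has_real_derivative h' t) (at t)" for t
    unfolding h_def h'_def by (rule derivative_eq_intros D dphi | simp add: algebra_simps)+
  have contphi: "isCont std_normal_density t" for t using dphi DERIV_isCont by blast
  have hc: "isCont h' t" for t unfolding h'_def by (intro continuous_intros contphi cont contF)
  have lim0: "(h \<longlongrightarrow> 0) at_infinity"
  proof (rule Lim_null_comparison[OF _ tendsto_mult_right_zero[OF poly_gauss_decay[of k], of C]])
    show "\<forall>\<^sub>F t in at_infinity. norm (h t) \<le> C * ((1 + t\<^sup>2) ^ k * std_normal_density t)"
      using b by (intro always_eventually) (auto simp: h_def abs_mult mult.assoc[symmetric] intro!: mult_right_mono)
  qed
  have int: "integrable stdn (\<lambda>t. F' t - t * F t)" using i1 i2 by simp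
  then have inth: "integrable lborel h'" unfolding h'_def by (subst (asm) integrable_density) auto
  have "(LBINT t=-\<infinity>..\<infinity>. h' t) = 0 - 0"
  proof (rule interval_integral_FTC_integrable[where F=h])
    show "set_integrable lborel (einterval (- \<infinity>) \<infinity>) h'" using inth by (simp add: set_integrable_def)
    show "((h \<circ> real_of_ereal) \<longlongrightarrow> 0) (at_right (- \<infinity>))"
      unfolding ereal_tendsto_simps using lim0 by (rule tendsto_mono[OF at_bot_le_at_infinity])
    show "((h \<circ> real_of_ereal) \<longlongrightarrow> 0) (at_left \<infinity>)"
      unfolding ereal_tendsto_simps using lim0 by (rule tendsto_mono[OF at_top_le_at_infinity])
  qed (use hd hc in \<open>auto simp: has_real_derivative_iff_has_vector_derivative[symmetric]\<close>)
  then have "(\<integral>t. h' t \<partial>lborel) = 0"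
    by (simp add: interval_lebesgue_integral_def set_lebesgue_integral_def)
  then have "(\<integral>t. F' t - t * F t \<partial>stdn) = 0" unfolding h'_def by (subst integral_density) auto
  then show ?thesis using i1 i2 by simp
qed

text \<open>Polynomially bounded functions: an algebra of functions integrable for the Gaussian measure, which
  discharges all integrability conditions below.\<close>

definition pb :: "'i set \<Rightarrow> (('i \<Rightarrow> real) \<Rightarrow> real) \<Rightarrow> bool" where
  "pb I g \<longleftrightarrow> g \<in> borel_measurable (Pi\<^sub>M I (\<lambda>_. borel)) \<and>
     (\<exists>C k. \<forall>f\<in>I \<rightarrow>\<^sub>E UNIV. \<bar>g f\<bar> \<le> C * (1 + (\<Sum>i\<in>I. (f i)\<^sup>2)) ^ k)"

lemma pb_measurable: "pb I g \<Longrightarrow> g \<in> borel_measurable (Pi\<^sub>M I (\<lambda>_. borel))"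
  by (simp add: pb_def)

lemma pb_measurable': "pb I g \<Longrightarrow> g \<in> borel_measurable (gpm I)"
  using pb_measurable by (simp cong: measurable_cong_sets add: sets_gpm)

lemma pb_bounded:
  assumes "g \<in> borel_measurable (Pi\<^sub>M I (\<lambda>_. borel))" "\<And>f. f \<in> I \<rightarrow>\<^sub>E UNIV \<Longrightarrow> \<bar>g f\<bar> \<le> C"
  shows "pb I g"
  unfolding pb_def using assms by (intro conjI exI[of _ C] exI[of _ 0]) auto

lemma pb_const [intro, simp]: "pb I (\<lambda>_. c)"
  by (rule pb_bounded[of _ _ "\<bar>c\<bar>"]) auto

lemma pb_obtain:
  assumes "pb I g"
  obtains C k where "0 \<le> C" "\<And>f K. f \<in> I \<rightarrow>\<^sub>E UNIV \<Longrightarrow> k \<le> K \<Longrightarrow> \<bar>g f\<bar> \<le> C * (1 + (\<Sum>i\<in>I. (f i)\<^sup>2)) ^ K"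
proof -
  obtain C k where b: "\<And>f. f \<in> I \<rightarrow>\<^sub>E UNIV \<Longrightarrow> \<bar>g f\<bar> \<le> C * (1 + (\<Sum>i\<in>I. (f i)\<^sup>2)) ^ k"
    using assms unfolding pb_def by blast
  show thesis
  proof (rule that[of "\<bar>C\<bar>" k])
    fix f :: "'a \<Rightarrow> real" and K assume f: "f \<in> I \<rightarrow>\<^sub>E UNIV" and K: "k \<le> K"
    have s: "0 \<le> (\<Sum>i\<in>I. (f i)\<^sup>2)" by (simp add: sum_nonneg)
    have "\<bar>g f\<bar> \<le> C * (1 + (\<Sum>i\<in>I. (f i)\<^sup>2)) ^ k" by (rule b[OF f])
    also have "\<dots> \<le> \<bar>C\<bar> * (1 + (\<Sum>i\<in>I. (f i)\<^sup>2)) ^ K"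
      using s K by (intro mult_mono power_increasing) auto
    finally show "\<bar>g f\<bar> \<le> \<bar>C\<bar> * (1 + (\<Sum>i\<in>I. (f i)\<^sup>2)) ^ K" .
  qed simp
qed

lemma pb_add [intro]:
  assumes "pb I g" "pb I h" shows "pb I (\<lambda>f. g f + h f)"
proof -
  obtain C k where g: "0 \<le> C" "\<And>f K. f \<in> I \<rightarrow>\<^sub>E UNIV \<Longrightarrow> k \<le> K \<Longrightarrow> \<bar>g f\<bar> \<le> C * (1 + (\<Sum>i\<in>I. (f i)\<^sup>2)) ^ K"
    using assms(1) by (rule pb_obtain) blast
  obtain C' k' where h: "0 \<le> C'" "\<And>f K. f \<in> I \<rightarrow>\<^sub>E UNIV \<Longrightarrow> k' \<le> K \<Longrightarrow> \<bar>h f\<bar> \<le> C' * (1 + (\<Sum>i\<in>I. (f i)\<^sup>2)) ^ K"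
    using assms(2) by (rule pb_obtain) blast
  have "\<bar>g f + h f\<bar> \<le> (C + C') * (1 + (\<Sum>i\<in>I. (f i)\<^sup>2)) ^ (max k k')" if "f \<in> I \<rightarrow>\<^sub>E UNIV" for f
    using g(2)[OF that, of "max k k'"] h(2)[OF that, of "max k k'"] by (simp add: algebra_simps)
  then show ?thesis using assms unfolding pb_def by auto
qed

lemma pb_mult [intro]:
  assumes "pb I g" "pb I h" shows "pb I (\<lambda>f. g f * h f)"
proof -
  obtain C k where g: "0 \<le> C" "\<And>f K. f \<in> I \<rightarrow>\<^sub>E UNIV \<Longrightarrow> k \<le> K \<Longrightarrow> \<bar>g f\<bar> \<le> C * (1 + (\<Sum>i\<in>I. (f i)\<^sup>2)) ^ K"
    using assms(1) by (rule pb_obtain) blast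
  obtain C' k' where h: "0 \<le> C'" "\<And>f K. f \<in> I \<rightarrow>\<^sub>E UNIV \<Longrightarrow> k' \<le> K \<Longrightarrow> \<bar>h f\<bar> \<le> C' * (1 + (\<Sum>i\<in>I. (f i)\<^sup>2)) ^ K"
    using assms(2) by (rule pb_obtain) blast
  have "\<bar>g f * h f\<bar> \<le> (C * C') * (1 + (\<Sum>i\<in>I. (f i)\<^sup>2)) ^ (k + k')" if "f \<in> I \<rightarrow>\<^sub>E UNIV" for f
  proof -
    have "\<bar>g f * h f\<bar> \<le> (C * (1 + (\<Sum>i\<in>I. (f i)\<^sup>2)) ^ k) * (C' * (1 + (\<Sum>i\<in>I. (f i)\<^sup>2)) ^ k')"
      unfolding abs_mult using g(1)
      by (intro mult_mono g(2) h(2) that order_refl mult_nonneg_nonneg zero_le_power) (auto simp: sum_nonneg)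
    then show ?thesis by (simp add: power_add mult_ac)
  qed
  then show ?thesis using assms unfolding pb_def by auto
qed

lemma pb_uminus [intro]: "pb I g \<Longrightarrow> pb I (\<lambda>f. - g f)"
  using pb_mult[OF pb_const[of I "-1"]] by simp

lemma pb_diff [intro]: "pb I g \<Longrightarrow> pb I h \<Longrightarrow> pb I (\<lambda>f. g f - h f)"
  using pb_add[OF _ pb_uminus] by fastforce

lemma pb_power [intro]: "pb I g \<Longrightarrow> pb I (\<lambda>f. g f ^ k)"
  by (induction k) auto

lemma pb_sum [intro]: "(\<And>j. j \<in> J \<Longrightarrow> pb I (g j)) \<Longrightarrow> pb I (\<lambda>f. \<Sum>j\<in>J. g j f)"
  by (induction J rule: infinite_finite_induct) auto

lemma pb_coord [intro]: assumes "finite I" "i \<in> I" shows "pb I (\<lambda>f. f i)"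
  unfolding pb_def
proof (intro conjI exI[of _ 1] ballI)
  fix f :: "'a \<Rightarrow> real"
  have "(f i)\<^sup>2 \<le> (\<Sum>i\<in>I. (f i)\<^sup>2)" by (rule member_le_sum) (use assms in auto)
  moreover have "\<bar>f i\<bar> \<le> 1 + (f i)\<^sup>2" by (rule abs_le_one_plus_sq)
  ultimately show "\<bar>f i\<bar> \<le> 1 * (1 + (\<Sum>i\<in>I. (f i)\<^sup>2)) ^ 1" by simp
qed (use assms in simp)

text \<open>Replaces the sum by a product of functions of single coordinates, whose integrability is
  that of the factors.\<close>

lemma one_plus_sum_le_prod:
  assumes "finite I" "\<And>i. i \<in> I \<Longrightarrow> (0::real) \<le> g i"
  shows "1 + (\<Sum>i\<in>I. g i) \<le> (\<Prod>i\<in>I. 1 + g i)"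
  using assms
proof (induction I rule: finite_induct)
  case (insert i I)
  have "1 \<le> (\<Prod>i\<in>I. 1 + g i)" using insert by (intro prod_ge_1) auto
  then have "g i * 1 \<le> g i * (\<Prod>i\<in>I. 1 + g i)" using insert by (intro mult_left_mono) auto
  then show ?case using insert by (simp add: algebra_simps)
qed simp

lemma pb_integrable:
  assumes I: "finite I" and g: "pb I g"
  shows "integrable (gpm I) g"
proof -
  obtain C k where b: "0 \<le> C" "\<And>f K. f \<in> I \<rightarrow>\<^sub>E UNIV \<Longrightarrow> k \<le> K \<Longrightarrow> \<bar>g f\<bar> \<le> C * (1 + (\<Sum>i\<in>I. (f i)\<^sup>2)) ^ K"
    using g by (rule pb_obtain) blast
  have "integrable (gpm I) (\<lambda>f. C * (\<Prod>i\<in>I. (1 + (f i)\<^sup>2) ^ k))"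
    by (intro integrable_mult_right gprod.product_integrable_prod I integrable_stdn_poly)
  then show ?thesis
  proof (rule Bochner_Integration.integrable_bound)
    show "AE f in gpm I. norm (g f) \<le> norm (C * (\<Prod>i\<in>I. (1 + (f i)\<^sup>2) ^ k))"
    proof (rule AE_I2)
      fix f :: "'a \<Rightarrow> real" assume "f \<in> space (gpm I)"
      then have f: "f \<in> I \<rightarrow>\<^sub>E UNIV" by (simp add: space_gpm)
      have "\<bar>g f\<bar> \<le> C * (1 + (\<Sum>i\<in>I. (f i)\<^sup>2)) ^ k" by (rule b(2)[OF f]) simp
      also have "\<dots> \<le> C * (\<Prod>i\<in>I. 1 + (f i)\<^sup>2) ^ k"
        by (intro mult_left_mono power_mono one_plus_sum_le_prod I b(1)) (auto simp: sum_nonneg)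
      also have "\<dots> = C * (\<Prod>i\<in>I. (1 + (f i)\<^sup>2) ^ k)" by (simp add: prod_power_distrib)
      finally show "norm (g f) \<le> norm (C * (\<Prod>i\<in>I. (1 + (f i)\<^sup>2) ^ k))"
        using b(1) by simp
    qed
  qed (rule pb_measurable'[OF g])
qed

lemma pb_section:
  assumes I: "finite I" "i \<in> I" and g: "pb I g" and f: "f \<in> (I - {i}) \<rightarrow>\<^sub>E UNIV"
  shows "\<exists>C k. \<forall>t. \<bar>g (f(i := t))\<bar> \<le> C * (1 + t\<^sup>2) ^ k"
proof -
  obtain C k where b: "0 \<le> C" "\<And>f K. f \<in> I \<rightarrow>\<^sub>E UNIV \<Longrightarrow> k \<le> K \<Longrightarrow> \<bar>g f\<bar> \<le> C * (1 + (\<Sum>i\<in>I. (f i)\<^sup>2)) ^ K"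
    using g by (rule pb_obtain) blast
  define S where "S = (\<Sum>i\<in>I - {i}. (f i)\<^sup>2)"
  have S: "0 \<le> S" by (simp add: S_def sum_nonneg)
  show ?thesis
  proof (intro exI allI)
    fix t
    have sp: "f(i := t) \<in> I \<rightarrow>\<^sub>E UNIV" using f I by (auto simp: PiE_iff extensional_def)
    have "(\<Sum>j\<in>I. ((f(i := t)) j)\<^sup>2) = t\<^sup>2 + S"
      unfolding S_def using I by (subst sum.remove[of I i]) (auto intro!: sum.cong)
    then have "\<bar>g (f(i := t))\<bar> \<le> C * (1 + (t\<^sup>2 + S)) ^ k" using b(2)[OF sp, of k] by simp
    \<comment> \<open>The fixed coordinates move into the constant:
      \<open>1 + t\<^sup>2 + S \<le> (1 + S) * (1 + t\<^sup>2)\<close>.\<close>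
    also have "\<dots> \<le> C * ((1 + S) * (1 + t\<^sup>2)) ^ k"
      using S by (intro mult_left_mono power_mono b(1)) (auto simp: algebra_simps)
    finally show "\<bar>g (f(i := t))\<bar> \<le> (C * (1 + S) ^ k) * (1 + t\<^sup>2) ^ k" by (simp add: power_mult_distrib mult_ac)
  qed
qed

text \<open>Fubini, with coordinate \<open>i\<close> integrated first, reduces the claim to
  \<open>stein_1d\<close> on each line.\<close>

lemma stein:
  assumes I: "finite I" "i \<in> I" and g: "pb I g" and g': "pb I g'"
    and D: "\<And>f t. f \<in> I \<rightarrow>\<^sub>E UNIV \<Longrightarrow> ((\<lambda>t. g (f(i := t))) has_real_derivative g' (f(i := t))) (at t)"
    and cont: "\<And>f t. f \<in> I \<rightarrow>\<^sub>E UNIV \<Longrightarrow> isCont (\<lambda>t. g' (f(i := t))) t"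
  shows "(\<integral>f. f i * g f \<partial>gpm I) = (\<integral>f. g' f \<partial>gpm I)"
proof -
  have ins: "insert i (I - {i}) = I" using I by auto
  have "(\<integral>f. f i * g f \<partial>gpm I) = (\<integral>f. (\<integral>t. (f(i := t)) i * g (f(i := t)) \<partial>stdn) \<partial>gpm (I - {i}))"
    using gprod.product_integral_insert[of "I - {i}" i "\<lambda>f. f i * g f"] I ins
      pb_integrable[OF I(1) pb_mult[OF pb_coord[OF I] g]] by simp
  also have "\<dots> = (\<integral>f. (\<integral>t. g' (f(i := t)) \<partial>stdn) \<partial>gpm (I - {i}))"
  proof (rule Bochner_Integration.integral_cong[OF refl])
    fix f :: "'a \<Rightarrow> real" assume "f \<in> space (gpm (I - {i}))"
    then have f: "f \<in> (I - {i}) \<rightarrow>\<^sub>E UNIV" by (simp add: space_gpm)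
    have sp: "f(i := 0) \<in> I \<rightarrow>\<^sub>E UNIV" using f I by (auto simp: PiE_iff extensional_def)
    obtain C k where b: "\<And>t. \<bar>g (f(i := t))\<bar> \<le> C * (1 + t\<^sup>2) ^ k" using pb_section[OF I g f] by blast
    obtain C' k' where b': "\<And>t. \<bar>g' (f(i := t))\<bar> \<le> C' * (1 + t\<^sup>2) ^ k'" using pb_section[OF I g' f] by blast
    show "(\<integral>t. (f(i := t)) i * g (f(i := t)) \<partial>stdn) = (\<integral>t. g' (f(i := t)) \<partial>stdn)"
      using stein_1d[of "\<lambda>t. g (f(i := t))" "\<lambda>t. g' (f(i := t))", OF _ _ b b'] D[OF sp] cont[OF sp] by simp
  qed
  also have "\<dots> = (\<integral>f. g' f \<partial>gpm I)"
    using gprod.product_integral_insert[of "I - {i}" i g'] I ins pb_integrable[OF I(1) g'] by simp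
  finally show ?thesis .
qed

section \<open>Derivatives of a rank-one update in one coordinate of its vector\<close>

lemma deriv_mv:
  assumes "\<And>d. d < n \<Longrightarrow> ((\<lambda>t. R t b d) has_real_derivative R' b d) (at t)"
    and "\<And>d. d < n \<Longrightarrow> ((\<lambda>t. x t d) has_real_derivative x' d) (at t)"
  shows "((\<lambda>t. mv n (R t) (x t) b) has_real_derivative (mv n R' (x t) b + mv n (R t) x' b)) (at t)"
proof -
  have "((\<lambda>t. \<Sum>d<n. R t b d * x t d) has_real_derivative (\<Sum>d<n. R' b d * x t d + R t b d * x' d)) (at t)"
    by (rule DERIV_sum) (auto intro!: derivative_eq_intros assms)
  then show ?thesis by (simp add: mv_def sum.distrib)
qed

lemma deriv_ip:
  assumes "\<And>d. d < n \<Longrightarrow> ((\<lambda>t. x t d) has_real_derivative x' d) (at t)"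
    and "\<And>d. d < n \<Longrightarrow> ((\<lambda>t. y t d) has_real_derivative y' d) (at t)"
  shows "((\<lambda>t. ip n (x t) (y t)) has_real_derivative (ip n x' (y t) + ip n (x t) y')) (at t)"
proof -
  have "((\<lambda>t. \<Sum>d<n. x t d * y t d) has_real_derivative (\<Sum>d<n. x' d * y t d + x t d * y' d)) (at t)"
    by (rule DERIV_sum) (auto intro!: derivative_eq_intros assms)
  then show ?thesis by (simp add: inner_N_def sum.distrib)
qed

lemma mv_rank_two:
  "mv n (\<lambda>b d. k * (p b * u d + r b * q d)) v b = k * (p b * ip n v u + r b * ip n q v)"
  by (simp add: mv_def inner_N_def algebra_simps sum.distrib sum_distrib_left)

lemma isCont_mv:
  assumes "\<And>d. d < n \<Longrightarrow> isCont (\<lambda>t. R t b d) t0" "\<And>d. d < n \<Longrightarrow> isCont (\<lambda>t. x t d) t0"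
  shows "isCont (\<lambda>t. mv n (R t) (x t) b) t0"
  unfolding mv_def by (intro continuous_intros) (use assms in auto)

lemma isCont_ip:
  assumes "\<And>d. d < n \<Longrightarrow> isCont (\<lambda>t. x t d) t0" "\<And>d. d < n \<Longrightarrow> isCont (\<lambda>t. y t d) t0"
  shows "isCont (\<lambda>t. ip n (x t) (y t)) t0"
  unfolding inner_N_def by (intro continuous_intros) (use assms in auto)

lemma isCont_trc:
  assumes "\<And>b d. b < n \<Longrightarrow> d < n \<Longrightarrow> isCont (\<lambda>t. R t b d) t0"
  shows "isCont (\<lambda>t. trc n (R t)) t0"
  unfolding trc_def by (intro continuous_intros) (use assms in auto)

abbreviation basis_at :: "nat \<Rightarrow> nat \<Rightarrow> real" where
  "basis_at a \<equiv> (\<lambda>b. if a = b then 1 else 0)"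

lemma deriv_upd: "((\<lambda>t. (x(a := t)) d) has_real_derivative basis_at a d) (at t)" for x :: "nat \<Rightarrow> real"
  by (cases "d = a") (auto intro!: derivative_eq_intros)

context
  fixes n :: nat and A :: "nat \<Rightarrow> nat \<Rightarrow> real" and c :: real and x :: "nat \<Rightarrow> real" and a :: nat
  assumes psdA: "psd n A" and c0: "0 \<le> c" and a: "a < n"
begin

abbreviation (input) "xt t \<equiv> x(a := t)"
abbreviation (input) "st t \<equiv> sm n A c (xt t)"

lemma deriv_mv_upd: "((\<lambda>t. mv n A (xt t) b) has_real_derivative A b a) (at t)"
  using deriv_mv[where R="\<lambda>_. A" and R'="\<lambda>_ _. 0" and n=n and b=b and t=t and x=xt and x'="basis_at a"]
    deriv_upd[of x a] a by (simp add: mv_unit mv_def[of n "\<lambda>_ _. 0"])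

lemma deriv_quad_upd: "((\<lambda>t. ip n (xt t) (mv n A (xt t))) has_real_derivative 2 * mv n A (xt t) a) (at t)"
proof -
  have "((\<lambda>t. ip n (xt t) (mv n A (xt t))) has_real_derivative
      (ip n (basis_at a) (mv n A (xt t)) + ip n (xt t) (\<lambda>b. A b a))) (at t)"
    by (rule deriv_ip[where n=n and x="\<lambda>t. xt t" and x'="basis_at a" and y="\<lambda>t. mv n A (xt t)" and y'="\<lambda>b. A b a",
          OF deriv_upd deriv_mv_upd])
  moreover have "ip n (xt t) (\<lambda>b. A b a) = mv n A (xt t) a"
    unfolding inner_N_def mv_def using psd_sym[OF psdA] a by (intro sum.cong) auto
  ultimately show ?thesis using a by (simp add: ip_unit)
qed

text \<open>The subtracted rank-one term is controlled by Cauchy-Schwarz for the form of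
  \<open>A\<close>.\<close>

lemma psd_sm: "psd n (sm n A c v)"
proof -
  have D: "0 < 1 + c * ip n v (mv n A v)" by (rule sm_denom[OF psdA c0])
  have "0 \<le> ip n u (mv n (sm n A c v) u)" for u
  proof -
    have "ip n u (mv n (sm n A c v) u)
        = ip n u (\<lambda>b. mv n A u b - (c * ip n v (mv n A u) / (1 + c * ip n v (mv n A v))) * mv n A v b)"
      by (rule ip_cong) (auto simp: mv_sm[OF psd_sym[OF psdA]] mult_ac)
    also have "\<dots> = ip n u (mv n A u) - (c * ip n v (mv n A u) / (1 + c * ip n v (mv n A v))) * ip n v (mv n A u)"
      by (simp only: ip_diff_right ip_scale_right) (metis psd_ip_mv[OF psdA] ip_commute)
    also have "\<dots> = (ip n u (mv n A u) + c * (ip n u (mv n A u) * ip n v (mv n A v) - (ip n v (mv n A u))\<^sup>2))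
        / (1 + c * ip n v (mv n A v))"
      using D by (simp add: field_simps power2_eq_square)
    also have "\<dots> \<ge> 0"
      using psd_cauchy[OF psdA, of v u] psd_nonneg[OF psdA, of u] c0 D
      by (intro divide_nonneg_pos add_nonneg_nonneg mult_nonneg_nonneg) (auto simp: mult.commute)
    finally show ?thesis .
  qed
  moreover have "sm n A c v b d = sm n A c v d b" if "b < n" "d < n" for b d
    using psd_sym[OF psdA that] by (simp add: sm_def mult_ac)
  ultimately show ?thesis by (simp add: psd_def)
qed

text \<open>The rule for the derivative of an inverse: minus \<open>R D R\<close>, where
  \<open>D = c (e_a x^T + x e_a^T)\<close> is the direction in which \<open>B + c x x^T\<close>
  moves. It is expressed by the updated matrix itself, so that derivatives of further expressions
  keep the same shape.\<close>

lemma deriv_sm: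
  "((\<lambda>t. st t b d) has_real_derivative
     - c * (st t b a * mv n (st t) (xt t) d + mv n (st t) (xt t) b * st t d a)) (at t)"
proof -
  define D where "D t = 1 + c * ip n (xt t) (mv n A (xt t))" for t
  have D: "D t > 0" for t unfolding D_def by (rule sm_denom[OF psdA c0])
  have dD: "(D has_real_derivative c * (2 * mv n A (xt t) a)) (at t)" for t
    unfolding D_def by (auto intro!: derivative_eq_intros deriv_quad_upd)
  have "((\<lambda>t. A b d - c * mv n A (xt t) b * mv n A (xt t) d / D t) has_real_derivative
      0 - ((c * A b a * mv n A (xt t) d + c * mv n A (xt t) b * A d a) * D t
        - c * mv n A (xt t) b * mv n A (xt t) d * (c * (2 * mv n A (xt t) a))) / (D t * D t)) (at t)"
    using D[of t] deriv_mv_upd dD by (auto intro!: derivative_eq_intros)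
  moreover have "0 - ((c * A b a * mv n A (xt t) d + c * mv n A (xt t) b * A d a) * D t
        - c * mv n A (xt t) b * mv n A (xt t) d * (c * (2 * mv n A (xt t) a))) / (D t * D t)
     = - c * (st t b a * mv n (st t) (xt t) d + mv n (st t) (xt t) b * st t d a)"
    using D[of t] by (simp add: mv_sm_self[OF psdA c0] sm_def D_def[symmetric] field_simps)
  ultimately show ?thesis by (simp add: sm_def D_def)
qed

lemma isCont_sm: "isCont (\<lambda>t. st t b d) t"
  using deriv_sm DERIV_isCont by blast

lemma mv_sm_sym: "ip n (\<lambda>d. st t d a) v = mv n (st t) v a"
  unfolding mv_def inner_N_def using psd_sym[OF psd_sm] a by (intro sum.cong) auto

lemma deriv_sm_mv:
  "b < n \<Longrightarrow> ((\<lambda>t. mv n (st t) (xt t) b) has_real_derivative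
     st t b a - c * (st t b a * ip n (xt t) (mv n (st t) (xt t)) + mv n (st t) (xt t) b * mv n (st t) (xt t) a)) (at t)"
proof -
  assume b: "b < n"
  let ?R' = "\<lambda>b d. - c * (st t b a * mv n (st t) (xt t) d + mv n (st t) (xt t) b * st t d a)"
  have 1: "((\<lambda>t. mv n (st t) (xt t) b) has_real_derivative (mv n ?R' (xt t) b + mv n (st t) (basis_at a) b)) (at t)"
    by (rule deriv_mv[where n=n and R="\<lambda>t. st t" and R'="?R'" and x="\<lambda>t. xt t" and x'="basis_at a" and b=b and t=t,
          OF deriv_sm deriv_upd])
  have 2: "mv n ?R' (xt t) b
      = - c * (st t b a * ip n (xt t) (mv n (st t) (xt t)) + mv n (st t) (xt t) b * mv n (st t) (xt t) a)"
    by (simp only: mv_rank_two mv_sm_sym)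
  show ?thesis by (rule DERIV_cong[OF 1], unfold 2) (simp add: mv_unit[OF a] algebra_simps)
qed

lemma deriv_sm_trc:
  "((\<lambda>t. trc n (st t)) has_real_derivative - 2 * c * mv n (st t) (mv n (st t) (xt t)) a) (at t)"
proof -
  have "((\<lambda>t. trc n (st t)) has_real_derivative
      (\<Sum>d<n. - c * (st t d a * mv n (st t) (xt t) d + mv n (st t) (xt t) d * st t d a))) (at t)"
    unfolding trc_def by (rule DERIV_sum) (rule deriv_sm)
  also have "(\<Sum>d<n. - c * (st t d a * mv n (st t) (xt t) d + mv n (st t) (xt t) d * st t d a))
      = - 2 * c * mv n (st t) (mv n (st t) (xt t)) a"
    unfolding mv_sm_sym[symmetric] by (simp add: inner_N_def sum_distrib_left algebra_simps)
  finally show ?thesis .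
qed

lemma deriv_sm_mv2:
  assumes b: "b < n"
  shows "((\<lambda>t. mv n (st t) (mv n (st t) (xt t)) b) has_real_derivative
     mv n (st t) (\<lambda>d. st t d a) b
     - c * (st t b a * ip n (mv n (st t) (xt t)) (mv n (st t) (xt t)) + mv n (st t) (xt t) b * mv n (st t) (mv n (st t) (xt t)) a)
     - c * (mv n (st t) (\<lambda>d. st t d a) b * ip n (xt t) (mv n (st t) (xt t))
        + mv n (st t) (mv n (st t) (xt t)) b * mv n (st t) (xt t) a)) (at t)"
proof -
  let ?R' = "\<lambda>b d. - c * (st t b a * mv n (st t) (xt t) d + mv n (st t) (xt t) b * st t d a)"
  let ?x' = "\<lambda>b. st t b a - c * (st t b a * ip n (xt t) (mv n (st t) (xt t)) + mv n (st t) (xt t) b * mv n (st t) (xt t) a)"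
  have 1: "((\<lambda>t. mv n (st t) (mv n (st t) (xt t)) b) has_real_derivative
      (mv n ?R' (mv n (st t) (xt t)) b + mv n (st t) ?x' b)) (at t)"
    by (rule deriv_mv[where n=n and R="\<lambda>t. st t" and R'="?R'" and x="\<lambda>t. mv n (st t) (xt t)" and x'="?x'" and b=b and t=t,
          OF deriv_sm deriv_sm_mv])
  have 2: "mv n ?R' (mv n (st t) (xt t)) b = - c * (st t b a * ip n (mv n (st t) (xt t)) (mv n (st t) (xt t))
      + mv n (st t) (xt t) b * mv n (st t) (mv n (st t) (xt t)) a)"
    by (simp only: mv_rank_two mv_sm_sym)
  have "?x' = (\<lambda>d. (st t d a - (c * ip n (xt t) (mv n (st t) (xt t))) * st t d a)
      - (c * mv n (st t) (xt t) a) * mv n (st t) (xt t) d)" by (simp add: fun_eq_iff algebra_simps)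
  then have 3: "mv n (st t) ?x' b = mv n (st t) (\<lambda>d. st t d a) b - (c * ip n (xt t) (mv n (st t) (xt t))) * mv n (st t) (\<lambda>d. st t d a) b
      - (c * mv n (st t) (xt t) a) * mv n (st t) (mv n (st t) (xt t)) b"
    by (simp only: mv_diff mv_scale)
  show ?thesis by (rule DERIV_cong[OF 1], unfold 2 3) (simp add: algebra_simps)
qed

end

section \<open>The resolvent of a Gaussian array\<close>

text \<open>An array \<open>f\<close> indexed by \<open>(j, a)\<close> holds entry \<open>a\<close> of the \<open>j\<close>-th column of the design, divided by
  \<open>sqrt (lam j)\<close>.\<close>

definition col :: "(nat \<times> nat \<Rightarrow> real) \<Rightarrow> nat \<Rightarrow> nat \<Rightarrow> real" where
  "col f j a = f (j, a)"

abbreviation (input) flat :: "nat \<Rightarrow> nat \<Rightarrow> (nat \<times> nat) set" where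
  "flat N n \<equiv> {..<N} \<times> {..<n}"

lemma col_upd_same: "col (f((j, a) := t)) j = (col f j)(a := t)"
  by (auto simp: col_def fun_eq_iff)

lemma col_upd_other: "i \<noteq> j \<Longrightarrow> col (f((j, a) := t)) i = col f i"
  by (auto simp: col_def fun_eq_iff)

locale weighted =
  fixes N n :: nat and \<rho> :: real and w :: "nat \<Rightarrow> real"
  assumes \<rho>: "0 < \<rho>" and w0: "\<And>j. j < N \<Longrightarrow> 0 \<le> w j"
begin

abbreviation "E \<equiv> integral\<^sup>L (gpm (flat N n))"
abbreviation "R J f \<equiv> res n \<rho> w J (col f)"

lemma finJ: "J \<subseteq> {..<N} \<Longrightarrow> finite J"
  by (rule finite_subset) auto

lemma R_is_res: "J \<subseteq> {..<N} \<Longrightarrow> is_res n \<rho> w J (col f) (R J f)"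
  by (rule res_is_res) (use \<rho> w0 finJ in auto)

lemma R_psd: "J \<subseteq> {..<N} \<Longrightarrow> psd n (R J f)"
  by (rule res_psd) (use \<rho> w0 finJ in auto)

lemma R_remove:
  "J \<subseteq> {..<N} \<Longrightarrow> j \<in> J \<Longrightarrow> R J f = sm n (R (J - {j}) f) (w j) (col f j)"
  using res_insert[of "J - {j}" \<rho> j w n "col f"] \<rho> w0 finJ[of J] by (auto simp: insert_absorb)

lemma R_upd_other: "j \<notin> J \<Longrightarrow> R J (f((j, a) := t)) = R J f"
  by (rule res_cong) (metis col_upd_other)

text \<open>Moving one entry of column \<open>j\<close> is an update of a fixed matrix by a moving
  vector, so the derivatives computed for \<open>sm\<close> apply to the resolvent.\<close>

lemma R_upd:
  "J \<subseteq> {..<N} \<Longrightarrow> j \<in> J \<Longrightarrow> R J (f((j, a) := t)) = sm n (R (J - {j}) f) (w j) ((col f j)(a := t))"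
  by (subst R_remove, assumption+) (simp add: R_upd_other col_upd_same)

lemma col_measurable: "j < N \<Longrightarrow> a < n \<Longrightarrow> (\<lambda>f. col f j a) \<in> borel_measurable (Pi\<^sub>M (flat N n) (\<lambda>_. borel))"
  unfolding col_def by (rule measurable_component_singleton) auto

lemma R_measurable:
  assumes "J \<subseteq> {..<N}"
  shows "(\<lambda>f. R J f a b) \<in> borel_measurable (Pi\<^sub>M (flat N n) (\<lambda>_. borel))"
  using finJ[OF assms] assms
proof (induction J arbitrary: a b rule: finite_induct)
  case empty
  show ?case using \<rho> by (simp add: res_empty)
next
  case (insert j J)
  then have [measurable]: "\<And>a b. (\<lambda>f. R J f a b) \<in> borel_measurable (Pi\<^sub>M (flat N n) (\<lambda>_. borel))" by auto
  have [measurable]: "\<And>a. a < n \<Longrightarrow> (\<lambda>f. col f j a) \<in> borel_measurable (Pi\<^sub>M (flat N n) (\<lambda>_. borel))"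
    using insert col_measurable by auto
  have m: "(\<lambda>f. mv n (R J f) (col f j) a) \<in> borel_measurable (Pi\<^sub>M (flat N n) (\<lambda>_. borel))" for a
    unfolding mv_def by (intro borel_measurable_sum borel_measurable_times) auto
  have q: "(\<lambda>f. ip n (col f j) (mv n (R J f) (col f j))) \<in> borel_measurable (Pi\<^sub>M (flat N n) (\<lambda>_. borel))"
    unfolding inner_N_def by (intro borel_measurable_sum borel_measurable_times m) auto
  have "R (insert j J) f = sm n (R J f) (w j) (col f j)" for f
    using insert \<rho> w0 by (intro res_insert) auto
  then show ?case
    unfolding sm_def by simp (intro borel_measurable_diff borel_measurable_divide borel_measurable_times
        borel_measurable_add borel_measurable_const m q, simp_all)
qed

text \<open>Each column lowers the trace, which starts from \<open>n / \<rho>\<close>. The bound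
  blows up as the ridge vanishes and serves integrability alone.\<close>

lemma trc_R_le:
  assumes "J \<subseteq> {..<N}" shows "trc n (R J f) \<le> real n / \<rho>"
  using finJ[OF assms] assms
proof (induction J rule: finite_induct)
  case empty
  show ?case using \<rho> by (simp add: res_empty trc_def)
next
  case (insert j J)
  have "R (insert j J) f = sm n (R J f) (w j) (col f j)"
    using insert \<rho> w0 by (intro res_insert) auto
  moreover have "trc n (sm n (R J f) (w j) (col f j)) \<le> trc n (R J f)"
    by (rule trc_sm_le[OF R_psd]) (use insert w0 in auto)
  ultimately show ?case using insert by simp
qed

text \<open>The entries are bounded; this is why a positive ridge is kept throughout the
  probabilistic part.\<close>

lemma pb_R [intro]:
  assumes J: "J \<subseteq> {..<N}" shows "pb (flat N n) (\<lambda>f. R J f a b)"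
proof (cases "a < n \<and> b < n")
  case True
  show ?thesis
    by (rule pb_bounded[where C="real n / \<rho>", OF R_measurable[OF J]])
       (use True in \<open>auto intro!: order_trans[OF psd_entry_le_trc[OF R_psd[OF J]] trc_R_le[OF J]]\<close>)
next
  case False
  then have "R J f a b = 0" for f using R_is_res[OF J, of f] by (auto simp: is_res_def not_less)
  then show ?thesis by simp
qed

lemma pb_col [intro]: "j < N \<Longrightarrow> a < n \<Longrightarrow> pb (flat N n) (\<lambda>f. col f j a)"
  unfolding col_def by (rule pb_coord) auto

end

lemma pb_mv:
  assumes "\<And>b. b < n \<Longrightarrow> pb I (\<lambda>f. A f a b)" "\<And>b. b < n \<Longrightarrow> pb I (\<lambda>f. v f b)"
  shows "pb I (\<lambda>f. mv n (A f) (v f) a)"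
  unfolding mv_def by (intro pb_sum pb_mult) (use assms in auto)

lemma pb_ip:
  assumes "\<And>b. b < n \<Longrightarrow> pb I (\<lambda>f. u f b)" "\<And>b. b < n \<Longrightarrow> pb I (\<lambda>f. v f b)"
  shows "pb I (\<lambda>f. ip n (u f) (v f))"
  unfolding inner_N_def by (intro pb_sum pb_mult) (use assms in auto)

lemma pb_trc: "(\<And>b. b < n \<Longrightarrow> pb I (\<lambda>f. A f b b)) \<Longrightarrow> pb I (\<lambda>f. trc n (A f))"
  unfolding trc_def by (intro pb_sum) auto

lemma pb_frob: "(\<And>a b. a < n \<Longrightarrow> b < n \<Longrightarrow> pb I (\<lambda>f. A f a b)) \<Longrightarrow> pb I (\<lambda>f. frob n (A f))"
  unfolding frob_def by (intro pb_sum pb_power) auto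

section \<open>Mean identities and moment bounds uniform in the ridge\<close>

context weighted
begin

lemma fin_flat: "finite (flat N n)" by simp

abbreviation "Y J j f \<equiv> ip n (col f j) (mv n (R J f) (col f j))"
abbreviation "Y2 J j f \<equiv> ip n (mv n (R J f) (col f j)) (mv n (R J f) (col f j))"
abbreviation "Y3 J j f \<equiv> ip n (mv n (R J f) (col f j)) (mv n (R J f) (mv n (R J f) (col f j)))"
abbreviation "T J f \<equiv> trc n (R J f)"
abbreviation "F J f \<equiv> frob n (R J f)"

lemma pb_quantities:
  assumes "J \<subseteq> {..<N}"
  shows "pb (flat N n) (\<lambda>f. T J f)" "pb (flat N n) (\<lambda>f. F J f)"
    and "j < N \<Longrightarrow> pb (flat N n) (\<lambda>f. mv n (R J f) (col f j) a)"
    and "j < N \<Longrightarrow> pb (flat N n) (\<lambda>f. mv n (R J f) (mv n (R J f) (col f j)) a)"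
    and "j < N \<Longrightarrow> pb (flat N n) (\<lambda>f. Y J j f)" "j < N \<Longrightarrow> pb (flat N n) (\<lambda>f. Y2 J j f)"
    and "j < N \<Longrightarrow> pb (flat N n) (\<lambda>f. Y3 J j f)"
  by (intro pb_trc pb_frob pb_R assms pb_mv pb_ip pb_col; assumption)+

lemma int_pb: "pb (flat N n) g \<Longrightarrow> integrable (gpm (flat N n)) g"
  by (rule pb_integrable[OF fin_flat])

text \<open>The divergence form \<open>E (z \<bullet> g) = E (div g)\<close> for one column.\<close>

lemma stein_sum:
  assumes j: "j < N" and g: "\<And>a. a < n \<Longrightarrow> pb (flat N n) (g a)" and g': "\<And>a. a < n \<Longrightarrow> pb (flat N n) (g' a)"
    and D: "\<And>a f t. a < n \<Longrightarrow> ((\<lambda>t. g a (f((j, a) := t))) has_real_derivative g' a (f((j, a) := t))) (at t)"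
    and cont: "\<And>a f t. a < n \<Longrightarrow> isCont (\<lambda>t. g' a (f((j, a) := t))) t"
  shows "E (\<lambda>f. \<Sum>a<n. col f j a * g a f) = E (\<lambda>f. \<Sum>a<n. g' a f)"
proof -
  have "E (\<lambda>f. col f j a * g a f) = E (g' a)" if "a < n" for a
    unfolding col_def using stein[OF fin_flat, of "(j, a)" "g a" "g' a"] g[OF that] g'[OF that] D[OF that] cont[OF that] j that
    by auto
  moreover have "E (\<lambda>f. \<Sum>a<n. col f j a * g a f) = (\<Sum>a<n. E (\<lambda>f. col f j a * g a f))"
    by (rule Bochner_Integration.integral_sum) (intro int_pb pb_mult g pb_col j; simp)
  moreover have "E (\<lambda>f. \<Sum>a<n. g' a f) = (\<Sum>a<n. E (g' a))"
    by (rule Bochner_Integration.integral_sum) (intro int_pb g'; simp)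
  moreover have "(\<Sum>a<n. E (\<lambda>f. col f j a * g a f)) = (\<Sum>a<n. E (g' a))"
    by (intro sum.cong refl) (use calculation(1) in auto)
  ultimately show ?thesis by simp
qed

text \<open>Integration by parts for the vector field \<open>R (z j)\<close>, whose inner product
  with \<open>z j\<close> is \<open>Y\<close>.\<close>

lemma stein1:
  assumes J: "J \<subseteq> {..<N}" and j: "j \<in> J"
  shows "E (\<lambda>f. Y J j f) = E (\<lambda>f. T J f - w j * (T J f * Y J j f + Y2 J j f))"
proof -
  have jN: "j < N" using J j by auto
  let ?g' = "\<lambda>a f. R J f a a - w j * (R J f a a * Y J j f + mv n (R J f) (col f j) a * mv n (R J f) (col f j) a)"
  have "E (\<lambda>f. \<Sum>a<n. col f j a * mv n (R J f) (col f j) a) = E (\<lambda>f. \<Sum>a<n. ?g' a f)"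
  proof (rule stein_sum[OF jN])
    fix a f t assume a: "a < n"
    note P = R_psd[of "J - {j}" f] w0[OF jN]
    have P': "psd n (R (J - {j}) f)" using J by (intro R_psd) auto
    show "((\<lambda>t. mv n (R J (f((j, a) := t))) (col (f((j, a) := t)) j) a) has_real_derivative ?g' a (f((j, a) := t))) (at t)"
      unfolding R_upd[OF J j] col_upd_same by (rule deriv_sm_mv[OF P' w0[OF jN] a a])
    show "isCont (\<lambda>t. ?g' a (f((j, a) := t))) t"
      unfolding R_upd[OF J j] col_upd_same
      by (intro continuous_intros isCont_mv isCont_ip isCont_sm[OF P' w0[OF jN] a] DERIV_isCont[OF deriv_upd])
  qed (intro pb_diff pb_mult pb_add pb_quantities pb_R pb_const J jN)+
  also have "(\<lambda>f. \<Sum>a<n. ?g' a f) = (\<lambda>f. T J f - w j * (T J f * Y J j f + Y2 J j f))"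
    by (simp add: trc_def sum_subtractf sum.distrib sum_distrib_left sum_distrib_right
        inner_N_def[of n "mv n _ _"] algebra_simps)
  finally show ?thesis by (simp add: inner_N_def)
qed

lemma sum_split: "(\<Sum>a<k. h a * t + u a * (- 2 * c * v a)) = (\<Sum>a<k. h a) * t - 2 * c * (\<Sum>a<k. u a * v a)"
  for h u v :: "nat \<Rightarrow> real" and t c :: real
  by (simp add: sum.distrib sum_distrib_right sum_distrib_left sum_negf sum_subtractf mult_ac)

text \<open>The vector field is \<open>T * R (z j)\<close>; the derivative of the trace adds the
  term with \<open>Y3\<close>.\<close>

lemma stein2:
  assumes J: "J \<subseteq> {..<N}" and j: "j \<in> J"
  shows "E (\<lambda>f. Y J j f * T J f)
    = E (\<lambda>f. (T J f)\<^sup>2 - w j * ((T J f)\<^sup>2 * Y J j f + T J f * Y2 J j f) - 2 * w j * Y3 J j f)"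
proof -
  have jN: "j < N" using J j by auto
  let ?h = "\<lambda>a f. R J f a a - w j * (R J f a a * Y J j f + mv n (R J f) (col f j) a * mv n (R J f) (col f j) a)"
  let ?g' = "\<lambda>a f. ?h a f * T J f + mv n (R J f) (col f j) a * (- 2 * w j * mv n (R J f) (mv n (R J f) (col f j)) a)"
  have "E (\<lambda>f. \<Sum>a<n. col f j a * (mv n (R J f) (col f j) a * T J f)) = E (\<lambda>f. \<Sum>a<n. ?g' a f)"
  proof (rule stein_sum[OF jN])
    fix a f t assume a: "a < n"
    have P': "psd n (R (J - {j}) f)" using J by (intro R_psd) auto
    note D1 = deriv_sm_mv[OF P' w0[OF jN] a a] and D2 = deriv_sm_trc[OF P' w0[OF jN] a]
    show "((\<lambda>t. mv n (R J (f((j, a) := t))) (col (f((j, a) := t)) j) a * T J (f((j, a) := t)))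
        has_real_derivative ?g' a (f((j, a) := t))) (at t)"
      unfolding R_upd[OF J j] col_upd_same
      by (rule DERIV_cong[OF DERIV_mult[OF D1 D2]]) (simp add: mult_ac)
    show "isCont (\<lambda>t. ?g' a (f((j, a) := t))) t"
      unfolding R_upd[OF J j] col_upd_same
      by (intro continuous_intros isCont_mv isCont_ip isCont_trc isCont_sm[OF P' w0[OF jN] a] DERIV_isCont[OF deriv_upd])
  qed (intro pb_diff pb_mult pb_add pb_quantities pb_R pb_const J jN)+
  also have "(\<lambda>f. \<Sum>a<n. ?g' a f) = (\<lambda>f. (\<Sum>a<n. ?h a f) * T J f
       - 2 * w j * (\<Sum>a<n. mv n (R J f) (col f j) a * mv n (R J f) (mv n (R J f) (col f j)) a))"
    by (rule ext, rule sum_split)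
  also have "\<dots> = (\<lambda>f. (T J f - w j * (T J f * Y J j f + Y2 J j f)) * T J f - 2 * w j * Y3 J j f)"
    by (simp add: trc_def[of n] sum_subtractf sum.distrib sum_distrib_left[symmetric] sum_distrib_right[symmetric]
        inner_N_def[of n "mv n _ _"])
  finally have *: "E (\<lambda>f. \<Sum>a<n. col f j a * (mv n (R J f) (col f j) a * T J f))
    = E (\<lambda>f. (T J f - w j * (T J f * Y J j f + Y2 J j f)) * T J f - 2 * w j * Y3 J j f)" .
  have l: "(\<Sum>a<n. col f j a * (mv n (R J f) (col f j) a * T J f)) = Y J j f * T J f" for f
    by (simp only: inner_N_def sum_distrib_right mult.assoc)
  have r: "(T J f - w j * (T J f * Y J j f + Y2 J j f)) * T J f - 2 * w j * Y3 J j f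
    = (T J f)\<^sup>2 - w j * ((T J f)\<^sup>2 * Y J j f + T J f * Y2 J j f) - 2 * w j * Y3 J j f" for f
    by (simp add: algebra_simps power2_eq_square)
  show ?thesis using * unfolding l r .
qed

text \<open>The vector field is \<open>R (R (z j))\<close>.\<close>

lemma stein3:
  assumes J: "J \<subseteq> {..<N}" and j: "j \<in> J"
  shows "E (\<lambda>f. Y2 J j f)
    = E (\<lambda>f. F J f - w j * (T J f * Y2 J j f + F J f * Y J j f + 2 * Y3 J j f))"
proof -
  have jN: "j < N" using J j by auto
  let ?g' = "\<lambda>a f. mv n (R J f) (\<lambda>d. R J f d a) a
     - w j * (R J f a a * Y2 J j f + mv n (R J f) (col f j) a * mv n (R J f) (mv n (R J f) (col f j)) a)
     - w j * (mv n (R J f) (\<lambda>d. R J f d a) a * Y J j f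
        + mv n (R J f) (mv n (R J f) (col f j)) a * mv n (R J f) (col f j) a)"
  have "E (\<lambda>f. \<Sum>a<n. col f j a * mv n (R J f) (mv n (R J f) (col f j)) a) = E (\<lambda>f. \<Sum>a<n. ?g' a f)"
  proof (rule stein_sum[OF jN])
    fix a f t assume a: "a < n"
    have P': "psd n (R (J - {j}) f)" using J by (intro R_psd) auto
    show "((\<lambda>t. mv n (R J (f((j, a) := t))) (mv n (R J (f((j, a) := t))) (col (f((j, a) := t)) j)) a)
        has_real_derivative ?g' a (f((j, a) := t))) (at t)"
      unfolding R_upd[OF J j] col_upd_same
      by (rule deriv_sm_mv2[OF P' w0[OF jN] a a])
    show "isCont (\<lambda>t. ?g' a (f((j, a) := t))) t"
      unfolding R_upd[OF J j] col_upd_same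
      by (intro continuous_intros isCont_mv isCont_ip isCont_trc isCont_sm[OF P' w0[OF jN] a] DERIV_isCont[OF deriv_upd])
  qed (intro pb_diff pb_mult pb_add pb_mv pb_quantities pb_R pb_const J jN)+
  also have "(\<lambda>f. \<Sum>a<n. ?g' a f) = (\<lambda>f. F J f - w j * (T J f * Y2 J j f + F J f * Y J j f + 2 * Y3 J j f))"
  proof
    fix f
    have F: "F J f = (\<Sum>a<n. mv n (R J f) (\<lambda>d. R J f d a) a)"
      unfolding frob_def mv_def
      using psd_sym[OF R_psd[OF J, of f]] by (intro sum.cong refl) (auto simp: power2_eq_square)
    have Y3: "Y3 J j f = (\<Sum>a<n. mv n (R J f) (col f j) a * mv n (R J f) (mv n (R J f) (col f j)) a)"
      by (simp add: inner_N_def)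
    show "(\<Sum>a<n. ?g' a f) = F J f - w j * (T J f * Y2 J j f + F J f * Y J j f + 2 * Y3 J j f)"
      unfolding F Y3 trc_def
      by (simp add: sum_subtractf sum.distrib sum_distrib_left[symmetric] sum_distrib_right[symmetric] mult.commute[of "mv n (R J f) (mv n (R J f) (col f j)) _"])
         (simp add: algebra_simps)
  qed
  finally have "E (\<lambda>f. \<Sum>a<n. col f j a * mv n (R J f) (mv n (R J f) (col f j)) a)
    = E (\<lambda>f. F J f - w j * (T J f * Y2 J j f + F J f * Y J j f + 2 * Y3 J j f))" .
  moreover have "(\<Sum>a<n. col f j a * mv n (R J f) (mv n (R J f) (col f j)) a) = Y2 J j f" for f
    using psd_ip_mv[OF R_psd[OF J, of f], of "col f j" "mv n (R J f) (col f j)"] by (simp add: inner_N_def)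
  ultimately show ?thesis by simp
qed

lemma trace_sums:
  assumes J: "J \<subseteq> {..<N}"
  shows "(\<Sum>j\<in>J. w j * Y J j f) = real n - \<rho> * T J f"
    and "(\<Sum>j\<in>J. w j * Y2 J j f) = T J f - \<rho> * F J f"
    and "(\<Sum>j\<in>J. w j * Y3 J j f) \<le> F J f"
  using res_trace1[OF R_is_res[OF J]] res_trace2[OF R_is_res[OF J]] apply (simp, simp)
  by (rule res_trace3[OF R_is_res[OF J]]) (use \<rho> w0 J in auto)

lemma T_nonneg: "J \<subseteq> {..<N} \<Longrightarrow> 0 \<le> T J f"
  by (rule trc_nonneg[OF R_psd])

text \<open>Summing the three identities over \<open>J\<close> and inserting the trace sums makes
  \<open>card J - n\<close>, up to the losses 1, 3 and 2, the coefficient of the wanted mean. The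
  left sides are bounded by the same trace sums divided by \<open>c\<close>, because the weights are
  at least \<open>c\<close>. All terms with \<open>\<rho>\<close> have the favourable sign, so the
  bounds do not depend on the ridge.\<close>

lemma moment_bounds:
  assumes J: "J \<subseteq> {..<N}" and c: "0 < c" "\<And>j. j \<in> J \<Longrightarrow> c \<le> w j"
    and d: "0 < d" "d \<le> real (card J) - real n - 3"
  shows "E (T J) \<le> real n / (c * d)" "E (\<lambda>f. (T J f)\<^sup>2) \<le> (real n / (c * d))\<^sup>2"
    and "E (F J) \<le> (real n / (c * (c * d)) + (real n / (c * d))\<^sup>2) / d"
proof -
  have jN: "j < N" if "j \<in> J" for j using J that by auto
  note pbq = pb_quantities[OF J]
  have ETn: "0 \<le> E (T J)" "0 \<le> E (\<lambda>f. (T J f)\<^sup>2)" "0 \<le> E (F J)"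
    using T_nonneg[OF J] frob_nonneg by (auto intro!: integral_nonneg_AE)
  have yw: "Y J j f \<le> w j * Y J j f / c" "Y2 J j f \<le> w j * Y2 J j f / c" if "j \<in> J" for j f
    using c(1) c(2)[OF that] psd_nonneg[OF R_psd[OF J]] ip_nonneg
    by (auto simp: field_simps mult_right_mono)
  have m1: "(real (card J) - real n - 1) * E (T J) \<le> real n / c" if "True"
  proof -
    have "(\<Sum>j\<in>J. E (\<lambda>f. Y J j f)) = (\<Sum>j\<in>J. E (\<lambda>f. T J f - w j * (T J f * Y J j f + Y2 J j f)))"
      by (intro sum.cong refl stein1 J)
    also have "\<dots> = E (\<lambda>f. \<Sum>j\<in>J. T J f - w j * (T J f * Y J j f + Y2 J j f))"
      by (rule Bochner_Integration.integral_sum[symmetric])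
         (intro int_pb pb_diff pb_mult pb_add pbq pb_const jN)
    also have "(\<lambda>f. \<Sum>j\<in>J. T J f - w j * (T J f * Y J j f + Y2 J j f))
        = (\<lambda>f. real (card J) * T J f - T J f * (real n - \<rho> * T J f) - (T J f - \<rho> * F J f))"
      unfolding trace_sums(1,2)[OF J, symmetric]
      by (simp add: sum_subtractf sum.distrib sum_distrib_left algebra_simps)
    \<comment> \<open>The terms with \<open>\<rho>\<close> are nonnegative and are dropped; the loss
      of 1 is the sum of the \<open>w j * Y2\<close>.\<close>
    also have "E \<dots> \<ge> E (\<lambda>f. (real (card J) - real n - 1) * T J f)"
    proof (rule integral_mono)
      fix f
      have "0 \<le> \<rho> * (T J f * T J f) + \<rho> * F J f"
        using \<rho> frob_nonneg T_nonneg[OF J] by (intro add_nonneg_nonneg mult_nonneg_nonneg) auto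
      then show "(real (card J) - real n - 1) * T J f \<le> real (card J) * T J f - T J f * (real n - \<rho> * T J f) - (T J f - \<rho> * F J f)"
        by (simp add: algebra_simps)
    qed (intro int_pb pb_diff pb_mult pb_add pbq pb_const)+
    finally have "(real (card J) - real n - 1) * E (T J) \<le> (\<Sum>j\<in>J. E (\<lambda>f. Y J j f))" by simp
    also have "\<dots> = E (\<lambda>f. \<Sum>j\<in>J. Y J j f)"
      by (rule Bochner_Integration.integral_sum[symmetric]) (intro int_pb pbq jN)
    also have "\<dots> \<le> E (\<lambda>f. real n / c)"
    proof (rule integral_mono)
      fix f
      have "(\<Sum>j\<in>J. Y J j f) \<le> (\<Sum>j\<in>J. w j * Y J j f / c)" by (intro sum_mono yw)
      also have "\<dots> = (real n - \<rho> * T J f) / c" unfolding sum_divide_distrib[symmetric] trace_sums[OF J] ..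
      also have "\<dots> \<le> real n / c" using \<rho> T_nonneg[OF J] c by (simp add: divide_right_mono)
      finally show "(\<Sum>j\<in>J. Y J j f) \<le> real n / c" .
    qed (intro int_pb pb_sum pbq pb_const jN; assumption)+
    also have "\<dots> = real n / c" by (simp add: prob_space.prob_space[OF prob_space_gpm])
    finally show ?thesis .
  qed
  have m2: "(real (card J) - real n - 3) * E (\<lambda>f. (T J f)\<^sup>2) \<le> real n / c * E (T J)" if "True"
  proof -
    have "(\<Sum>j\<in>J. E (\<lambda>f. Y J j f * T J f))
       = (\<Sum>j\<in>J. E (\<lambda>f. (T J f)\<^sup>2 - w j * ((T J f)\<^sup>2 * Y J j f + T J f * Y2 J j f) - 2 * w j * Y3 J j f))"
      by (intro sum.cong refl stein2 J)
    also have "\<dots> = E (\<lambda>f. \<Sum>j\<in>J. (T J f)\<^sup>2 - w j * ((T J f)\<^sup>2 * Y J j f + T J f * Y2 J j f) - 2 * w j * Y3 J j f)"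
      by (rule Bochner_Integration.integral_sum[symmetric])
         (intro int_pb pb_diff pb_mult pb_add pb_power pbq pb_const jN)
    also have "(\<lambda>f. \<Sum>j\<in>J. (T J f)\<^sup>2 - w j * ((T J f)\<^sup>2 * Y J j f + T J f * Y2 J j f) - 2 * w j * Y3 J j f)
        = (\<lambda>f. real (card J) * (T J f)\<^sup>2 - (T J f)\<^sup>2 * (real n - \<rho> * T J f) - T J f * (T J f - \<rho> * F J f) - 2 * (\<Sum>j\<in>J. w j * Y3 J j f))"
      unfolding trace_sums(1,2)[OF J, symmetric]
      by (simp add: sum_subtractf sum.distrib sum_distrib_left algebra_simps)
    also have "E \<dots> \<ge> E (\<lambda>f. (real (card J) - real n - 3) * (T J f)\<^sup>2)"
    proof (rule integral_mono)
      fix f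
      have "0 \<le> \<rho> * ((T J f)\<^sup>2 * T J f) + \<rho> * (T J f * F J f)"
        using \<rho> frob_nonneg T_nonneg[OF J] by (intro add_nonneg_nonneg mult_nonneg_nonneg) auto
      \<comment> \<open>This costs 2 of the 3; the remaining 1 comes from
        \<open>T * Y2\<close>.\<close>
      moreover have "(\<Sum>j\<in>J. w j * Y3 J j f) \<le> (T J f)\<^sup>2"
        using trace_sums(3)[OF J, of f] frob_le_trc[OF R_psd[OF J], of f] by linarith
      ultimately show "(real (card J) - real n - 3) * (T J f)\<^sup>2 \<le> real (card J) * (T J f)\<^sup>2 - (T J f)\<^sup>2 * (real n - \<rho> * T J f)
          - T J f * (T J f - \<rho> * F J f) - 2 * (\<Sum>j\<in>J. w j * Y3 J j f)"
        by (simp add: algebra_simps power2_eq_square)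
    qed (intro int_pb pb_diff pb_mult pb_add pb_power pb_sum pbq pb_const jN; assumption)+
    finally have "(real (card J) - real n - 3) * E (\<lambda>f. (T J f)\<^sup>2) \<le> (\<Sum>j\<in>J. E (\<lambda>f. Y J j f * T J f))" by simp
    also have "\<dots> = E (\<lambda>f. \<Sum>j\<in>J. Y J j f * T J f)"
      by (rule Bochner_Integration.integral_sum[symmetric]) (intro int_pb pb_mult pbq jN)
    also have "\<dots> \<le> E (\<lambda>f. real n / c * T J f)"
    proof (rule integral_mono)
      fix f
      have "(\<Sum>j\<in>J. Y J j f) \<le> (\<Sum>j\<in>J. w j * Y J j f / c)" by (intro sum_mono yw)
      also have "\<dots> = (real n - \<rho> * T J f) / c" unfolding sum_divide_distrib[symmetric] trace_sums[OF J] ..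
      also have "\<dots> \<le> real n / c" using \<rho> T_nonneg[OF J] c by (simp add: divide_right_mono)
      finally show "(\<Sum>j\<in>J. Y J j f * T J f) \<le> real n / c * T J f"
        unfolding sum_distrib_right[symmetric] by (intro mult_right_mono T_nonneg J)
    qed (intro int_pb pb_sum pb_mult pbq pb_const jN; assumption)+
    also have "\<dots> = real n / c * E (T J)" by simp
    finally show ?thesis .
  qed
  have m3: "(real (card J) - real n - 2) * E (F J) \<le> E (T J) / c + E (\<lambda>f. (T J f)\<^sup>2)" if "True"
  proof -
    have "(\<Sum>j\<in>J. E (\<lambda>f. Y2 J j f))
       = (\<Sum>j\<in>J. E (\<lambda>f. F J f - w j * (T J f * Y2 J j f + F J f * Y J j f + 2 * Y3 J j f)))"
      by (intro sum.cong refl stein3 J)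
    also have "\<dots> = E (\<lambda>f. \<Sum>j\<in>J. F J f - w j * (T J f * Y2 J j f + F J f * Y J j f + 2 * Y3 J j f))"
      by (rule Bochner_Integration.integral_sum[symmetric])
         (intro int_pb pb_diff pb_mult pb_add pb_power pbq pb_const jN)
    also have "(\<lambda>f. \<Sum>j\<in>J. F J f - w j * (T J f * Y2 J j f + F J f * Y J j f + 2 * Y3 J j f))
        = (\<lambda>f. real (card J) * F J f - T J f * (T J f - \<rho> * F J f) - F J f * (real n - \<rho> * T J f) - 2 * (\<Sum>j\<in>J. w j * Y3 J j f))"
      unfolding trace_sums(1,2)[OF J, symmetric]
      by (simp add: sum_subtractf sum.distrib sum_distrib_left algebra_simps)
    \<comment> \<open>\<open>T * Y2\<close> sums to at most \<open>T\<^sup>2\<close>, which is later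
      moved to the other side; the two copies of \<open>Y3\<close> cost 2.\<close>
    also have "E \<dots> \<ge> E (\<lambda>f. (real (card J) - real n - 2) * F J f - (T J f)\<^sup>2)"
    proof (rule integral_mono)
      fix f
      have "0 \<le> \<rho> * (T J f * F J f)"
        using \<rho> frob_nonneg T_nonneg[OF J] by (intro add_nonneg_nonneg mult_nonneg_nonneg) auto
      moreover have "(\<Sum>j\<in>J. w j * Y3 J j f) \<le> F J f"
        using trace_sums(3)[OF J, of f] by linarith
      ultimately show "(real (card J) - real n - 2) * F J f - (T J f)\<^sup>2 \<le> real (card J) * F J f - T J f * (T J f - \<rho> * F J f)
          - F J f * (real n - \<rho> * T J f) - 2 * (\<Sum>j\<in>J. w j * Y3 J j f)"
        by (simp add: algebra_simps power2_eq_square)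
    qed (intro int_pb pb_diff pb_mult pb_add pb_power pb_sum pbq pb_const jN; assumption)+
    finally have "E (\<lambda>f. (real (card J) - real n - 2) * F J f - (T J f)\<^sup>2) \<le> (\<Sum>j\<in>J. E (\<lambda>f. Y2 J j f))" .
    also have "\<dots> = E (\<lambda>f. \<Sum>j\<in>J. Y2 J j f)"
      by (rule Bochner_Integration.integral_sum[symmetric]) (intro int_pb pb_mult pbq jN)
    also have "\<dots> \<le> E (\<lambda>f. T J f / c)"
    proof (rule integral_mono)
      fix f
      have "(\<Sum>j\<in>J. Y2 J j f) \<le> (\<Sum>j\<in>J. w j * Y2 J j f / c)" by (intro sum_mono yw)
      also have "\<dots> = (T J f - \<rho> * F J f) / c" unfolding sum_divide_distrib[symmetric] trace_sums[OF J] ..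
      also have "\<dots> \<le> T J f / c" using \<rho> frob_nonneg c by (simp add: divide_right_mono)
      finally show "(\<Sum>j\<in>J. Y2 J j f) \<le> T J f / c" .
    qed (unfold divide_inverse, (intro int_pb pb_sum pb_mult pbq pb_const jN; assumption)+)
    also have "\<dots> = E (T J) / c" by simp
    also have "E (\<lambda>f. (real (card J) - real n - 2) * F J f - (T J f)\<^sup>2)
        = (real (card J) - real n - 2) * E (F J) - E (\<lambda>f. (T J f)\<^sup>2)"
      by (subst Bochner_Integration.integral_diff) (intro int_pb pb_mult pb_power pbq pb_const | simp)+
    finally show ?thesis by simp
  qed
  have "d * E (T J) \<le> (real (card J) - real n - 1) * E (T J)" using d ETn by (intro mult_right_mono) auto
  also note m1[OF TrueI]
  finally have "E (T J) * (c * d) \<le> real n" using c by (simp add: field_simps)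
  then show 1: "E (T J) \<le> real n / (c * d)" using c d by (simp add: field_simps)
  have "d * E (\<lambda>f. (T J f)\<^sup>2) \<le> (real (card J) - real n - 3) * E (\<lambda>f. (T J f)\<^sup>2)"
    using d ETn by (intro mult_right_mono) auto
  also note m2[OF TrueI]
  also have "real n / c * E (T J) \<le> real n / c * (real n / (c * d))" using 1 c by (intro mult_left_mono) auto
  finally have "E (\<lambda>f. (T J f)\<^sup>2) \<le> real n / c * (real n / (c * d)) / d"
    by (subst pos_le_divide_eq[OF d(1)]) (simp only: mult.commute)
  then show 2: "E (\<lambda>f. (T J f)\<^sup>2) \<le> (real n / (c * d))\<^sup>2" by (simp add: power2_eq_square mult_ac)
  have "d * E (F J) \<le> (real (card J) - real n - 2) * E (F J)" using d ETn by (intro mult_right_mono) auto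
  also note m3[OF TrueI]
  also have "E (T J) / c + E (\<lambda>f. (T J f)\<^sup>2) \<le> real n / (c * d) / c + (real n / (c * d))\<^sup>2"
    using 1 2 c by (intro add_mono divide_right_mono) auto
  finally show "E (F J) \<le> (real n / (c * (c * d)) + (real n / (c * d))\<^sup>2) / d"
    using d by (simp add: field_simps)
qed

end

lemma pb_abs [intro]: "pb I g \<Longrightarrow> pb I (\<lambda>f. \<bar>g f\<bar>)"
  unfolding pb_def by (auto intro!: borel_measurable_abs)

lemma div_ge_one_le: "0 \<le> x \<Longrightarrow> 1 \<le> y \<Longrightarrow> x / y \<le> x" for x y :: real
  using frac_le[of x x 1 y] by simp

context weighted
begin

text \<open>The three facts below are about a matrix that does not depend on column \<open>j\<close>.\<close>

lemma quad_centered: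
  assumes j: "j < N" and A: "\<And>f. psd n (A f)" "\<And>a b. a < n \<Longrightarrow> b < n \<Longrightarrow> pb (flat N n) (\<lambda>f. A f a b)"
    and indep: "\<And>f a t. A (f((j, a) := t)) = A f"
    and h: "pb (flat N n) h" "\<And>f a t. h (f((j, a) := t)) = h f"
  shows "E (\<lambda>f. (ip n (col f j) (mv n (A f) (col f j)) - trc n (A f)) * h f) = 0"
proof -
  have pbmv: "pb (flat N n) (\<lambda>f. mv n (A f) (col f j) a)" if "a < n" for a
    by (intro pb_mv A that pb_col j; assumption)
  have "E (\<lambda>f. \<Sum>a<n. col f j a * (mv n (A f) (col f j) a * h f)) = E (\<lambda>f. \<Sum>a<n. A f a a * h f)"
  proof (rule stein_sum[OF j])
    fix a f t assume a: "a < n"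
    show "((\<lambda>t. mv n (A (f((j, a) := t))) (col (f((j, a) := t)) j) a * h (f((j, a) := t)))
      has_real_derivative A (f((j, a) := t)) a a * h (f((j, a) := t))) (at t)"
      unfolding indep h(2) col_upd_same
      by (rule DERIV_cmult_right[OF deriv_mv_upd[OF A(1) order_refl a]])
    show "isCont (\<lambda>t. A (f((j, a) := t)) a a * h (f((j, a) := t))) t"
      unfolding indep h(2) by simp
  qed (intro pb_mult pbmv h A; assumption)+
  then have "E (\<lambda>f. ip n (col f j) (mv n (A f) (col f j)) * h f) = E (\<lambda>f. trc n (A f) * h f)"
    by (simp only: inner_N_def trc_def sum_distrib_right mult.assoc)
  moreover have "integrable (gpm (flat N n)) (\<lambda>f. ip n (col f j) (mv n (A f) (col f j)) * h f)"
    "integrable (gpm (flat N n)) (\<lambda>f. trc n (A f) * h f)"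
    by (intro int_pb pb_mult pb_ip pb_trc pb_col pbmv h A j; assumption)+
  ultimately show ?thesis by (simp add: left_diff_distrib)
qed

lemma quad_norm_mean:
  assumes j: "j < N" and A: "\<And>f. psd n (A f)" "\<And>a b. a < n \<Longrightarrow> b < n \<Longrightarrow> pb (flat N n) (\<lambda>f. A f a b)"
    and indep: "\<And>f a t. A (f((j, a) := t)) = A f"
  shows "E (\<lambda>f. ip n (mv n (A f) (col f j)) (mv n (A f) (col f j))) = E (\<lambda>f. frob n (A f))"
proof -
  have pbmv: "pb (flat N n) (\<lambda>f. mv n (A f) (col f j) a)" if "a < n" for a
    by (intro pb_mv A that pb_col j; assumption)
  let ?g' = "\<lambda>a f. mv n (A f) (\<lambda>d. A f d a) a"
  have "E (\<lambda>f. \<Sum>a<n. col f j a * mv n (A f) (mv n (A f) (col f j)) a) = E (\<lambda>f. \<Sum>a<n. ?g' a f)"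
  proof (rule stein_sum[OF j])
    fix a f t assume a: "a < n"
    have D0: "((\<lambda>t. mv n (A f) (mv n (A f) ((col f j)(a := t))) a) has_real_derivative
        (mv n (\<lambda>_ _. 0) (mv n (A f) ((col f j)(a := t))) a + mv n (A f) (\<lambda>d. A f d a) a)) (at t)"
      by (rule deriv_mv[where n=n and R="\<lambda>t. A f" and R'="\<lambda>_ _. 0" and x="\<lambda>t. mv n (A f) ((col f j)(a := t))"
            and x'="\<lambda>d. A f d a" and b=a and t=t, OF DERIV_const deriv_mv_upd[OF A(1) order_refl a]])
    show "((\<lambda>t. mv n (A (f((j, a) := t))) (mv n (A (f((j, a) := t))) (col (f((j, a) := t)) j)) a)
      has_real_derivative ?g' a (f((j, a) := t))) (at t)"
      unfolding indep col_upd_same by (rule DERIV_cong[OF D0]) (simp add: mv_def[of n "\<lambda>_ _. 0"])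
    show "isCont (\<lambda>t. ?g' a (f((j, a) := t))) t"
      unfolding indep by simp
  qed (intro pb_mv pbmv A; assumption)+
  moreover have "(\<Sum>a<n. col f j a * mv n (A f) (mv n (A f) (col f j)) a)
      = ip n (mv n (A f) (col f j)) (mv n (A f) (col f j))" for f
    using psd_ip_mv[OF A(1)[of f], of "col f j" "mv n (A f) (col f j)"] by (simp add: inner_N_def)
  moreover have "(\<Sum>a<n. ?g' a f) = frob n (A f)" for f
    unfolding frob_def mv_def
    using psd_sym[OF A(1)[of f]] by (intro sum.cong refl) (auto simp: power2_eq_square)
  ultimately show ?thesis by simp
qed

lemma quad_variance:
  assumes j: "j < N" and A: "\<And>f. psd n (A f)" "\<And>a b. a < n \<Longrightarrow> b < n \<Longrightarrow> pb (flat N n) (\<lambda>f. A f a b)"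
    and indep: "\<And>f a t. A (f((j, a) := t)) = A f"
  shows "E (\<lambda>f. (ip n (col f j) (mv n (A f) (col f j)) - trc n (A f))\<^sup>2) = 2 * E (\<lambda>f. frob n (A f))"
proof -
  have pbmv: "pb (flat N n) (\<lambda>f. mv n (A f) (col f j) a)" if "a < n" for a
    by (intro pb_mv A that pb_col j; assumption)
  define v where "v f = ip n (col f j) (mv n (A f) (col f j)) - trc n (A f)" for f
  have v: "pb (flat N n) v" unfolding v_def
    by (intro pb_diff pb_ip pb_trc pb_col pbmv A j; assumption)
  have pbt: "pb (flat N n) (\<lambda>f. trc n (A f))" by (intro pb_trc A; assumption)
  have pbq: "pb (flat N n) (\<lambda>f. ip n (col f j) (mv n (A f) (col f j)))"
    by (intro pb_ip pb_col pbmv j; assumption)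
  \<comment> \<open>The vector field is \<open>A (z j)\<close> times the centred form itself; its
    divergence is \<open>tr A\<close> times that form plus twice the squared norm of
    \<open>A (z j)\<close>.\<close>
  let ?g' = "\<lambda>a f. A f a a * v f + mv n (A f) (col f j) a * (2 * mv n (A f) (col f j) a)"
  have "E (\<lambda>f. \<Sum>a<n. col f j a * (mv n (A f) (col f j) a * v f)) = E (\<lambda>f. \<Sum>a<n. ?g' a f)"
  proof (rule stein_sum[OF j])
    fix a f t assume a: "a < n"
    note D1 = deriv_mv_upd[OF A(1)[of f] order_refl a, of "col f j" a t]
      and D2 = DERIV_diff[OF deriv_quad_upd[OF A(1)[of f] order_refl a, of "col f j" t] DERIV_const[of "trc n (A f)"]]
    show "((\<lambda>t. mv n (A (f((j, a) := t))) (col (f((j, a) := t)) j) a * v (f((j, a) := t)))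
      has_real_derivative ?g' a (f((j, a) := t))) (at t)"
      unfolding indep col_upd_same v_def
      by (rule DERIV_cong[OF DERIV_mult[OF D1 D2]]) (simp add: mult_ac)
    show "isCont (\<lambda>t. ?g' a (f((j, a) := t))) t"
      unfolding indep v_def col_upd_same
      by (intro continuous_intros isCont_mv isCont_ip DERIV_isCont[OF deriv_upd])
  qed (intro pb_add pb_mult pbmv A v pb_const; assumption)+
  moreover have "(\<Sum>a<n. col f j a * (mv n (A f) (col f j) a * v f))
      = (v f)\<^sup>2 + trc n (A f) * v f" for f
  proof -
    have "(\<Sum>a<n. col f j a * (mv n (A f) (col f j) a * v f)) = ip n (col f j) (mv n (A f) (col f j)) * v f"
      by (simp only: inner_N_def sum_distrib_right mult.assoc)
    also have "\<dots> = (v f)\<^sup>2 + trc n (A f) * v f" by (simp add: v_def algebra_simps power2_eq_square)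
    finally show ?thesis .
  qed
  moreover have "(\<Sum>a<n. ?g' a f) = trc n (A f) * v f + 2 * ip n (mv n (A f) (col f j)) (mv n (A f) (col f j))" for f
    by (simp add: sum.distrib trc_def sum_distrib_right sum_distrib_left inner_N_def[of n "mv n _ _"] mult_ac)
  ultimately have "E (\<lambda>f. (v f)\<^sup>2 + trc n (A f) * v f)
      = E (\<lambda>f. trc n (A f) * v f + 2 * ip n (mv n (A f) (col f j)) (mv n (A f) (col f j)))" by simp
  moreover have "integrable (gpm (flat N n)) (\<lambda>f. (v f)\<^sup>2)" "integrable (gpm (flat N n)) (\<lambda>f. trc n (A f) * v f)"
    "integrable (gpm (flat N n)) (\<lambda>f. ip n (mv n (A f) (col f j)) (mv n (A f) (col f j)))"
    by (intro int_pb pb_power pb_mult v pbt pb_ip pbmv; assumption)+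
  ultimately show ?thesis using quad_norm_mean[OF j A indep] by (simp add: v_def)
qed

section \<open>Leaving out one column\<close>

abbreviation "Rm J j f \<equiv> R (J - {j}) f"
abbreviation "q J j f \<equiv> ip n (col f j) (mv n (Rm J j f) (col f j))"
abbreviation "r J j f \<equiv> ip n (mv n (Rm J j f) (col f j)) (mv n (Rm J j f) (col f j))"

text \<open>Sherman-Morrison expresses quantities of the full resolvent by the resolvent of the
  other columns, which is independent of column \<open>j\<close>.\<close>

lemma loo:
  assumes J: "J \<subseteq> {..<N}" and j: "j \<in> J"
  shows "Y J j f = q J j f / (1 + w j * q J j f)" "Y2 J j f = r J j f / (1 + w j * q J j f)\<^sup>2"
    and "T J f = T (J - {j}) f - w j * r J j f / (1 + w j * q J j f)"
    and "0 \<le> q J j f" "0 \<le> r J j f" "0 \<le> w j"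
proof -
  have P: "psd n (Rm J j f)" using J by (intro R_psd) auto
  show w: "0 \<le> w j" using J j w0 by auto
  show "Y J j f = q J j f / (1 + w j * q J j f)" unfolding R_remove[OF J j] by (rule ip_mv_sm_self[OF P w])
  show "Y2 J j f = r J j f / (1 + w j * q J j f)\<^sup>2" unfolding R_remove[OF J j] by (rule norm_mv_sm_self[OF P w])
  show "T J f = T (J - {j}) f - w j * r J j f / (1 + w j * q J j f)"
    unfolding R_remove[OF J j] by (rule trc_sm[OF P w])
  show "0 \<le> q J j f" by (rule psd_nonneg[OF P])
  show "0 \<le> r J j f" by (rule ip_nonneg)
qed

text \<open>Adding column \<open>j\<close> lowers the trace by at most
  \<open>w j * r\<close>.\<close>

lemma q_minus_T:
  assumes J: "J \<subseteq> {..<N}" and j: "j \<in> J"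
  shows "\<bar>q J j f - T J f\<bar> \<le> \<bar>q J j f - T (J - {j}) f\<bar> + w j * r J j f"
proof -
  note l = loo(1-5)[OF J j, of f] loo(6)[OF J j]
  have "0 \<le> w j * r J j f / (1 + w j * q J j f)" using l(4-6) by (simp add: add_nonneg_nonneg)
  moreover have "w j * r J j f / (1 + w j * q J j f) \<le> w j * r J j f"
    using l(4-6) by (intro div_ge_one_le) auto
  ultimately show ?thesis using l(3) by linarith
qed

text \<open>The resolvent without column \<open>j\<close> does not change with that column, so it
  may take the place of the matrix \<open>A\<close> in \<open>quad_variance\<close> and
  \<open>quad_norm_mean\<close>.\<close>

lemma quad_loo:
  assumes J: "J \<subseteq> {..<N}" and j: "j \<in> J"
  shows "E (\<lambda>f. (q J j f - T (J - {j}) f)\<^sup>2) = 2 * E (F (J - {j}))"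
    and "E (\<lambda>f. r J j f) = E (F (J - {j}))"
proof -
  have jN: "j < N" and J': "J - {j} \<subseteq> {..<N}" using J j by auto
  have "Rm J j (f((j, a) := t)) = Rm J j f" for f a t by (rule R_upd_other) simp
  then show "E (\<lambda>f. (q J j f - T (J - {j}) f)\<^sup>2) = 2 * E (F (J - {j}))"
    "E (\<lambda>f. r J j f) = E (F (J - {j}))"
    using quad_variance[OF jN, of "Rm J j", OF R_psd[OF J'] pb_R[OF J']]
      quad_norm_mean[OF jN, of "Rm J j", OF R_psd[OF J'] pb_R[OF J']] by auto
qed

lemma pb_loo:
  assumes J: "J \<subseteq> {..<N}" and j: "j \<in> J"
  shows "pb (flat N n) (\<lambda>f. q J j f)" "pb (flat N n) (\<lambda>f. r J j f)" "pb (flat N n) (\<lambda>f. T (J - {j}) f)"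
proof -
  have jN: "j < N" and J': "J - {j} \<subseteq> {..<N}" using J j by auto
  show "pb (flat N n) (\<lambda>f. q J j f)" by (rule pb_quantities(5)[OF J' jN])
  show "pb (flat N n) (\<lambda>f. r J j f)" by (rule pb_quantities(6)[OF J' jN])
  show "pb (flat N n) (\<lambda>f. T (J - {j}) f)" by (rule pb_quantities(1)[OF J'])
qed

lemma q_minus_T_mean:
  assumes J: "J \<subseteq> {..<N}" and j: "j \<in> J" and K: "E (F (J - {j})) \<le> K" "0 < K"
  shows "E (\<lambda>f. \<bar>q J j f - T J f\<bar>) \<le> sqrt (2 * K) + w j * K"
proof -
  \<comment> \<open>The inequality \<open>2 * s * \<bar>v\<bar> \<le> s\<^sup>2 + v\<^sup>2\<close>
    replaces Cauchy-Schwarz for integrals. For a second moment of at most \<open>2 * K\<close> this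
    \<open>s\<close> is the best choice, and the mean is then at most \<open>s\<close>.\<close>
  define s where "s = sqrt (2 * K)"
  have s: "s > 0" "s\<^sup>2 = 2 * K" using K by (auto simp: s_def)
  note pbl = pb_loo[OF J j] pb_quantities[OF J]
  have "E (\<lambda>f. \<bar>q J j f - T J f\<bar>) \<le> E (\<lambda>f. (s / 2 + inverse (2 * s) * (q J j f - T (J - {j}) f)\<^sup>2) + w j * r J j f)"
  proof (rule integral_mono)
    fix f
    have "0 \<le> (s - \<bar>q J j f - T (J - {j}) f\<bar>)\<^sup>2" by simp
    then have "2 * s * \<bar>q J j f - T (J - {j}) f\<bar> \<le> s\<^sup>2 + (q J j f - T (J - {j}) f)\<^sup>2"
      by (simp add: power2_diff)
    then have "\<bar>q J j f - T (J - {j}) f\<bar> \<le> s / 2 + inverse (2 * s) * (q J j f - T (J - {j}) f)\<^sup>2"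
      using s by (simp add: field_simps power2_eq_square)
    then show "\<bar>q J j f - T J f\<bar> \<le> (s / 2 + inverse (2 * s) * (q J j f - T (J - {j}) f)\<^sup>2) + w j * r J j f"
      using q_minus_T[OF J j, of f] by linarith
  qed (intro int_pb pb_abs pb_add pb_mult pb_power pb_diff pbl pb_const)+
  also have "\<dots> = s / 2 + inverse (2 * s) * E (\<lambda>f. (q J j f - T (J - {j}) f)\<^sup>2) + w j * E (\<lambda>f. r J j f)"
  proof -
    have i: "integrable (gpm (flat N n)) (\<lambda>f. (q J j f - T (J - {j}) f)\<^sup>2)" "integrable (gpm (flat N n)) (\<lambda>f. r J j f)"
      by (intro int_pb pb_power pb_diff pbl)+
    interpret prob_space "gpm (flat N n)" by (rule prob_space_gpm)
    show ?thesis using i by (simp add: prob_space)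
  qed
  also have "\<dots> \<le> s / 2 + inverse (2 * s) * (2 * K) + w j * K"
    unfolding quad_loo[OF J j] using s K loo(6)[OF J j] by (intro add_mono mult_left_mono) auto
  also have "\<dots> = s + w j * K" using s by (simp add: field_simps power2_eq_square)
  finally show ?thesis by (simp add: s_def)
qed

lemma phi_lipschitz:
  fixes v x y :: real
  assumes "0 \<le> v" "0 \<le> x" "0 \<le> y"
  shows "\<bar>v * x / (1 + v * x) - v * y / (1 + v * y)\<bar> \<le> v * \<bar>x - y\<bar>"
proof -
  have p: "1 \<le> 1 + v * x" "1 \<le> 1 + v * y" using assms by auto
  then have "v * x / (1 + v * x) - v * y / (1 + v * y) = (v * (x - y)) / ((1 + v * x) * (1 + v * y))"
    by (simp add: divide_simps) (simp add: algebra_simps)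
  then have "\<bar>v * x / (1 + v * x) - v * y / (1 + v * y)\<bar> = (v * \<bar>x - y\<bar>) / ((1 + v * x) * (1 + v * y))"
    using p assms by (simp add: abs_mult)
  also have "\<dots> \<le> v * \<bar>x - y\<bar>"
    using p assms mult_mono[of 1 "1 + v * x" 1 "1 + v * y"] by (intro div_ge_one_le) auto
  finally show ?thesis .
qed

text \<open>The trace nearly solves \<open>n = (\<Sum>j\<in>J. w j * u / (1 + w j * u))\<close>; the columns in the head
  \<open>J\<^sub>0\<close> may carry arbitrarily large weights.\<close>

lemma fixed_point_mean:
  assumes J: "J \<subseteq> {..<N}" and K: "\<And>j. j \<in> J \<Longrightarrow> E (F (J - {j})) \<le> K" "0 < K"
    and J0: "J0 \<subseteq> J" and C: "\<And>j. j \<in> J - J0 \<Longrightarrow> w j \<le> C" "0 \<le> C"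
  shows "E (\<lambda>f. \<bar>real n - \<rho> * T J f - (\<Sum>j\<in>J. w j * T J f / (1 + w j * T J f))\<bar>)
     \<le> card J0 + card J * (C * (sqrt (2 * K) + C * K))"
proof -
  have fin: "finite J" "finite J0" using finJ[OF J] J0 by (auto intro: finite_subset)
  note pbq = pb_quantities[OF J]
  have wn: "0 \<le> w j" if "j \<in> J" for j using loo(6)[OF J that] .
  have pbl: "pb (flat N n) (\<lambda>f. q J j f)" if "j \<in> J" for j by (rule pb_loo[OF J that])
  have pbphi: "pb (flat N n) (\<lambda>f. w j * T J f / (1 + w j * T J f))" if "j \<in> J" for j
  proof (rule pb_bounded[where C=1])
    have [measurable]: "T J \<in> borel_measurable (Pi\<^sub>M (flat N n) (\<lambda>_. borel))" by (rule pb_measurable[OF pbq(1)])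
    show "(\<lambda>f. w j * T J f / (1 + w j * T J f)) \<in> borel_measurable (Pi\<^sub>M (flat N n) (\<lambda>_. borel))" by measurable
    fix f show "\<bar>w j * T J f / (1 + w j * T J f)\<bar> \<le> 1"
      using mult_nonneg_nonneg[OF wn[OF that] T_nonneg[OF J, of f]] by simp
  qed
  have "E (\<lambda>f. \<bar>real n - \<rho> * T J f - (\<Sum>j\<in>J. w j * T J f / (1 + w j * T J f))\<bar>)
      \<le> E (\<lambda>f. card J0 + (\<Sum>j\<in>J - J0. w j * \<bar>q J j f - T J f\<bar>))"
  proof (rule integral_mono)
    fix f
    let ?d = "\<lambda>j. w j * q J j f / (1 + w j * q J j f) - w j * T J f / (1 + w j * T J f)"
    have eq: "real n - \<rho> * T J f - (\<Sum>j\<in>J. w j * T J f / (1 + w j * T J f)) = (\<Sum>j\<in>J. ?d j)"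
      unfolding trace_sums(1)[OF J, symmetric] using loo(1)[OF J] by (simp add: sum_subtractf)
    have "\<bar>real n - \<rho> * T J f - (\<Sum>j\<in>J. w j * T J f / (1 + w j * T J f))\<bar> \<le> (\<Sum>j\<in>J. \<bar>?d j\<bar>)"
      unfolding eq by (rule sum_abs)
    \<comment> \<open>In the head both fractions lie between 0 and 1; elsewhere the Lipschitz
      estimate applies, with weights of at most \<open>C\<close>.\<close>
    also have "\<dots> = (\<Sum>j\<in>J0. \<bar>?d j\<bar>) + (\<Sum>j\<in>J - J0. \<bar>?d j\<bar>)"
      by (rule trans[OF sum.subset_diff[OF J0 fin(1)] add.commute])
    also have "\<dots> \<le> (\<Sum>j\<in>J0. 1) + (\<Sum>j\<in>J - J0. w j * \<bar>q J j f - T J f\<bar>)"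
    proof (intro add_mono sum_mono)
      fix j assume j: "j \<in> J0"
      then have "j \<in> J" using J0 by auto
      have u: "0 \<le> x / (1 + x) \<and> x / (1 + x) \<le> 1" if "0 \<le> x" for x :: real using that by simp
      have "0 \<le> w j * q J j f" "0 \<le> w j * T J f"
        using wn[OF \<open>j \<in> J\<close>] loo(4)[OF J \<open>j \<in> J\<close>, of f] T_nonneg[OF J, of f] by simp_all
      from u[OF this(1)] u[OF this(2)] show "\<bar>?d j\<bar> \<le> 1" by linarith
    next
      fix j assume "j \<in> J - J0"
      then show "\<bar>?d j\<bar> \<le> w j * \<bar>q J j f - T J f\<bar>"
        using loo(4)[OF J, of j f] loo(6)[OF J, of j] T_nonneg[OF J, of f] by (intro phi_lipschitz) auto
    qed
    finally show "\<bar>real n - \<rho> * T J f - (\<Sum>j\<in>J. w j * T J f / (1 + w j * T J f))\<bar>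
      \<le> card J0 + (\<Sum>j\<in>J - J0. w j * \<bar>q J j f - T J f\<bar>)" by simp
  qed (intro int_pb pb_abs pb_diff pb_add pb_sum pb_mult pbphi pbq pbl pb_const; blast)+
  also have "\<dots> = card J0 + (\<Sum>j\<in>J - J0. w j * E (\<lambda>f. \<bar>q J j f - T J f\<bar>))"
  proof -
    interpret prob_space "gpm (flat N n)" by (rule prob_space_gpm)
    have i: "integrable (gpm (flat N n)) (\<lambda>f. \<bar>q J j f - T J f\<bar>)" if "j \<in> J - J0" for j
      using that by (intro int_pb pb_abs pb_diff pbl pbq) auto
    then have "integrable (gpm (flat N n)) (\<lambda>f. \<Sum>j\<in>J - J0. w j * \<bar>q J j f - T J f\<bar>)"
      by (intro Bochner_Integration.integrable_sum integrable_mult_right) auto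
    then show ?thesis using i by (simp add: prob_space)
  qed
  also have "\<dots> \<le> card J0 + (\<Sum>j\<in>J - J0. C * (sqrt (2 * K) + C * K))"
  proof (intro add_left_mono sum_mono)
    fix j assume j: "j \<in> J - J0"
    have "0 \<le> C" using C(2) .
    have "E (\<lambda>f. \<bar>q J j f - T J f\<bar>) \<le> sqrt (2 * K) + w j * K"
      using j by (intro q_minus_T_mean[OF J _ K]) auto
    also have "\<dots> \<le> sqrt (2 * K) + C * K" using C(1)[OF j] K by (intro add_mono mult_right_mono) auto
    finally show "w j * E (\<lambda>f. \<bar>q J j f - T J f\<bar>) \<le> C * (sqrt (2 * K) + C * K)"
      using C(1)[OF j] wn[of j] j \<open>0 \<le> C\<close> by (intro mult_mono) auto
  qed
  also have "\<dots> \<le> card J0 + card J * (C * (sqrt (2 * K) + C * K))"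
    using K fin C(2) by (auto intro!: mult_right_mono card_mono)
  finally show ?thesis .
qed

end

section \<open>Riemann sums with a moving end point\<close>

lemma riemann_sum_step:
  fixes g :: "real \<Rightarrow> real"
  assumes g: "continuous_on {0..1} g" and N: "0 < N" and m: "m \<le> N" and e: "0 \<le> e"
    and u: "\<And>x y. x \<in> {0..1} \<Longrightarrow> y \<in> {0..1} \<Longrightarrow> \<bar>x - y\<bar> \<le> 1 / real N \<Longrightarrow> \<bar>g x - g y\<bar> \<le> e"
  shows "\<bar>(\<Sum>j<m. g (real (j + 1) / N)) / N - integral {0..real m / N} g\<bar> \<le> real m / N * e"
  using m
proof (induction m)
  case (Suc m)
  let ?a = "real m / N" and ?b = "real (Suc m) / N"
  have ab: "0 \<le> ?a" "?a \<le> ?b" "?b \<le> 1" using Suc.prems N by (auto simp: divide_right_mono)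
  have gi: "g integrable_on {c..d}" if "0 \<le> c" "d \<le> 1" for c d
    by (rule integrable_continuous_interval, rule continuous_on_subset[OF g]) (use that in auto)
  have "integral {0..?a} g + integral {?a..?b} g = integral {0..?b} g"
    using ab by (intro Henstock_Kurzweil_Integration.integral_combine gi) auto
  moreover have "\<bar>g ?b / N - integral {?a..?b} g\<bar> \<le> e / N"
  proof -
    have len: "?b - ?a = 1 / N" by (simp add: add_divide_distrib)
    have c: "integral {?a..?b} (\<lambda>_. g ?b) = g ?b / N" using ab len by simp
    have "\<bar>g ?b / N - integral {?a..?b} g\<bar> = \<bar>integral {?a..?b} (\<lambda>x. g ?b - g x)\<bar>"
      unfolding c[symmetric] using ab
      by (subst Henstock_Kurzweil_Integration.integral_diff) (auto intro!: gi)
    also have "\<dots> \<le> integral {?a..?b} (\<lambda>x. e)"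
    proof -
      have "norm (integral {?a..?b} (\<lambda>x. g ?b - g x)) \<le> integral {?a..?b} (\<lambda>x. e)"
      proof (rule integral_norm_bound_integral)
        fix x assume x: "x \<in> {?a..?b}"
        show "norm (g ?b - g x) \<le> e"
        proof -
          have "x \<in> {0..1}" "?b \<in> {0..1}" "\<bar>?b - x\<bar> \<le> 1 / N"
            using x order_trans[OF ab(1), of x] order_trans[of x ?b 1] order_trans[OF ab(1,2)] ab(3) len
            unfolding atLeastAtMost_iff by linarith+
          then show ?thesis using u[of ?b x] by simp
        qed
      qed (use ab in \<open>auto intro!: integrable_diff gi\<close>)
      then show ?thesis by simp
    qed
    also have "\<dots> = e / N" using ab len by simp
    finally show ?thesis .
  qed
  moreover have "(\<Sum>j<Suc m. g (real (j + 1) / N)) / N = (\<Sum>j<m. g (real (j + 1) / N)) / N + g ?b / N"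
    by (simp add: add_divide_distrib)
  moreover have "real (Suc m) / N * e = real m / N * e + e / N" by (simp add: add_divide_distrib algebra_simps)
  ultimately show ?case using Suc.IH Suc.prems by linarith
qed simp

text \<open>Two limits are separated: the quadrature error up to \<open>m k / N k\<close> vanishes
  by uniform continuity, and the integral is continuous in its end point.\<close>

lemma riemann_sum:
  fixes g :: "real \<Rightarrow> real"
  assumes g: "continuous_on {0..1} g" and N: "filterlim N at_top sequentially" and m: "\<And>k. m k \<le> N k"
    and lim: "(\<lambda>k. real (m k) / real (N k)) \<longlonglongrightarrow> a" and a: "0 \<le> a" "a \<le> 1"
  shows "(\<lambda>k. (\<Sum>j<m k. g (real (j + 1) / N k)) / N k) \<longlonglongrightarrow> integral {0..a} g"
proof -
  have lim0: "(\<lambda>k. (\<Sum>j<m k. g (real (j + 1) / N k)) / N k - integral {0..real (m k) / N k} g) \<longlonglongrightarrow> 0"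
  proof (rule LIMSEQ_I)
    fix e :: real assume e: "0 < e"
    have "uniformly_continuous_on {0..1} g" by (rule compact_uniformly_continuous[OF g]) simp
    then obtain d where d: "0 < d" "\<And>x y. x \<in> {0..1} \<Longrightarrow> y \<in> {0..1} \<Longrightarrow> dist x y < d \<Longrightarrow> dist (g x) (g y) < e / 2"
      using e unfolding uniformly_continuous_on_def by (metis half_gt_zero)
    have "eventually (\<lambda>k. 1 / d < real (N k)) sequentially"
      using filterlim_compose[OF filterlim_real_sequentially N] by (auto simp: filterlim_at_top_dense)
    then have "eventually (\<lambda>k. norm ((\<Sum>j<m k. g (real (j + 1) / N k)) / N k - integral {0..real (m k) / N k} g - 0) < e) sequentially"
    proof eventually_elim
      case (elim k)
      have "0 < 1 / d" using d(1) by simp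
      with elim have Nk: "0 < real (N k)" by linarith
      have "1 / real (N k) < d" using elim d(1) Nk by (simp add: field_simps)
      then have "\<bar>(\<Sum>j<m k. g (real (j + 1) / N k)) / N k - integral {0..real (m k) / N k} g\<bar> \<le> real (m k) / N k * (e / 2)"
      proof (intro riemann_sum_step[OF g _ m])
        fix x y :: real assume "x \<in> {0..1}" "y \<in> {0..1}" "\<bar>x - y\<bar> \<le> 1 / real (N k)"
        then show "\<bar>g x - g y\<bar> \<le> e / 2"
          using d(2)[of x y] \<open>1 / real (N k) < d\<close> by (simp add: dist_real_def)
      qed (use Nk e in auto)
      also have "\<dots> \<le> 1 * (e / 2)" using e m[of k] Nk by (intro mult_right_mono) auto
      finally show ?case using e by simp
    qed
    then show "\<exists>no. \<forall>k\<ge>no. norm ((\<Sum>j<m k. g (real (j + 1) / N k)) / N k - integral {0..real (m k) / N k} g - 0) < e"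
      by (simp add: eventually_sequentially)
  qed
  have "continuous_on {0..1} (\<lambda>x. integral {0..x} g)"
    by (rule indefinite_integral_continuous_1[OF integrable_continuous_interval[OF g]])
  then have "(\<lambda>k. integral {0..real (m k) / N k} g) \<longlonglongrightarrow> integral {0..a} g"
    by (rule continuous_on_tendsto_compose[OF _ lim]) (use a m in \<open>auto intro!: always_eventually simp: divide_le_eq_1\<close>)
  from tendsto_add[OF lim0 this] show ?thesis by simp
qed

section \<open>The limiting equation\<close>

locale power_spectrum =
  fixes \<kappa> \<alpha> \<beta> :: real
  assumes \<kappa>: "0 < \<kappa>" and \<beta>: "0 < \<beta>" "\<beta> < \<alpha>" and \<alpha>: "\<alpha> \<le> 1"
begin

text \<open>The integral of \<open>m_kappa_eq\<close> after the substitution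
  \<open>t = s powr (- \<kappa>)\<close>, which maps the half-line to the range of relative column
  positions.\<close>

definition J1 :: "real \<Rightarrow> real" where
  "J1 m = integral {0..\<alpha>} (\<lambda>s. 1 / (s powr \<kappa> + m))"

lemma \<alpha>_pos: "0 < \<alpha>" using \<beta> by simp

lemma cont_powr: "S \<subseteq> {0..} \<Longrightarrow> continuous_on S (\<lambda>s. s powr \<kappa>)"
  using \<kappa> by (intro continuous_on_powr' continuous_intros) auto

lemma cont_kernel: "0 < m \<Longrightarrow> S \<subseteq> {0..} \<Longrightarrow> continuous_on S (\<lambda>s. 1 / (s powr \<kappa> + m))"
  by (intro continuous_intros cont_powr) (auto simp: add_nonneg_eq_0_iff)

lemma den_pos: "0 < m \<Longrightarrow> 0 < s powr \<kappa> + m"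
  by (simp add: add_nonneg_pos)

lemma int_cont: "continuous_on {0..\<alpha>} g \<Longrightarrow> g integrable_on {0..\<alpha>}" for g :: "real \<Rightarrow> real"
  by (rule integrable_continuous_interval)

text \<open>\<open>F\<close> is an antiderivative of the integrand along the substitution. The
  integrand is nonnegative, so the fundamental theorem applies on the half-line without a separate
  proof of integrability.\<close>

lemma J1_substitution:
  assumes m: "0 < m"
  shows "(LINT t:{\<alpha> powr (- \<kappa>)..}|lborel. 1 / (\<kappa> * t powr (1 / \<kappa>) * (1 + t * m))) = J1 m"
proof -
  define a where "a = \<alpha> powr (- \<kappa>)"
  have a: "0 < a" using \<alpha>_pos by (simp add: a_def)
  define f where "f t = 1 / (\<kappa> * t powr (1 / \<kappa>) * (1 + t * m))" for t
  define G where "G x = integral {0..x} (\<lambda>s. 1 / (s powr \<kappa> + m))" for x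
  define F where "F t = - G (t powr (- (1 / \<kappa>)))" for t
  have ck: "continuous_on {0..\<alpha>} (\<lambda>s. 1 / (s powr \<kappa> + m))" by (rule cont_kernel[OF m]) auto
  have Gd: "(G has_real_derivative 1 / (x powr \<kappa> + m)) (at x)" if "0 < x" "x < \<alpha>" for x
  proof -
    have "(G has_real_derivative 1 / (x powr \<kappa> + m)) (at x within {0..\<alpha>})"
      unfolding G_def by (rule integral_has_real_derivative[OF ck]) (use that in auto)
    moreover have "at x within {0..\<alpha>} = at x" by (rule at_within_interior) (use that in simp)
    ultimately show ?thesis by simp
  qed
  have Gc: "continuous_on {0..\<alpha>} G"
    unfolding G_def by (rule indefinite_integral_continuous_1[OF int_cont[OF ck]])
  have inv: "a powr (- (1 / \<kappa>)) = \<alpha>" using \<kappa> \<alpha>_pos by (simp add: a_def powr_powr)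
  have range: "0 < t powr (- (1 / \<kappa>)) \<and> t powr (- (1 / \<kappa>)) < \<alpha>" if "a < t" for t
  proof -
    have "t powr (- (1 / \<kappa>)) < a powr (- (1 / \<kappa>))"
      using that a \<kappa> by (intro powr_less_mono2_neg) auto
    then show ?thesis using that a inv by auto
  qed
  have Fd: "(F has_real_derivative f t) (at t)" if "a < t" for t
  proof -
    have t: "0 < t" using that a by simp
    let ?x = "t powr (- (1 / \<kappa>))"
    have "(F has_real_derivative - (1 / (?x powr \<kappa> + m) * (- (1 / \<kappa>) * t powr (- (1 / \<kappa>) - 1)))) (at t)"
      unfolding F_def using range[OF that]
      by (intro DERIV_minus DERIV_chain2[where f=G] Gd has_real_derivative_powr t) auto
    moreover have "- (1 / (?x powr \<kappa> + m) * (- (1 / \<kappa>) * t powr (- (1 / \<kappa>) - 1))) = f t"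
    proof -
      have x: "?x powr \<kappa> = 1 / t"
      proof -
        have "?x powr \<kappa> = t powr (- (1 / \<kappa>) * \<kappa>)" by (rule powr_powr)
        also have "- (1 / \<kappa>) * \<kappa> = - 1" using \<kappa> by simp
        finally show ?thesis using t by (simp add: powr_minus_divide)
      qed
      have p: "t powr (- (1 / \<kappa>) - 1) = 1 / (t powr (1 / \<kappa>) * t)"
        using t by (simp add: powr_diff powr_minus_divide)
      have "1 + t * m > 0" using t m by (simp add: add_pos_pos)
      then have "1 / (1 / t + m) = t / (1 + t * m)" using t m by (simp add: field_simps)
      then show ?thesis unfolding x p f_def using t \<kappa> by simp
    qed
    ultimately show ?thesis by simp
  qed
  have "(LBINT t=ereal a..\<infinity>. f t) = 0 - (- G \<alpha>)"
  proof (rule interval_integral_FTC_nonneg(2)[where F=F])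
    show "((F \<circ> real_of_ereal) \<longlongrightarrow> - G \<alpha>) (at_right (ereal a))"
    proof -
      have "((\<lambda>t. t powr (- (1 / \<kappa>))) \<longlongrightarrow> \<alpha>) (at_right a)"
        unfolding inv[symmetric] by (intro tendsto_intros) (use a in auto)
      then have "((\<lambda>t. G (t powr (- (1 / \<kappa>)))) \<longlongrightarrow> G \<alpha>) (at_right a)"
        using \<alpha>_pos range
        by (intro continuous_on_tendsto_compose[OF Gc])
           (auto simp: eventually_at_right_less intro!: eventually_mono[OF eventually_at_right_less[of a]] less_imp_le)
      then have "(F \<longlongrightarrow> - G \<alpha>) (at_right a)" unfolding F_def by (intro tendsto_intros)
      then show ?thesis by (simp add: ereal_tendsto_simps)
    qed
    show "((F \<circ> real_of_ereal) \<longlongrightarrow> 0) (at_left \<infinity>)"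
    proof -
      have "((\<lambda>t. t powr (- (1 / \<kappa>))) \<longlongrightarrow> 0) at_top"
        by (rule tendsto_neg_powr) (use \<kappa> in \<open>auto intro: filterlim_ident\<close>)
      then have "((\<lambda>t. G (t powr (- (1 / \<kappa>)))) \<longlongrightarrow> G 0) at_top"
        using \<alpha>_pos range
        by (intro continuous_on_tendsto_compose[OF Gc])
           (auto intro!: eventually_mono[OF eventually_gt_at_top[of a]] less_imp_le)
      then have "(F \<longlongrightarrow> - G 0) at_top" unfolding F_def by (intro tendsto_intros)
      then show ?thesis by (simp add: ereal_tendsto_simps G_def)
    qed
    show "isCont f t" if "ereal a < ereal t" "ereal t < \<infinity>" for t
    proof -
      have "0 < t" "0 < 1 + t * m" using that a m by (auto intro: add_pos_pos less_trans)
      then show ?thesis unfolding f_def using \<kappa> by (intro continuous_intros) auto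
    qed
    show "AE t in lborel. ereal a < ereal t \<longrightarrow> ereal t < \<infinity> \<longrightarrow> 0 \<le> f t"
      unfolding f_def using a m \<kappa> by (intro AE_I2) auto
  qed (use Fd in auto)
  then have "(LINT t:{a<..}|lborel. f t) = G \<alpha>" by (simp add: interval_integral_to_infinity_eq)
  moreover have "(LINT t:{a<..}|lborel. f t) = (LINT t:{a..}|lborel. f t)"
  proof -
    have [measurable]: "f \<in> borel_measurable borel" unfolding f_def by measurable
    show ?thesis unfolding set_lebesgue_integral_def
      by (rule integral_cong_AE) (auto intro!: eventually_mono[OF AE_lborel_singleton[of a]] simp: indicator_def)
  qed
  ultimately show ?thesis by (simp add: a_def f_def G_def J1_def)
qed

lemma m_kappa_eq_iff: "0 < m \<Longrightarrow> m_kappa_eq \<kappa> \<alpha> \<beta> z m \<longleftrightarrow> - z = 1 / m - J1 m / \<beta>"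
  by (simp add: m_kappa_eq_def J1_substitution)

text \<open>Multiplied by \<open>\<beta> * m\<close>, the equation for \<open>m_kappa\<close> reads
  \<open>h m + (- z * \<beta>) * m = \<beta>\<close>, and its left side is strictly increasing in
  \<open>m\<close>.\<close>

definition h :: "real \<Rightarrow> real" where
  "h m = integral {0..\<alpha>} (\<lambda>s. m / (s powr \<kappa> + m))"

lemma h_J1: "h m = m * J1 m"
  unfolding h_def J1_def by (subst integral_mult_right[symmetric]) simp

lemma h_cont: "continuous_on {0<..} h"
proof -
  have "continuous_on {0<..} (\<lambda>m. integral (cbox 0 \<alpha>) (\<lambda>s. m / (s powr \<kappa> + m)))"
  proof (rule integral_continuous_on_param)
    have "continuous_on ({0<..} \<times> cbox 0 \<alpha>) (\<lambda>x. fst x / (snd x powr \<kappa> + fst x))"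
      using \<kappa> by (intro continuous_intros continuous_on_powr') (auto simp: add_nonneg_eq_0_iff)
    then show "continuous_on ({0<..} \<times> cbox 0 \<alpha>) (\<lambda>(m, s). m / (s powr \<kappa> + m))"
      by (simp add: case_prod_unfold)
  qed
  then show ?thesis by (simp add: h_def[abs_def] cbox_interval)
qed

text \<open>The divided difference of \<open>m \<mapsto> J1 m\<close> is \<open>- J2\<close>.\<close>

definition J2 :: "real \<Rightarrow> real \<Rightarrow> real" where
  "J2 m m' = integral {0..\<alpha>} (\<lambda>s. 1 / ((s powr \<kappa> + m) * (s powr \<kappa> + m')))"

lemma cont_J2_kernel: "0 < m \<Longrightarrow> 0 < m' \<Longrightarrow> continuous_on {0..\<alpha>} (\<lambda>s. 1 / ((s powr \<kappa> + m) * (s powr \<kappa> + m')))"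
  by (intro continuous_intros cont_powr) (auto simp: add_nonneg_eq_0_iff)

lemma J1_diff:
  assumes "0 < m" "0 < m'"
  shows "J1 m - J1 m' = (m' - m) * J2 m m'"
proof -
  have "J1 m - J1 m' = integral {0..\<alpha>} (\<lambda>s. 1 / (s powr \<kappa> + m) - 1 / (s powr \<kappa> + m'))"
    unfolding J1_def using assms
    by (intro Henstock_Kurzweil_Integration.integral_diff[symmetric] int_cont cont_kernel) auto
  also have "\<dots> = integral {0..\<alpha>} (\<lambda>s. (m' - m) * (1 / ((s powr \<kappa> + m) * (s powr \<kappa> + m'))))"
  proof (rule Henstock_Kurzweil_Integration.integral_cong)
    fix s
    have "0 < s powr \<kappa> + m" "0 < s powr \<kappa> + m'" using assms by (auto intro: add_nonneg_pos)
    then show "1 / (s powr \<kappa> + m) - 1 / (s powr \<kappa> + m') = (m' - m) * (1 / ((s powr \<kappa> + m) * (s powr \<kappa> + m')))"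
      by (simp add: field_simps)
  qed
  finally show ?thesis by (simp only: J2_def integral_mult_right)
qed

lemma J2_nonneg: "0 < m \<Longrightarrow> 0 < m' \<Longrightarrow> 0 \<le> J2 m m'"
  unfolding J2_def by (intro Henstock_Kurzweil_Integration.integral_nonneg int_cont cont_J2_kernel) auto

text \<open>The integrands in question vanish at 0, so a positive lower bound is taken on the upper
  half of the interval.\<close>

lemma integral_pos:
  fixes g :: "real \<Rightarrow> real"
  assumes g: "continuous_on {0..\<alpha>} g" and p: "\<And>s. 0 < s \<Longrightarrow> s \<le> \<alpha> \<Longrightarrow> 0 < g s"
  shows "0 < integral {0..\<alpha>} g"
proof -
  have sub: "{\<alpha> / 2..\<alpha>} \<subseteq> {0..\<alpha>}" using \<alpha>_pos by auto
  have n: "0 \<le> g 0"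
  proof -
    have "(g \<longlongrightarrow> g 0) (at 0 within {0..\<alpha>})" using g \<alpha>_pos by (auto simp: continuous_on_def)
    then have "(g \<longlongrightarrow> g 0) (at_right 0)" using \<alpha>_pos by (simp add: at_within_Icc_at_right)
    then show ?thesis
      by (rule tendsto_lowerbound) (use \<alpha>_pos p in \<open>auto simp: eventually_at_right intro!: exI[of _ \<alpha>] less_imp_le\<close>)
  qed
  obtain s0 where s0: "s0 \<in> {\<alpha> / 2..\<alpha>}" "\<And>s. s \<in> {\<alpha> / 2..\<alpha>} \<Longrightarrow> g s0 \<le> g s"
    using continuous_attains_inf[of "{\<alpha> / 2..\<alpha>}" g] continuous_on_subset[OF g sub] \<alpha>_pos by auto
  have "0 < g s0" using s0(1) \<alpha>_pos by (intro p) auto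
  then have "0 < \<alpha> / 2 * g s0" using \<alpha>_pos by simp
  also have "\<dots> = integral {\<alpha> / 2..\<alpha>} (\<lambda>_. g s0)" using \<alpha>_pos by simp
  also have "\<dots> \<le> integral {\<alpha> / 2..\<alpha>} g"
    by (intro integral_le integrable_continuous_interval continuous_on_subset[OF g sub] s0(2)) auto
  also have "\<dots> \<le> integral {0..\<alpha>} g"
  proof (rule integral_subset_le[OF sub])
    show "g integrable_on {\<alpha> / 2..\<alpha>}" by (intro integrable_continuous_interval continuous_on_subset[OF g sub])
    show "\<forall>s\<in>{0..\<alpha>}. 0 \<le> g s"
    proof
      fix s assume "s \<in> {0..\<alpha>}"
      then show "0 \<le> g s" using n p[of s] by (cases "s = 0") auto
    qed
  qed (rule int_cont[OF g])
  finally show ?thesis .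
qed

lemma h_strict_mono:
  assumes "0 < m" "m < m'" shows "h m < h m'"
proof -
  have c: "continuous_on {0..\<alpha>} (\<lambda>s. m / (s powr \<kappa> + m))" if "0 < m" for m
    using that by (intro continuous_intros cont_powr) (auto simp: add_nonneg_eq_0_iff)
  have "0 < integral {0..\<alpha>} (\<lambda>s. m' / (s powr \<kappa> + m') - m / (s powr \<kappa> + m))"
  proof (rule integral_pos)
    fix s :: real assume s: "0 < s"
    then have "m * s powr \<kappa> < m' * s powr \<kappa>" using assms by (intro mult_strict_right_mono) auto
    with den_pos[of m s] den_pos[of m' s] assms
    have "m / (s powr \<kappa> + m) < m' / (s powr \<kappa> + m')" by (simp add: divide_simps) (simp add: algebra_simps)
    then show "0 < m' / (s powr \<kappa> + m') - m / (s powr \<kappa> + m)" by simp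
  qed (use assms in \<open>auto intro!: continuous_on_diff c\<close>)
  also have "\<dots> = h m' - h m" unfolding h_def using assms
    by (intro Henstock_Kurzweil_Integration.integral_diff int_cont c) auto
  finally show ?thesis by simp
qed

text \<open>Splitting at \<open>d\<close> shows that \<open>h m\<close> becomes small with
  \<open>m\<close>, although the integrand is 1 at the origin for every \<open>m\<close>.\<close>

lemma h_le:
  assumes m: "0 < m" and d: "0 < d" "d \<le> \<alpha>"
  shows "h m \<le> d + m / d powr \<kappa>"
proof -
  have c: "continuous_on {0..\<alpha>} (\<lambda>s. m / (s powr \<kappa> + m))"
    using m by (intro continuous_intros cont_powr) (auto simp: add_nonneg_eq_0_iff)
  have i: "(\<lambda>s. m / (s powr \<kappa> + m)) integrable_on {u..v}" if "0 \<le> u" "v \<le> \<alpha>" for u v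
    by (rule integrable_continuous_interval, rule continuous_on_subset[OF c]) (use that in auto)
  have p: "0 < s powr \<kappa> + m" for s using m by (simp add: add_nonneg_pos)
  have "h m = integral {0..d} (\<lambda>s. m / (s powr \<kappa> + m)) + integral {d..\<alpha>} (\<lambda>s. m / (s powr \<kappa> + m))"
    unfolding h_def using d by (intro Henstock_Kurzweil_Integration.integral_combine[symmetric] i) auto
  also have "\<dots> \<le> integral {0..d} (\<lambda>s. 1) + integral {d..\<alpha>} (\<lambda>s. m / d powr \<kappa>)"
  proof (intro add_mono integral_le i integrable_const_ivl)
    fix s show "m / (s powr \<kappa> + m) \<le> 1" using p[of s] m by simp
    assume "s \<in> {d..\<alpha>}"
    then have "d powr \<kappa> \<le> s powr \<kappa>" using d \<kappa> by (intro powr_mono2) auto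
    then show "m / (s powr \<kappa> + m) \<le> m / d powr \<kappa>" using m d den_pos[OF m, of s] by (intro divide_left_mono mult_pos_pos) auto
  qed (use d in auto)
  also have "\<dots> = d + (\<alpha> - d) * (m / d powr \<kappa>)" using d by simp
  also have "\<dots> \<le> d + 1 * (m / d powr \<kappa>)" using d \<alpha> m by (intro add_left_mono mult_right_mono) auto
  finally show ?thesis by simp
qed

text \<open>As \<open>s powr \<kappa> \<le> 1\<close> on the interval, \<open>h m\<close> comes
  arbitrarily close to \<open>\<alpha>\<close> for large \<open>m\<close>; since
  \<open>\<beta> < \<alpha>\<close>, the level \<open>\<beta>\<close> is reached.\<close>

lemma h_ge:
  assumes m: "0 < m" shows "\<alpha> * (m / (1 + m)) \<le> h m"
proof -
  have c: "continuous_on {0..\<alpha>} (\<lambda>s. m / (s powr \<kappa> + m))"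
    using m by (intro continuous_intros cont_powr) (auto simp: add_nonneg_eq_0_iff)
  have "\<alpha> * (m / (1 + m)) = integral {0..\<alpha>} (\<lambda>s. m / (1 + m))" using \<alpha>_pos by simp
  also have "\<dots> \<le> h m" unfolding h_def
  proof (intro integral_le int_cont[OF c] integrable_const_ivl)
    fix s assume s: "s \<in> {0..\<alpha>}"
    then have "s powr \<kappa> \<le> 1" using \<alpha> \<kappa> by (intro powr_le1) auto
    then show "m / (1 + m) \<le> m / (s powr \<kappa> + m)" using m by (intro divide_left_mono) (auto simp: add_nonneg_pos)
  qed
  finally show ?thesis .
qed

lemma root_exists:
  assumes z: "0 \<le> z'"
  shows "\<exists>m>0. h m + z' * m = \<beta>"
proof -
  \<comment> \<open>With this \<open>d\<close>, each of the contributions \<open>d\<close>,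
    \<open>m1 / d powr \<kappa>\<close> and \<open>z' * m1\<close> is at most a quarter of
    \<open>\<beta>\<close>.\<close>
  define d where "d = \<beta> / 4"
  have d: "0 < d" "d \<le> \<alpha>" using \<beta> by (auto simp: d_def)
  define m1 where "m1 = min (d powr \<kappa> * (\<beta> / 4)) (\<beta> / (4 * (1 + z')))"
  have m1: "0 < m1" using d \<beta> z by (simp add: m1_def)
  have "m1 / d powr \<kappa> \<le> \<beta> / 4" using d by (simp add: m1_def divide_le_eq mult.commute)
  moreover have "z' * m1 \<le> \<beta> / 4"
  proof -
    have "z' * m1 \<le> z' * (\<beta> / (4 * (1 + z')))" using z by (intro mult_left_mono) (auto simp: m1_def)
    also have "\<dots> = \<beta> / 4 * (z' / (1 + z'))" using z by simp
    also have "\<dots> \<le> \<beta> / 4 * 1" using z \<beta> by (intro mult_left_mono) auto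
    finally show ?thesis by simp
  qed
  ultimately have lo: "h m1 + z' * m1 \<le> \<beta>" using h_le[OF m1 d] \<beta> unfolding d_def by linarith
  \<comment> \<open>\<open>\<beta> \<le> \<alpha> * (m / (1 + m))\<close> amounts to
    \<open>m \<ge> \<beta> / (\<alpha> - \<beta>)\<close>; the maximum secures
    \<open>m1 \<le> m2\<close>.\<close>
  define m2 where "m2 = max m1 (\<beta> / (\<alpha> - \<beta>))"
  have m2: "0 < m2" "m1 \<le> m2" using m1 by (auto simp: m2_def)
  have "\<beta> / (\<alpha> - \<beta>) \<le> m2" by (simp add: m2_def)
  then have "\<beta> \<le> m2 * (\<alpha> - \<beta>)" using \<beta> by (simp add: divide_le_eq)
  then have "\<beta> * (1 + m2) \<le> \<alpha> * m2" by (simp add: algebra_simps)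
  then have "\<beta> \<le> \<alpha> * (m2 / (1 + m2))" using m2 by (simp add: le_divide_eq)
  then have hi: "\<beta> \<le> h m2 + z' * m2" using h_ge[OF m2(1)] z m2 by (simp add: add_increasing2)
  have "continuous_on {m1..m2} (\<lambda>m. h m + z' * m)"
    by (intro continuous_intros continuous_on_subset[OF h_cont]) (use m1 in auto)
  from IVT'[of "\<lambda>m. h m + z' * m", OF lo hi m2(2) this] m1 show ?thesis
    by (metis order_less_le_trans)
qed

lemma m_kappa_eq_root:
  "0 < m \<Longrightarrow> m_kappa_eq \<kappa> \<alpha> \<beta> z m \<longleftrightarrow> h m + (- z * \<beta>) * m = \<beta>"
  using \<beta> by (simp add: m_kappa_eq_iff h_J1 field_simps)

lemma root_unique:
  assumes "0 \<le> z'" "0 < m" "0 < m'" "h m + z' * m = \<beta>" "h m' + z' * m' = \<beta>"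
  shows "m = m'"
proof (rule ccontr)
  have "h a + z' * a < h b + z' * b" if "0 < a" "a < b" for a b
    using h_strict_mono[OF that] assms(1) that by (intro add_less_le_mono mult_left_mono) auto
  moreover assume "m \<noteq> m'"
  ultimately show False using assms by (metis less_irrefl linorder_neqE)
qed

text \<open>There is one positive root, so the minimality clause is automatic.\<close>

lemma is_m_kappa_iff: "z \<le> 0 \<Longrightarrow> is_m_kappa \<kappa> \<alpha> \<beta> z m \<longleftrightarrow> 0 < m \<and> h m + (- z * \<beta>) * m = \<beta>"
  unfolding is_m_kappa_def using root_unique[of "- z * \<beta>"] \<beta> m_kappa_eq_root
  by (smt (verit) mult_nonneg_nonneg)

lemma is_m_kappa_ex1: assumes z: "z \<le> 0" shows "\<exists>!m. is_m_kappa \<kappa> \<alpha> \<beta> z m"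
proof -
  have z': "0 \<le> - z * \<beta>" using z \<beta> by (intro mult_nonneg_nonneg) auto
  show ?thesis unfolding is_m_kappa_iff[OF z]
    using root_exists[OF z'] root_unique[OF z'] by blast
qed

lemma m_kappa_root: "z \<le> 0 \<Longrightarrow> 0 < m_kappa \<kappa> \<alpha> \<beta> z \<and> h (m_kappa \<kappa> \<alpha> \<beta> z) + (- z * \<beta>) * m_kappa \<kappa> \<alpha> \<beta> z = \<beta>"
  using theI'[OF is_m_kappa_ex1] is_m_kappa_iff unfolding m_kappa_def by blast

definition \<mu> :: real where "\<mu> = m_kappa \<kappa> \<alpha> \<beta> 0"

text \<open>\<open>S2 = \<beta> - \<mu> * h' \<mu>\<close>.\<close>

definition S2 :: real where "S2 = integral {0..\<alpha>} (\<lambda>s. (\<mu> / (s powr \<kappa> + \<mu>))\<^sup>2)"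

lemma \<mu>: "0 < \<mu>" "h \<mu> = \<beta>"
  using m_kappa_root[of 0] by (simp_all add: \<mu>_def)

lemma S2_J2: "S2 = \<mu>\<^sup>2 * J2 \<mu> \<mu>"
  unfolding S2_def J2_def
  by (subst integral_mult_right[symmetric]) (simp add: power_divide power2_eq_square)

text \<open>The integrand of \<open>h\<close> lies strictly between 0 and 1 for
  \<open>s > 0\<close>, so its square has the smaller integral. This makes the slope at
  \<open>\<mu>\<close> positive and the limiting risk finite.\<close>

lemma S2_less: "S2 < \<beta>"
proof -
  have c1: "continuous_on {0..\<alpha>} (\<lambda>s. \<mu> / (s powr \<kappa> + \<mu>))"
    using \<mu> by (intro continuous_intros cont_powr) (auto simp: add_nonneg_eq_0_iff)
  have "0 < integral {0..\<alpha>} (\<lambda>s. \<mu> / (s powr \<kappa> + \<mu>) - (\<mu> / (s powr \<kappa> + \<mu>))\<^sup>2)"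
  proof (rule integral_pos)
    fix s :: real assume "0 < s"
    then have "0 < \<mu> / (s powr \<kappa> + \<mu>)" "\<mu> / (s powr \<kappa> + \<mu>) < 1"
      using den_pos[OF \<mu>(1), of s] \<mu>(1) by (simp_all add: divide_less_eq_1_pos)
    then have "\<mu> / (s powr \<kappa> + \<mu>) * (\<mu> / (s powr \<kappa> + \<mu>)) < \<mu> / (s powr \<kappa> + \<mu>) * 1"
      by (intro mult_strict_left_mono)
    then show "0 < \<mu> / (s powr \<kappa> + \<mu>) - (\<mu> / (s powr \<kappa> + \<mu>))\<^sup>2" by (simp add: power2_eq_square)
  qed (intro continuous_intros c1)
  also have "\<dots> = h \<mu> - S2" unfolding S2_def h_def
    by (intro Henstock_Kurzweil_Integration.integral_diff int_cont continuous_intros c1)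
  finally show ?thesis using \<mu>(2) by simp
qed

lemma S2_nonneg: "0 \<le> S2"
  unfolding S2_J2 using J2_nonneg[OF \<mu>(1) \<mu>(1)] by simp

text \<open>The equation for \<open>m_kappa\<close> gives \<open>z = (m - \<mu>) * slope m\<close> with \<open>m = m_kappa z\<close>.\<close>

definition slope :: "real \<Rightarrow> real" where
  "slope m = 1 / (m * \<mu>) - J2 m \<mu> / \<beta>"

section \<open>The one-sided derivative at zero\<close>

lemma m_kappa_le: assumes "z \<le> 0" shows "m_kappa \<kappa> \<alpha> \<beta> z \<le> \<mu>"
proof (rule ccontr)
  assume "\<not> ?thesis"
  then have "h \<mu> < h (m_kappa \<kappa> \<alpha> \<beta> z)" using h_strict_mono[OF \<mu>(1)] by simp
  moreover have "0 \<le> (- z * \<beta>) * m_kappa \<kappa> \<alpha> \<beta> z"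
    using assms \<beta> m_kappa_root[OF assms] by (intro mult_nonneg_nonneg) auto
  ultimately show False using m_kappa_root[OF assms] \<mu>(2) by linarith
qed

lemma m_kappa_slope:
  assumes z: "z \<le> 0"
  shows "z = (m_kappa \<kappa> \<alpha> \<beta> z - \<mu>) * slope (m_kappa \<kappa> \<alpha> \<beta> z)"
proof -
  define m where "m = m_kappa \<kappa> \<alpha> \<beta> z"
  have m: "0 < m" "h m + (- z * \<beta>) * m = \<beta>" using m_kappa_root[OF z] by (auto simp: m_def)
  have e1: "- z = 1 / m - J1 m / \<beta>" using m_kappa_eq_root[OF m(1)] m(2) m_kappa_eq_iff[OF m(1)] by simp
  have "h \<mu> + (- 0 * \<beta>) * \<mu> = \<beta>" using \<mu> by simp
  then have e2: "- 0 = 1 / \<mu> - J1 \<mu> / \<beta>" using m_kappa_eq_root[OF \<mu>(1)] m_kappa_eq_iff[OF \<mu>(1)] by metis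
  have "z = (1 / \<mu> - 1 / m) + (J1 m - J1 \<mu>) / \<beta>" using e1 e2 by (simp add: diff_divide_distrib)
  also have "1 / \<mu> - 1 / m = (m - \<mu>) / (m * \<mu>)" using m \<mu> by (simp add: field_simps)
  finally show ?thesis
    unfolding J1_diff[OF m(1) \<mu>(1)] slope_def m_def[symmetric] by (simp add: algebra_simps diff_divide_distrib)
qed

text \<open>For \<open>m \<le> \<mu>\<close> one factor of the kernel is at most its value at
  \<open>\<mu>\<close>. The bound is uniform in \<open>m\<close>, so it gives continuity of
  \<open>m_kappa\<close> at 0 before any derivative is known.\<close>

lemma slope_lower:
  assumes m: "0 < m" "m \<le> \<mu>"
  shows "(1 - S2 / \<beta>) / \<mu>\<^sup>2 \<le> slope m"
proof -
  have "m * \<mu> * J2 m \<mu> = integral {0..\<alpha>} (\<lambda>s. m * \<mu> * (1 / ((s powr \<kappa> + m) * (s powr \<kappa> + \<mu>))))"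
    unfolding J2_def by (rule integral_mult_right[symmetric])
  also have "\<dots> \<le> S2" unfolding S2_def
  proof (rule integral_le)
    fix s :: real
    have p: "0 < s powr \<kappa> + m" "0 < s powr \<kappa> + \<mu>" using m \<mu> by (auto intro: add_nonneg_pos)
    have "m * s powr \<kappa> \<le> \<mu> * s powr \<kappa>" using m by (intro mult_right_mono) auto
    then have "m / (s powr \<kappa> + m) \<le> \<mu> / (s powr \<kappa> + \<mu>)" using p by (simp add: divide_simps) (simp add: algebra_simps)
    then have "m / (s powr \<kappa> + m) * (\<mu> / (s powr \<kappa> + \<mu>)) \<le> \<mu> / (s powr \<kappa> + \<mu>) * (\<mu> / (s powr \<kappa> + \<mu>))"
      using p \<mu> by (intro mult_right_mono) auto
    then show "m * \<mu> * (1 / ((s powr \<kappa> + m) * (s powr \<kappa> + \<mu>))) \<le> (\<mu> / (s powr \<kappa> + \<mu>))\<^sup>2"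
      by (simp add: power2_eq_square)
  next
    show "(\<lambda>s. m * \<mu> * (1 / ((s powr \<kappa> + m) * (s powr \<kappa> + \<mu>)))) integrable_on {0..\<alpha>}"
      using m \<mu> by (intro int_cont continuous_on_mult continuous_on_const cont_J2_kernel) auto
    show "(\<lambda>s. (\<mu> / (s powr \<kappa> + \<mu>))\<^sup>2) integrable_on {0..\<alpha>}"
      using \<mu> by (intro int_cont continuous_intros cont_powr) (auto simp: add_nonneg_eq_0_iff)
  qed
  finally have "m * \<mu> * J2 m \<mu> / \<beta> \<le> S2 / \<beta>" using \<beta> by (intro divide_right_mono) auto
  then have "(1 - S2 / \<beta>) / (m * \<mu>) \<le> (1 - m * \<mu> * J2 m \<mu> / \<beta>) / (m * \<mu>)"
    using m \<mu> by (intro divide_right_mono) auto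
  also have "\<dots> = slope m" unfolding slope_def using m \<mu> by (simp add: field_simps)
  finally have "(1 - S2 / \<beta>) / (m * \<mu>) \<le> slope m" .
  moreover have "(1 - S2 / \<beta>) / \<mu>\<^sup>2 \<le> (1 - S2 / \<beta>) / (m * \<mu>)"
    using S2_less \<beta> m \<mu> by (intro divide_left_mono) (auto simp: power2_eq_square mult_right_mono)
  ultimately show ?thesis by linarith
qed

text \<open>Follows from \<open>z = (m - \<mu>) * slope m\<close> and the uniform lower bound of
  \<open>slope\<close>.\<close>

lemma m_kappa_tendsto: "(m_kappa \<kappa> \<alpha> \<beta> \<longlongrightarrow> \<mu>) (at 0 within {..0})"
proof -
  define c where "c = (1 - S2 / \<beta>) / \<mu>\<^sup>2"
  have c: "0 < c" using S2_less \<beta> \<mu> by (simp add: c_def)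
  have b: "\<bar>m_kappa \<kappa> \<alpha> \<beta> z - \<mu>\<bar> \<le> \<bar>z\<bar> / c" if z: "z \<le> 0" for z
  proof -
    have s: "c \<le> slope (m_kappa \<kappa> \<alpha> \<beta> z)"
      unfolding c_def by (rule slope_lower) (use m_kappa_root[OF z] m_kappa_le[OF z] in auto)
    have "\<bar>m_kappa \<kappa> \<alpha> \<beta> z - \<mu>\<bar> * c \<le> \<bar>m_kappa \<kappa> \<alpha> \<beta> z - \<mu>\<bar> * slope (m_kappa \<kappa> \<alpha> \<beta> z)"
      using s by (intro mult_left_mono) auto
    also have "\<dots> = \<bar>z\<bar>" using s c arg_cong[OF m_kappa_slope[OF z], of abs] by (simp add: abs_mult)
    finally show ?thesis using c by (simp add: le_divide_eq)
  qed
  have "((\<lambda>z. m_kappa \<kappa> \<alpha> \<beta> z - \<mu>) \<longlongrightarrow> 0) (at 0 within {..0})"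
  proof (rule Lim_null_comparison)
    show "\<forall>\<^sub>F z in at 0 within {..0}. norm (m_kappa \<kappa> \<alpha> \<beta> z - \<mu>) \<le> \<bar>z\<bar> / c"
      using b by (auto simp: eventually_at_filter)
    show "((\<lambda>z. \<bar>z\<bar> / c) \<longlongrightarrow> 0) (at 0 within {..0})"
      using c by (auto intro!: tendsto_eq_intros)
  qed
  then show ?thesis by (simp add: LIM_zero_iff)
qed

lemma slope_tendsto: "((\<lambda>z. slope (m_kappa \<kappa> \<alpha> \<beta> z)) \<longlongrightarrow> slope \<mu>) (at 0 within {..0})"
proof -
  have "continuous_on {0<..} (\<lambda>m. integral (cbox 0 \<alpha>) (\<lambda>s. 1 / ((s powr \<kappa> + m) * (s powr \<kappa> + \<mu>))))"
  proof (rule integral_continuous_on_param)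
    have "continuous_on ({0<..} \<times> cbox 0 \<alpha>) (\<lambda>x. 1 / ((snd x powr \<kappa> + fst x) * (snd x powr \<kappa> + \<mu>)))"
      using \<kappa> \<mu> by (intro continuous_intros continuous_on_powr') (auto simp: add_nonneg_eq_0_iff)
    then show "continuous_on ({0<..} \<times> cbox 0 \<alpha>) (\<lambda>(m, s). 1 / ((s powr \<kappa> + m) * (s powr \<kappa> + \<mu>)))"
      by (simp add: case_prod_unfold)
  qed
  then have "continuous_on {0<..} slope"
    unfolding slope_def J2_def using \<mu> \<beta> by (intro continuous_intros) (auto simp: cbox_interval)
  then show ?thesis
    by (rule continuous_on_tendsto_compose[OF _ m_kappa_tendsto])
       (use \<mu> m_kappa_root in \<open>auto simp: eventually_at_filter\<close>)
qed

lemma slope_\<mu>: "slope \<mu> = (1 - S2 / \<beta>) / \<mu>\<^sup>2"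
  using \<mu> \<beta> by (simp add: slope_def S2_J2 power2_eq_square field_simps)

text \<open>The difference quotient at 0 equals \<open>1 / slope m\<close> with
  \<open>m = m_kappa z\<close> exactly, so continuity of \<open>slope\<close> and
  \<open>m_kappa\<close> suffices.\<close>

lemma m_kappa_has_derivative:
  "(m_kappa \<kappa> \<alpha> \<beta> has_real_derivative 1 / slope \<mu>) (at 0 within {..0})"
proof -
  have s: "slope \<mu> \<noteq> 0" using S2_less \<beta> \<mu> by (simp add: slope_\<mu>)
  have "((\<lambda>z. 1 / slope (m_kappa \<kappa> \<alpha> \<beta> z)) \<longlongrightarrow> 1 / slope \<mu>) (at 0 within {..0})"
    by (intro tendsto_intros slope_tendsto s)
  then have "((\<lambda>z. (m_kappa \<kappa> \<alpha> \<beta> z - m_kappa \<kappa> \<alpha> \<beta> 0) / (z - 0)) \<longlongrightarrow> 1 / slope \<mu>) (at 0 within {..0})"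
  proof (rule Lim_transform_eventually)
    show "\<forall>\<^sub>F z in at 0 within {..0}. 1 / slope (m_kappa \<kappa> \<alpha> \<beta> z) = (m_kappa \<kappa> \<alpha> \<beta> z - m_kappa \<kappa> \<alpha> \<beta> 0) / (z - 0)"
      unfolding eventually_at_filter
    proof (intro always_eventually allI impI)
      fix z :: real assume z: "z \<noteq> 0" "z \<in> {..0}"
      have e: "z = (m_kappa \<kappa> \<alpha> \<beta> z - \<mu>) * slope (m_kappa \<kappa> \<alpha> \<beta> z)" using z by (intro m_kappa_slope) auto
      then have "slope (m_kappa \<kappa> \<alpha> \<beta> z) \<noteq> 0" "m_kappa \<kappa> \<alpha> \<beta> z - \<mu> \<noteq> 0" using z by auto
      then have "(m_kappa \<kappa> \<alpha> \<beta> z - \<mu>) / ((m_kappa \<kappa> \<alpha> \<beta> z - \<mu>) * slope (m_kappa \<kappa> \<alpha> \<beta> z)) = 1 / slope (m_kappa \<kappa> \<alpha> \<beta> z)"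
        by simp
      then show "1 / slope (m_kappa \<kappa> \<alpha> \<beta> z) = (m_kappa \<kappa> \<alpha> \<beta> z - m_kappa \<kappa> \<alpha> \<beta> 0) / (z - 0)"
        unfolding e[symmetric] by (simp add: \<mu>_def)
    qed
  qed
  then show ?thesis by (simp add: has_field_derivative_iff)
qed

lemma m_kappa_deriv_0: "m_kappa_deriv \<kappa> \<alpha> \<beta> 0 = \<mu>\<^sup>2 * (\<beta> / (\<beta> - S2))"
proof -
  \<comment> \<open>0 is a limit point of \<open>{..0}\<close>, which makes the derivative within
    this set unique.\<close>
  have nt: "at (0::real) within {..0} \<noteq> bot"
    using trivial_limit_at_left_real[of "0::real"] at_le[of "{..<0::real}" "{..0::real}" 0] by (auto simp: bot_unique subset_eq)
  have "m_kappa_deriv \<kappa> \<alpha> \<beta> 0 = 1 / slope \<mu>"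
    unfolding m_kappa_deriv_def
    by (rule vector_derivative_within[OF nt])
       (use m_kappa_has_derivative in \<open>simp add: has_real_derivative_iff_has_vector_derivative\<close>)
  also have "\<dots> = \<mu>\<^sup>2 * (\<beta> / (\<beta> - S2))" unfolding slope_\<mu> using \<beta> \<mu> S2_less by (simp add: field_simps)
  finally show ?thesis .
qed

text \<open>The spectrum \<open>s powr - \<kappa>\<close> is perturbed by bounded factors; an unbounded \<open>s powr - \<kappa>\<close> in
  place of \<open>trunc e s\<close> would not leave the weights positive for small negative \<open>t\<close>.\<close>

definition trunc :: "real \<Rightarrow> real \<Rightarrow> real" where
  "trunc e s = 1 / max (s powr \<kappa>) (e powr \<kappa>)"

text \<open>For weights perturbed by the factor \<open>1 + t * trunc e s\<close>, the trace tends to the solution \<open>u\<close> of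
  \<open>Phi e t u = \<beta>\<close>.\<close>

definition Phi :: "real \<Rightarrow> real \<Rightarrow> real \<Rightarrow> real" where
  "Phi e t u = integral {0..\<alpha>} (\<lambda>s. u * (1 + t * trunc e s) / (s powr \<kappa> + u * (1 + t * trunc e s)))"

section \<open>The equation for perturbed spectra\<close>

lemma cont_trunc: "0 < e \<Longrightarrow> S \<subseteq> {0..} \<Longrightarrow> continuous_on S (trunc e)"
  unfolding trunc_def by (intro continuous_intros cont_powr) (auto simp: max_def not_le intro: less_imp_neq)

lemma trunc_bounds: "0 < e \<Longrightarrow> 0 < trunc e s" "0 < e \<Longrightarrow> trunc e s \<le> 1 / e powr \<kappa>" "0 < e \<Longrightarrow> s powr \<kappa> * trunc e s \<le> 1"
  by (auto simp: trunc_def less_max_iff_disj divide_le_eq intro!: divide_left_mono mult_pos_pos)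

lemma trunc_eq: "0 < e \<Longrightarrow> e \<le> s \<Longrightarrow> s powr \<kappa> * trunc e s = 1"
  using \<kappa> powr_mono2[of \<kappa> e s] by (simp add: trunc_def max_def)

lemma Phi_integrand_cont:
  assumes e: "0 < e" and u: "0 < u" and t: "\<bar>t\<bar> < e powr \<kappa>" and S: "S \<subseteq> {0..}"
  shows "continuous_on S (\<lambda>s. u * (1 + t * trunc e s) / (s powr \<kappa> + u * (1 + t * trunc e s)))"
    and "0 < 1 + t * trunc e s"
proof -
  have p: "0 < 1 + t * trunc e s" for s
  proof -
    have "\<bar>t * trunc e s\<bar> \<le> \<bar>t\<bar> * (1 / e powr \<kappa>)"
      unfolding abs_mult using trunc_bounds[OF e, of s] by (intro mult_left_mono) auto
    also have "\<dots> < 1" using t e by (simp add: divide_less_eq)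
    finally show ?thesis by linarith
  qed
  then show "0 < 1 + t * trunc e s" .
  have "0 < s powr \<kappa> + u * (1 + t * trunc e s)" for s using p[of s] u by (intro den_pos mult_pos_pos)
  then show "continuous_on S (\<lambda>s. u * (1 + t * trunc e s) / (s powr \<kappa> + u * (1 + t * trunc e s)))"
    using e S by (intro continuous_intros cont_powr cont_trunc) (auto simp: less_imp_neq[symmetric] dest: less_imp_neq)
qed

text \<open>The difference quotient at 0 of \<open>t \<mapsto> Phi e (- t) (\<mu> + t * b)\<close>.\<close>

definition Dq :: "real \<Rightarrow> real \<Rightarrow> real \<Rightarrow> real" where
  "Dq e b t = integral {0..\<alpha>} (\<lambda>s. s powr \<kappa> * (b - \<mu> * trunc e s - t * b * trunc e s)
      / ((s powr \<kappa> + (\<mu> + t * b) * (1 - t * trunc e s)) * (s powr \<kappa> + \<mu>)))"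

lemma small_t:
  assumes e: "0 < e"
  shows "\<exists>t0>0. t0 < e powr \<kappa> \<and> (\<forall>t. \<bar>t\<bar> \<le> t0 \<longrightarrow> 0 < \<mu> + t * b)"
proof -
  \<comment> \<open>The first bound keeps the factors \<open>1 + t * trunc e s\<close> positive, the
    second gives \<open>\<bar>t * b\<bar> \<le> \<mu> / 2\<close>.\<close>
  define t0 where "t0 = min (e powr \<kappa> / 2) (\<mu> / (2 * (1 + \<bar>b\<bar>)))"
  have "0 < e powr \<kappa>" using e by simp
  then have t0: "0 < t0" "t0 < e powr \<kappa>" using \<mu> by (auto simp: t0_def min_less_iff_disj)
  have "0 < \<mu> + t * b" if "\<bar>t\<bar> \<le> t0" for t
  proof -
    have "\<bar>t * b\<bar> \<le> t0 * \<bar>b\<bar>" using that by (simp add: abs_mult mult_right_mono)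
    also have "\<dots> \<le> \<mu> / (2 * (1 + \<bar>b\<bar>)) * (1 + \<bar>b\<bar>)"
      using t0 \<mu> by (intro mult_mono) (auto simp: t0_def)
    also have "\<dots> = \<mu> / 2" by (simp add: field_simps)
    finally show ?thesis using \<mu> by linarith
  qed
  then show ?thesis using t0 by blast
qed

text \<open>The denominators stay positive for \<open>\<bar>t\<bar> \<le> t0\<close>, so the
  integrand is jointly continuous.\<close>

lemma Dq_cont:
  assumes e: "0 < e" and t0: "t0 < e powr \<kappa>" "\<And>t. \<bar>t\<bar> \<le> t0 \<Longrightarrow> 0 < \<mu> + t * b"
  shows "continuous_on {-t0..t0} (Dq e b)"
proof -
  have "continuous_on {-t0..t0} (\<lambda>t. integral (cbox 0 \<alpha>) (\<lambda>s. s powr \<kappa> * (b - \<mu> * trunc e s - t * b * trunc e s)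
      / ((s powr \<kappa> + (\<mu> + t * b) * (1 - t * trunc e s)) * (s powr \<kappa> + \<mu>))))"
  proof (rule integral_continuous_on_param)
    have pc: "continuous_on ({-t0..t0} \<times> cbox 0 \<alpha>) (\<lambda>x. snd x powr \<kappa>)"
      using \<kappa> by (intro continuous_intros continuous_on_powr') auto
    have tc: "continuous_on ({-t0..t0} \<times> cbox 0 \<alpha>) (\<lambda>x. trunc e (snd x))"
      by (rule continuous_on_compose2[OF cont_trunc[OF e order_refl] continuous_on_snd[OF continuous_on_id]]) auto
    have nz: "(snd x powr \<kappa> + (\<mu> + fst x * b) * (1 - fst x * trunc e (snd x))) * (snd x powr \<kappa> + \<mu>) \<noteq> 0"
      if "x \<in> {-t0..t0} \<times> cbox 0 \<alpha>" for x
    proof -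
      have ft: "\<bar>fst x\<bar> \<le> t0" using that by auto
      have "0 < 1 + (- fst x) * trunc e (snd x)"
        by (rule Phi_integrand_cont(2)[OF e \<mu>(1), where S="{}"]) (use ft t0 in auto)
      then have "0 < (\<mu> + fst x * b) * (1 - fst x * trunc e (snd x))" using t0(2)[OF ft] by simp
      then show ?thesis using den_pos[of _ "snd x"] \<mu>(1) by (metis less_irrefl mult_pos_pos)
    qed
    have "continuous_on ({-t0..t0} \<times> cbox 0 \<alpha>) (\<lambda>x. snd x powr \<kappa> * (b - \<mu> * trunc e (snd x) - fst x * b * trunc e (snd x))
      / ((snd x powr \<kappa> + (\<mu> + fst x * b) * (1 - fst x * trunc e (snd x))) * (snd x powr \<kappa> + \<mu>)))"
      by (intro continuous_on_divide continuous_on_mult continuous_on_add continuous_on_diff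
          continuous_on_const continuous_on_fst continuous_on_id pc tc ballI nz)
    then show "continuous_on ({-t0..t0} \<times> cbox 0 \<alpha>) (\<lambda>(t, s). s powr \<kappa> * (b - \<mu> * trunc e s - t * b * trunc e s)
      / ((s powr \<kappa> + (\<mu> + t * b) * (1 - t * trunc e s)) * (s powr \<kappa> + \<mu>)))"
      by (simp add: case_prod_unfold)
  qed
  then show ?thesis by (simp add: Dq_def[abs_def] cbox_interval)
qed

text \<open>Rests on \<open>x / (y + x) - \<mu> / (y + \<mu>) = y * (x - \<mu>) / ((y + x) * (y +
  \<mu>))\<close>, where \<open>x - \<mu>\<close> carries a factor \<open>t\<close>.\<close>

lemma Phi_Dq:
  assumes e: "0 < e" and t: "\<bar>t\<bar> < e powr \<kappa>" and u: "0 < \<mu> + t * b"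
  shows "Phi e (- t) (\<mu> + t * b) - \<beta> = t * Dq e b t"
proof -
  have c: "continuous_on {0..\<alpha>} (\<lambda>s. (\<mu> + t * b) * (1 + (-t) * trunc e s) / (s powr \<kappa> + (\<mu> + t * b) * (1 + (-t) * trunc e s)))"
    by (rule Phi_integrand_cont(1)[OF e u]) (use t in auto)
  have c1: "continuous_on {0..\<alpha>} (\<lambda>s. \<mu> / (s powr \<kappa> + \<mu>))"
    using \<mu> by (intro continuous_intros cont_powr) (auto simp: add_nonneg_eq_0_iff)
  have "Phi e (- t) (\<mu> + t * b) - h \<mu> = integral {0..\<alpha>} (\<lambda>s. (\<mu> + t * b) * (1 + (-t) * trunc e s) / (s powr \<kappa> + (\<mu> + t * b) * (1 + (-t) * trunc e s)) - \<mu> / (s powr \<kappa> + \<mu>))"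
    unfolding Phi_def h_def by (intro Henstock_Kurzweil_Integration.integral_diff[symmetric] int_cont c c1)
  also have "\<dots> = integral {0..\<alpha>} (\<lambda>s. t * (s powr \<kappa> * (b - \<mu> * trunc e s - t * b * trunc e s)
      / ((s powr \<kappa> + (\<mu> + t * b) * (1 - t * trunc e s)) * (s powr \<kappa> + \<mu>))))"
  proof (rule Henstock_Kurzweil_Integration.integral_cong)
    fix s
    have "0 < 1 + (- t) * trunc e s"
      by (rule Phi_integrand_cont(2)[OF e \<mu>(1), where S="{}"]) (use t in auto)
    then have "0 < (\<mu> + t * b) * (1 + (-t) * trunc e s)" using u by simp
    from den_pos[OF this, of s] den_pos[OF \<mu>(1), of s]
    have key: "x / (y + x) - \<mu> / (y + \<mu>) = y * (x - \<mu>) / ((y + x) * (y + \<mu>))"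
      if "y = s powr \<kappa>" "x = (\<mu> + t * b) * (1 + (-t) * trunc e s)" for x y
      unfolding that[symmetric] by (simp add: divide_simps) (simp add: algebra_simps)
    have x: "(\<mu> + t * b) * (1 + (-t) * trunc e s) - \<mu> = t * (b - \<mu> * trunc e s - t * b * trunc e s)"
      by (simp add: algebra_simps)
    show "(\<mu> + t * b) * (1 + (-t) * trunc e s) / (s powr \<kappa> + (\<mu> + t * b) * (1 + (-t) * trunc e s)) - \<mu> / (s powr \<kappa> + \<mu>)
      = t * (s powr \<kappa> * (b - \<mu> * trunc e s - t * b * trunc e s)
      / ((s powr \<kappa> + (\<mu> + t * b) * (1 - t * trunc e s)) * (s powr \<kappa> + \<mu>)))"
      unfolding key[OF refl refl] x by simp
  qed
  also have "\<dots> = t * Dq e b t" by (simp only: Dq_def integral_mult_right)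
  finally show ?thesis using \<mu>(2) by simp
qed

text \<open>With \<open>P = \<mu> / (s powr \<kappa> + \<mu>)\<close>, the integrand at
  \<open>t = 0\<close> multiplied by \<open>\<mu>\<close> is \<open>b * (P - P\<^sup>2)\<close>
  minus \<open>P\<^sup>2\<close> times \<open>s powr \<kappa> * trunc e s\<close>. The last factor
  is at most 1 and equals 1 from \<open>e\<close> on, so the truncation changes \<open>S2\<close> by
  at most \<open>e\<close>.\<close>

lemma Dq_0:
  assumes e: "0 < e"
  shows "b * (\<beta> - S2) - S2 \<le> \<mu> * Dq e b 0" and "e \<le> \<alpha> \<Longrightarrow> \<mu> * Dq e b 0 \<le> b * (\<beta> - S2) - S2 + e"
proof -
  define P where "P s = \<mu> / (s powr \<kappa> + \<mu>)" for s
  have c1: "continuous_on S P" if "S \<subseteq> {0..}" for S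
    unfolding P_def using that \<mu> by (intro continuous_intros cont_powr) (auto simp: add_nonneg_eq_0_iff)
  have cy: "continuous_on S (\<lambda>s. s powr \<kappa> * trunc e s * (P s)\<^sup>2)" if "S \<subseteq> {0..}" for S
    using that e by (intro continuous_intros cont_powr cont_trunc c1)
  define W where "W = integral {0..\<alpha>} (\<lambda>s. s powr \<kappa> * trunc e s * (P s)\<^sup>2)"
  have "\<mu> * Dq e b 0 = integral {0..\<alpha>} (\<lambda>s. b * (P s - (P s)\<^sup>2) - s powr \<kappa> * trunc e s * (P s)\<^sup>2)"
    unfolding Dq_def integral_mult_right[symmetric]
  proof (rule Henstock_Kurzweil_Integration.integral_cong)
    fix s
    have p: "0 < s powr \<kappa> + \<mu>" by (rule den_pos[OF \<mu>(1)])
    have a: "s powr \<kappa> * \<mu> / (s powr \<kappa> + \<mu>)\<^sup>2 = P s - (P s)\<^sup>2"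
      using p by (simp add: P_def power2_eq_square divide_simps) (simp add: algebra_simps)
    have "\<mu> * (s powr \<kappa> * (b - \<mu> * trunc e s - 0 * b * trunc e s) / ((s powr \<kappa> + (\<mu> + 0 * b) * (1 - 0 * trunc e s)) * (s powr \<kappa> + \<mu>)))
      = b * (s powr \<kappa> * \<mu> / (s powr \<kappa> + \<mu>)\<^sup>2) - s powr \<kappa> * trunc e s * (P s)\<^sup>2"
      by (simp add: P_def power2_eq_square diff_divide_distrib algebra_simps)
    then show "\<mu> * (s powr \<kappa> * (b - \<mu> * trunc e s - 0 * b * trunc e s) / ((s powr \<kappa> + (\<mu> + 0 * b) * (1 - 0 * trunc e s)) * (s powr \<kappa> + \<mu>)))
      = b * (P s - (P s)\<^sup>2) - s powr \<kappa> * trunc e s * (P s)\<^sup>2" unfolding a .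
  qed
  also have "\<dots> = integral {0..\<alpha>} (\<lambda>s. b * (P s - (P s)\<^sup>2)) - W" unfolding W_def
    by (intro Henstock_Kurzweil_Integration.integral_diff int_cont continuous_intros c1 cy) auto
  also have "integral {0..\<alpha>} (\<lambda>s. b * (P s - (P s)\<^sup>2)) = b * (integral {0..\<alpha>} P - integral {0..\<alpha>} (\<lambda>s. (P s)\<^sup>2))"
    unfolding integral_mult_right
    by (subst Henstock_Kurzweil_Integration.integral_diff) (auto intro!: int_cont continuous_intros c1)
  also have "integral {0..\<alpha>} P = \<beta>" using \<mu>(2) by (simp add: h_def P_def[abs_def])
  also have "integral {0..\<alpha>} (\<lambda>s. (P s)\<^sup>2) = S2" by (simp add: S2_def P_def)
  finally have D: "\<mu> * Dq e b 0 = b * (\<beta> - S2) - W" .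
  have yt: "0 \<le> s powr \<kappa> * trunc e s" "s powr \<kappa> * trunc e s \<le> 1" for s
    using trunc_bounds[OF e, of s] by auto
  have P01: "0 \<le> (P s)\<^sup>2" "(P s)\<^sup>2 \<le> 1" for s
    using den_pos[OF \<mu>(1), of s] \<mu>(1) by (auto simp: P_def power_le_one)
  have "W \<le> integral {0..\<alpha>} (\<lambda>s. (P s)\<^sup>2)" unfolding W_def
    using yt P01 by (intro integral_le int_cont continuous_intros c1 cy) (auto intro: mult_left_le_one_le)
  then show "b * (\<beta> - S2) - S2 \<le> \<mu> * Dq e b 0" unfolding D by (simp add: S2_def P_def)
  assume ea: "e \<le> \<alpha>"
  have i: "(\<lambda>s. (P s)\<^sup>2) integrable_on {u..v}" "(\<lambda>s. s powr \<kappa> * trunc e s * (P s)\<^sup>2) integrable_on {u..v}" if "0 \<le> u" for u v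
    by (intro integrable_continuous_interval continuous_intros c1 cy; use that in auto)+
  have "S2 = integral {0..e} (\<lambda>s. (P s)\<^sup>2) + integral {e..\<alpha>} (\<lambda>s. (P s)\<^sup>2)"
    unfolding S2_def P_def[symmetric] using e ea
    by (intro Henstock_Kurzweil_Integration.integral_combine[symmetric] i) auto
  also have "\<dots> \<le> integral {0..e} (\<lambda>s. 1) + integral {e..\<alpha>} (\<lambda>s. s powr \<kappa> * trunc e s * (P s)\<^sup>2)"
  proof (intro add_mono integral_le i integrable_const_ivl)
    fix s show "(P s)\<^sup>2 \<le> 1" by (rule P01)
    assume "s \<in> {e..\<alpha>}"
    then show "(P s)\<^sup>2 \<le> s powr \<kappa> * trunc e s * (P s)\<^sup>2" using trunc_eq[OF e, of s] by simp
  qed (use e in auto)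
  also have "integral {e..\<alpha>} (\<lambda>s. s powr \<kappa> * trunc e s * (P s)\<^sup>2) \<le> W" unfolding W_def
    by (rule integral_subset_le) (use e yt P01 in \<open>auto intro!: i mult_nonneg_nonneg\<close>)
  finally have "S2 \<le> e + W" using e by simp
  then show "\<mu> * Dq e b 0 \<le> b * (\<beta> - S2) - S2 + e" unfolding D by simp
qed

text \<open>\<open>Phi\<close> starts at \<open>\<beta>\<close> for \<open>t = 0\<close>, and
  \<open>Dq e b 0\<close> is its slope along the line \<open>\<mu> + t * b\<close>. Both parts state
  that \<open>Phi\<close> exceeds \<open>\<beta>\<close>, because the convexity argument asks for
  upper bounds of the perturbed traces for either sign of the perturbation.\<close>

lemma path_exceeds:
  assumes e: "0 < e"
  shows "S2 < b * (\<beta> - S2) \<Longrightarrow> \<exists>t0>0. t0 < e powr \<kappa> \<and> (\<forall>t. 0 < t \<and> t \<le> t0 \<longrightarrow> 0 < \<mu> + t * b \<and> \<beta> < Phi e (- t) (\<mu> + t * b))"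
    and "e \<le> \<alpha> \<Longrightarrow> b * (\<beta> - S2) < S2 - e \<Longrightarrow>
      \<exists>t0>0. t0 < e powr \<kappa> \<and> (\<forall>t. 0 < t \<and> t \<le> t0 \<longrightarrow> 0 < \<mu> - t * b \<and> \<beta> < Phi e t (\<mu> - t * b))"
proof -
  obtain t0 where t0: "0 < t0" "t0 < e powr \<kappa>" "\<And>t. \<bar>t\<bar> \<le> t0 \<Longrightarrow> 0 < \<mu> + t * b"
    using small_t[OF e] by blast
  have "continuous_on {-t0..t0} (Dq e b)" by (rule Dq_cont[OF e t0(2,3)])
  then have cont: "\<forall>x\<in>{-t0..t0}. \<forall>d>0. \<exists>r>0. \<forall>y\<in>{-t0..t0}. dist y x < r \<longrightarrow> dist (Dq e b y) (Dq e b x) < d"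
    unfolding continuous_on_iff by blast
  have near: "\<exists>r>0. r \<le> t0 \<and> (\<forall>t. \<bar>t\<bar> \<le> r \<longrightarrow> \<bar>Dq e b t - Dq e b 0\<bar> < d)" if d: "0 < d" for d
  proof -
    have "0 \<in> {-t0..t0}" using t0(1) by simp
    then obtain r where r: "0 < r" "\<forall>y\<in>{-t0..t0}. dist y 0 < r \<longrightarrow> dist (Dq e b y) (Dq e b 0) < d"
      using cont d by blast
    have "\<bar>Dq e b t - Dq e b 0\<bar> < d" if "\<bar>t\<bar> \<le> min (r / 2) t0" for t
    proof -
      have "t \<in> {-t0..t0}" "dist t 0 < r" using that r(1) by (auto simp: dist_real_def abs_le_iff)
      then show ?thesis using r(2) by (auto simp: dist_real_def)
    qed
    then show ?thesis using r t0(1) by (intro exI[of _ "min (r / 2) t0"]) auto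
  qed
  {
    assume "S2 < b * (\<beta> - S2)"
    then have "0 < \<mu> * Dq e b 0" using Dq_0(1)[OF e, of b] by linarith
    then have D: "0 < Dq e b 0" using \<mu>(1) by (simp add: zero_less_mult_iff)
    from near[OF this] obtain r where r: "0 < r" "r \<le> t0" "\<And>t. \<bar>t\<bar> \<le> r \<Longrightarrow> \<bar>Dq e b t - Dq e b 0\<bar> < Dq e b 0" by blast
    have "0 < \<mu> + t * b \<and> \<beta> < Phi e (- t) (\<mu> + t * b)" if t: "0 < t" "t \<le> r" for t
    proof -
      have u: "0 < \<mu> + t * b" using t r t0 by auto
      have "0 < Dq e b t" using r(3)[of t] t by auto
      then have "0 < t * Dq e b t" using t by simp
      then have "0 < Phi e (- t) (\<mu> + t * b) - \<beta>" using t r t0 u by (subst Phi_Dq[OF e]) auto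
      then show ?thesis using u by simp
    qed
    then show "\<exists>t0>0. t0 < e powr \<kappa> \<and> (\<forall>t. 0 < t \<and> t \<le> t0 \<longrightarrow> 0 < \<mu> + t * b \<and> \<beta> < Phi e (- t) (\<mu> + t * b))"
      using r t0 by (intro exI[of _ r]) auto
  }
  {
    assume "e \<le> \<alpha>" "b * (\<beta> - S2) < S2 - e"
    then have "\<mu> * Dq e b 0 < 0" using Dq_0(2)[OF e, of b] by linarith
    then have D: "0 < - Dq e b 0" using \<mu>(1) by (simp add: mult_less_0_iff)
    from near[OF this] obtain r where r: "0 < r" "r \<le> t0" "\<And>t. \<bar>t\<bar> \<le> r \<Longrightarrow> \<bar>Dq e b t - Dq e b 0\<bar> < - Dq e b 0" by blast
    have "0 < \<mu> - t * b \<and> \<beta> < Phi e t (\<mu> - t * b)" if t: "0 < t" "t \<le> r" for t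
    proof -
      have u: "0 < \<mu> + (- t) * b" by (rule t0(3)) (use t r in auto)
      have "Dq e b (- t) < 0" using r(3)[of "- t"] t by auto
      then have "0 < (- t) * Dq e b (- t)" using t by (simp add: mult_less_0_iff)
      then have "0 < Phi e (- (- t)) (\<mu> + (- t) * b) - \<beta>" using t r t0 u by (subst Phi_Dq[OF e]) auto
      then show ?thesis using u by simp
    qed
    then show "\<exists>t0>0. t0 < e powr \<kappa> \<and> (\<forall>t. 0 < t \<and> t \<le> t0 \<longrightarrow> 0 < \<mu> - t * b \<and> \<beta> < Phi e t (\<mu> - t * b))"
      using r t0 by (intro exI[of _ r]) auto
  }
qed

end

section \<open>Convergence of the trace\<close>

text \<open>Measurability is included so that it is carried along by sums, products and quotients.
  The limit is a constant, while the spaces vary with \<open>k\<close>.\<close>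

definition conv_prob :: "(nat \<Rightarrow> 'b measure) \<Rightarrow> (nat \<Rightarrow> 'b \<Rightarrow> real) \<Rightarrow> real \<Rightarrow> bool" where
  "conv_prob M X l \<longleftrightarrow> (\<forall>k. X k \<in> borel_measurable (M k)) \<and>
     (\<forall>\<eta>>0. (\<lambda>k. measure (M k) {f \<in> space (M k). \<bar>X k f - l\<bar> > \<eta>}) \<longlonglongrightarrow> 0)"

lemma conv_prob_measurable: "conv_prob M X l \<Longrightarrow> X k \<in> borel_measurable (M k)"
  by (simp add: conv_prob_def)

text \<open>A single \<open>\<eta>\<close> bounds both deviation and probability; this is enough
  since the probability decreases in the threshold.\<close>

lemma conv_probI:
  assumes "\<And>k. X k \<in> borel_measurable (M k)"
    and "\<And>\<eta>. 0 < \<eta> \<Longrightarrow> eventually (\<lambda>k. measure (M k) {f \<in> space (M k). \<bar>X k f - l\<bar> > \<eta>} \<le> \<eta>) sequentially"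
    and P: "\<And>k. prob_space (M k)"
  shows "conv_prob M X l"
  unfolding conv_prob_def
proof (intro conjI allI impI)
  fix \<eta> :: real assume \<eta>: "0 < \<eta>"
  show "(\<lambda>k. measure (M k) {f \<in> space (M k). \<bar>X k f - l\<bar> > \<eta>}) \<longlonglongrightarrow> 0"
  proof (rule tendstoI)
    fix d :: real assume d: "0 < d"
    define r where "r = min \<eta> (d / 2)"
    have r: "0 < r" "r \<le> \<eta>" "r < d" using \<eta> d by (auto simp: r_def)
    show "eventually (\<lambda>k. dist (measure (M k) {f \<in> space (M k). \<bar>X k f - l\<bar> > \<eta>}) 0 < d) sequentially"
      using assms(2)[OF r(1)]
    proof eventually_elim
      case (elim k)
      interpret prob_space "M k" by (rule P)
      have [measurable]: "X k \<in> borel_measurable (M k)" by (rule assms(1))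
      have "measure (M k) {f \<in> space (M k). \<bar>X k f - l\<bar> > \<eta>} \<le> measure (M k) {f \<in> space (M k). \<bar>X k f - l\<bar> > r}"
        using r by (intro finite_measure_mono) auto
      then show ?case using elim r by simp
    qed
  qed
qed (rule assms(1))

lemma conv_prob_small:
  assumes "conv_prob M X l" "0 < \<eta>" "0 < d"
  shows "eventually (\<lambda>k. measure (M k) {f \<in> space (M k). \<bar>X k f - l\<bar> > \<eta>} < d) sequentially"
proof -
  have "(\<lambda>k. measure (M k) {f \<in> space (M k). \<bar>X k f - l\<bar> > \<eta>}) \<longlonglongrightarrow> 0"
    using assms by (simp add: conv_prob_def)
  from order_tendstoD(2)[OF this assms(3)] show ?thesis .
qed

text \<open>Continuous mapping for two sequences. Continuity is asked for at the limit point alone,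
  which covers quotients.\<close>

lemma conv_prob_cont2:
  assumes X: "conv_prob M X a" and Y: "conv_prob M Y b" and P: "\<And>k. prob_space (M k)"
    and g: "isCont (\<lambda>z. g (fst z) (snd z)) (a, b)"
    and m: "\<And>k. (\<lambda>f. g (X k f) (Y k f)) \<in> borel_measurable (M k)"
  shows "conv_prob M (\<lambda>k f. g (X k f) (Y k f)) (g a b)"
proof (rule conv_probI[OF m _ P])
  fix \<eta> :: real assume \<eta>: "0 < \<eta>"
  obtain d where d: "0 < d" "\<And>z. dist z (a, b) < d \<Longrightarrow> dist (g (fst z) (snd z)) (g a b) < \<eta>"
    using g \<eta> unfolding continuous_at_eps_delta by (metis fst_conv snd_conv)
  have near: "\<bar>g x y - g a b\<bar> \<le> \<eta>" if "\<bar>x - a\<bar> \<le> d / 3" "\<bar>y - b\<bar> \<le> d / 3" for x y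
  proof -
    have "dist (x, y) (a, b) \<le> \<bar>x - a\<bar> + \<bar>y - b\<bar>"
      unfolding dist_Pair_Pair dist_real_def using sqrt_sum_squares_le_sum_abs[of "x - a" "y - b"] by simp
    also have "\<dots> < d" using that d(1) by linarith
    finally show ?thesis using d(2)[of "(x, y)"] by (simp add: dist_real_def)
  qed
  have d3: "0 < d / 3" "0 < \<eta> / 2" using d \<eta> by auto
  show "eventually (\<lambda>k. measure (M k) {f \<in> space (M k). \<bar>g (X k f) (Y k f) - g a b\<bar> > \<eta>} \<le> \<eta>) sequentially"
    using conv_prob_small[OF X d3] conv_prob_small[OF Y d3]
  proof eventually_elim
    case (elim k)
    interpret prob_space "M k" by (rule P)
    have [measurable]: "X k \<in> borel_measurable (M k)" "Y k \<in> borel_measurable (M k)"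
      using X Y by (auto simp: conv_prob_def)
    have "measure (M k) {f \<in> space (M k). \<bar>g (X k f) (Y k f) - g a b\<bar> > \<eta>}
       \<le> measure (M k) ({f \<in> space (M k). \<bar>X k f - a\<bar> > d / 3} \<union> {f \<in> space (M k). \<bar>Y k f - b\<bar> > d / 3})"
    proof (rule finite_measure_mono)
      show "{f \<in> space (M k). \<bar>g (X k f) (Y k f) - g a b\<bar> > \<eta>}
       \<subseteq> {f \<in> space (M k). \<bar>X k f - a\<bar> > d / 3} \<union> {f \<in> space (M k). \<bar>Y k f - b\<bar> > d / 3}"
        using near by (auto simp: not_less[symmetric])
    qed simp
    also have "\<dots> \<le> measure (M k) {f \<in> space (M k). \<bar>X k f - a\<bar> > d / 3} + measure (M k) {f \<in> space (M k). \<bar>Y k f - b\<bar> > d / 3}"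
      by (rule measure_Un_le) auto
    also have "\<dots> \<le> \<eta>" using elim by simp
    finally show ?case .
  qed
qed

lemma conv_prob_add:
  assumes "conv_prob M X a" "conv_prob M Y b" "\<And>k. prob_space (M k)"
  shows "conv_prob M (\<lambda>k f. X k f + Y k f) (a + b)"
  using assms conv_prob_measurable[OF assms(1)] conv_prob_measurable[OF assms(2)]
  by (intro conv_prob_cont2[where g="(+)"] borel_measurable_add continuous_intros) auto

lemma conv_prob_mult:
  assumes "conv_prob M X a" "conv_prob M Y b" "\<And>k. prob_space (M k)"
  shows "conv_prob M (\<lambda>k f. X k f * Y k f) (a * b)"
  using assms conv_prob_measurable[OF assms(1)] conv_prob_measurable[OF assms(2)]
  by (intro conv_prob_cont2[where g="(*)"] borel_measurable_times continuous_intros) auto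

lemma conv_prob_divide:
  assumes "conv_prob M X a" "conv_prob M Y b" "\<And>k. prob_space (M k)" "b \<noteq> 0"
  shows "conv_prob M (\<lambda>k f. X k f / Y k f) (a / b)"
  using assms conv_prob_measurable[OF assms(1)] conv_prob_measurable[OF assms(2)]
  by (intro conv_prob_cont2[where g="(/)"] borel_measurable_divide continuous_intros) auto

lemma conv_prob_deterministic:
  assumes "x \<longlonglongrightarrow> a"
  shows "conv_prob M (\<lambda>k f. x k) a"
  unfolding conv_prob_def
proof (intro conjI allI impI)
  fix \<eta> :: real assume "0 < \<eta>"
  then have "eventually (\<lambda>k. dist (x k) a < \<eta>) sequentially" by (rule tendstoD[OF assms])
  then have "eventually (\<lambda>k. 0 = measure (M k) {f \<in> space (M k). \<bar>x k - a\<bar> > \<eta>}) sequentially"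
    by eventually_elim (auto simp: dist_real_def)
  then show "(\<lambda>k. measure (M k) {f \<in> space (M k). \<bar>x k - a\<bar> > \<eta>}) \<longlonglongrightarrow> 0"
    by (rule Lim_transform_eventually[OF tendsto_const])
qed simp

lemma prob_markov:
  assumes P: "prob_space M" and i: "integrable M X" and n: "\<And>f. f \<in> space M \<Longrightarrow> 0 \<le> X f" and c: "0 < c"
  shows "measure M {f \<in> space M. X f > c} \<le> integral\<^sup>L M X / c"
proof -
  interpret prob_space M by (rule P)
  have [measurable]: "X \<in> borel_measurable M" using i by simp
  have "measure M {f \<in> space M. X f > c} \<le> measure M {f \<in> space M. X f \<ge> c}"
    by (intro finite_measure_mono) auto
  also have "\<dots> \<le> integral\<^sup>L M X / c"
    using integral_Markov_inequality_measure[OF i _ _ c, of "{}"] n by auto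
  finally show ?thesis .
qed

lemma conv_prob_L1:
  assumes P: "\<And>k. prob_space (M k)" and i: "\<And>k. integrable (M k) (X k)" and m: "\<And>k. X k \<in> borel_measurable (M k)"
    and l: "(\<lambda>k. integral\<^sup>L (M k) (\<lambda>f. \<bar>X k f\<bar>)) \<longlonglongrightarrow> 0"
  shows "conv_prob M X 0"
proof (rule conv_probI[OF m _ P])
  fix \<eta> :: real assume \<eta>: "0 < \<eta>"
  then have "eventually (\<lambda>k. integral\<^sup>L (M k) (\<lambda>f. \<bar>X k f\<bar>) < \<eta> * \<eta>) sequentially"
    by (intro order_tendstoD(2)[OF l]) simp
  then show "eventually (\<lambda>k. measure (M k) {f \<in> space (M k). \<bar>X k f - 0\<bar> > \<eta>} \<le> \<eta>) sequentially"
  proof eventually_elim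
    case (elim k)
    have "measure (M k) {f \<in> space (M k). \<bar>X k f\<bar> > \<eta>} \<le> integral\<^sup>L (M k) (\<lambda>f. \<bar>X k f\<bar>) / \<eta>"
      using i[of k] \<eta> by (intro prob_markov P) auto
    also have "\<dots> \<le> \<eta>" using elim \<eta> by (simp add: divide_le_eq)
    finally show ?case by simp
  qed
qed

text \<open>The ridge is an arbitrary sequence in \<open>(0, 1]\<close>: convergence along every
  such sequence takes the place of uniformity in the ridge.\<close>

locale asymptotic = power_spectrum +
  fixes p n N :: "nat \<Rightarrow> nat" and \<rho> :: "nat \<Rightarrow> real"
  assumes \<beta>1: "\<beta> < 1" and pN: "\<And>k. p k \<le> N k" and N_lim: "filterlim N at_top sequentially"
    and p_lim: "(\<lambda>k. real (p k) / real (N k)) \<longlonglongrightarrow> \<alpha>"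
    and n_lim: "(\<lambda>k. real (n k) / real (N k)) \<longlonglongrightarrow> \<beta>"
    and \<rho>_pos: "\<And>k. 0 < \<rho> k" and \<rho>_le: "\<And>k. \<rho> k \<le> 1"
begin

abbreviation "G k \<equiv> gpm (flat (N k) (n k))"

definition pt :: "nat \<Rightarrow> nat \<Rightarrow> real" where
  "pt k j = real (j + 1) / real (N k)"

text \<open>For \<open>t = 0\<close> these are the eigenvalues times \<open>N powr \<kappa>\<close>.
  The scaling turns sums over columns into Riemann sums on the unit interval and keeps the
  unperturbed weights at least 1.\<close>

definition wt :: "real \<Rightarrow> real \<Rightarrow> nat \<Rightarrow> nat \<Rightarrow> real" where
  "wt e t k j = pt k j powr (- \<kappa>) * (1 + t * trunc e (pt k j))"

definition tau :: "real \<Rightarrow> real \<Rightarrow> nat \<Rightarrow> (nat \<times> nat \<Rightarrow> real) \<Rightarrow> real" where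
  "tau e t k f = trc (n k) (res (n k) (\<rho> k) (wt e t k) {..<p k} (col f))"

lemma prob_G: "prob_space (G k)"
  by (rule prob_space_gpm)

lemma pt_bounds: "j < N k \<Longrightarrow> 0 < pt k j" "j < N k \<Longrightarrow> pt k j \<le> 1"
  by (auto simp: pt_def)

lemma pt_powr: assumes "j < N k" shows "1 \<le> pt k j powr (- \<kappa>)" "pt k j powr \<kappa> * pt k j powr (- \<kappa>) = 1" "0 < pt k j powr \<kappa>"
proof -
  show "pt k j powr \<kappa> * pt k j powr (- \<kappa>) = 1" "0 < pt k j powr \<kappa>"
    using pt_bounds[OF assms] by (auto simp: powr_minus)
  have "pt k j powr \<kappa> \<le> 1" using pt_bounds[OF assms] \<kappa> by (intro powr_le1) auto
  then show "1 \<le> pt k j powr (- \<kappa>)"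
    using pt_bounds[OF assms] by (simp add: powr_minus one_le_inverse_iff)
qed

context
  fixes e t :: real
  assumes e: "0 < e" and t: "\<bar>t\<bar> \<le> e powr \<kappa> / 2"
begin

text \<open>\<open>trunc e\<close> is at most \<open>1 / e powr \<kappa>\<close>. The weights thus
  stay bounded below and comparable to the unperturbed ones.\<close>

lemma factor_bounds: "1 / 2 \<le> 1 + t * trunc e s" "1 + t * trunc e s \<le> 3 / 2"
proof -
  have "0 < e powr \<kappa>" using e by simp
  have "\<bar>t * trunc e s\<bar> \<le> (e powr \<kappa> / 2) * (1 / e powr \<kappa>)"
    unfolding abs_mult using trunc_bounds[OF e, of s] t by (intro mult_mono) auto
  also have "\<dots> = 1 / 2" using \<open>0 < e powr \<kappa>\<close> by simp
  finally show "1 / 2 \<le> 1 + t * trunc e s" "1 + t * trunc e s \<le> 3 / 2" by (auto simp: abs_le_iff)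
qed

lemma wt_bounds:
  assumes "j < N k" shows "1 / 2 \<le> wt e t k j" "wt e t k j \<le> 2 * pt k j powr (- \<kappa>)"
proof -
  have "1 * (1 / 2) \<le> wt e t k j" unfolding wt_def
    using pt_powr[OF assms] factor_bounds by (intro mult_mono) auto
  then show "1 / 2 \<le> wt e t k j" by simp
  have "wt e t k j \<le> pt k j powr (- \<kappa>) * (3 / 2)" unfolding wt_def
    using pt_powr[OF assms] factor_bounds by (intro mult_left_mono) auto
  also have "\<dots> \<le> 2 * pt k j powr (- \<kappa>)" using pt_powr[OF assms] by simp
  finally show "wt e t k j \<le> 2 * pt k j powr (- \<kappa>)" .
qed

lemma weighted_wt: "weighted (N k) (\<rho> k) (wt e t k)"
  by unfold_locales (use \<rho>_pos wt_bounds(1)[of _ k] in \<open>auto intro: order_trans[of 0 "1/2"]\<close>)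

end

text \<open>The 1 allows for a column left out and the 3 is the loss in
  \<open>moment_bounds\<close>; both disappear in half of the gap
  \<open>\<alpha> - \<beta>\<close>.\<close>

lemma eventually_dims:
  "eventually (\<lambda>k. 0 < N k \<and> n k \<le> N k \<and> n k < p k \<and> \<beta> * N k \<le> p k \<and> (\<alpha> - \<beta>) / 2 * N k \<le> real (p k) - 1 - real (n k) - 3) sequentially"
proof -
  have rN: "filterlim (\<lambda>k. real (N k)) at_top sequentially"
    by (rule filterlim_compose[OF filterlim_real_sequentially N_lim])
  have "eventually (\<lambda>k. 4 / ((\<alpha> - \<beta>) / 4) < real (N k)) sequentially"
    using rN by (simp add: filterlim_at_top_dense)
  moreover have "eventually (\<lambda>k. 0 < real (N k)) sequentially"
    using rN unfolding filterlim_at_top_dense by blast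
  moreover have "eventually (\<lambda>k. real (n k) / N k < 1) sequentially"
    by (rule order_tendstoD(2)[OF n_lim \<beta>1])
  moreover have "eventually (\<lambda>k. \<beta> < real (p k) / N k) sequentially"
    by (rule order_tendstoD(1)[OF p_lim \<beta>(2)])
  moreover have "(\<lambda>k. real (p k) / N k - real (n k) / N k) \<longlonglongrightarrow> \<alpha> - \<beta>"
    by (intro tendsto_intros p_lim n_lim)
  then have "eventually (\<lambda>k. (\<alpha> - \<beta>) * (3 / 4) < real (p k) / N k - real (n k) / N k) sequentially"
    using \<beta> by (intro order_tendstoD(1)) auto
  ultimately show ?thesis
  proof eventually_elim
    case (elim k)
    define x where "x = (\<alpha> - \<beta>) * real (N k)"
    have "x * (3 / 4) \<le> real (p k) - real (n k)"
      using elim(2,5) by (simp add: x_def diff_divide_distrib[symmetric] less_divide_eq mult_ac) (simp add: algebra_simps)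
    moreover have "4 \<le> x / 4" using elim(1) \<beta> by (simp add: x_def divide_less_eq mult.commute)
    ultimately have "x / 2 \<le> real (p k) - 1 - real (n k) - 3" by linarith
    then have "(\<alpha> - \<beta>) / 2 * N k \<le> real (p k) - 1 - real (n k) - 3" by (simp add: x_def)
    moreover have "0 \<le> (\<alpha> - \<beta>) / 2 * N k" using \<beta> by simp
    ultimately show ?case using elim by (auto simp: less_divide_eq divide_less_eq)
  qed
qed

text \<open>The weights are at least 1/2 whatever \<open>e\<close> and \<open>t\<close> are, so the
  constant depends on \<open>\<alpha> - \<beta>\<close> alone, and \<open>e\<close> may be chosen
  after it.\<close>

lemma moment_constants:
  obtains K where "0 < K"
    "\<And>e t. 0 < e \<Longrightarrow> \<bar>t\<bar> \<le> e powr \<kappa> / 2 \<Longrightarrow> eventually (\<lambda>k.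
      (\<forall>j<p k. integral\<^sup>L (G k) (\<lambda>f. frob (n k) (res (n k) (\<rho> k) (wt e t k) ({..<p k} - {j}) (col f))) \<le> K / N k)
      \<and> integral\<^sup>L (G k) (tau e t k) \<le> K) sequentially"
proof -
  define d where "d = (\<alpha> - \<beta>) / 2"
  have d: "0 < d" using \<beta> by (simp add: d_def)
  \<comment> \<open>The values of \<open>moment_bounds\<close> for \<open>c = 1 / 2\<close>, surplus
    \<open>d * N\<close> and \<open>n \<le> N\<close>.\<close>
  define K where "K = max ((4 / d + (2 / d)\<^sup>2) / d) (2 / d)"
  have K: "0 < K" using d by (simp add: K_def less_max_iff_disj)
  show thesis
  proof (rule that[OF K])
    fix e t :: real assume et: "0 < e" "\<bar>t\<bar> \<le> e powr \<kappa> / 2"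
    show "eventually (\<lambda>k.
      (\<forall>j<p k. integral\<^sup>L (G k) (\<lambda>f. frob (n k) (res (n k) (\<rho> k) (wt e t k) ({..<p k} - {j}) (col f))) \<le> K / N k)
      \<and> integral\<^sup>L (G k) (tau e t k) \<le> K) sequentially"
      using eventually_dims
    proof eventually_elim
      case (elim k)
      interpret W: weighted "N k" "n k" "\<rho> k" "wt e t k" by (rule weighted_wt[OF et])
      have Nk: "0 < real (N k)" "real (n k) \<le> real (N k)" using elim by auto
      have dN: "0 < d * N k" using d Nk by simp
      have c: "wt e t k j \<ge> 1 / 2" if "j < p k" for j using wt_bounds(1)[OF et, of j k] that pN[of k] by auto
      have nb: "real (n k) / (1 / 2 * (d * N k)) \<le> 2 / d"
        using Nk d by (simp add: divide_simps)
      have nb0: "0 \<le> real (n k) / (1 / 2 * (d * N k))" using dN by simp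
      have nb2: "real (n k) / (1 / 2 * (1 / 2 * (d * N k))) \<le> 4 / d"
        using Nk d by (simp add: divide_simps)
      have "integral\<^sup>L (G k) (\<lambda>f. frob (n k) (res (n k) (\<rho> k) (wt e t k) ({..<p k} - {j}) (col f))) \<le> K / N k"
        if j: "j < p k" for j
      proof -
        have "integral\<^sup>L (G k) (\<lambda>f. frob (n k) (res (n k) (\<rho> k) (wt e t k) ({..<p k} - {j}) (col f)))
          \<le> (real (n k) / (1 / 2 * (1 / 2 * (d * N k))) + (real (n k) / (1 / 2 * (d * N k)))\<^sup>2) / (d * N k)"
          by (rule W.moment_bounds(3)) (use j pN[of k] c dN elim in \<open>auto simp: d_def of_nat_diff\<close>)
        also have "\<dots> \<le> (4 / d + (2 / d)\<^sup>2) / (d * N k)"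
          using nb nb0 nb2 dN by (intro divide_right_mono add_mono power_mono) auto
        also have "\<dots> = ((4 / d + (2 / d)\<^sup>2) / d) / N k" by simp
        also have "\<dots> \<le> K / N k" using Nk by (intro divide_right_mono) (auto simp: K_def)
        finally show ?thesis .
      qed
      moreover have "integral\<^sup>L (G k) (tau e t k) \<le> real (n k) / (1 / 2 * (d * N k))"
        unfolding tau_def
        by (rule W.moment_bounds(1)) (use pN[of k] c dN elim in \<open>auto simp: d_def\<close>)
      ultimately show ?case using nb by (auto simp: K_def)
    qed
  qed
qed

definition H :: "real \<Rightarrow> real \<Rightarrow> nat \<Rightarrow> real \<Rightarrow> real" where
  "H e t k u = (\<Sum>j<p k. wt e t k j * u / (1 + wt e t k j * u)) / N k"

text \<open>Multiplying numerator and denominator of each term by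
  \<open>pt k j powr \<kappa>\<close> removes the singularity at 0 and gives a Riemann sum of a
  continuous function.\<close>

lemma H_lim:
  assumes e: "0 < e" and t: "\<bar>t\<bar> \<le> e powr \<kappa> / 2" and u: "0 < u"
  shows "(\<lambda>k. H e t k u) \<longlonglongrightarrow> Phi e t u"
proof -
  have "0 < e powr \<kappa>" using e by simp
  then have t': "\<bar>t\<bar> < e powr \<kappa>" using t by linarith
  let ?g = "\<lambda>s. u * (1 + t * trunc e s) / (s powr \<kappa> + u * (1 + t * trunc e s))"
  have "(\<lambda>k. (\<Sum>j<p k. ?g (real (j + 1) / N k)) / N k) \<longlonglongrightarrow> integral {0..\<alpha>} ?g"
    by (rule riemann_sum[OF Phi_integrand_cont(1)[OF e u t'] N_lim pN p_lim]) (use \<alpha> \<beta> in auto)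
  moreover have "(\<Sum>j<p k. ?g (real (j + 1) / N k)) = (\<Sum>j<p k. wt e t k j * u / (1 + wt e t k j * u))" for k
  proof (intro sum.cong refl)
    fix j assume "j \<in> {..<p k}"
    then have j: "j < N k" using pN[of k] by auto
    define y x where "y = pt k j powr \<kappa>" and "x = u * (1 + t * trunc e (pt k j))"
    have y: "0 < y" using pt_powr[OF j] by (simp add: y_def)
    have w: "wt e t k j * u = x / y" using pt_powr(2)[OF j] y
      by (simp add: wt_def x_def y_def[symmetric] nonzero_eq_divide_eq mult_ac)
    have x: "0 < x" using factor_bounds(1)[OF e t, of "pt k j"] u by (simp add: x_def)
    have "?g (real (j + 1) / N k) = x / (y + x)" by (simp add: x_def y_def pt_def)
    also have "\<dots> = (x / y) / (1 + x / y)" using x y by (simp add: field_simps)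
    finally show "?g (real (j + 1) / N k) = wt e t k j * u / (1 + wt e t k j * u)" unfolding w .
  qed
  ultimately show ?thesis by (simp add: H_def Phi_def)
qed

lemma H_mono:
  assumes e: "0 < e" and t: "\<bar>t\<bar> \<le> e powr \<kappa> / 2" and u: "0 \<le> u" "u \<le> v"
  shows "H e t k u \<le> H e t k v"
  unfolding H_def
proof (intro divide_right_mono sum_mono)
  fix j assume "j \<in> {..<p k}"
  then have "0 \<le> wt e t k j" using wt_bounds(1)[OF e t, of j k] pN[of k] by auto
  then have "0 \<le> wt e t k j * u" "wt e t k j * u \<le> wt e t k j * v" using u by (auto intro: mult_left_mono)
  then show "wt e t k j * u / (1 + wt e t k j * u) \<le> wt e t k j * v / (1 + wt e t k j * v)"
    by (simp add: divide_simps) (simp add: algebra_simps)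
qed simp

text \<open>Outside the head the weights are bounded by a constant depending on \<open>e\<close>;
  inside they may grow with \<open>N\<close>.\<close>

definition head :: "real \<Rightarrow> nat \<Rightarrow> nat set" where
  "head e k = {j. j < p k \<and> pt k j < e}"

lemma card_head: assumes "0 \<le> e" shows "real (card (head e k)) \<le> e * real (N k)"
proof -
  have "head e k \<subseteq> {..<nat \<lfloor>e * N k\<rfloor>}"
  proof
    fix j assume "j \<in> head e k"
    then have j: "j < N k" "pt k j < e" using pN[of k] by (auto simp: head_def)
    \<comment> \<open>Positions are counted from \<open>j + 1\<close>, so no index is lost: there
      are at most \<open>e * N\<close> of them.\<close>
    then have "real (j + 1) < e * N k" by (simp add: pt_def divide_less_eq)
    then have "int (j + 1) \<le> \<lfloor>e * N k\<rfloor>" by (simp add: le_floor_iff)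
    then show "j \<in> {..<nat \<lfloor>e * N k\<rfloor>}" by auto
  qed
  then have "card (head e k) \<le> nat \<lfloor>e * N k\<rfloor>" using card_mono[of "{..<nat \<lfloor>e * N k\<rfloor>}"] by fastforce
  also have "real (nat \<lfloor>e * N k\<rfloor>) \<le> e * N k" using assms by (simp add: of_nat_nat)
  finally show ?thesis by simp
qed

lemma tail_weight:
  assumes e: "0 < e" and t: "\<bar>t\<bar> \<le> e powr \<kappa> / 2" and d: "0 < d" and j: "j < p k" "j \<notin> head d k"
  shows "wt e t k j \<le> 2 * d powr (- \<kappa>)"
proof -
  have jN: "j < N k" using j pN[of k] by auto
  have "d \<le> pt k j" using j by (auto simp: head_def)
  then have "pt k j powr (- \<kappa>) \<le> d powr (- \<kappa>)" using d \<kappa> by (intro powr_mono2') auto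
  then show ?thesis using wt_bounds(2)[OF e t jN] by linarith
qed

lemma rate_lim: "0 \<le> K \<Longrightarrow> (\<lambda>k. C * (sqrt (2 * (K / N k)) + C * (K / N k))) \<longlonglongrightarrow> 0"
proof -
  have rN: "filterlim (\<lambda>k. real (N k)) at_infinity sequentially"
    by (rule filterlim_mono[OF filterlim_compose[OF filterlim_real_sequentially N_lim] at_top_le_at_infinity order_refl])
  have "(\<lambda>k. K / real (N k)) \<longlonglongrightarrow> 0" by (rule tendsto_divide_0[OF tendsto_const rN])
  then have "(\<lambda>k. C * (sqrt (2 * (K / N k)) + C * (K / N k))) \<longlonglongrightarrow> C * (sqrt (2 * 0) + C * 0)"
    by (intro tendsto_intros)
  then show ?thesis by simp
qed

text \<open>Measures by how much the trace fails to solve the finite equation, ridge term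
  included.\<close>

definition defect :: "real \<Rightarrow> real \<Rightarrow> nat \<Rightarrow> (nat \<times> nat \<Rightarrow> real) \<Rightarrow> real" where
  "defect e t k f = real (n k) / N k - \<rho> k * tau e t k f / N k - H e t k (tau e t k f)"

context
  fixes e t :: real
  assumes e: "0 < e" and t: "\<bar>t\<bar> \<le> e powr \<kappa> / 2"
begin

lemma sub: "{..<p k} \<subseteq> {..<N k}" "{..<p k} - {j} \<subseteq> {..<N k}" using pN[of k] by auto

lemma tau_nonneg: "0 \<le> tau e t k f"
proof -
  interpret W: weighted "N k" "n k" "\<rho> k" "wt e t k" by (rule weighted_wt[OF e t])
  show ?thesis unfolding tau_def by (rule W.T_nonneg[OF sub(1)])
qed

lemma pb_tau: "pb (flat (N k) (n k)) (tau e t k)"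
proof -
  interpret W: weighted "N k" "n k" "\<rho> k" "wt e t k" by (rule weighted_wt[OF e t])
  show ?thesis unfolding tau_def[abs_def] by (rule W.pb_quantities(1)[OF sub(1)])
qed

lemma tau_measurable [measurable]: "tau e t k \<in> borel_measurable (G k)"
  by (rule pb_measurable'[OF pb_tau])

lemma defect_measurable [measurable]: "defect e t k \<in> borel_measurable (G k)"
  unfolding defect_def[abs_def] H_def by measurable

lemma pb_H: "pb (flat (N k) (n k)) (\<lambda>f. H e t k (tau e t k f))"
proof (rule pb_bounded)
  have [measurable]: "tau e t k \<in> borel_measurable (Pi\<^sub>M (flat (N k) (n k)) (\<lambda>_. borel))"
    by (rule pb_measurable[OF pb_tau])
  show "(\<lambda>f. H e t k (tau e t k f)) \<in> borel_measurable (Pi\<^sub>M (flat (N k) (n k)) (\<lambda>_. borel))"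
    unfolding H_def by measurable
  fix f
  have u: "\<bar>wt e t k j * tau e t k f / (1 + wt e t k j * tau e t k f)\<bar> \<le> 1" if "j < p k" for j
  proof -
    have "0 \<le> wt e t k j * tau e t k f"
      using wt_bounds(1)[OF e t, of j k] that pN[of k] tau_nonneg by (intro mult_nonneg_nonneg) auto
    then show ?thesis by simp
  qed
  have "\<bar>\<Sum>j<p k. wt e t k j * tau e t k f / (1 + wt e t k j * tau e t k f)\<bar> \<le> (\<Sum>j<p k. 1)"
    by (rule order_trans[OF sum_abs]) (intro sum_mono u, simp)
  then show "\<bar>H e t k (tau e t k f)\<bar> \<le> real (p k) / N k"
    by (simp add: H_def divide_right_mono)
qed

lemma pb_defect: "pb (flat (N k) (n k)) (defect e t k)"
  unfolding defect_def[abs_def] divide_inverse mult.assoc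
  by (intro pb_diff pb_mult pb_const pb_tau pb_H)

lemma defect_mean: "(\<lambda>k. integral\<^sup>L (G k) (\<lambda>f. \<bar>defect e t k f\<bar>)) \<longlonglongrightarrow> 0"
proof (rule tendstoI)
  fix r :: real assume r: "0 < r"
  obtain K where K: "0 < K" "\<And>e t. 0 < e \<Longrightarrow> \<bar>t\<bar> \<le> e powr \<kappa> / 2 \<Longrightarrow> eventually (\<lambda>k.
      (\<forall>j<p k. integral\<^sup>L (G k) (\<lambda>f. frob (n k) (res (n k) (\<rho> k) (wt e t k) ({..<p k} - {j}) (col f))) \<le> K / N k)
      \<and> integral\<^sup>L (G k) (tau e t k) \<le> K) sequentially" by (rule moment_constants) blast
  \<comment> \<open>The head takes half of \<open>r\<close>. Its size fixes the bound
    \<open>C\<close> of the other weights, and for fixed \<open>C\<close> their contribution tends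
    to 0 and fits into the other half.\<close>
  define d where "d = r / 2"
  define C where "C = 2 * d powr (- \<kappa>)"
  have d: "0 < d" using r by (simp add: d_def)
  have C: "0 \<le> C" by (simp add: C_def)
  have "eventually (\<lambda>k. C * (sqrt (2 * (K / N k)) + C * (K / N k)) < r / 2) sequentially"
    by (rule order_tendstoD(2)[OF rate_lim]) (use r K in auto)
  then show "eventually (\<lambda>k. dist (integral\<^sup>L (G k) (\<lambda>f. \<bar>defect e t k f\<bar>)) 0 < r) sequentially"
    using K(2)[OF e t] eventually_dims
  proof eventually_elim
    case (elim k)
    interpret W: weighted "N k" "n k" "\<rho> k" "wt e t k" by (rule weighted_wt[OF e t])
    have Nk: "0 < real (N k)" using elim by simp
    have "integral\<^sup>L (G k) (\<lambda>f. \<bar>real (n k) - \<rho> k * tau e t k f - (\<Sum>j<p k. wt e t k j * tau e t k f / (1 + wt e t k j * tau e t k f))\<bar>)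
      \<le> card (head d k) + card {..<p k} * (C * (sqrt (2 * (K / N k)) + C * (K / N k)))"
      unfolding tau_def
    proof (rule W.fixed_point_mean[OF sub(1)])
      show "head d k \<subseteq> {..<p k}" by (auto simp: head_def)
      show "wt e t k j \<le> C" if "j \<in> {..<p k} - head d k" for j
        unfolding C_def using that by (intro tail_weight[OF e t d]) auto
    qed (use elim K(1) Nk C in auto)
    also have "\<dots> \<le> d * N k + real (N k) * (C * (sqrt (2 * (K / N k)) + C * (K / N k)))"
      using d C K(1) pN[of k] by (intro add_mono card_head mult_right_mono) auto
    also have "\<dots> < d * N k + real (N k) * (r / 2)"
      using elim Nk by (intro add_strict_left_mono mult_strict_left_mono) auto
    also have "\<dots> = r * N k" by (simp add: d_def)
    finally have lt: "integral\<^sup>L (G k) (\<lambda>f. \<bar>real (n k) - \<rho> k * tau e t k f - (\<Sum>j<p k. wt e t k j * tau e t k f / (1 + wt e t k j * tau e t k f))\<bar>) < r * N k" .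
    have "\<bar>defect e t k f\<bar> = \<bar>real (n k) - \<rho> k * tau e t k f - (\<Sum>j<p k. wt e t k j * tau e t k f / (1 + wt e t k j * tau e t k f))\<bar> / N k" for f
      by (simp add: defect_def H_def diff_divide_distrib[symmetric])
    then have "integral\<^sup>L (G k) (\<lambda>f. \<bar>defect e t k f\<bar>) < r"
      using lt Nk by (simp add: divide_less_eq)
    moreover have "0 \<le> integral\<^sup>L (G k) (\<lambda>f. \<bar>defect e t k f\<bar>)" by (rule integral_nonneg_AE) simp
    ultimately show ?case by simp
  qed
qed

lemma defect_conv: "conv_prob G (defect e t) 0"
  by (rule conv_prob_L1[OF prob_G _ _ defect_mean]) (auto intro!: pb_integrable pb_defect)

lemma rN_div: "(\<lambda>k. c / real (N k)) \<longlonglongrightarrow> 0" for c :: real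
  using tendsto_divide_0[OF tendsto_const filterlim_mono[OF filterlim_compose[OF filterlim_real_sequentially N_lim] at_top_le_at_infinity order_refl]]
  by blast

text \<open>\<open>H\<close> is increasing, so \<open>u < tau\<close> forces its value at
  \<open>tau\<close> above that at \<open>u\<close>, which exceeds \<open>n / N\<close> in the
  limit; this is a defect of fixed size.\<close>

lemma tau_upper:
  assumes u: "0 < u" and P: "\<beta> < Phi e t u"
  shows "(\<lambda>k. measure (G k) {f \<in> space (G k). u < tau e t k f}) \<longlonglongrightarrow> 0"
proof -
  \<comment> \<open>One third each for the limit of \<open>H\<close>, the limit of
    \<open>n / N\<close> and the defect.\<close>
  define g where "g = (Phi e t u - \<beta>) / 3"
  have g: "0 < g" using P by (simp add: g_def)
  have l: "(\<lambda>k. measure (G k) {f \<in> space (G k). \<bar>defect e t k f - 0\<bar> > g}) \<longlonglongrightarrow> 0"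
    using defect_conv g by (simp add: conv_prob_def)
  have "eventually (\<lambda>k. Phi e t u - g < H e t k u) sequentially"
    by (rule order_tendstoD(1)[OF H_lim[OF e t u]]) (use g in simp)
  moreover have "eventually (\<lambda>k. real (n k) / N k < \<beta> + g) sequentially"
    by (rule order_tendstoD(2)[OF n_lim]) (use g in simp)
  ultimately have "eventually (\<lambda>k. measure (G k) {f \<in> space (G k). u < tau e t k f}
      \<le> measure (G k) {f \<in> space (G k). \<bar>defect e t k f - 0\<bar> > g}) sequentially"
  proof eventually_elim
    case (elim k)
    interpret prob_space "G k" by (rule prob_G)
    show ?case
    proof (rule finite_measure_mono)
      show "{f \<in> space (G k). u < tau e t k f} \<subseteq> {f \<in> space (G k). \<bar>defect e t k f - 0\<bar> > g}"
      proof safe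
        fix f assume f: "u < tau e t k f"
        have "H e t k u \<le> H e t k (tau e t k f)" using f u by (intro H_mono[OF e t]) auto
        moreover have "0 \<le> \<rho> k * tau e t k f / N k" using \<rho>_pos[of k] tau_nonneg[of k f] by simp
        ultimately have "defect e t k f < - g" using elim g_def unfolding defect_def by argo
        then show "g < \<bar>defect e t k f - 0\<bar>" by simp
      qed
    qed measurable
  qed
  then show ?thesis
    by (intro tendsto_sandwich[OF always_eventually _ tendsto_const l]) auto
qed

lemma tau_lower:
  assumes u: "0 < u" and P: "Phi e t u < \<beta>"
  shows "(\<lambda>k. measure (G k) {f \<in> space (G k). tau e t k f < u}) \<longlonglongrightarrow> 0"
proof -
  \<comment> \<open>A fourth share is reserved for the ridge term, which has the unfavourable sign
    here.\<close>
  define g where "g = (\<beta> - Phi e t u) / 4"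
  have g: "0 < g" using P by (simp add: g_def)
  have l: "(\<lambda>k. measure (G k) {f \<in> space (G k). \<bar>defect e t k f - 0\<bar> > g}) \<longlonglongrightarrow> 0"
    using defect_conv g by (simp add: conv_prob_def)
  have "eventually (\<lambda>k. H e t k u < Phi e t u + g) sequentially"
    by (rule order_tendstoD(2)[OF H_lim[OF e t u]]) (use g in simp)
  moreover have "eventually (\<lambda>k. \<beta> - g < real (n k) / N k) sequentially"
    by (rule order_tendstoD(1)[OF n_lim]) (use g in simp)
  moreover have "eventually (\<lambda>k. u / real (N k) < g) sequentially"
    by (rule order_tendstoD(2)[OF rN_div g])
  ultimately have "eventually (\<lambda>k. measure (G k) {f \<in> space (G k). tau e t k f < u}
      \<le> measure (G k) {f \<in> space (G k). \<bar>defect e t k f - 0\<bar> > g}) sequentially"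
  proof eventually_elim
    case (elim k)
    interpret prob_space "G k" by (rule prob_G)
    show ?case
    proof (rule finite_measure_mono)
      show "{f \<in> space (G k). tau e t k f < u} \<subseteq> {f \<in> space (G k). \<bar>defect e t k f - 0\<bar> > g}"
      proof safe
        fix f assume f: "tau e t k f < u"
        have "H e t k (tau e t k f) \<le> H e t k u" using f by (intro H_mono[OF e t] tau_nonneg) auto
        moreover have "\<rho> k * tau e t k f / N k \<le> 1 * u / N k"
          using \<rho>_pos[of k] \<rho>_le[of k] tau_nonneg[of k f] f by (intro divide_right_mono mult_mono) auto
        ultimately have "g < defect e t k f" using elim g_def unfolding defect_def by argo
        then show "g < \<bar>defect e t k f - 0\<bar>" by simp
      qed
    qed measurable
  qed
  then show ?thesis
    by (intro tendsto_sandwich[OF always_eventually _ tendsto_const l]) auto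
qed

end

end

section \<open>Convergence of the derivative of the trace\<close>

context asymptotic
begin

abbreviation "w0 k j \<equiv> pt k j powr (- \<kappa>)"

lemma wt_0: "wt e 0 k = w0 k"
  by (simp add: wt_def fun_eq_iff)

lemma weighted_w0: "weighted (N k) (\<rho> k) (w0 k)"
  using weighted_wt[of 1 0 k] by (simp add: wt_0)

definition Rb :: "nat \<Rightarrow> (nat \<times> nat \<Rightarrow> real) \<Rightarrow> nat \<Rightarrow> nat \<Rightarrow> real" where
  "Rb k f = res (n k) (\<rho> k) (w0 k) {..<p k} (col f)"

definition y2 :: "nat \<Rightarrow> nat \<Rightarrow> (nat \<times> nat \<Rightarrow> real) \<Rightarrow> real" where
  "y2 k j f = ip (n k) (mv (n k) (Rb k f) (col f j)) (mv (n k) (Rb k f) (col f j))"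

definition trB :: "nat \<Rightarrow> (nat \<times> nat \<Rightarrow> real) \<Rightarrow> real" where
  "trB k f = (\<Sum>j<p k. (w0 k j)\<^sup>2 * y2 k j f)"

text \<open>\<open>trBe e\<close> is minus the derivative of \<open>tau e t\<close> at \<open>t = 0\<close>, and approximates \<open>trB\<close> for small \<open>e\<close>.\<close>

definition trBe :: "real \<Rightarrow> nat \<Rightarrow> (nat \<times> nat \<Rightarrow> real) \<Rightarrow> real" where
  "trBe e k f = (\<Sum>j<p k. w0 k j * trunc e (pt k j) * y2 k j f)"

text \<open>At \<open>t = 0\<close> the weights do not involve \<open>e\<close>; every
  \<open>e\<close> gives the same function.\<close>

abbreviation "tau0 \<equiv> tau 1 0"

lemma tau0_Rb: "tau0 k f = trc (n k) (Rb k f)"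
  by (simp add: tau_def wt_0 Rb_def)

lemma sub_p: "{..<p k} \<subseteq> {..<N k}" "{..<p k} - {j} \<subseteq> {..<N k}" using pN[of k] by auto

lemma Phi_0: "Phi e 0 u = h u"
  by (simp add: Phi_def h_def)

lemma tau0_nonneg: "0 \<le> tau0 k f"
  using tau_nonneg[of 1 0 k f] by simp

lemma tau0_measurable: "tau0 k \<in> borel_measurable (G k)"
  using tau_measurable[of 1 0 k] by simp

lemma tau0_conv: "conv_prob G tau0 \<mu>"
proof (rule conv_probI[OF tau0_measurable _ prob_G])
  fix \<eta> :: real assume \<eta>: "0 < \<eta>"
  \<comment> \<open>At most \<open>\<mu> / 2\<close>, so that \<open>\<mu> - d\<close> stays
    positive.\<close>
  define d where "d = min \<eta> (\<mu> / 2)"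
  have d: "0 < d" "d \<le> \<eta>" "0 < \<mu> - d" using \<eta> \<mu> by (auto simp: d_def)
  have "h \<mu> < h (\<mu> + d)" "h (\<mu> - d) < h \<mu>" using h_strict_mono[of \<mu> "\<mu> + d"] h_strict_mono[of "\<mu> - d" \<mu>] d \<mu>(1) by simp_all
  then have P: "\<beta> < Phi 1 0 (\<mu> + d)" "Phi 1 0 (\<mu> - d) < \<beta>" using \<mu> by (auto simp: Phi_0)
  have l: "(\<lambda>k. measure (G k) {f \<in> space (G k). \<mu> + d < tau0 k f}) \<longlonglongrightarrow> 0"
    "(\<lambda>k. measure (G k) {f \<in> space (G k). tau0 k f < \<mu> - d}) \<longlonglongrightarrow> 0"
    using tau_upper[of 1 0 "\<mu> + d"] tau_lower[of 1 0 "\<mu> - d"] P d \<mu> by auto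
  have \<eta>2: "0 < \<eta> / 2" using \<eta> by simp
  show "eventually (\<lambda>k. measure (G k) {f \<in> space (G k). \<bar>tau0 k f - \<mu>\<bar> > \<eta>} \<le> \<eta>) sequentially"
    using order_tendstoD(2)[OF l(1) \<eta>2] order_tendstoD(2)[OF l(2) \<eta>2]
  proof eventually_elim
    case (elim k)
    interpret prob_space "G k" by (rule prob_G)
    note [measurable] = tau0_measurable
    have "measure (G k) {f \<in> space (G k). \<bar>tau0 k f - \<mu>\<bar> > \<eta>}
      \<le> measure (G k) ({f \<in> space (G k). \<mu> + d < tau0 k f} \<union> {f \<in> space (G k). tau0 k f < \<mu> - d})"
      using d by (intro finite_measure_mono) auto
    also have "\<dots> \<le> measure (G k) {f \<in> space (G k). \<mu> + d < tau0 k f} + measure (G k) {f \<in> space (G k). tau0 k f < \<mu> - d}"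
      by (rule measure_Un_le) auto
    finally show ?case using elim by simp
  qed
qed

lemma pb_y2: "j < N k \<Longrightarrow> pb (flat (N k) (n k)) (y2 k j)"
proof -
  assume j: "j < N k"
  interpret W: weighted "N k" "n k" "\<rho> k" "w0 k" by (rule weighted_w0)
  show ?thesis unfolding y2_def[abs_def] Rb_def by (rule W.pb_quantities(6)[OF sub_p(1) j])
qed

lemma y2_nonneg: "0 \<le> y2 k j f"
  by (simp add: y2_def ip_nonneg)

lemma pb_trB: "pb (flat (N k) (n k)) (trB k)"
  unfolding trB_def[abs_def] by (intro pb_sum pb_mult pb_const pb_y2) (use pN[of k] in auto)

lemma pb_trBe: "pb (flat (N k) (n k)) (trBe e k)"
  unfolding trBe_def[abs_def] by (intro pb_sum pb_mult pb_const pb_y2) (use pN[of k] in auto)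

lemma trB_measurable [measurable]: "trB k \<in> borel_measurable (G k)"
  by (rule pb_measurable'[OF pb_trB])

lemma trBe_measurable [measurable]: "trBe e k \<in> borel_measurable (G k)"
  by (rule pb_measurable'[OF pb_trBe])

lemma trB_nonneg: "0 \<le> trB k f"
  unfolding trB_def by (intro sum_nonneg mult_nonneg_nonneg y2_nonneg) auto

text \<open>The tangent inequality \<open>trc_res_convex\<close> at the unperturbed weights, in the
  direction \<open>w0 k j * trunc e (pt k j)\<close>. It holds for either sign of \<open>t\<close>,
  so it bounds \<open>trBe\<close> from both sides.\<close>

lemma sandwich:
  assumes e: "0 < e" and t: "\<bar>t\<bar> \<le> e powr \<kappa> / 2"
  shows "tau0 k f - t * trBe e k f \<le> tau e t k f"
proof -
  interpret W: weighted "N k" "n k" "\<rho> k" "w0 k" by (rule weighted_w0)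
  interpret V: weighted "N k" "n k" "\<rho> k" "wt e t k" by (rule weighted_wt[OF e t])
  have "trc (n k) (W.R {..<p k} f)
      - (\<Sum>j\<in>{..<p k}. (wt e t k j - w0 k j) * ip (n k) (mv (n k) (W.R {..<p k} f) (col f j)) (mv (n k) (W.R {..<p k} f) (col f j)))
    \<le> trc (n k) (V.R {..<p k} f)"
    by (rule trc_res_convex[OF W.R_is_res[OF sub_p(1)] V.R_is_res[OF sub_p(1)]])
       (use V.\<rho> V.w0 pN[of k] in \<open>auto intro: less_imp_le\<close>)
  moreover have "(\<Sum>j\<in>{..<p k}. (wt e t k j - w0 k j) * ip (n k) (mv (n k) (W.R {..<p k} f) (col f j)) (mv (n k) (W.R {..<p k} f) (col f j)))
    = t * trBe e k f"
    unfolding trBe_def sum_distrib_left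
    by (intro sum.cong refl) (simp add: wt_def y2_def Rb_def algebra_simps)
  ultimately show ?thesis by (simp add: tau_def wt_0)
qed

text \<open>The zero in \<open>b\<close> of \<open>b * (\<beta> - S2) - S2\<close>, that is, of
  \<open>\<mu>\<close> times the slope of \<open>Phi\<close> along \<open>\<mu> + t * b\<close> when
  the truncation disappears. This is implicit differentiation of
  \<open>Phi e (- t) u = \<beta>\<close>.\<close>

definition bb :: real where "bb = S2 / (\<beta> - S2)"

lemma bb_eq: "bb * (\<beta> - S2) = S2"
  using S2_less by (simp add: bb_def)

text \<open>With weights lowered by the factor \<open>1 - t * trunc e s\<close> the trace stays
  below \<open>\<mu> + t * b\<close> with high probability, because \<open>Phi\<close> exceeds
  \<open>\<beta>\<close> there. By the tangent inequality \<open>t * trBe\<close> is at most the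
  growth of the trace.\<close>

lemma trBe_upper:
  assumes e: "0 < e" and \<eta>: "0 < \<eta>" and b: "bb < b"
  shows "(\<lambda>k. measure (G k) {f \<in> space (G k). b + \<eta> < trBe e k f}) \<longlonglongrightarrow> 0"
proof -
  have "S2 < b * (\<beta> - S2)" using b bb_eq S2_less mult_strict_right_mono[of bb b "\<beta> - S2"] by simp
  then obtain t0 where t0: "0 < t0" "\<And>t. 0 < t \<Longrightarrow> t \<le> t0 \<Longrightarrow> 0 < \<mu> + t * b \<and> \<beta> < Phi e (- t) (\<mu> + t * b)"
    using path_exceeds(1)[OF e] by blast
  define t where "t = min t0 (e powr \<kappa> / 2)"
  have "0 < e powr \<kappa>" using e by simp
  then have t: "0 < t" "t \<le> t0" "\<bar>- t\<bar> \<le> e powr \<kappa> / 2" using t0(1) by (auto simp: t_def)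
  have l1: "(\<lambda>k. measure (G k) {f \<in> space (G k). \<mu> + t * b < tau e (- t) k f}) \<longlonglongrightarrow> 0"
    using t0(2)[OF t(1,2)] by (intro tau_upper[OF e t(3)]) auto
  have l2: "(\<lambda>k. measure (G k) {f \<in> space (G k). \<bar>tau0 k f - \<mu>\<bar> > t * \<eta>}) \<longlonglongrightarrow> 0"
    using tau0_conv t \<eta> by (simp add: conv_prob_def)
  have "measure (G k) {f \<in> space (G k). b + \<eta> < trBe e k f}
     \<le> measure (G k) {f \<in> space (G k). \<mu> + t * b < tau e (- t) k f} + measure (G k) {f \<in> space (G k). \<bar>tau0 k f - \<mu>\<bar> > t * \<eta>}" for k
  proof -
    interpret prob_space "G k" by (rule prob_G)
    note [measurable] = tau0_measurable tau_measurable[OF e t(3)]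
    have "measure (G k) {f \<in> space (G k). b + \<eta> < trBe e k f}
      \<le> measure (G k) ({f \<in> space (G k). \<mu> + t * b < tau e (- t) k f} \<union> {f \<in> space (G k). \<bar>tau0 k f - \<mu>\<bar> > t * \<eta>})"
    proof (rule finite_measure_mono)
      show "{f \<in> space (G k). b + \<eta> < trBe e k f}
        \<subseteq> {f \<in> space (G k). \<mu> + t * b < tau e (- t) k f} \<union> {f \<in> space (G k). \<bar>tau0 k f - \<mu>\<bar> > t * \<eta>}"
      proof (rule subsetI, rule ccontr)
        fix f assume f: "f \<in> {f \<in> space (G k). b + \<eta> < trBe e k f}"
          "f \<notin> {f \<in> space (G k). \<mu> + t * b < tau e (- t) k f} \<union> {f \<in> space (G k). \<bar>tau0 k f - \<mu>\<bar> > t * \<eta>}"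
        then have "tau e (- t) k f \<le> \<mu> + t * b" "\<mu> - t * \<eta> \<le> tau0 k f" by auto
        moreover have "tau0 k f - (- t) * trBe e k f \<le> tau e (- t) k f" by (rule sandwich[OF e t(3)])
        ultimately have "t * trBe e k f \<le> t * (b + \<eta>)" by (simp add: algebra_simps)
        then show False using f t(1) by simp
      qed
    qed measurable
    also have "\<dots> \<le> measure (G k) {f \<in> space (G k). \<mu> + t * b < tau e (- t) k f} + measure (G k) {f \<in> space (G k). \<bar>tau0 k f - \<mu>\<bar> > t * \<eta>}"
      by (rule measure_Un_le) measurable
    finally show ?thesis .
  qed
  then show ?thesis
    by (intro tendsto_sandwich[OF _ _ tendsto_const tendsto_add_zero[OF l1 l2]]) (auto intro!: always_eventually)
qed

text \<open>With raised weights the trace falls by nearly \<open>t * b\<close> or more, and the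
  tangent inequality bounds the fall by \<open>t * trBe\<close>.\<close>

lemma trBe_lower:
  assumes e: "0 < e" "e \<le> \<alpha>" and \<eta>: "0 < \<eta>" and b: "b * (\<beta> - S2) < S2 - e"
  shows "(\<lambda>k. measure (G k) {f \<in> space (G k). trBe e k f < b - \<eta>}) \<longlonglongrightarrow> 0"
proof -
  obtain t0 where t0: "0 < t0" "\<And>t. 0 < t \<Longrightarrow> t \<le> t0 \<Longrightarrow> 0 < \<mu> - t * b \<and> \<beta> < Phi e t (\<mu> - t * b)"
    using path_exceeds(2)[OF e(1) e(2) b] by blast
  define t where "t = min t0 (e powr \<kappa> / 2)"
  have "0 < e powr \<kappa>" using e by simp
  then have t: "0 < t" "t \<le> t0" "\<bar>t\<bar> \<le> e powr \<kappa> / 2" using t0(1) by (auto simp: t_def)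
  have l1: "(\<lambda>k. measure (G k) {f \<in> space (G k). \<mu> - t * b < tau e t k f}) \<longlonglongrightarrow> 0"
    using t0(2)[OF t(1,2)] by (intro tau_upper[OF e(1) t(3)]) auto
  have l2: "(\<lambda>k. measure (G k) {f \<in> space (G k). \<bar>tau0 k f - \<mu>\<bar> > t * \<eta>}) \<longlonglongrightarrow> 0"
    using tau0_conv t \<eta> by (simp add: conv_prob_def)
  have "measure (G k) {f \<in> space (G k). trBe e k f < b - \<eta>}
     \<le> measure (G k) {f \<in> space (G k). \<mu> - t * b < tau e t k f} + measure (G k) {f \<in> space (G k). \<bar>tau0 k f - \<mu>\<bar> > t * \<eta>}" for k
  proof -
    interpret prob_space "G k" by (rule prob_G)
    note [measurable] = tau0_measurable tau_measurable[OF e(1) t(3)]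
    have "measure (G k) {f \<in> space (G k). trBe e k f < b - \<eta>}
      \<le> measure (G k) ({f \<in> space (G k). \<mu> - t * b < tau e t k f} \<union> {f \<in> space (G k). \<bar>tau0 k f - \<mu>\<bar> > t * \<eta>})"
    proof (rule finite_measure_mono)
      show "{f \<in> space (G k). trBe e k f < b - \<eta>}
        \<subseteq> {f \<in> space (G k). \<mu> - t * b < tau e t k f} \<union> {f \<in> space (G k). \<bar>tau0 k f - \<mu>\<bar> > t * \<eta>}"
      proof (rule subsetI, rule ccontr)
        fix f assume f: "f \<in> {f \<in> space (G k). trBe e k f < b - \<eta>}"
          "f \<notin> {f \<in> space (G k). \<mu> - t * b < tau e t k f} \<union> {f \<in> space (G k). \<bar>tau0 k f - \<mu>\<bar> > t * \<eta>}"
        then have "tau e t k f \<le> \<mu> - t * b" "\<mu> - t * \<eta> \<le> tau0 k f" by auto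
        moreover have "tau0 k f - t * trBe e k f \<le> tau e t k f" by (rule sandwich[OF e(1) t(3)])
        ultimately have "t * (b - \<eta>) \<le> t * trBe e k f" by (simp add: algebra_simps)
        then show False using f t(1) by simp
      qed
    qed measurable
    also have "\<dots> \<le> measure (G k) {f \<in> space (G k). \<mu> - t * b < tau e t k f} + measure (G k) {f \<in> space (G k). \<bar>tau0 k f - \<mu>\<bar> > t * \<eta>}"
      by (rule measure_Un_le) measurable
    finally show ?thesis .
  qed
  then show ?thesis
    by (intro tendsto_sandwich[OF _ _ tendsto_const tendsto_add_zero[OF l1 l2]]) (auto intro!: always_eventually)
qed

section \<open>The head, column by column\<close>

definition qq :: "nat \<Rightarrow> nat \<Rightarrow> (nat \<times> nat \<Rightarrow> real) \<Rightarrow> real" where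
  "qq k j f = ip (n k) (col f j) (mv (n k) (res (n k) (\<rho> k) (w0 k) ({..<p k} - {j}) (col f)) (col f j))"

definition tm :: "nat \<Rightarrow> nat \<Rightarrow> (nat \<times> nat \<Rightarrow> real) \<Rightarrow> real" where
  "tm k j f = trc (n k) (res (n k) (\<rho> k) (w0 k) ({..<p k} - {j}) (col f))"

definition rr :: "nat \<Rightarrow> nat \<Rightarrow> (nat \<times> nat \<Rightarrow> real) \<Rightarrow> real" where
  "rr k j f = ip (n k) (mv (n k) (res (n k) (\<rho> k) (w0 k) ({..<p k} - {j}) (col f)) (col f j))
     (mv (n k) (res (n k) (\<rho> k) (w0 k) ({..<p k} - {j}) (col f)) (col f j))"

lemma loo_facts:
  assumes j: "j < p k"
  shows "ip (n k) (col f j) (mv (n k) (Rb k f) (col f j)) = qq k j f / (1 + w0 k j * qq k j f)"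
    and "y2 k j f = rr k j f / (1 + w0 k j * qq k j f)\<^sup>2"
    and "tau0 k f \<le> tm k j f" "0 \<le> qq k j f" "0 \<le> rr k j f"
    and "pb (flat (N k) (n k)) (qq k j)" "pb (flat (N k) (n k)) (tm k j)" "pb (flat (N k) (n k)) (rr k j)"
proof -
  interpret W: weighted "N k" "n k" "\<rho> k" "w0 k" by (rule weighted_w0)
  have jp: "j \<in> {..<p k}" using j by simp
  note l = W.loo(1-5)[OF sub_p(1) jp, of f] W.loo(6)[OF sub_p(1) jp]
  show "ip (n k) (col f j) (mv (n k) (Rb k f) (col f j)) = qq k j f / (1 + w0 k j * qq k j f)"
    "y2 k j f = rr k j f / (1 + w0 k j * qq k j f)\<^sup>2" "0 \<le> qq k j f" "0 \<le> rr k j f"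
    using l by (auto simp: Rb_def qq_def rr_def y2_def)
  have "0 \<le> w0 k j * rr k j f / (1 + w0 k j * qq k j f)"
    using l(4-6) by (simp add: qq_def rr_def)
  then show "tau0 k f \<le> tm k j f" using l(3) by (simp add: tau0_Rb Rb_def tm_def qq_def rr_def)
  show "pb (flat (N k) (n k)) (qq k j)" "pb (flat (N k) (n k)) (tm k j)" "pb (flat (N k) (n k)) (rr k j)"
    unfolding qq_def[abs_def] tm_def[abs_def] rr_def[abs_def] using W.pb_loo[OF sub_p(1) jp] by auto
qed

lemma w0_pos: "j < p k \<Longrightarrow> 1 \<le> w0 k j"
  using pt_powr(1)[of j k] pN[of k] by simp

lemma head_sub: "j \<in> head e k \<Longrightarrow> j < p k" "finite (head e k)"
  by (auto simp: head_def)

text \<open>Off this event all head columns have \<open>qq \<ge> \<mu> / 2\<close> at once: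
  \<open>tm\<close> is at least \<open>tau0\<close>, and a quarter of \<open>\<mu>\<close> is lost
  twice.\<close>

definition bad :: "real \<Rightarrow> nat \<Rightarrow> (nat \<times> nat \<Rightarrow> real) set" where
  "bad e k = (\<Union>j\<in>head e k. {f \<in> space (G k). \<mu> / 4 < \<bar>qq k j f - tm k j f\<bar>})
     \<union> {f \<in> space (G k). \<mu> / 4 < \<bar>tau0 k f - \<mu>\<bar>}"

lemma loo_measurable [measurable]:
  "j < p k \<Longrightarrow> qq k j \<in> borel_measurable (G k)" "j < p k \<Longrightarrow> tm k j \<in> borel_measurable (G k)"
  "j < p k \<Longrightarrow> rr k j \<in> borel_measurable (G k)"
  by (auto intro: pb_measurable' loo_facts)

lemma bad_sets: "bad e k \<in> sets (G k)"
proof -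
  note [measurable] = tau0_measurable
  have "{f \<in> space (G k). \<mu> / 4 < \<bar>qq k j f - tm k j f\<bar>} \<in> sets (G k)" if "j \<in> head e k" for j
  proof -
    have [measurable]: "qq k j \<in> borel_measurable (G k)" "tm k j \<in> borel_measurable (G k)"
      using loo_measurable head_sub(1)[OF that] by auto
    show ?thesis by measurable
  qed
  then show ?thesis unfolding bad_def by (intro sets.Un sets.finite_UN head_sub(2)) auto
qed

lemma good_head:
  assumes "f \<in> space (G k)" "f \<notin> bad e k"
  shows "\<And>j. j \<in> head e k \<Longrightarrow> \<mu> / 2 \<le> qq k j f" "3 * \<mu> / 4 \<le> tau0 k f"
proof -
  have "\<bar>tau0 k f - \<mu>\<bar> \<le> \<mu> / 4" using assms by (auto simp: bad_def not_less)
  then show t: "3 * \<mu> / 4 \<le> tau0 k f" by linarith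
  fix j assume j: "j \<in> head e k"
  have "\<bar>qq k j f - tm k j f\<bar> \<le> \<mu> / 4" using assms j by (auto simp: bad_def not_less)
  then show "\<mu> / 2 \<le> qq k j f" using t loo_facts(3)[OF head_sub(1)[OF j], of f] by linarith
qed

lemma loo_constants:
  obtains K where "0 < K" "eventually (\<lambda>k. \<forall>j<p k.
      integral\<^sup>L (G k) (\<lambda>f. (qq k j f - tm k j f)\<^sup>2) \<le> 2 * (K / N k) \<and> integral\<^sup>L (G k) (rr k j) \<le> K / N k
      \<and> integral\<^sup>L (G k) (\<lambda>f. \<bar>qq k j f - tau0 k f\<bar>) \<le> sqrt (2 * (K / N k)) + w0 k j * (K / N k)) sequentially"
proof -
  obtain K where K: "0 < K" "\<And>e t. 0 < e \<Longrightarrow> \<bar>t\<bar> \<le> e powr \<kappa> / 2 \<Longrightarrow> eventually (\<lambda>k.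
      (\<forall>j<p k. integral\<^sup>L (G k) (\<lambda>f. frob (n k) (res (n k) (\<rho> k) (wt e t k) ({..<p k} - {j}) (col f))) \<le> K / N k)
      \<and> integral\<^sup>L (G k) (tau e t k) \<le> K) sequentially" by (rule moment_constants) blast
  have ev: "eventually (\<lambda>k.
      \<forall>j<p k. integral\<^sup>L (G k) (\<lambda>f. frob (n k) (res (n k) (\<rho> k) (w0 k) ({..<p k} - {j}) (col f))) \<le> K / N k) sequentially"
    using K(2)[of 1 0] unfolding wt_0 by (auto elim: eventually_mono)
  show thesis
  proof (rule that[OF K(1)])
    show "eventually (\<lambda>k. \<forall>j<p k.
      integral\<^sup>L (G k) (\<lambda>f. (qq k j f - tm k j f)\<^sup>2) \<le> 2 * (K / N k) \<and> integral\<^sup>L (G k) (rr k j) \<le> K / N k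
      \<and> integral\<^sup>L (G k) (\<lambda>f. \<bar>qq k j f - tau0 k f\<bar>) \<le> sqrt (2 * (K / N k)) + w0 k j * (K / N k)) sequentially"
      using ev eventually_dims
    proof eventually_elim
      case (elim k)
      interpret W: weighted "N k" "n k" "\<rho> k" "w0 k" by (rule weighted_w0)
      show ?case
      proof (intro allI impI)
        fix j assume j: "j < p k"
        then have jp: "j \<in> {..<p k}" by simp
        have F: "W.E (W.F ({..<p k} - {j})) \<le> K / N k" using elim j by simp
        have KN: "0 < K / N k" using K(1) elim by simp
        show "integral\<^sup>L (G k) (\<lambda>f. (qq k j f - tm k j f)\<^sup>2) \<le> 2 * (K / N k) \<and> integral\<^sup>L (G k) (rr k j) \<le> K / N k
          \<and> integral\<^sup>L (G k) (\<lambda>f. \<bar>qq k j f - tau0 k f\<bar>) \<le> sqrt (2 * (K / N k)) + w0 k j * (K / N k)"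
          using W.quad_loo[OF sub_p(1) jp] W.q_minus_T_mean[OF sub_p(1) jp F KN] F
          unfolding qq_def[abs_def] tm_def rr_def[abs_def] tau0_Rb Rb_def by simp
      qed
    qed
  qed
qed

text \<open>Chebyshev bounds each of the at most \<open>e * N\<close> head events by
  \<open>C / N\<close>, so their union has probability at most \<open>C * e\<close>. As
  \<open>C\<close> precedes \<open>e\<close>, the latter can be taken small afterwards.\<close>

lemma bad_small:
  obtains C where "0 < C" "\<And>e d. 0 < e \<Longrightarrow> C * e < d \<Longrightarrow> eventually (\<lambda>k. measure (G k) (bad e k) < d) sequentially"
proof -
  obtain K where K: "0 < K" "eventually (\<lambda>k. \<forall>j<p k.
      integral\<^sup>L (G k) (\<lambda>f. (qq k j f - tm k j f)\<^sup>2) \<le> 2 * (K / N k) \<and> integral\<^sup>L (G k) (rr k j) \<le> K / N k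
      \<and> integral\<^sup>L (G k) (\<lambda>f. \<bar>qq k j f - tau0 k f\<bar>) \<le> sqrt (2 * (K / N k)) + w0 k j * (K / N k)) sequentially"
    by (rule loo_constants) blast
  define C where "C = 2 * K / (\<mu> / 4)\<^sup>2"
  have C: "0 < C" using K \<mu> by (simp add: C_def)
  show thesis
  proof (rule that[OF C])
    fix e d assume e: "0 < e" and d: "C * e < d"
    have m4: "0 < \<mu> / 4" "0 < d - C * e" using \<mu> d by auto
    show "eventually (\<lambda>k. measure (G k) (bad e k) < d) sequentially"
      using K(2) eventually_dims conv_prob_small[OF tau0_conv m4]
    proof eventually_elim
      case (elim k)
      interpret prob_space "G k" by (rule prob_G)
      note [measurable] = tau0_measurable
      have Nk: "0 < real (N k)" using elim by simp
      have one: "measure (G k) {f \<in> space (G k). \<mu> / 4 < \<bar>qq k j f - tm k j f\<bar>} \<le> C / N k" if j: "j \<in> head e k" for j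
      proof -
        have jp: "j < p k" by (rule head_sub(1)[OF j])
        have "{f \<in> space (G k). \<mu> / 4 < \<bar>qq k j f - tm k j f\<bar>} = {f \<in> space (G k). (\<mu> / 4)\<^sup>2 < (qq k j f - tm k j f)\<^sup>2}"
        proof -
          have "\<mu> / 4 < \<bar>y\<bar> \<longleftrightarrow> (\<mu> / 4)\<^sup>2 < y\<^sup>2" for y
            using \<mu>(1) abs_le_square_iff[of y "\<mu> / 4"] unfolding not_le[symmetric] by simp
          then show ?thesis by simp
        qed
        then have "measure (G k) {f \<in> space (G k). \<mu> / 4 < \<bar>qq k j f - tm k j f\<bar>}
          \<le> integral\<^sup>L (G k) (\<lambda>f. (qq k j f - tm k j f)\<^sup>2) / (\<mu> / 4)\<^sup>2"
          using \<mu>(1) loo_facts(6,7)[OF jp]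
          by (simp only:) (rule prob_markov[OF prob_G], auto intro!: pb_integrable pb_power pb_diff)
        also have "\<dots> \<le> 2 * (K / N k) / (\<mu> / 4)\<^sup>2" using elim jp by (intro divide_right_mono) auto
        also have "\<dots> = C / N k" by (simp add: C_def)
        finally show ?thesis .
      qed
      have ms: "{f \<in> space (G k). \<mu> / 4 < \<bar>qq k j f - tm k j f\<bar>} \<in> sets (G k)" if "j \<in> head e k" for j
      proof -
        have [measurable]: "qq k j \<in> borel_measurable (G k)" "tm k j \<in> borel_measurable (G k)"
          using loo_measurable head_sub(1)[OF that] by auto
        show ?thesis by measurable
      qed
      have "measure (G k) (\<Union>j\<in>head e k. {f \<in> space (G k). \<mu> / 4 < \<bar>qq k j f - tm k j f\<bar>})
        \<le> (\<Sum>j\<in>head e k. measure (G k) {f \<in> space (G k). \<mu> / 4 < \<bar>qq k j f - tm k j f\<bar>})"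
        by (rule finite_measure_subadditive_finite[OF head_sub(2)], rule image_subsetI, rule ms)
      also have "\<dots> \<le> (\<Sum>j\<in>head e k. C / N k)" by (intro sum_mono one)
      also have "\<dots> = real (card (head e k)) * (C / N k)" by simp
      also have "\<dots> \<le> (e * N k) * (C / N k)" using C e by (intro mult_right_mono card_head) auto
      also have "\<dots> = C * e" using Nk by simp
      finally have u: "measure (G k) (\<Union>j\<in>head e k. {f \<in> space (G k). \<mu> / 4 < \<bar>qq k j f - tm k j f\<bar>}) \<le> C * e" .
      have "measure (G k) (bad e k) \<le> measure (G k) (\<Union>j\<in>head e k. {f \<in> space (G k). \<mu> / 4 < \<bar>qq k j f - tm k j f\<bar>})
          + measure (G k) {f \<in> space (G k). \<mu> / 4 < \<bar>tau0 k f - \<mu>\<bar>}"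
        unfolding bad_def by (intro measure_Un_le sets.finite_UN head_sub(2) ms) auto
      then show ?case using u elim by linarith
    qed
  qed
qed

text \<open>\<open>trunc e\<close> never exceeds \<open>w0\<close> and agrees with it outside the
  head.\<close>

lemma trB_between:
  assumes e: "0 < e"
  shows "trBe e k f \<le> trB k f" "trB k f \<le> trBe e k f + (\<Sum>j\<in>head e k. (w0 k j)\<^sup>2 * y2 k j f)"
proof -
  have j1: "trunc e (pt k j) \<le> w0 k j" "0 < trunc e (pt k j)" if "j < p k" for j
  proof -
    have jN: "j < N k" using that pN[of k] by simp
    have "trunc e (pt k j) \<le> 1 / pt k j powr \<kappa>"
      using pt_powr(3)[OF jN] by (auto simp: trunc_def less_max_iff_disj intro!: divide_left_mono mult_pos_pos)
    then show "trunc e (pt k j) \<le> w0 k j" by (simp add: powr_minus_divide)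
    show "0 < trunc e (pt k j)" by (rule trunc_bounds(1)[OF e])
  qed
  show "trBe e k f \<le> trB k f"
    unfolding trBe_def trB_def power2_eq_square
    by (intro sum_mono mult_right_mono mult_left_mono y2_nonneg j1) auto
  have "trB k f - trBe e k f = (\<Sum>j<p k. w0 k j * (w0 k j - trunc e (pt k j)) * y2 k j f)"
    by (simp add: trB_def trBe_def sum_subtractf[symmetric] power2_eq_square algebra_simps)
  also have "\<dots> = (\<Sum>j\<in>head e k. w0 k j * (w0 k j - trunc e (pt k j)) * y2 k j f)"
  proof (rule sum.mono_neutral_right)
    show "\<forall>j\<in>{..<p k} - head e k. w0 k j * (w0 k j - trunc e (pt k j)) * y2 k j f = 0"
    proof
      fix j assume "j \<in> {..<p k} - head e k"
      then have j: "j < N k" "e \<le> pt k j" using pN[of k] by (auto simp: head_def)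
      have "pt k j powr \<kappa> * trunc e (pt k j) = pt k j powr \<kappa> * w0 k j"
        using trunc_eq[OF e j(2)] pt_powr(2)[OF j(1)] by simp
      then have "trunc e (pt k j) = w0 k j" using pt_powr(3)[OF j(1)] by simp
      then show "w0 k j * (w0 k j - trunc e (pt k j)) * y2 k j f = 0" by simp
    qed
  qed (auto simp: head_def)
  also have "\<dots> \<le> (\<Sum>j\<in>head e k. (w0 k j)\<^sup>2 * y2 k j f)"
    unfolding power2_eq_square using j1 head_sub(1)
    by (intro sum_mono mult_right_mono mult_left_mono y2_nonneg) (auto intro: less_imp_le)
  finally show "trB k f \<le> trBe e k f + (\<Sum>j\<in>head e k. (w0 k j)\<^sup>2 * y2 k j f)" by simp
qed

text \<open>The weight cancels: the denominator is at least \<open>w0 * (\<mu> / 2)\<close> squared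
  and absorbs the factor \<open>w0\<close> squared, which is unbounded over the head.\<close>

lemma head_remainder:
  assumes f: "f \<in> space (G k)" "f \<notin> bad e k"
  shows "(\<Sum>j\<in>head e k. (w0 k j)\<^sup>2 * y2 k j f) \<le> 4 / \<mu>\<^sup>2 * (\<Sum>j\<in>head e k. rr k j f)"
  unfolding sum_distrib_left
proof (rule sum_mono)
  fix j assume j: "j \<in> head e k"
  have jp: "j < p k" by (rule head_sub(1)[OF j])
  have q: "\<mu> / 2 \<le> qq k j f" by (rule good_head(1)[OF f j])
  have w: "1 \<le> w0 k j" by (rule w0_pos[OF jp])
  have wq: "0 < w0 k j * (\<mu> / 2)" using w \<mu>(1) by (intro mult_pos_pos; linarith)
  have "w0 k j * (\<mu> / 2) \<le> 1 + w0 k j * qq k j f" using q w mult_left_mono[OF q, of "w0 k j"] by simp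
  then have "(w0 k j * (\<mu> / 2))\<^sup>2 \<le> (1 + w0 k j * qq k j f)\<^sup>2" using wq by (intro power_mono) auto
  then have "rr k j f / (1 + w0 k j * qq k j f)\<^sup>2 \<le> rr k j f / (w0 k j * (\<mu> / 2))\<^sup>2"
    by (rule frac_le[OF loo_facts(5)[OF jp] order_refl zero_less_power[OF wq]])
  then have "(w0 k j)\<^sup>2 * y2 k j f \<le> (w0 k j)\<^sup>2 * (rr k j f / (w0 k j * (\<mu> / 2))\<^sup>2)"
    unfolding loo_facts(2)[OF jp] by (intro mult_left_mono) auto
  also have "\<dots> = 4 / \<mu>\<^sup>2 * rr k j f"
  proof -
    have "c\<^sup>2 * (x / (c * (\<mu> / 2))\<^sup>2) = 4 / \<mu>\<^sup>2 * x" if "1 \<le> c" for c x :: real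
      using that \<mu>(1) by (simp add: power_mult_distrib power_divide)
    then show ?thesis using w .
  qed
  finally show "(w0 k j)\<^sup>2 * y2 k j f \<le> 4 / \<mu>\<^sup>2 * rr k j f" .
qed

end

context asymptotic
begin

text \<open>At most \<open>e * N\<close> terms, each of mean at most \<open>K / N\<close>, and
  Markov's inequality.\<close>

lemma rr_sum_small:
  assumes c: "0 < c" and C: "0 < C" and ev: "eventually (\<lambda>k. \<forall>j<p k. integral\<^sup>L (G k) (rr k j) \<le> K / N k) sequentially"
    and e: "0 < e" and K: "0 < K"
  shows "eventually (\<lambda>k. measure (G k) {f \<in> space (G k). c < C * (\<Sum>j\<in>head e k. rr k j f)} \<le> C * K * e / c) sequentially"
  using ev eventually_dims
proof eventually_elim
  case (elim k)
  have Nk: "0 < real (N k)" using elim by simp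
  have i: "integrable (G k) (rr k j)" if "j \<in> head e k" for j
    by (rule pb_integrable[OF _ loo_facts(8)[OF head_sub(1)[OF that]]]) simp
  have "measure (G k) {f \<in> space (G k). c < C * (\<Sum>j\<in>head e k. rr k j f)}
    \<le> integral\<^sup>L (G k) (\<lambda>f. C * (\<Sum>j\<in>head e k. rr k j f)) / c"
    using C by (intro prob_markov prob_G c mult_nonneg_nonneg sum_nonneg integrable_mult_right Bochner_Integration.integrable_sum i)
       (auto intro: loo_facts(5) head_sub(1))
  also have "integral\<^sup>L (G k) (\<lambda>f. C * (\<Sum>j\<in>head e k. rr k j f)) = C * (\<Sum>j\<in>head e k. integral\<^sup>L (G k) (rr k j))"
    using i by simp
  also have "\<dots> / c \<le> C * (\<Sum>j\<in>head e k. K / N k) / c"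
    using C c elim by (intro divide_right_mono mult_left_mono sum_mono) (auto dest: head_sub(1))
  also have "\<dots> \<le> C * ((e * N k) * (K / N k)) / c"
    using C c K e by (simp only: sum_constant, intro divide_right_mono mult_left_mono mult_right_mono card_head) auto
  also have "\<dots> = C * K * e / c" using Nk by simp
  finally show ?case .
qed

lemma measure_Un3:
  assumes "A \<in> sets (G k)" "B \<in> sets (G k)" "D \<in> sets (G k)" "X \<subseteq> A \<union> B \<union> D"
  shows "measure (G k) X \<le> measure (G k) A + measure (G k) B + measure (G k) D"
proof -
  interpret prob_space "G k" by (rule prob_G)
  have "measure (G k) X \<le> measure (G k) (A \<union> B \<union> D)" using assms by (intro finite_measure_mono) auto
  also have "\<dots> \<le> measure (G k) (A \<union> B) + measure (G k) D" using assms by (intro measure_Un_le) auto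
  also have "\<dots> \<le> (measure (G k) A + measure (G k) B) + measure (G k) D"
    using assms by (intro add_right_mono measure_Un_le) auto
  finally show ?thesis .
qed

lemma rr_sum_measurable: "(\<lambda>f. \<Sum>j\<in>head e k. rr k j f) \<in> borel_measurable (G k)"
  by (intro borel_measurable_sum loo_measurable(3) head_sub(1))

lemma trB_conv: "conv_prob G trB bb"
proof (rule conv_probI[OF trB_measurable _ prob_G])
  fix \<eta> :: real assume \<eta>: "0 < \<eta>"
  obtain C where C: "0 < C" "\<And>e d. 0 < e \<Longrightarrow> C * e < d \<Longrightarrow> eventually (\<lambda>k. measure (G k) (bad e k) < d) sequentially"
    by (rule bad_small) blast
  obtain K where K: "0 < K" "eventually (\<lambda>k. \<forall>j<p k.
      integral\<^sup>L (G k) (\<lambda>f. (qq k j f - tm k j f)\<^sup>2) \<le> 2 * (K / N k) \<and> integral\<^sup>L (G k) (rr k j) \<le> K / N k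
      \<and> integral\<^sup>L (G k) (\<lambda>f. \<bar>qq k j f - tau0 k f\<bar>) \<le> sqrt (2 * (K / N k)) + w0 k j * (K / N k)) sequentially"
    by (rule loo_constants) blast
  have Kr: "eventually (\<lambda>k. \<forall>j<p k. integral\<^sup>L (G k) (rr k j) \<le> K / N k) sequentially"
    using K(2) by (rule eventually_mono) auto
  define M where "M = 4 / \<mu>\<^sup>2 * K / (\<eta> / 4)"
  have M: "0 < M" using K \<mu> \<eta> by (simp add: M_def)
  have S: "0 < \<beta> - S2" using S2_less by simp
  \<comment> \<open>The truncation error must stay below the margin \<open>\<eta> / 4\<close> around
    \<open>bb\<close>, and the bad event and the Markov bound for the head get probability at most
    \<open>\<eta> / 8\<close> each; \<open>e \<le> \<alpha>\<close> is a premise of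
    \<open>trBe_lower\<close>.\<close>
  define e where "e = min (min \<alpha> (\<eta> / 8 * (\<beta> - S2))) (min (\<eta> / (16 * C)) (\<eta> / (8 * M)))"
  have e: "0 < e" "e \<le> \<alpha>" "e \<le> \<eta> / 8 * (\<beta> - S2)" "e \<le> \<eta> / (16 * C)" "e \<le> \<eta> / (8 * M)"
    using \<alpha>_pos \<eta> S C M by (auto simp: e_def)
  have Ce: "C * e < \<eta> / 8"
  proof -
    have "C * e \<le> C * (\<eta> / (16 * C))" using e C by (intro mult_left_mono) auto
    also have "\<dots> = \<eta> / 16" using C by simp
    finally show ?thesis using \<eta> by simp
  qed
  have Me: "4 / \<mu>\<^sup>2 * K * e / (\<eta> / 4) \<le> \<eta> / 8"
  proof -
    have "M * e \<le> M * (\<eta> / (8 * M))" using e M by (intro mult_left_mono) auto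
    also have "\<dots> = \<eta> / 8" using M by simp
    finally show ?thesis by (simp add: M_def)
  qed
  have "0 < \<eta> / 4 * (\<beta> - S2)" using S \<eta> by simp
  moreover have "\<eta> / 8 * (\<beta> - S2) = \<eta> / 4 * (\<beta> - S2) / 2" by simp
  ultimately have "e < \<eta> / 4 * (\<beta> - S2)" using e(3) by linarith
  then have b: "(bb - \<eta> / 4) * (\<beta> - S2) < S2 - e"
    using bb_eq by (simp add: left_diff_distrib)
  have \<eta>4: "0 < \<eta> / 4" "0 < \<eta> / 8" "bb < bb + \<eta> / 4" using \<eta> by auto
  have \<mu>4: "0 < 4 / \<mu>\<^sup>2" using \<mu>(1) by simp
  show "eventually (\<lambda>k. measure (G k) {f \<in> space (G k). \<bar>trB k f - bb\<bar> > \<eta>} \<le> \<eta>) sequentially"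
    using order_tendstoD(2)[OF trBe_upper[OF e(1) \<eta>4(1) \<eta>4(3)] \<eta>4(2)]
      order_tendstoD(2)[OF trBe_lower[OF e(1,2) \<eta>4(1) b] \<eta>4(2)]
      C(2)[OF e(1) Ce] rr_sum_small[OF \<eta>4(1) \<mu>4 Kr e(1) K(1)]
  proof eventually_elim
    case (elim k)
    interpret prob_space "G k" by (rule prob_G)
    note [measurable] = rr_sum_measurable
    \<comment> \<open>Of the excess \<open>\<eta>\<close> over \<open>bb\<close>, half is granted to
      \<open>trBe\<close> and a quarter to the head remainder.\<close>
    have up: "measure (G k) {f \<in> space (G k). trB k f > bb + \<eta>}
      \<le> measure (G k) {f \<in> space (G k). bb + \<eta> / 4 + \<eta> / 4 < trBe e k f} + measure (G k) (bad e k)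
        + measure (G k) {f \<in> space (G k). \<eta> / 4 < 4 / \<mu>\<^sup>2 * (\<Sum>j\<in>head e k. rr k j f)}"
    proof (rule measure_Un3)
      show "{f \<in> space (G k). trB k f > bb + \<eta>} \<subseteq> {f \<in> space (G k). bb + \<eta> / 4 + \<eta> / 4 < trBe e k f} \<union> bad e k
        \<union> {f \<in> space (G k). \<eta> / 4 < 4 / \<mu>\<^sup>2 * (\<Sum>j\<in>head e k. rr k j f)}"
      proof (rule subsetI, rule ccontr)
        fix f assume f: "f \<in> {f \<in> space (G k). trB k f > bb + \<eta>}" and nf: "f \<notin> {f \<in> space (G k). bb + \<eta> / 4 + \<eta> / 4 < trBe e k f} \<union> bad e k
        \<union> {f \<in> space (G k). \<eta> / 4 < 4 / \<mu>\<^sup>2 * (\<Sum>j\<in>head e k. rr k j f)}"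
        then have sp: "f \<in> space (G k)" and a: "bb + \<eta> < trB k f" and nb: "f \<notin> bad e k" by auto
        have 1: "trBe e k f \<le> bb + \<eta> / 4 + \<eta> / 4" "4 / \<mu>\<^sup>2 * (\<Sum>j\<in>head e k. rr k j f) \<le> \<eta> / 4"
          using nf sp unfolding Un_iff mem_Collect_eq not_less[symmetric] by blast+
        show False using 1 a trB_between(2)[OF e(1), of k f] head_remainder[OF sp nb] \<eta> by linarith
      qed
    qed (auto intro: bad_sets)
    have lo: "measure (G k) {f \<in> space (G k). trB k f < bb - \<eta>}
      \<le> measure (G k) {f \<in> space (G k). trBe e k f < bb - \<eta> / 4 - \<eta> / 4}"
    proof (rule finite_measure_mono)
      show "{f \<in> space (G k). trB k f < bb - \<eta>} \<subseteq> {f \<in> space (G k). trBe e k f < bb - \<eta> / 4 - \<eta> / 4}"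
      proof safe
        fix f assume "trB k f < bb - \<eta>"
        then show "trBe e k f < bb - \<eta> / 4 - \<eta> / 4" using trB_between(1)[OF e(1), of k f] \<eta> by linarith
      qed
    qed measurable
    have "measure (G k) {f \<in> space (G k). \<bar>trB k f - bb\<bar> > \<eta>}
      \<le> measure (G k) ({f \<in> space (G k). trB k f > bb + \<eta>} \<union> {f \<in> space (G k). trB k f < bb - \<eta>})"
      by (rule finite_measure_mono) auto
    also have "\<dots> \<le> measure (G k) {f \<in> space (G k). trB k f > bb + \<eta>} + measure (G k) {f \<in> space (G k). trB k f < bb - \<eta>}"
      by (rule measure_Un_le) auto
    finally show ?case using up lo elim Me \<eta> by linarith
  qed
qed

section \<open>The columns in the regression\<close>

definition T1 :: "nat \<Rightarrow> (nat \<times> nat \<Rightarrow> real) \<Rightarrow> real" where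
  "T1 k f = (\<Sum>j<p k. w0 k j * (1 - w0 k j * ip (n k) (col f j) (mv (n k) (Rb k f) (col f j)))) / N k"

lemma pb_T1: "pb (flat (N k) (n k)) (T1 k)"
proof -
  interpret W: weighted "N k" "n k" "\<rho> k" "w0 k" by (rule weighted_w0)
  show ?thesis unfolding T1_def[abs_def] Rb_def divide_inverse
    by (intro pb_mult pb_sum pb_diff pb_const W.pb_quantities(5)[OF sub_p(1)]) (use pN[of k] in auto)
qed

text \<open>By \<open>1 - w * q / (1 + w * q) = 1 / (1 + w * q)\<close>.\<close>

lemma T1_loo: "T1 k f = (\<Sum>j<p k. w0 k j / (1 + w0 k j * qq k j f)) / N k"
proof -
  have "w0 k j * (1 - w0 k j * ip (n k) (col f j) (mv (n k) (Rb k f) (col f j))) = w0 k j / (1 + w0 k j * qq k j f)"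
    if j: "j < p k" for j
  proof -
    have "0 \<le> w0 k j * qq k j f" using loo_facts(4)[OF j] by simp
    then show ?thesis unfolding loo_facts(1)[OF j] by (simp add: field_simps)
  qed
  then show ?thesis by (simp add: T1_def)
qed

text \<open>\<open>T1\<close> with every \<open>qq k j\<close> replaced by the common value
  \<open>tau0\<close>. In this form the limit follows from the trace equation, since
  \<open>H\<close> at \<open>tau0\<close> is close to \<open>n / N\<close>.\<close>

definition U1 :: "nat \<Rightarrow> (nat \<times> nat \<Rightarrow> real) \<Rightarrow> real" where
  "U1 k f = H 1 0 k (tau0 k f) / tau0 k f"

lemma U1_conv: "conv_prob G U1 (\<beta> / \<mu>)"
proof -
  have d: "conv_prob G (defect 1 0) 0" by (rule defect_conv) auto
  have rN: "(\<lambda>k. - (\<rho> k / real (N k))) \<longlonglongrightarrow> 0"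
  proof (rule Lim_null_comparison)
    show "eventually (\<lambda>k. norm (- (\<rho> k / real (N k))) \<le> 1 / real (N k)) sequentially"
      using \<rho>_pos \<rho>_le by (intro always_eventually allI) (auto simp: less_imp_le intro!: divide_right_mono)
    show "(\<lambda>k. 1 / real (N k)) \<longlonglongrightarrow> 0" by (rule rN_div[of 1 0]) auto
  qed
  \<comment> \<open>The definition of \<open>defect\<close> solved for \<open>H\<close>; both
    correction terms tend to 0.\<close>
  have "conv_prob G (\<lambda>k f. real (n k) / N k + (- (\<rho> k / real (N k)) * tau0 k f + - 1 * defect 1 0 k f)) (\<beta> + (0 * \<mu> + - 1 * 0))"
    by (intro conv_prob_add conv_prob_mult conv_prob_deterministic n_lim rN tau0_conv d prob_G tendsto_const)
  also have "(\<lambda>k f. real (n k) / N k + (- (\<rho> k / real (N k)) * tau0 k f + - 1 * defect 1 0 k f)) = (\<lambda>k f. H 1 0 k (tau0 k f))"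
    by (simp add: defect_def fun_eq_iff)
  finally have "conv_prob G (\<lambda>k f. H 1 0 k (tau0 k f)) \<beta>" by simp
  from conv_prob_divide[OF this tau0_conv prob_G] \<mu>(1) show ?thesis by (simp add: U1_def[abs_def])
qed

lemma U1_eq: "0 < tau0 k f \<Longrightarrow> U1 k f = (\<Sum>j<p k. w0 k j / (1 + w0 k j * tau0 k f)) / N k"
  by (simp add: U1_def H_def wt_0 sum_divide_distrib[symmetric]) (simp add: sum_divide_distrib)

lemma U1_measurable: "U1 k \<in> borel_measurable (G k)"
  using U1_conv by (rule conv_prob_measurable)

lemma resolvent_lipschitz:
  fixes v x y :: real
  assumes "0 \<le> v" "0 \<le> x" "0 \<le> y"
  shows "\<bar>v / (1 + v * x) - v / (1 + v * y)\<bar> \<le> v\<^sup>2 * \<bar>x - y\<bar>"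
proof -
  have p: "1 \<le> 1 + v * x" "1 \<le> 1 + v * y" using assms by auto
  then have "v / (1 + v * x) - v / (1 + v * y) = (v\<^sup>2 * (y - x)) / ((1 + v * x) * (1 + v * y))"
    by (simp add: divide_simps) (simp add: algebra_simps power2_eq_square)
  then have "\<bar>v / (1 + v * x) - v / (1 + v * y)\<bar> = (v\<^sup>2 * \<bar>x - y\<bar>) / ((1 + v * x) * (1 + v * y))"
    using p assms by (simp add: abs_mult abs_minus_commute)
  also have "\<dots> \<le> v\<^sup>2 * \<bar>x - y\<bar>"
    using p assms mult_mono[of 1 "1 + v * x" 1 "1 + v * y"] by (intro div_ge_one_le) auto
  finally show ?thesis .
qed

text \<open>In the head both terms are at most \<open>2 / \<mu>\<close> whatever the weight, since
  \<open>w / (1 + w * x) \<le> 1 / x\<close>; elsewhere the bounded weights allow a Lipschitz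
  estimate.\<close>

lemma T1_U1_bound:
  assumes d: "0 < d" and f: "f \<in> space (G k)" "f \<notin> bad d k"
  shows "\<bar>T1 k f - U1 k f\<bar> \<le> 2 * d / \<mu> + (2 * d powr (- \<kappa>))\<^sup>2 * ((\<Sum>j\<in>{..<p k} - head d k. \<bar>qq k j f - tau0 k f\<bar>) / N k)"
proof (cases "N k = 0")
  case True
  then show ?thesis using pN[of k] d \<mu>(1) by (simp add: T1_def U1_def H_def)
next
  case False
  then have Nk: "0 < real (N k)" by simp
  let ?C = "2 * d powr (- \<kappa>)"
  let ?D = "\<lambda>j. w0 k j / (1 + w0 k j * qq k j f) - w0 k j / (1 + w0 k j * tau0 k f)"
  have t: "3 * \<mu> / 4 \<le> tau0 k f" using good_head(2)[OF f] .
  have t0: "0 < tau0 k f" using t \<mu>(1) by linarith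
  have "T1 k f - U1 k f = (\<Sum>j<p k. ?D j) / N k"
    unfolding T1_loo U1_eq[OF t0] by (simp add: sum_subtractf diff_divide_distrib)
  then have "\<bar>T1 k f - U1 k f\<bar> = \<bar>\<Sum>j<p k. ?D j\<bar> / N k" by simp
  also have "\<dots> \<le> (\<Sum>j<p k. \<bar>?D j\<bar>) / N k" by (intro divide_right_mono sum_abs) auto
  also have "(\<Sum>j<p k. \<bar>?D j\<bar>) = (\<Sum>j\<in>{..<p k} - head d k. \<bar>?D j\<bar>) + (\<Sum>j\<in>head d k. \<bar>?D j\<bar>)"
    by (rule sum.subset_diff) (auto simp: head_def)
  also have "\<dots> / N k \<le> ((\<Sum>j\<in>{..<p k} - head d k. ?C\<^sup>2 * \<bar>qq k j f - tau0 k f\<bar>) + (\<Sum>j\<in>head d k. 2 / \<mu>)) / N k"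
  proof (intro divide_right_mono add_mono sum_mono)
    fix j assume j: "j \<in> {..<p k} - head d k"
    then have jp: "j < p k" by simp
    have "wt 1 0 k j \<le> ?C" using j by (intro tail_weight d) auto
    then have wC: "w0 k j \<le> ?C" by (simp add: wt_0)
    have w: "0 \<le> w0 k j" using w0_pos[OF jp] by linarith
    have "\<bar>?D j\<bar> \<le> (w0 k j)\<^sup>2 * \<bar>qq k j f - tau0 k f\<bar>"
      by (rule resolvent_lipschitz[OF w loo_facts(4)[OF jp] tau0_nonneg])
    also have "\<dots> \<le> ?C\<^sup>2 * \<bar>qq k j f - tau0 k f\<bar>" using w wC by (intro mult_right_mono power_mono) auto
    finally show "\<bar>?D j\<bar> \<le> ?C\<^sup>2 * \<bar>qq k j f - tau0 k f\<bar>" .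
  next
    fix j assume j: "j \<in> head d k"
    have jp: "j < p k" by (rule head_sub(1)[OF j])
    have w: "1 \<le> w0 k j" by (rule w0_pos[OF jp])
    have r: "0 \<le> w0 k j / (1 + w0 k j * x) \<and> w0 k j / (1 + w0 k j * x) \<le> 2 / \<mu>" if x: "\<mu> / 2 \<le> x" for x
    proof -
      have x0: "0 < x" using x \<mu>(1) by linarith
      have wx: "0 < w0 k j * x" using w x0 by (intro mult_pos_pos) linarith+
      have "w0 k j / (1 + w0 k j * x) \<le> w0 k j / (w0 k j * x)" using w wx by (intro divide_left_mono) (auto intro: mult_pos_pos)
      also have "\<dots> = 1 / x" by (rule nonzero_divide_mult_cancel_left) (use w in auto)
      also have "\<dots> \<le> 1 / (\<mu> / 2)" using x x0 \<mu>(1) by (intro divide_left_mono) auto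
      finally show ?thesis using w wx by simp
    qed
    have "\<mu> / 2 \<le> tau0 k f" using t \<mu>(1) by linarith
    from r[OF this] r[OF good_head(1)[OF f j]] show "\<bar>?D j\<bar> \<le> 2 / \<mu>" by linarith
  qed auto
  also have "\<dots> = ?C\<^sup>2 * ((\<Sum>j\<in>{..<p k} - head d k. \<bar>qq k j f - tau0 k f\<bar>) / N k) + real (card (head d k)) * (2 / \<mu>) / N k"
    by (simp add: sum_distrib_left[symmetric] add_divide_distrib)
  also have "real (card (head d k)) * (2 / \<mu>) / N k \<le> (d * N k) * (2 / \<mu>) / N k"
    using card_head[of d k] d \<mu>(1) by (intro divide_right_mono mult_right_mono) auto
  also have "\<dots> = 2 * d / \<mu>" using Nk by simp
  finally show ?thesis by simp
qed

lemma T1_conv: "conv_prob G T1 (\<beta> / \<mu>)"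
proof -
  have mT1: "T1 k \<in> borel_measurable (G k)" for k by (rule pb_measurable'[OF pb_T1])
  have "conv_prob G (\<lambda>k f. T1 k f - U1 k f) 0"
  proof (rule conv_probI[OF _ _ prob_G])
    show "(\<lambda>f. T1 k f - U1 k f) \<in> borel_measurable (G k)" for k
      by (intro borel_measurable_diff mT1 U1_measurable)
    fix \<eta> :: real assume \<eta>: "0 < \<eta>"
    obtain C where C: "0 < C" "\<And>e d. 0 < e \<Longrightarrow> C * e < d \<Longrightarrow> eventually (\<lambda>k. measure (G k) (bad e k) < d) sequentially"
      by (rule bad_small) blast
    obtain K where K: "0 < K" "eventually (\<lambda>k. \<forall>j<p k.
        integral\<^sup>L (G k) (\<lambda>f. (qq k j f - tm k j f)\<^sup>2) \<le> 2 * (K / N k) \<and> integral\<^sup>L (G k) (rr k j) \<le> K / N k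
        \<and> integral\<^sup>L (G k) (\<lambda>f. \<bar>qq k j f - tau0 k f\<bar>) \<le> sqrt (2 * (K / N k)) + w0 k j * (K / N k)) sequentially"
      by (rule loo_constants) blast
    \<comment> \<open>The first bound makes the head contribution at most \<open>\<eta> / 4\<close>,
      the second keeps the probability of the bad event below \<open>\<eta> / 2\<close>.\<close>
    define d where "d = min (\<eta> * \<mu> / 8) (\<eta> / (8 * C))"
    have d: "0 < d" "d \<le> \<eta> * \<mu> / 8" "d \<le> \<eta> / (8 * C)" using \<eta> \<mu>(1) C by (auto simp: d_def)
    have Cd: "C * d < \<eta> / 2"
    proof -
      have "C * d \<le> C * (\<eta> / (8 * C))" using d C by (intro mult_left_mono) auto
      also have "\<dots> = \<eta> / 8" using C by simp
      finally show ?thesis using \<eta> by simp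
    qed
    have d\<mu>: "2 * d / \<mu> \<le> \<eta> / 4" using d(2) \<mu>(1) by (simp add: divide_le_eq mult_ac)
    define c where "c = 2 * d powr (- \<kappa>)"
    have c: "0 < c" using d by (simp add: c_def)
    define X where "X k f = c\<^sup>2 * ((\<Sum>j\<in>{..<p k} - head d k. \<bar>qq k j f - tau0 k f\<bar>) / N k)" for k f
    have iq: "integrable (G k) (\<lambda>f. \<bar>qq k j f - tau0 k f\<bar>)" if "j < p k" for j k
      by (intro pb_integrable pb_abs pb_diff loo_facts(6)[OF that]) (use pb_tau[of 1 0 k] in auto)
    have l: "(\<lambda>k. c * (c * (sqrt (2 * (K / N k)) + c * (K / N k)))) \<longlonglongrightarrow> c * 0"
      by (intro tendsto_mult tendsto_const rate_lim) (use K in auto)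
    have "eventually (\<lambda>k. c * (c * (sqrt (2 * (K / N k)) + c * (K / N k))) < \<eta> / 2 * (\<eta> / 2)) sequentially"
      by (rule order_tendstoD(2)[OF l]) (use \<eta> in simp)
    then show "eventually (\<lambda>k. measure (G k) {f \<in> space (G k). \<bar>T1 k f - U1 k f - 0\<bar> > \<eta>} \<le> \<eta>) sequentially"
      using K(2) C(2)[OF d(1) Cd] eventually_dims
    proof eventually_elim
      case (elim k)
      interpret prob_space "G k" by (rule prob_G)
      have Nk: "0 < real (N k)" using elim by simp
      have KN: "0 \<le> K / N k" using K(1) by simp
      have iX: "integrable (G k) (X k)" unfolding X_def[abs_def]
        by (intro integrable_mult_right integrable_divide Bochner_Integration.integrable_sum iq) auto
      have "integral\<^sup>L (G k) (X k) = c\<^sup>2 * ((\<Sum>j\<in>{..<p k} - head d k. integral\<^sup>L (G k) (\<lambda>f. \<bar>qq k j f - tau0 k f\<bar>)) / N k)"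
        unfolding X_def[abs_def] using iq by simp
      also have "\<dots> \<le> c\<^sup>2 * ((\<Sum>j\<in>{..<p k} - head d k. sqrt (2 * (K / N k)) + c * (K / N k)) / N k)"
      proof (intro mult_left_mono divide_right_mono sum_mono)
        fix j assume j: "j \<in> {..<p k} - head d k"
        have "wt 1 0 k j \<le> c" unfolding c_def using j by (intro tail_weight d) auto
        then have "w0 k j \<le> c" by (simp add: wt_0)
        then have "w0 k j * (K / N k) \<le> c * (K / N k)" using KN by (rule mult_right_mono)
        moreover have "integral\<^sup>L (G k) (\<lambda>f. \<bar>qq k j f - tau0 k f\<bar>) \<le> sqrt (2 * (K / N k)) + w0 k j * (K / N k)"
          using elim j by auto
        ultimately show "integral\<^sup>L (G k) (\<lambda>f. \<bar>qq k j f - tau0 k f\<bar>) \<le> sqrt (2 * (K / N k)) + c * (K / N k)" by linarith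
      qed auto
      also have "\<dots> = c\<^sup>2 * (real (card ({..<p k} - head d k)) / N k * (sqrt (2 * (K / N k)) + c * (K / N k)))" by simp
      also have "\<dots> \<le> c\<^sup>2 * (1 * (sqrt (2 * (K / N k)) + c * (K / N k)))"
      proof (intro mult_left_mono mult_right_mono)
        have "card ({..<p k} - head d k) \<le> card {..<p k}" by (rule card_mono) auto
        then show "real (card ({..<p k} - head d k)) / N k \<le> 1" using pN[of k] Nk by simp
        show "0 \<le> sqrt (2 * (K / N k)) + c * (K / N k)"
          using KN c by (intro add_nonneg_nonneg mult_nonneg_nonneg real_sqrt_ge_zero) auto
      qed auto
      also have "\<dots> < \<eta> / 2 * (\<eta> / 2)" using elim by (simp add: power2_eq_square mult_ac)
      finally have EX: "integral\<^sup>L (G k) (X k) < \<eta> / 2 * (\<eta> / 2)" .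
      have X0: "0 \<le> X k f" for f unfolding X_def by (intro mult_nonneg_nonneg divide_nonneg_nonneg sum_nonneg) auto
      have "measure (G k) {f \<in> space (G k). X k f > \<eta> / 2} \<le> integral\<^sup>L (G k) (X k) / (\<eta> / 2)"
        using \<eta> by (intro prob_markov prob_G iX X0) auto
      also have "\<dots> \<le> \<eta> / 2" using EX \<eta> by (simp add: divide_le_eq)
      finally have mX: "measure (G k) {f \<in> space (G k). X k f > \<eta> / 2} \<le> \<eta> / 2" .
      have [measurable]: "X k \<in> borel_measurable (G k)" using iX by simp
      have "measure (G k) {f \<in> space (G k). \<bar>T1 k f - U1 k f - 0\<bar> > \<eta>} \<le> measure (G k) (bad d k \<union> {f \<in> space (G k). X k f > \<eta> / 2})"
      proof (rule finite_measure_mono)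
        show "{f \<in> space (G k). \<bar>T1 k f - U1 k f - 0\<bar> > \<eta>} \<subseteq> bad d k \<union> {f \<in> space (G k). X k f > \<eta> / 2}"
        proof (rule subsetI, rule ccontr)
          fix f assume f: "f \<in> {f \<in> space (G k). \<bar>T1 k f - U1 k f - 0\<bar> > \<eta>}"
            and nf: "f \<notin> bad d k \<union> {f \<in> space (G k). X k f > \<eta> / 2}"
          have "\<bar>T1 k f - U1 k f\<bar> \<le> 2 * d / \<mu> + X k f"
            unfolding X_def c_def using f nf by (intro T1_U1_bound d) auto
          moreover have "X k f \<le> \<eta> / 2" "\<eta> < \<bar>T1 k f - U1 k f\<bar>" using f nf by auto
          ultimately show False using d\<mu> \<eta> by linarith
        qed
      qed (use bad_sets in auto)
      also have "\<dots> \<le> measure (G k) (bad d k) + measure (G k) {f \<in> space (G k). X k f > \<eta> / 2}"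
        by (rule measure_Un_le) (use bad_sets in auto)
      finally show ?case using mX elim by linarith
    qed
  qed
  from conv_prob_add[OF this U1_conv prob_G] show ?thesis by simp
qed

end

section \<open>The columns outside the regression\<close>

context asymptotic
begin

text \<open>The matrix \<open>B / (1 + trB)\<close> of the quadratic form by which the columns \<open>p \<le> j < N\<close> enter;
  the normalisation makes its entries bounded.\<close>

definition Bt :: "nat \<Rightarrow> (nat \<times> nat \<Rightarrow> real) \<Rightarrow> nat \<Rightarrow> nat \<Rightarrow> real" where
  "Bt k f a b = (\<Sum>i<p k. (w0 k i)\<^sup>2 * mv (n k) (Rb k f) (col f i) a * mv (n k) (Rb k f) (col f i) b) / (1 + trB k f)"

lemma mv_Bt: "mv (n k) (Bt k f) v a
  = (\<Sum>i<p k. (w0 k i)\<^sup>2 * mv (n k) (Rb k f) (col f i) a * ip (n k) (mv (n k) (Rb k f) (col f i)) v) / (1 + trB k f)"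
proof -
  let ?u = "\<lambda>i. mv (n k) (Rb k f) (col f i)"
  have "mv (n k) (Bt k f) v a = (\<Sum>b<n k. \<Sum>i<p k. (w0 k i)\<^sup>2 * ?u i a * (?u i b * v b)) / (1 + trB k f)"
    by (simp add: mv_def[of "n k" "Bt k f"] Bt_def sum_distrib_right sum_distrib_left sum_divide_distrib mult_ac)
  also have "(\<Sum>b<n k. \<Sum>i<p k. (w0 k i)\<^sup>2 * ?u i a * (?u i b * v b)) = (\<Sum>i<p k. \<Sum>b<n k. (w0 k i)\<^sup>2 * ?u i a * (?u i b * v b))"
    by (rule sum.swap)
  finally show ?thesis by (simp add: inner_N_def sum_distrib_left)
qed

lemma ip_Bt: "ip (n k) v (mv (n k) (Bt k f) v)
  = (\<Sum>i<p k. (w0 k i)\<^sup>2 * (ip (n k) v (mv (n k) (Rb k f) (col f i)))\<^sup>2) / (1 + trB k f)"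
proof -
  let ?u = "\<lambda>i. mv (n k) (Rb k f) (col f i)"
  have "ip (n k) v (mv (n k) (Bt k f) v) = (\<Sum>a<n k. \<Sum>i<p k. (w0 k i)\<^sup>2 * ip (n k) (?u i) v * (v a * ?u i a)) / (1 + trB k f)"
    by (simp add: inner_N_def[of "n k" v] mv_Bt sum_distrib_left sum_divide_distrib mult_ac)
  also have "(\<Sum>a<n k. \<Sum>i<p k. (w0 k i)\<^sup>2 * ip (n k) (?u i) v * (v a * ?u i a))
      = (\<Sum>i<p k. \<Sum>a<n k. (w0 k i)\<^sup>2 * ip (n k) (?u i) v * (v a * ?u i a))"
    by (rule sum.swap)
  also have "\<dots> = (\<Sum>i<p k. (w0 k i)\<^sup>2 * ip (n k) (?u i) v * ip (n k) v (?u i))"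
    by (simp add: inner_N_def[of "n k" v] sum_distrib_left)
  finally show ?thesis by (simp add: ip_commute[of _ _ v] power2_eq_square mult_ac)
qed

lemma trc_Bt: "trc (n k) (Bt k f) = trB k f / (1 + trB k f)"
proof -
  have "trc (n k) (Bt k f) = (\<Sum>a<n k. \<Sum>i<p k. (w0 k i)\<^sup>2 * (mv (n k) (Rb k f) (col f i) a * mv (n k) (Rb k f) (col f i) a)) / (1 + trB k f)"
    by (simp add: trc_def Bt_def sum_divide_distrib mult_ac)
  also have "(\<Sum>a<n k. \<Sum>i<p k. (w0 k i)\<^sup>2 * (mv (n k) (Rb k f) (col f i) a * mv (n k) (Rb k f) (col f i) a)) = trB k f"
    unfolding trB_def y2_def inner_N_def by (subst sum.swap) (simp add: sum_distrib_left)
  finally show ?thesis .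
qed

lemma psd_Bt: "psd (n k) (Bt k f)"
  unfolding psd_def ip_Bt using trB_nonneg[of k f]
  by (auto simp: Bt_def mult_ac intro!: divide_nonneg_nonneg sum_nonneg)

lemma trc_Bt_le: "trc (n k) (Bt k f) \<le> 1"
  unfolding trc_Bt using trB_nonneg[of k f] by simp

lemma pb_Bt:
  assumes ab: "a < n k" "b < n k"
  shows "pb (flat (N k) (n k)) (\<lambda>f. Bt k f a b)"
proof (rule pb_bounded[where C=1])
  interpret W: weighted "N k" "n k" "\<rho> k" "w0 k" by (rule weighted_w0)
  have m: "(\<lambda>f. mv (n k) (Rb k f) (col f i) a) \<in> borel_measurable (Pi\<^sub>M (flat (N k) (n k)) (\<lambda>_. borel))"
    if "i < p k" for i a
    unfolding Rb_def using that pN[of k] by (intro pb_measurable W.pb_quantities(3)[OF sub_p(1)]) auto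
  have "trB k \<in> borel_measurable (Pi\<^sub>M (flat (N k) (n k)) (\<lambda>_. borel))" by (rule pb_measurable[OF pb_trB])
  then show "(\<lambda>f. Bt k f a b) \<in> borel_measurable (Pi\<^sub>M (flat (N k) (n k)) (\<lambda>_. borel))"
    unfolding Bt_def
    by (intro borel_measurable_divide borel_measurable_sum borel_measurable_times borel_measurable_add borel_measurable_const m) auto
  fix f show "\<bar>Bt k f a b\<bar> \<le> 1"
    using psd_entry_le_trc[OF psd_Bt ab, of f] trc_Bt_le[of k f] by linarith
qed

lemma Bt_upd: "p k \<le> j \<Longrightarrow> Bt k (f((j, a) := t)) = Bt k f"
proof -
  assume j: "p k \<le> j"
  interpret W: weighted "N k" "n k" "\<rho> k" "w0 k" by (rule weighted_w0)
  have R: "Rb k (f((j, a) := t)) = Rb k f" unfolding Rb_def using j by (intro W.R_upd_other) auto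
  have c: "col (f((j, a) := t)) i = col f i" if "i < p k" for i using that j by (intro col_upd_other) auto
  show ?thesis by (intro ext) (simp add: Bt_def trB_def y2_def R c)
qed

definition vv :: "nat \<Rightarrow> nat \<Rightarrow> (nat \<times> nat \<Rightarrow> real) \<Rightarrow> real" where
  "vv k j f = ip (n k) (col f j) (mv (n k) (Bt k f) (col f j)) - trc (n k) (Bt k f)"

lemma pb_vv: "j < N k \<Longrightarrow> pb (flat (N k) (n k)) (vv k j)"
proof -
  assume j: "j < N k"
  interpret W: weighted "N k" "n k" "\<rho> k" "w0 k" by (rule weighted_w0)
  show ?thesis unfolding vv_def[abs_def] by (intro pb_diff pb_ip pb_mv pb_trc pb_Bt W.pb_col j; assumption)
qed

text \<open>The variance is twice the mean squared Frobenius norm, which the normalisation of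
  \<open>Bt\<close> keeps at most 1.\<close>

lemma vv_second_moment:
  assumes "p k \<le> j" "j < N k"
  shows "integral\<^sup>L (G k) (\<lambda>f. (vv k j f)\<^sup>2) \<le> 2"
proof -
  interpret W: weighted "N k" "n k" "\<rho> k" "w0 k" by (rule weighted_w0)
  interpret prob_space "G k" by (rule prob_G)
  have "integral\<^sup>L (G k) (\<lambda>f. (vv k j f)\<^sup>2) = 2 * integral\<^sup>L (G k) (\<lambda>f. frob (n k) (Bt k f))"
    unfolding vv_def by (rule W.quad_variance[where A="Bt k", OF assms(2) psd_Bt pb_Bt Bt_upd[OF assms(1)]])
  also have "integral\<^sup>L (G k) (\<lambda>f. frob (n k) (Bt k f)) \<le> integral\<^sup>L (G k) (\<lambda>f. 1)"
  proof (rule integral_mono)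
    fix f
    have "frob (n k) (Bt k f) \<le> (trc (n k) (Bt k f))\<^sup>2" by (rule frob_le_trc[OF psd_Bt])
    also have "\<dots> \<le> 1\<^sup>2" using trc_nonneg[OF psd_Bt] trc_Bt_le by (intro power_mono) auto
    finally show "frob (n k) (Bt k f) \<le> 1" by simp
  qed (intro W.int_pb pb_frob pb_Bt pb_const; assumption)+
  finally show ?thesis by (simp add: prob_space)
qed

text \<open>\<open>vv k l\<close> does not involve column \<open>j\<close>, and
  \<open>vv k j\<close> is centred when column \<open>j\<close> alone is integrated.\<close>

lemma vv_uncorrelated:
  assumes "p k \<le> j" "j < N k" "p k \<le> l" "l < N k" "j \<noteq> l"
  shows "integral\<^sup>L (G k) (\<lambda>f. vv k j f * vv k l f) = 0"
proof -
  interpret W: weighted "N k" "n k" "\<rho> k" "w0 k" by (rule weighted_w0)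
  have "vv k l (f((j, a) := t)) = vv k l f" for f a t
    using assms by (simp add: vv_def Bt_upd col_upd_other)
  from W.quad_centered[where A="Bt k" and h="vv k l", OF assms(2) psd_Bt pb_Bt Bt_upd[OF assms(1)] pb_vv[OF assms(4)] this]
  show ?thesis by (simp only: vv_def[of k j])
qed

definition Dt :: "nat \<Rightarrow> (nat \<times> nat \<Rightarrow> real) \<Rightarrow> real" where
  "Dt k f = (\<Sum>j\<in>{p k..<N k}. w0 k j * vv k j f) / N k"

lemma pb_Dt: "pb (flat (N k) (n k)) (Dt k)"
  unfolding Dt_def[abs_def] divide_inverse by (intro pb_mult pb_sum pb_const pb_vv) auto

text \<open>The diagonal alone survives: at most \<open>N\<close> bounded terms against the factor
  \<open>1 / N\<^sup>2\<close>. The weights of the outer columns are bounded because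
  \<open>p \<ge> \<beta> * N\<close>.\<close>

lemma Dt_second_moment:
  assumes Nk: "0 < N k" and pk: "\<beta> * N k \<le> p k"
  shows "integral\<^sup>L (G k) (\<lambda>f. (Dt k f)\<^sup>2) \<le> 2 * (\<beta> powr (- \<kappa>))\<^sup>2 / N k"
proof -
  let ?J = "{p k..<N k}"
  have w: "0 \<le> w0 k j" "w0 k j \<le> \<beta> powr (- \<kappa>)" if "j \<in> ?J" for j
  proof -
    have "\<beta> \<le> pt k j" using pk Nk that by (simp add: pt_def le_divide_eq)
    then show "w0 k j \<le> \<beta> powr (- \<kappa>)" using \<beta> \<kappa> by (intro powr_mono2') auto
  qed simp
  have i: "integrable (G k) (\<lambda>f. vv k j f * vv k l f)" if "j \<in> ?J" "l \<in> ?J" for j l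
    using that by (intro pb_integrable pb_mult pb_vv) auto
  have "integral\<^sup>L (G k) (\<lambda>f. (Dt k f)\<^sup>2)
      = integral\<^sup>L (G k) (\<lambda>f. (\<Sum>j\<in>?J. \<Sum>l\<in>?J. w0 k j * w0 k l * (vv k j f * vv k l f)) / (real (N k))\<^sup>2)"
    by (simp add: Dt_def power_divide power2_eq_square sum_product mult_ac)
  also have "\<dots> = (\<Sum>j\<in>?J. \<Sum>l\<in>?J. w0 k j * w0 k l * integral\<^sup>L (G k) (\<lambda>f. vv k j f * vv k l f)) / (real (N k))\<^sup>2"
  proof -
    have s1: "integrable (G k) (\<lambda>f. w0 k j * w0 k l * (vv k j f * vv k l f))" if "j \<in> ?J" "l \<in> ?J" for j l
      by (rule integrable_mult_right[OF i[OF that]])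
    have "integral\<^sup>L (G k) (\<lambda>f. \<Sum>j\<in>?J. \<Sum>l\<in>?J. w0 k j * w0 k l * (vv k j f * vv k l f))
        = (\<Sum>j\<in>?J. integral\<^sup>L (G k) (\<lambda>f. \<Sum>l\<in>?J. w0 k j * w0 k l * (vv k j f * vv k l f)))"
      by (rule Bochner_Integration.integral_sum) (intro Bochner_Integration.integrable_sum s1)
    also have "\<dots> = (\<Sum>j\<in>?J. \<Sum>l\<in>?J. integral\<^sup>L (G k) (\<lambda>f. w0 k j * w0 k l * (vv k j f * vv k l f)))"
      by (intro sum.cong refl Bochner_Integration.integral_sum s1)
    finally show ?thesis by (simp only: integral_divide_zero integral_mult_right_zero)
  qed
  also have "(\<Sum>j\<in>?J. \<Sum>l\<in>?J. w0 k j * w0 k l * integral\<^sup>L (G k) (\<lambda>f. vv k j f * vv k l f))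
      = (\<Sum>j\<in>?J. w0 k j * w0 k j * integral\<^sup>L (G k) (\<lambda>f. vv k j f * vv k j f))"
  proof (intro sum.cong refl)
    fix j assume j: "j \<in> ?J"
    have "(\<Sum>l\<in>?J. w0 k j * w0 k l * integral\<^sup>L (G k) (\<lambda>f. vv k j f * vv k l f))
        = (\<Sum>l\<in>{j}. w0 k j * w0 k l * integral\<^sup>L (G k) (\<lambda>f. vv k j f * vv k l f))"
      using j by (intro sum.mono_neutral_right) (auto simp: vv_uncorrelated)
    then show "(\<Sum>l\<in>?J. w0 k j * w0 k l * integral\<^sup>L (G k) (\<lambda>f. vv k j f * vv k l f))
        = w0 k j * w0 k j * integral\<^sup>L (G k) (\<lambda>f. vv k j f * vv k j f)" by simp
  qed
  also have "\<dots> / (real (N k))\<^sup>2 \<le> (\<Sum>j\<in>?J. \<beta> powr (- \<kappa>) * \<beta> powr (- \<kappa>) * 2) / (real (N k))\<^sup>2"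
  proof (intro divide_right_mono sum_mono)
    fix j assume j: "j \<in> ?J"
    have "integral\<^sup>L (G k) (\<lambda>f. vv k j f * vv k j f) \<le> 2"
      using vv_second_moment[of k j] j by (simp add: power2_eq_square)
    moreover have "0 \<le> integral\<^sup>L (G k) (\<lambda>f. vv k j f * vv k j f)" by (rule integral_nonneg_AE) simp
    ultimately show "w0 k j * w0 k j * integral\<^sup>L (G k) (\<lambda>f. vv k j f * vv k j f) \<le> \<beta> powr (- \<kappa>) * \<beta> powr (- \<kappa>) * 2"
      using w[OF j] by (intro mult_mono) auto
  qed simp
  also have "\<dots> = real (card ?J) * (2 * (\<beta> powr (- \<kappa>))\<^sup>2) / (real (N k))\<^sup>2" by (simp add: power2_eq_square)
  also have "\<dots> \<le> real (N k) * (2 * (\<beta> powr (- \<kappa>))\<^sup>2) / (real (N k))\<^sup>2"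
    by (intro divide_right_mono mult_right_mono) auto
  also have "\<dots> = 2 * (\<beta> powr (- \<kappa>))\<^sup>2 / N k" using Nk by (simp add: power2_eq_square)
  finally show ?thesis .
qed

lemma Dt_conv: "conv_prob G Dt 0"
proof (rule conv_probI[OF _ _ prob_G])
  show m: "Dt k \<in> borel_measurable (G k)" for k by (rule pb_measurable'[OF pb_Dt])
  fix \<eta> :: real assume \<eta>: "0 < \<eta>"
  have "(\<lambda>k. 2 * (\<beta> powr (- \<kappa>))\<^sup>2 / real (N k)) \<longlonglongrightarrow> 0" by (rule rN_div[of 1 0]) auto
  then have "eventually (\<lambda>k. 2 * (\<beta> powr (- \<kappa>))\<^sup>2 / real (N k) < \<eta> * \<eta>\<^sup>2) sequentially"
    by (rule order_tendstoD(2)) (use \<eta> in simp)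
  then show "eventually (\<lambda>k. measure (G k) {f \<in> space (G k). \<bar>Dt k f - 0\<bar> > \<eta>} \<le> \<eta>) sequentially"
    using eventually_dims
  proof eventually_elim
    case (elim k)
    have eq: "{f \<in> space (G k). \<bar>Dt k f - 0\<bar> > \<eta>} = {f \<in> space (G k). \<eta>\<^sup>2 < (Dt k f)\<^sup>2}"
    proof -
      have "\<eta> < \<bar>y\<bar> \<longleftrightarrow> \<eta>\<^sup>2 < y\<^sup>2" for y :: real
        using \<eta> abs_le_square_iff[of y \<eta>] unfolding not_le[symmetric] by simp
      then show ?thesis by simp
    qed
    have "measure (G k) {f \<in> space (G k). \<bar>Dt k f - 0\<bar> > \<eta>} \<le> integral\<^sup>L (G k) (\<lambda>f. (Dt k f)\<^sup>2) / \<eta>\<^sup>2"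
      unfolding eq using \<eta> by (intro prob_markov prob_G pb_integrable pb_power pb_Dt) auto
    also have "\<dots> \<le> (\<eta> * \<eta>\<^sup>2) / \<eta>\<^sup>2"
      using Dt_second_moment[of k] elim by (intro divide_right_mono) auto
    also have "\<dots> = \<eta>" using \<eta> by simp
    finally show ?case .
  qed
qed

section \<open>The limit of the scaled risk\<close>

definition Vsum :: "nat \<Rightarrow> real" where
  "Vsum k = (\<Sum>j\<in>{p k..<N k}. w0 k j) / N k"

definition V :: real where "V = integral {\<alpha>..1} (\<lambda>s. s powr (- \<kappa>))"

lemma Vsum_lim: "Vsum \<longlonglongrightarrow> V"
proof -
  \<comment> \<open>Cut off at \<open>\<beta>\<close>, the function is continuous on the whole unit
    interval. Beyond \<open>\<beta>\<close>, where the points with \<open>j \<ge> p\<close>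
    eventually lie, it is unchanged.\<close>
  let ?g = "\<lambda>s. (max s \<beta>) powr (- \<kappa>)"
  have c: "continuous_on S ?g" for S using \<beta> by (intro continuous_intros) (auto simp: max_def)
  have NN: "(\<lambda>k. real (N k) / real (N k)) \<longlonglongrightarrow> 1"
  proof (rule Lim_transform_eventually[OF tendsto_const])
    show "eventually (\<lambda>k. 1 = real (N k) / real (N k)) sequentially"
      using eventually_dims by eventually_elim simp
  qed
  have "(\<lambda>k. (\<Sum>j<N k. ?g (real (j + 1) / N k)) / N k - (\<Sum>j<p k. ?g (real (j + 1) / N k)) / N k)
    \<longlonglongrightarrow> integral {0..1} ?g - integral {0..\<alpha>} ?g"
    using \<alpha> \<beta> by (intro tendsto_diff riemann_sum[OF c N_lim _ NN] riemann_sum[OF c N_lim pN p_lim]) auto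
  also have "integral {0..1} ?g - integral {0..\<alpha>} ?g = integral {\<alpha>..1} ?g"
    using Henstock_Kurzweil_Integration.integral_combine[of 0 \<alpha> 1 ?g] \<alpha> \<alpha>_pos integrable_continuous_interval[OF c, of 0 1] by simp
  also have "\<dots> = V" unfolding V_def
    by (rule Henstock_Kurzweil_Integration.integral_cong) (use \<beta> in \<open>auto simp: max_def\<close>)
  finally have "(\<lambda>k. (\<Sum>j<N k. ?g (real (j + 1) / N k)) / N k - (\<Sum>j<p k. ?g (real (j + 1) / N k)) / N k) \<longlonglongrightarrow> V" .
  then show ?thesis
  proof (rule Lim_transform_eventually)
    show "eventually (\<lambda>k. (\<Sum>j<N k. ?g (real (j + 1) / N k)) / N k - (\<Sum>j<p k. ?g (real (j + 1) / N k)) / N k = Vsum k) sequentially"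
      using eventually_dims
    proof eventually_elim
      case (elim k)
      have "(\<Sum>j<N k. ?g (pt k j)) = (\<Sum>j<p k. ?g (pt k j)) + (\<Sum>j\<in>{p k..<N k}. ?g (pt k j))"
        unfolding lessThan_atLeast0 using pN[of k] by (intro sum.atLeastLessThan_concat[symmetric]) auto
      moreover have "(\<Sum>j\<in>{p k..<N k}. ?g (pt k j)) = (\<Sum>j\<in>{p k..<N k}. w0 k j)"
      proof (intro sum.cong refl)
        fix j assume "j \<in> {p k..<N k}"
        then have "\<beta> \<le> pt k j" using elim by (simp add: pt_def le_divide_eq)
        then show "?g (pt k j) = w0 k j" by (simp add: max_def)
      qed
      ultimately show ?case by (simp add: pt_def Vsum_def diff_divide_distrib[symmetric])
    qed
  qed
qed

text \<open>With ridge 0 this is the scaled risk; with a ridge it is an approximation whose limit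
  can be computed.\<close>

definition Q :: "nat \<Rightarrow> (nat \<times> nat \<Rightarrow> real) \<Rightarrow> real" where
  "Q k f = T1 k f + (\<Sum>j\<in>{p k..<N k}. w0 k j *
     (1 + (\<Sum>i<p k. (w0 k i)\<^sup>2 * (ip (n k) (col f j) (mv (n k) (Rb k f) (col f i)))\<^sup>2))) / N k"

text \<open>Undoes the normalisation of \<open>Bt\<close>. The outer columns remain in
  \<open>Dt\<close> alone, which tends to 0.\<close>

lemma Q_decomp: "Q k f = T1 k f + (Vsum k + Dt k f) * (1 + trB k f)"
proof -
  have t: "0 < 1 + trB k f" using trB_nonneg[of k f] by simp
  have v: "1 + (\<Sum>i<p k. (w0 k i)\<^sup>2 * (ip (n k) (col f j) (mv (n k) (Rb k f) (col f i)))\<^sup>2) = (1 + vv k j f) * (1 + trB k f)" for j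
  proof -
    have "1 + x = (1 + (x / (1 + b) - b / (1 + b))) * (1 + b)" if "0 < 1 + b" for x b :: real
      using that by (simp add: distrib_right left_diff_distrib)
    then show ?thesis unfolding vv_def ip_Bt trc_Bt using t .
  qed
  have "(\<Sum>j\<in>{p k..<N k}. w0 k j * ((1 + vv k j f) * (1 + trB k f)))
    = ((\<Sum>j\<in>{p k..<N k}. w0 k j) + (\<Sum>j\<in>{p k..<N k}. w0 k j * vv k j f)) * (1 + trB k f)"
    by (simp add: algebra_simps sum.distrib sum_distrib_left)
  then show ?thesis unfolding Q_def v by (simp add: Vsum_def Dt_def add_divide_distrib[symmetric])
qed

lemma Q_conv: "conv_prob G Q (\<beta> / \<mu> + V * (1 + bb))"
proof -
  have "conv_prob G (\<lambda>k f. T1 k f + (Vsum k + Dt k f) * (1 + trB k f)) (\<beta> / \<mu> + (V + 0) * (1 + bb))"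
    by (intro conv_prob_add conv_prob_mult conv_prob_deterministic T1_conv Vsum_lim Dt_conv trB_conv prob_G tendsto_const)
  then show ?thesis by (simp add: Q_decomp[abs_def])
qed

end

section \<open>From the estimator to the Gaussian array\<close>

definition gram :: "nat \<Rightarrow> nat \<Rightarrow> (nat \<Rightarrow> nat \<Rightarrow> real) \<Rightarrow> real Matrix.mat" where
  "gram n p X = Matrix.mat n p (\<lambda>(i, j). X i j) * transpose_mat (Matrix.mat n p (\<lambda>(i, j). X i j))"

abbreviation (input) xcol :: "(nat \<Rightarrow> nat \<Rightarrow> real) \<Rightarrow> nat \<Rightarrow> nat \<Rightarrow> real" where
  "xcol X j \<equiv> (\<lambda>a. X a j)"

text \<open>Ridge 0 and unit weights: \<open>R\<close> is the inverse of the Gram matrix of the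
  first \<open>p\<close> columns. A predicate, since the inverse exists only almost surely.\<close>

abbreviation (input) is_ginv :: "nat \<Rightarrow> nat \<Rightarrow> (nat \<Rightarrow> nat \<Rightarrow> real) \<Rightarrow> (nat \<Rightarrow> nat \<Rightarrow> real) \<Rightarrow> bool" where
  "is_ginv n p X R \<equiv> is_res n 0 (\<lambda>_. 1) {..<p} (xcol X) R"

lemma gram_carrier: "gram n p X \<in> carrier_mat n n"
  unfolding gram_def by (rule mult_carrier_mat[where n=p]) auto

lemma mult_mat_entry:
  fixes A B :: "real Matrix.mat"
  assumes A: "A \<in> carrier_mat n m" and B: "B \<in> carrier_mat m l" and ab: "a < n" "b < l"
  shows "(A * B) $$ (a, b) = (\<Sum>c<m. A $$ (a, c) * B $$ (c, b))"
proof -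
  have 1: "(A * B) $$ (a, b) = Matrix.row A a \<bullet> Matrix.col B b"
    by (rule index_mult_mat(1)) (use A B ab in auto)
  have 2: "Matrix.row A a \<bullet> Matrix.col B b = (\<Sum>c\<in>{0..<m}. Matrix.row A a $ c * Matrix.col B b $ c)"
    unfolding scalar_prod_def using B by (simp only: dim_col carrier_matD)
  have 3: "(\<Sum>c\<in>{0..<m}. Matrix.row A a $ c * Matrix.col B b $ c) = (\<Sum>c\<in>{0..<m}. A $$ (a, c) * B $$ (c, b))"
    by (rule sum.cong[OF refl]) (use A B ab in auto)
  show ?thesis unfolding 1 2 3 by (simp only: lessThan_atLeast0)
qed

lemma mult_vec_entry:
  fixes A :: "real Matrix.mat"
  assumes A: "A \<in> carrier_mat n m" and v: "dim_vec v = m" and a: "a < n"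
  shows "(A *\<^sub>v v) $ a = (\<Sum>c<m. A $$ (a, c) * v $ c)"
proof -
  have 1: "(A *\<^sub>v v) $ a = Matrix.row A a \<bullet> v" by (rule index_mult_mat_vec) (use A a in auto)
  have 2: "Matrix.row A a \<bullet> v = (\<Sum>c\<in>{0..<m}. Matrix.row A a $ c * v $ c)"
    unfolding scalar_prod_def v ..
  have 3: "(\<Sum>c\<in>{0..<m}. Matrix.row A a $ c * v $ c) = (\<Sum>c\<in>{0..<m}. A $$ (a, c) * v $ c)"
    by (rule sum.cong[OF refl]) (use A a in auto)
  show ?thesis unfolding 1 2 3 by (simp only: lessThan_atLeast0)
qed

lemma gram_index:
  assumes ab: "a < n" "b < n"
  shows "gram n p X $$ (a, b) = (\<Sum>j<p. X a j * X b j)"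
  unfolding gram_def
  by (subst mult_mat_entry[OF _ _ ab, where m=p]) (use ab in \<open>auto intro!: sum.cong\<close>)

lemma gram_sym: "transpose_mat (gram n p X) = gram n p X"
proof (rule eq_matI)
  fix a b assume "a < dim_row (gram n p X)" "b < dim_col (gram n p X)"
  then have "a < n" "b < n" using gram_carrier[of n p X] by auto
  then show "transpose_mat (gram n p X) $$ (a, b) = gram n p X $$ (a, b)"
    using gram_carrier[of n p X] by (simp add: gram_index mult.commute)
qed (use gram_carrier[of n p X] in auto)

lemma mult_index:
  assumes "B \<in> carrier_mat n n" "a < n" "b < n"
  shows "(gram n p X * B) $$ (a, b) = (\<Sum>j<p. X a j * (\<Sum>c<n. X c j * B $$ (c, b)))"
proof -
  have "(gram n p X * B) $$ (a, b) = (\<Sum>c<n. (\<Sum>j<p. X a j * X c j) * B $$ (c, b))"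
    unfolding mult_mat_entry[OF gram_carrier assms] using assms by (intro sum.cong refl) (simp add: gram_index)
  also have "\<dots> = (\<Sum>j<p. \<Sum>c<n. X a j * X c j * B $$ (c, b))"
    by (simp add: sum_distrib_right) (rule sum.swap)
  finally show ?thesis by (simp add: sum_distrib_left mult.assoc)
qed

text \<open>A right inverse of a square matrix is two-sided, so the Gram matrix is a unit, and the
  computed inverse agrees with \<open>R\<close> by uniqueness.\<close>

lemma inv_mat_of_ginv:
  assumes R: "is_ginv n p X R"
  shows "mat_inverse (gram n p X) = Some (Matrix.mat n n (\<lambda>(a, b). R a b))"
proof -
  let ?B = "Matrix.mat n n (\<lambda>(a, b). R a b)" and ?G = "gram n p X"
  have B: "?B \<in> carrier_mat n n" by simp
  have "?G * ?B = 1\<^sub>m n"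
  proof (rule eq_matI)
    fix a b assume "a < dim_row (1\<^sub>m n :: real mat)" "b < dim_col (1\<^sub>m n :: real mat)"
    then have ab: "a < n" "b < n" by auto
    have "(?G * ?B) $$ (a, b) = (\<Sum>j<p. X a j * (\<Sum>c<n. X c j * R c b))"
      unfolding mult_index[OF B ab] using ab by (intro sum.cong refl) simp
    also have "\<dots> = (\<Sum>j<p. 1 * xcol X j a * mv n R (xcol X j) b)"
    proof -
      have "(\<Sum>c<n. X c j * R c b) = mv n R (xcol X j) b" for j
        unfolding mv_def using is_res_sym[OF R _ ab(2)] by (intro sum.cong refl) (simp add: mult.commute)
      then show ?thesis by simp
    qed
    also have "\<dots> = (if a = b then 1 else 0)" using R ab by (simp add: is_res_def)
    finally show "(?G * ?B) $$ (a, b) = 1\<^sub>m n $$ (a, b)" using ab by simp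
  qed (use gram_carrier in auto)
  then have GB: "?G * ?B = 1\<^sub>m n" .
  have BG: "?B * ?G = 1\<^sub>m n" by (rule mat_mult_left_right_inverse[OF gram_carrier B GB])
  have U: "?G \<in> Units (ring_mat TYPE(real) n ())"
    unfolding Units_def ring_mat_def using gram_carrier B GB BG by auto
  then obtain B' where B': "mat_inverse ?G = Some B'"
    using mat_inverse(1)[OF gram_carrier, of n p X "()"] by (cases "mat_inverse ?G") auto
  from mat_inverse(2)[OF gram_carrier B'] have b: "B' * ?G = 1\<^sub>m n" "B' \<in> carrier_mat n n" by auto
  have "B' = B' * (?G * ?B)" using b GB by simp
  also have "\<dots> = (B' * ?G) * ?B" using b gram_carrier B by (intro assoc_mult_mat[symmetric]) auto
  also have "\<dots> = ?B" using b B by simp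
  finally show ?thesis using B' by simp
qed

text \<open>The inverse of a symmetric matrix is symmetric, as \<open>is_res\<close>
  demands.\<close>

lemma ginv_of_inv_mat:
  assumes B: "mat_inverse (gram n p X) = Some B"
  shows "is_ginv n p X (\<lambda>a b. if a < n \<and> b < n then B $$ (a, b) else 0)"
proof -
  let ?G = "gram n p X"
  from mat_inverse(2)[OF gram_carrier B] have b: "?G * B = 1\<^sub>m n" "B * ?G = 1\<^sub>m n" "B \<in> carrier_mat n n" by auto
  have Bt: "transpose_mat B \<in> carrier_mat n n" using b by simp
  have "transpose_mat (?G * B) = transpose_mat B * transpose_mat ?G"
    using b gram_carrier by (intro transpose_mult) auto
  then have BtG: "transpose_mat B * ?G = 1\<^sub>m n" unfolding b gram_sym by simp
  have "transpose_mat B = transpose_mat B * (?G * B)" using b Bt by simp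
  also have "\<dots> = (transpose_mat B * ?G) * B" using b gram_carrier Bt by (intro assoc_mult_mat[symmetric]) auto
  also have "\<dots> = B" using BtG b by simp
  finally have sym: "B $$ (a, c) = B $$ (c, a)" if "a < n" "c < n" for a c
    using that b(3) by (metis carrier_matD(1) carrier_matD(2) index_transpose_mat(1))
  show ?thesis unfolding is_res_def
  proof (intro conjI allI impI)
    fix a c assume ac: "a < n" "c < n"
    have "(\<Sum>j<p. X a j * (\<Sum>d<n. X d j * B $$ (d, c))) = (if a = c then 1 else 0)"
      unfolding mult_index[OF b(3) ac, symmetric] b(1) using ac by simp
    moreover have "mv n (\<lambda>a b. if a < n \<and> b < n then B $$ (a, b) else 0) (xcol X j) c = (\<Sum>d<n. X d j * B $$ (d, c))" for j
      unfolding mv_def using sym ac by (intro sum.cong) auto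
    ultimately show "0 * (if a < n \<and> c < n then B $$ (a, c) else 0) +
      (\<Sum>j<p. 1 * X a j * mv n (\<lambda>a b. if a < n \<and> b < n then B $$ (a, b) else 0) (xcol X j) c) = (if a = c then 1 else 0)"
      by simp
  qed (use sym in auto)
qed

text \<open>A kernel vector of the Gram matrix is an eigenvector of the ridge resolvent with
  eigenvalue \<open>1 / \<rho>\<close>, and the trace is at least as large. Hence a bounded trace
  along a vanishing ridge certifies invertibility.\<close>

lemma trc_res_singular:
  assumes none: "\<And>R. \<not> is_ginv n p X R" and \<rho>: "0 < \<rho>"
  shows "1 / \<rho> \<le> trc n (res n \<rho> (\<lambda>_. 1) {..<p} (xcol X))"
proof -
  let ?G = "gram n p X" and ?R = "res n \<rho> (\<lambda>_. 1) {..<p} (xcol X)"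
  have R: "is_res n \<rho> (\<lambda>_. 1) {..<p} (xcol X) ?R" by (rule res_is_res) (use \<rho> in auto)
  have P: "psd n ?R" by (rule res_psd) (use \<rho> in auto)
  have "mat_inverse ?G = None"
  proof (cases "mat_inverse ?G")
    case (Some B)
    from ginv_of_inv_mat[OF this] none show ?thesis by blast
  qed
  then have "?G \<notin> Units (ring_mat TYPE(real) n ())" by (rule mat_inverse(1)[OF gram_carrier])
  then have "det ?G = 0" using det_non_zero_imp_unit[OF gram_carrier, of n p X "()"] by auto
  then obtain v where v: "v \<in> carrier_vec n" "v \<noteq> 0\<^sub>v n" "?G *\<^sub>v v = 0\<^sub>v n"
    using det_0_iff_vec_prod_zero_field[OF gram_carrier] by blast
  define u where "u = (\<lambda>a. v $ a)"
  have K: "(\<Sum>j<p. X a j * ip n (xcol X j) u) = 0" if a: "a < n" for a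
  proof -
    have "(?G *\<^sub>v v) $ a = (\<Sum>c<n. (\<Sum>j<p. X a j * X c j) * v $ c)"
      unfolding mult_vec_entry[OF gram_carrier carrier_vecD[OF v(1)] a]
      using a by (intro sum.cong refl) (simp add: gram_index)
    also have "\<dots> = (\<Sum>j<p. \<Sum>c<n. X a j * X c j * v $ c)"
      by (simp add: sum_distrib_right) (rule sum.swap)
    also have "\<dots> = (\<Sum>j<p. X a j * ip n (xcol X j) u)"
      by (simp add: inner_N_def u_def sum_distrib_left mult.assoc)
    finally show ?thesis using v a by simp
  qed
  have K': "(\<Sum>j<p. ip n (xcol X j) u * ip n (xcol X j) y) = 0" for y
  proof -
    have "(\<Sum>j<p. ip n (xcol X j) u * ip n (xcol X j) y) = (\<Sum>j<p. \<Sum>a<n. y a * (X a j * ip n (xcol X j) u))"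
      by (simp add: inner_N_def[of n _ y] sum_distrib_left mult_ac)
    also have "\<dots> = (\<Sum>a<n. y a * (\<Sum>j<p. X a j * ip n (xcol X j) u))"
      by (subst sum.swap) (simp add: sum_distrib_left)
    finally show ?thesis using K by simp
  qed
  have Ru: "\<rho> * mv n ?R u a = u a" if a: "a < n" for a
  proof -
    have "gform n \<rho> (\<lambda>_. 1) {..<p} (xcol X) u (\<lambda>c. ?R c a) = u a" by (rule res_col_gform[OF R a])
    moreover have "gform n \<rho> (\<lambda>_. 1) {..<p} (xcol X) u (\<lambda>c. ?R c a) = \<rho> * ip n u (\<lambda>c. ?R c a)"
      using K'[of "\<lambda>c. ?R c a"] by (simp add: gform_def)
    ultimately show ?thesis using res_col_ip[OF R a] by simp
  qed
  then have mvu: "mv n ?R u a = 1 / \<rho> * u a" if "a < n" for a using that \<rho> by (simp add: field_simps)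
  have "ip n (mv n ?R u) (mv n ?R u) = ip n (\<lambda>a. 1 / \<rho> * u a) (\<lambda>a. 1 / \<rho> * u a)" "ip n u (mv n ?R u) = ip n u (\<lambda>a. 1 / \<rho> * u a)"
    by (rule ip_cong; simp add: mvu)+
  then have i: "ip n (mv n ?R u) (mv n ?R u) = 1 / \<rho> * (1 / \<rho> * ip n u u)" "ip n u (mv n ?R u) = 1 / \<rho> * ip n u u"
    by (simp_all only: ip_scale_left ip_scale_right)
  have "0 < ip n u u"
  proof -
    obtain a where a: "a < n" "u a \<noteq> 0" using v unfolding u_def
      by (metis carrier_vecD eq_vecI index_zero_vec(1) index_zero_vec(2))
    have "0 < (u a)\<^sup>2" using a by simp
    also have "\<dots> \<le> ip n u u" unfolding inner_N_def power2_eq_square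
      by (rule member_le_sum) (use a in auto)
    finally show ?thesis .
  qed
  then have pos: "0 < 1 / \<rho> * ip n u u" using \<rho> by simp
  have "1 / \<rho> * (1 / \<rho> * ip n u u) \<le> trc n ?R * (1 / \<rho> * ip n u u)"
    using mv_norm_le[OF P, of u] unfolding i .
  then show ?thesis using pos by (rule mult_right_le_imp_le)
qed

definition gram_inv :: "nat \<Rightarrow> nat \<Rightarrow> (nat \<Rightarrow> nat \<Rightarrow> real) \<Rightarrow> nat \<Rightarrow> nat \<Rightarrow> real" where
  "gram_inv n p X a b = (if a < n \<and> b < n then inv_mat (gram n p X) $$ (a, b) else 0)"

lemma gram_inv_ginv:
  assumes R: "is_ginv n p X R" shows "gram_inv n p X = R"
proof (intro ext)
  fix a b
  show "gram_inv n p X a b = R a b"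
    using R by (auto simp: gram_inv_def inv_mat_def inv_mat_of_ginv[OF R] is_res_def)
qed

lemma gram_inv_singular: "(\<And>R. \<not> is_ginv n p X R) \<Longrightarrow> gram_inv n p X a b = 0"
  using ginv_of_inv_mat[of n p X] gram_carrier[of n p X]
  by (cases "mat_inverse (gram n p X)") (auto simp: gram_inv_def inv_mat_def)

text \<open>Expresses the inverse, including its default value 0, by countably many ridge
  resolvents, which are measurable. The condition detects invertibility: for a singular Gram matrix
  the trace is at least \<open>Suc m\<close> for every \<open>m\<close>, for an invertible one the
  traces are bounded.\<close>

lemma gram_inv_limit:
  "gram_inv n p X a b = (if \<exists>m::nat. trc n (res n (1 / real (Suc m)) (\<lambda>_. 1) {..<p} (xcol X)) < real (Suc m)
     then lim (\<lambda>m. res n (1 / real (Suc m)) (\<lambda>_. 1) {..<p} (xcol X) a b) else 0)"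
proof (cases "\<exists>R. is_ginv n p X R")
  case True
  then obtain R where R: "is_ginv n p X R" by blast
  have Rm: "is_res n (1 / real (Suc m)) (\<lambda>_. 1) {..<p} (xcol X) (res n (1 / real (Suc m)) (\<lambda>_. 1) {..<p} (xcol X))" for m
    by (rule res_is_res) auto
  have "(\<lambda>m. res n (1 / real (Suc m)) (\<lambda>_. 1) {..<p} (xcol X) a b) \<longlonglongrightarrow> R a b"
    by (rule res_tendsto0[OF Rm R _ LIMSEQ_Suc[OF lim_1_over_n]]) auto
  then have l: "lim (\<lambda>m. res n (1 / real (Suc m)) (\<lambda>_. 1) {..<p} (xcol X) a b) = R a b" by (rule limI)
  obtain m :: nat where "trc n R < real m" using reals_Archimedean2 by blast
  then have "trc n (res n (1 / real (Suc m)) (\<lambda>_. 1) {..<p} (xcol X)) < real (Suc m)"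
    using trc_res_le0[OF Rm R, of m] by simp
  then show ?thesis using l gram_inv_ginv[OF R] by auto
next
  case False
  then have n: "\<And>R. \<not> is_ginv n p X R" by blast
  have "\<not> (\<exists>m::nat. trc n (res n (1 / real (Suc m)) (\<lambda>_. 1) {..<p} (xcol X)) < real (Suc m))"
    using trc_res_singular[OF n, of "1 / real (Suc _)"] by (auto simp: not_less)
  then show ?thesis using gram_inv_singular[OF n] by simp
qed

lemma res_measurable:
  assumes "finite J" "0 < \<rho>" "\<And>j. j \<in> J \<Longrightarrow> 0 \<le> w j"
    and "\<And>j a. j \<in> J \<Longrightarrow> a < n \<Longrightarrow> (\<lambda>x. z x j a) \<in> borel_measurable M"
  shows "(\<lambda>x. res n \<rho> w J (z x) a b) \<in> borel_measurable M"
  using assms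
proof (induction J arbitrary: a b rule: finite_induct)
  case empty
  then show ?case by (simp add: res_empty)
next
  case (insert j J)
  then have R: "\<And>a b. (\<lambda>x. res n \<rho> w J (z x) a b) \<in> borel_measurable M" by auto
  have m: "(\<lambda>x. mv n (res n \<rho> w J (z x)) (z x j) a) \<in> borel_measurable M" for a
    unfolding mv_def using insert.prems by (intro borel_measurable_sum borel_measurable_times R) auto
  have q: "(\<lambda>x. ip n (z x j) (mv n (res n \<rho> w J (z x)) (z x j))) \<in> borel_measurable M"
    unfolding inner_N_def using insert.prems by (intro borel_measurable_sum borel_measurable_times m) auto
  have "res n \<rho> w (insert j J) (z x) = sm n (res n \<rho> w J (z x)) (w j) (z x j)" for x
    using insert by (intro res_insert) auto
  then show ?case
    unfolding sm_def by simp (intro borel_measurable_diff borel_measurable_divide borel_measurable_times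
        borel_measurable_add borel_measurable_const m q R)
qed

lemma gram_inv_measurable:
  assumes "\<And>a j. a < n \<Longrightarrow> j < p \<Longrightarrow> (\<lambda>x. X x a j) \<in> borel_measurable M"
  shows "(\<lambda>x. gram_inv n p (X x) a b) \<in> borel_measurable M"
proof -
  have [measurable]: "(\<lambda>x. res n (1 / real (Suc m)) (\<lambda>_. 1) {..<p} (xcol (X x)) a b) \<in> borel_measurable M" for m a b
    by (rule res_measurable[where z="\<lambda>x. xcol (X x)"]) (use assms in auto)
  have [measurable]: "(\<lambda>x. trc n (res n (1 / real (Suc m)) (\<lambda>_. 1) {..<p} (xcol (X x)))) \<in> borel_measurable M" for m
    unfolding trc_def by (intro borel_measurable_sum) measurable
  show ?thesis unfolding gram_inv_limit by measurable
qed

section \<open>The law of the design\<close>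

lemma distr_stdn_scale:
  assumes s: "0 < s"
  shows "distr stdn borel (\<lambda>x. s * x) = normal_law 0 s"
proof -
  have "distributed stdn lborel (\<lambda>x. x) std_normal_density"
    unfolding distributed_def by (auto simp: distr_id2)
  from stdn.normal_density_affine[OF this, of s 0] s
  have "distributed stdn lborel (\<lambda>x. s * x) (normal_density 0 s)" by simp
  then have "distr stdn lborel (\<lambda>x. s * x) = density lborel (normal_density 0 s)"
    by (simp add: distributed_def)
  moreover have "distr stdn borel (\<lambda>x. s * x) = distr stdn lborel (\<lambda>x. s * x)" by (rule distr_cong) auto
  ultimately show ?thesis using s by (simp add: normal_law_def)
qed

text \<open>The array is indexed by column first, the design by row first.\<close>

definition rows :: "nat \<Rightarrow> nat \<Rightarrow> (nat \<Rightarrow> real) \<Rightarrow> (nat \<times> nat \<Rightarrow> real) \<Rightarrow> nat \<Rightarrow> nat \<Rightarrow> real" where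
  "rows n N lam f = (\<lambda>i\<in>{..<n}. \<lambda>j\<in>{..<N}. sqrt (lam j) * f (j, i))"

lemma gpm_coord_indep:
  assumes "finite I" "I \<noteq> {}"
  shows "prob_space.indep_vars (gpm I) (\<lambda>_. borel) (\<lambda>i f. f i) I"
    and "i \<in> I \<Longrightarrow> distr (gpm I) borel (\<lambda>f. f i) = stdn"
proof -
  interpret prob_space "gpm I" by (rule prob_space_gpm)
  have c: "distr (gpm I) borel (\<lambda>f. f i) = stdn" if "i \<in> I" for i
  proof -
    interpret P: product_prob_space "\<lambda>_. stdn" I by unfold_locales
    have "distr (gpm I) borel (\<lambda>f. f i) = distr (gpm I) stdn (\<lambda>f. f i)" by (rule distr_cong) auto
    also have "\<dots> = stdn" by (rule P.PiM_component[OF that])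
    finally show ?thesis .
  qed
  then show "i \<in> I \<Longrightarrow> distr (gpm I) borel (\<lambda>f. f i) = stdn" .
  have m: "(\<lambda>f. f i) \<in> borel_measurable (gpm I)" if "i \<in> I" for i
    using measurable_component_singleton[OF that, of "\<lambda>_. stdn"] by (simp cong: measurable_cong_sets)
  have "distr (gpm I) (Pi\<^sub>M I (\<lambda>_. borel)) (\<lambda>f. \<lambda>i\<in>I. f i) = distr (gpm I) (gpm I) (\<lambda>f. f)"
    by (rule distr_cong) (auto simp: sets_gpm space_PiM PiE_def extensional_restrict intro!: sets_PiM_cong)
  also have "\<dots> = gpm I" by (rule distr_id)
  also have "\<dots> = Pi\<^sub>M I (\<lambda>i. distr (gpm I) borel (\<lambda>f. f i))" by (rule PiM_cong) (auto simp: c)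
  finally show "indep_vars (\<lambda>_. borel) (\<lambda>i f. f i) I"
    by (subst indep_vars_iff_distr_eq_PiM'[OF assms(2) m]) auto
qed

lemma distr_row:
  assumes i: "i < n" and N: "0 < N" and lam: "\<And>j. j < N \<Longrightarrow> 0 < lam j"
  shows "distr (gpm (flat N n)) (euc N) (\<lambda>f. \<lambda>j\<in>{..<N}. sqrt (lam j) * f (j, i)) = gauss_diag N lam"
proof -
  interpret prob_space "gpm (flat N n)" by (rule prob_space_gpm)
  have ne: "flat N n \<noteq> {}" using i N by (auto simp: lessThan_empty_iff)
  have c: "indep_vars (\<lambda>_. borel) (\<lambda>i f. f i) (flat N n)" by (rule gpm_coord_indep) (use ne in auto)
    have "indep_vars (\<lambda>j. Pi\<^sub>M {(j, i)} (\<lambda>_. borel)) (\<lambda>j f. restrict (\<lambda>l. f l) {(j, i)}) {..<N}"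
      by (rule indep_vars_restrict[OF c]) (use i in \<open>auto simp: disjoint_family_on_def\<close>)
    then have "indep_vars (\<lambda>_. borel) (\<lambda>j f. sqrt (lam j) * (restrict (\<lambda>l. f l) {(j, i)}) (j, i)) {..<N}"
      by (rule indep_vars_compose2) auto
    then have ind: "indep_vars (\<lambda>_. borel) (\<lambda>j f. sqrt (lam j) * f (j, i)) {..<N}" by simp
    have m: "(\<lambda>f. sqrt (lam j) * f (j, i)) \<in> borel_measurable (gpm (flat N n))" if "j \<in> {..<N}" for j
      using ind that by (auto simp: indep_vars_def)
    have ne': "{..<N} \<noteq> {}" using N by auto
    have "distr (gpm (flat N n)) (euc N) (\<lambda>f. \<lambda>j\<in>{..<N}. sqrt (lam j) * f (j, i))
      = Pi\<^sub>M {..<N} (\<lambda>j. distr (gpm (flat N n)) borel (\<lambda>f. sqrt (lam j) * f (j, i)))"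
      by (rule indep_vars_iff_distr_eq_PiM'[where X="\<lambda>j f. sqrt (lam j) * f (j, i)" and M'="\<lambda>_. borel",
            OF ne' m, THEN iffD1, OF _ ind])
    also have "\<dots> = gauss_diag N lam" unfolding gauss_diag_def
    proof (rule PiM_cong[OF refl])
      fix j assume j: "j \<in> {..<N}"
      have "(\<lambda>f. f (j, i)) \<in> borel_measurable (gpm (flat N n))"
        using c i j by (auto simp: indep_vars_def)
      then have "distr (gpm (flat N n)) borel (\<lambda>f. sqrt (lam j) * f (j, i))
          = distr (distr (gpm (flat N n)) borel (\<lambda>f. f (j, i))) borel (\<lambda>x. sqrt (lam j) * x)"
        by (subst distr_distr) (auto simp: comp_def)
      also have "distr (gpm (flat N n)) borel (\<lambda>f. f (j, i)) = stdn"
        by (rule gpm_coord_indep(2)) (use ne i j in auto)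
      also have "distr stdn borel (\<lambda>x. sqrt (lam j) * x) = normal_law 0 (sqrt (lam j))"
        using lam j by (intro distr_stdn_scale) auto
      finally show "distr (gpm (flat N n)) borel (\<lambda>f. sqrt (lam j) * f (j, i)) = normal_law 0 (sqrt (lam j))" .
    qed
    finally show ?thesis .
qed

lemma distr_rows:
  assumes n: "0 < n" and N: "0 < N" and lam: "\<And>j. j < N \<Longrightarrow> 0 < lam j"
  shows "distr (gpm (flat N n)) (Pi\<^sub>M {..<n} (\<lambda>_. euc N)) (rows n N lam) = Pi\<^sub>M {..<n} (\<lambda>_. gauss_diag N lam)"
proof -
  interpret prob_space "gpm (flat N n)" by (rule prob_space_gpm)
  have ne: "flat N n \<noteq> {}" using n N by (auto simp: lessThan_empty_iff)
  have c: "indep_vars (\<lambda>_. borel) (\<lambda>i f. f i) (flat N n)" by (rule gpm_coord_indep) (use ne in auto)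
  \<comment> \<open>Different rows of the design use disjoint blocks of the array.\<close>
  have "indep_vars (\<lambda>i. Pi\<^sub>M ({..<N} \<times> {i}) (\<lambda>_. borel)) (\<lambda>i f. restrict (\<lambda>l. f l) ({..<N} \<times> {i})) {..<n}"
    by (rule indep_vars_restrict[OF c]) (auto simp: disjoint_family_on_def)
  then have "indep_vars (\<lambda>_. euc N) (\<lambda>i f. \<lambda>j\<in>{..<N}. sqrt (lam j) * (restrict (\<lambda>l. f l) ({..<N} \<times> {i})) (j, i)) {..<n}"
  proof (rule indep_vars_compose2[where Y="\<lambda>i g. \<lambda>j\<in>{..<N}. sqrt (lam j) * g (j, i)"])
    fix i assume "i \<in> {..<n}"
    show "(\<lambda>g. \<lambda>j\<in>{..<N}. sqrt (lam j) * g (j, i)) \<in> Pi\<^sub>M ({..<N} \<times> {i}) (\<lambda>_. borel) \<rightarrow>\<^sub>M euc N"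
      by (rule measurable_restrict, rule borel_measurable_times, simp, rule measurable_component_singleton, simp)
  qed
  also have "(\<lambda>i f. \<lambda>j\<in>{..<N}. sqrt (lam j) * (restrict (\<lambda>l. f l) ({..<N} \<times> {i})) (j, i))
      = (\<lambda>i f. \<lambda>j\<in>{..<N}. sqrt (lam j) * (f (j, i) :: real))" by (auto simp: fun_eq_iff restrict_def)
  finally have ind: "indep_vars (\<lambda>_. euc N) (\<lambda>i f. \<lambda>j\<in>{..<N}. sqrt (lam j) * f (j, i)) {..<n}" .
  have m: "(\<lambda>f. \<lambda>j\<in>{..<N}. sqrt (lam j) * f (j, i)) \<in> measurable (gpm (flat N n)) (euc N)" if "i \<in> {..<n}" for i
    using ind that by (auto simp: indep_vars_def)
  have ne': "{..<n} \<noteq> {}" using n by auto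
  have "distr (gpm (flat N n)) (Pi\<^sub>M {..<n} (\<lambda>_. euc N)) (\<lambda>f. \<lambda>i\<in>{..<n}. \<lambda>j\<in>{..<N}. sqrt (lam j) * f (j, i))
      = Pi\<^sub>M {..<n} (\<lambda>i. distr (gpm (flat N n)) (euc N) (\<lambda>f. \<lambda>j\<in>{..<N}. sqrt (lam j) * f (j, i)))"
    by (rule indep_vars_iff_distr_eq_PiM'[where X="\<lambda>i f. \<lambda>j\<in>{..<N}. sqrt (lam j) * f (j, i)" and M'="\<lambda>_. euc N",
          OF ne' m, THEN iffD1, OF _ ind])
  also have "\<dots> = Pi\<^sub>M {..<n} (\<lambda>_. gauss_diag N lam)" by (rule PiM_cong) (auto simp: distr_row[OF _ N lam])
  finally show ?thesis by (simp add: rows_def[abs_def])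
qed

text \<open>The matrix \<open>I - \<Pi>\<close>, where the noiseless estimator is \<open>\<Pi> \<theta>\<close>.\<close>

definition resid :: "nat \<Rightarrow> nat \<Rightarrow> (nat \<Rightarrow> nat \<Rightarrow> real) \<Rightarrow> nat \<Rightarrow> nat \<Rightarrow> real" where
  "resid n p X j l = (if j = l then 1 else 0)
     - (if j < p then ip n (xcol X j) (mv n (gram_inv n p X) (xcol X l)) else 0)"

text \<open>The squared norms of the rows of \<open>I - \<Pi>\<close>, weighted by the eigenvalues.
  As \<open>\<theta>\<close> has identity covariance, this is the error for a fixed design averaged
  over \<open>\<theta>\<close>.\<close>

definition design_risk :: "nat \<Rightarrow> nat \<Rightarrow> nat \<Rightarrow> (nat \<Rightarrow> real) \<Rightarrow> (nat \<Rightarrow> nat \<Rightarrow> real) \<Rightarrow> real" where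
  "design_risk n p N lam X = (\<Sum>j<N. lam j * (\<Sum>l<N. (resid n p X j l)\<^sup>2))"

section \<open>The estimator without noise\<close>

lemma inv_mat_carrier: "inv_mat (gram n p X) \<in> carrier_mat n n"
  using mat_inverse(2)[OF gram_carrier, of n p X] gram_carrier[of n p X]
  by (cases "mat_inverse (gram n p X)") (auto simp: inv_mat_def)

lemma estimator_eq:
  assumes np: "n < p"
  shows "pcr_estimator n p X y j
    = (if j < p then \<Sum>i<n. (\<Sum>a<n. X a j * gram_inv n p X a i) * y i else 0)"
proof (cases "j < p")
  case True
  let ?A = "Matrix.mat n p (\<lambda>(i, j). X i j)"
  have T: "transpose_mat ?A * inv_mat (gram n p X) \<in> carrier_mat p n"
    by (rule mult_carrier_mat[OF _ inv_mat_carrier]) auto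
  have "pcr_estimator n p X y j = ((transpose_mat ?A * inv_mat (gram n p X)) *\<^sub>v Matrix.vec n y) $ j"
    using True np by (simp add: pcr_estimator_def ls_coef_def gram_def)
  also have "\<dots> = (\<Sum>i<n. (transpose_mat ?A * inv_mat (gram n p X)) $$ (j, i) * Matrix.vec n y $ i)"
    by (rule mult_vec_entry[OF T _ True]) simp
  also have "\<dots> = (\<Sum>i<n. (\<Sum>a<n. X a j * gram_inv n p X a i) * y i)"
  proof (intro sum.cong refl)
    fix i assume i: "i \<in> {..<n}"
    then have "(transpose_mat ?A * inv_mat (gram n p X)) $$ (j, i) = (\<Sum>a<n. transpose_mat ?A $$ (j, a) * inv_mat (gram n p X) $$ (a, i))"
      by (intro mult_mat_entry[OF _ inv_mat_carrier True]) auto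
    also have "\<dots> = (\<Sum>a<n. X a j * gram_inv n p X a i)"
      using i True by (intro sum.cong refl) (simp add: gram_inv_def)
    finally show "(transpose_mat ?A * inv_mat (gram n p X)) $$ (j, i) * Matrix.vec n y $ i = (\<Sum>a<n. X a j * gram_inv n p X a i) * y i"
      using i by simp
  qed
  finally show ?thesis using True by simp
qed (simp add: pcr_estimator_def)

lemma gram_inv_cong:
  assumes "\<And>a j. a < n \<Longrightarrow> j < p \<Longrightarrow> X a j = X' a j" shows "gram_inv n p X = gram_inv n p X'"
proof -
  have "Matrix.mat n p (\<lambda>(i, j). X i j) = Matrix.mat n p (\<lambda>(i, j). X' i j)"
    by (rule cong_mat) (use assms in auto)
  then show ?thesis by (simp add: gram_inv_def gram_def fun_eq_iff)
qed

text \<open>Without noise the response is linear in \<open>t\<close>, so the estimate is a matrix of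
  the design applied to \<open>t\<close>; exchanging the sums yields its entries.\<close>

lemma noiseless_residual:
  assumes np: "n < p" and j: "j < N"
  shows "t j - pcr_estimator n p X (\<lambda>i. ip N (X i) t) j = (\<Sum>l<N. resid n p X j l * t l)"
proof -
  have d: "(\<Sum>l<N. (if j = l then 1 else 0) * t l) = t j"
    using j by (simp add: if_distrib if_distribR cong: if_cong)
  have e: "(\<Sum>i<n. (\<Sum>a<n. X a j * gram_inv n p X a i) * ip N (X i) t)
      = (\<Sum>l<N. ip n (xcol X j) (mv n (gram_inv n p X) (xcol X l)) * t l)"
  proof -
    have "(\<Sum>l<N. ip n (xcol X j) (mv n (gram_inv n p X) (xcol X l)) * t l)
        = (\<Sum>l<N. \<Sum>i<n. (\<Sum>a<n. X a j * gram_inv n p X a i) * (X i l * t l))"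
    proof (intro sum.cong refl)
      fix l
      have "ip n (xcol X j) (mv n (gram_inv n p X) (xcol X l)) = (\<Sum>a<n. \<Sum>i<n. X a j * gram_inv n p X a i * X i l)"
        by (simp add: inner_N_def mv_def sum_distrib_left mult.assoc)
      also have "\<dots> = (\<Sum>i<n. (\<Sum>a<n. X a j * gram_inv n p X a i) * X i l)"
        by (subst sum.swap) (simp add: sum_distrib_right)
      finally show "ip n (xcol X j) (mv n (gram_inv n p X) (xcol X l)) * t l
        = (\<Sum>i<n. (\<Sum>a<n. X a j * gram_inv n p X a i) * (X i l * t l))"
        by (simp add: sum_distrib_right mult.assoc)
    qed
    also have "\<dots> = (\<Sum>i<n. \<Sum>l<N. (\<Sum>a<n. X a j * gram_inv n p X a i) * (X i l * t l))" by (rule sum.swap)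
    finally show ?thesis by (simp add: inner_N_def sum_distrib_left)
  qed
  show ?thesis
  proof (cases "j < p")
    case True
    have "(\<Sum>l<N. resid n p X j l * t l) = (\<Sum>l<N. (if j = l then 1 else 0) * t l)
        - (\<Sum>l<N. ip n (xcol X j) (mv n (gram_inv n p X) (xcol X l)) * t l)"
      using True by (simp only: resid_def if_True left_diff_distrib sum_subtractf)
    then show ?thesis using True e d by (simp add: estimator_eq[OF np])
  next
    case False
    then show ?thesis using d by (simp add: resid_def estimator_eq[OF np])
  qed
qed

text \<open>Integration by parts applied to the other coordinate.\<close>

lemma gpm_second_moment:
  assumes "finite I" "i \<in> I" "l \<in> I"
  shows "(\<integral>f. f i * f l \<partial>gpm I) = (if i = l then 1 else 0)"
proof -
  interpret prob_space "gpm I" by (rule prob_space_gpm)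
  have "(\<integral>f. f i * f l \<partial>gpm I) = (\<integral>f. (if i = l then 1 else 0) \<partial>gpm I)"
    by (rule stein[OF assms(1,2) pb_coord[OF assms(1,3)] pb_const])
       (auto intro!: derivative_eq_intros)
  then show ?thesis by (simp add: prob_space)
qed

lemma prediction_error_eq:
  assumes N: "0 < N" and lam: "\<And>j. j < N \<Longrightarrow> 0 < lam j"
  shows "prediction_error N lam 0 t t' = (\<Sum>j<N. lam j * (t j - t' j)\<^sup>2)"
proof -
  \<comment> \<open>An array with a single row realises \<open>gauss_diag\<close>, so the second
    moments come from \<open>gpm_second_moment\<close>.\<close>
  let ?I = "flat N 1"
  let ?g = "gauss_diag N lam" and ?u = "\<lambda>f. \<lambda>j\<in>{..<N}. sqrt (lam j) * f (j, 0::nat)"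
  have g: "distr (gpm ?I) (euc N) ?u = ?g" by (rule distr_row) (use N lam in auto)
  have mu: "?u \<in> gpm ?I \<rightarrow>\<^sub>M euc N"
    by (rule measurable_restrict) (auto intro!: borel_measurable_times pb_measurable'[OF pb_coord])
  interpret I: prob_space "gpm ?I" by (rule prob_space_gpm)
  interpret g: prob_space ?g unfolding g[symmetric] by (rule I.prob_space_distr[OF mu])
  have sg: "sets ?g = sets (euc N)" unfolding g[symmetric] by simp
  have law: "normal_law 0 0 = return borel (0::real)" by (simp add: normal_law_def)
  interpret r: prob_space "return borel (0::real)" by (rule prob_space_return) simp
  \<comment> \<open>For standard deviation 0 the noise is a point mass, and the product law is an
    image of the law of \<open>x\<close>.\<close>
  have pair: "?g \<Otimes>\<^sub>M return borel 0 = distr ?g (?g \<Otimes>\<^sub>M borel) (\<lambda>x. (x, 0::real))"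
  proof (rule pair_measure_eqI)
    show "sigma_finite_measure ?g" "sigma_finite_measure (return borel (0::real))" by unfold_locales
    show "sets (?g \<Otimes>\<^sub>M return borel 0) = sets (distr ?g (?g \<Otimes>\<^sub>M borel) (\<lambda>x. (x, 0::real)))"
      by (auto intro!: sets_pair_measure_cong)
    fix A B assume A: "A \<in> sets ?g" and B: "B \<in> sets (return borel (0::real))"
    have "(\<lambda>x. (x, 0::real)) -` (A \<times> B) \<inter> space ?g = (if 0 \<in> B then A else {})"
      using sets.sets_into_space[OF A] by auto
    then show "emeasure ?g A * emeasure (return borel 0) B = emeasure (distr ?g (?g \<Otimes>\<^sub>M borel) (\<lambda>x. (x, 0))) (A \<times> B)"
      using A B by (subst emeasure_distr) auto
  qed
  have mip: "(\<lambda>x. ip N x v) \<in> borel_measurable ?g" for v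
    unfolding inner_N_def using sg by (auto intro!: borel_measurable_sum borel_measurable_times simp: measurable_cong_sets[OF sg refl])
  have "prediction_error N lam 0 t t' = (\<integral>x. (ip N x t - ip N x t')\<^sup>2 \<partial>?g)"
    unfolding prediction_error_def law pair
    by (subst integral_distr) (auto simp: case_prod_unfold intro!: borel_measurable_power borel_measurable_diff borel_measurable_add measurable_compose[OF measurable_fst mip])
  also have "\<dots> = (\<integral>f. (ip N (?u f) t - ip N (?u f) t')\<^sup>2 \<partial>gpm ?I)"
    unfolding g[symmetric]
    by (subst integral_distr[OF mu]) (auto simp: inner_N_def intro!: borel_measurable_power borel_measurable_diff borel_measurable_sum borel_measurable_times)
  also have "\<dots> = (\<integral>f. (\<Sum>j<N. \<Sum>l<N. sqrt (lam j) * (t j - t' j) * (sqrt (lam l) * (t l - t' l)) * (f (j, 0) * f (l, 0))) \<partial>gpm ?I)"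
  proof (rule Bochner_Integration.integral_cong[OF refl])
    fix f :: "nat \<times> nat \<Rightarrow> real"
    have "ip N (?u f) t - ip N (?u f) t' = (\<Sum>j<N. sqrt (lam j) * (t j - t' j) * f (j, 0))"
      by (simp add: inner_N_def sum_subtractf[symmetric] algebra_simps)
    then show "(ip N (?u f) t - ip N (?u f) t')\<^sup>2
      = (\<Sum>j<N. \<Sum>l<N. sqrt (lam j) * (t j - t' j) * (sqrt (lam l) * (t l - t' l)) * (f (j, 0) * f (l, 0)))"
      by (simp add: power2_eq_square sum_product mult_ac)
  qed
  also have "\<dots> = (\<Sum>j<N. \<Sum>l<N. sqrt (lam j) * (t j - t' j) * (sqrt (lam l) * (t l - t' l)) * (if (j, 0::nat) = (l, 0) then 1 else 0))"
  proof -
    have i: "integrable (gpm ?I) (\<lambda>f. c * (f (j, 0) * f (l, 0)))" if "j < N" "l < N" for j l c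
      using that by (intro pb_integrable pb_mult pb_coord pb_const) auto
    have "(\<integral>f. (\<Sum>j<N. \<Sum>l<N. sqrt (lam j) * (t j - t' j) * (sqrt (lam l) * (t l - t' l)) * (f (j, 0) * f (l, 0))) \<partial>gpm ?I)
      = (\<Sum>j<N. (\<integral>f. (\<Sum>l<N. sqrt (lam j) * (t j - t' j) * (sqrt (lam l) * (t l - t' l)) * (f (j, 0) * f (l, 0))) \<partial>gpm ?I))"
      by (rule Bochner_Integration.integral_sum) (intro Bochner_Integration.integrable_sum i; simp)
    also have "\<dots> = (\<Sum>j<N. \<Sum>l<N. (\<integral>f. sqrt (lam j) * (t j - t' j) * (sqrt (lam l) * (t l - t' l)) * (f (j, 0) * f (l, 0)) \<partial>gpm ?I))"
      by (intro sum.cong refl Bochner_Integration.integral_sum i; simp)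
    also have "\<dots> = (\<Sum>j<N. \<Sum>l<N. sqrt (lam j) * (t j - t' j) * (sqrt (lam l) * (t l - t' l)) * (if (j, 0::nat) = (l, 0) then 1 else 0))"
    proof (intro sum.cong refl)
      fix j l assume "j \<in> {..<N}" "l \<in> {..<N}"
      then have "(\<integral>f. f (j, 0) * f (l, 0) \<partial>gpm ?I) = (if (j, 0::nat) = (l, 0) then 1 else 0)"
        by (intro gpm_second_moment) auto
      then show "(\<integral>f. sqrt (lam j) * (t j - t' j) * (sqrt (lam l) * (t l - t' l)) * (f (j, 0) * f (l, 0)) \<partial>gpm ?I)
        = sqrt (lam j) * (t j - t' j) * (sqrt (lam l) * (t l - t' l)) * (if (j, 0::nat) = (l, 0) then 1 else 0)"
        by (simp only: integral_mult_right_zero)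
    qed
    finally show ?thesis .
  qed
  also have "\<dots> = (\<Sum>j<N. lam j * (t j - t' j)\<^sup>2)"
  proof (intro sum.cong refl)
    fix j assume j: "j \<in> {..<N}"
    have "(\<Sum>l<N. sqrt (lam j) * (t j - t' j) * (sqrt (lam l) * (t l - t' l)) * (if (j, 0::nat) = (l, 0) then 1 else 0))
      = (\<Sum>l\<in>{j}. sqrt (lam j) * (t j - t' j) * (sqrt (lam l) * (t l - t' l)) * (if (j, 0::nat) = (l, 0) then 1 else 0))"
      using j by (intro sum.mono_neutral_right) auto
    also have "\<dots> = sqrt (lam j) * sqrt (lam j) * (t j - t' j)\<^sup>2" by (simp add: power2_eq_square mult_ac)
    also have "sqrt (lam j) * sqrt (lam j) = lam j" using lam[of j] j by simp
    finally show "(\<Sum>l<N. sqrt (lam j) * (t j - t' j) * (sqrt (lam l) * (t l - t' l)) * (if (j, 0::nat) = (l, 0) then 1 else 0))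
      = lam j * (t j - t' j)\<^sup>2" .
  qed
  finally show ?thesis .
qed

section \<open>Averaging over the coefficient vector\<close>

context pcr_model
begin

abbreviation "PD \<equiv> Pi\<^sub>M {..<n} (\<lambda>_. euc N)"
abbreviation "D \<equiv> design_rv n x"

lemma design_measurable: "D \<in> M \<rightarrow>\<^sub>M PD"
  using x_w_indep by (simp add: indep_pair_def)

lemma noise_measurable: "i < n \<Longrightarrow> w i \<in> borel_measurable M"
  using w_indep by (auto simp: indep_vars_def)

lemma theta_measurable: "theta \<in> M \<rightarrow>\<^sub>M euc N"
  using theta_indep by (simp add: indep_pair_def)

lemma entry_measurable: "i < n \<Longrightarrow> j < N \<Longrightarrow> (\<lambda>X. X i j) \<in> borel_measurable PD"
  by (rule measurable_compose[OF measurable_component_singleton[of i] measurable_component_singleton[of j]]) auto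

lemma theta_entry: "j < N \<Longrightarrow> (\<lambda>\<omega>. theta \<omega> j) \<in> borel_measurable M"
  by (rule measurable_compose[OF theta_measurable measurable_component_singleton]) simp

lemma design_entry: "i < n \<Longrightarrow> j < N \<Longrightarrow> (\<lambda>\<omega>. x i \<omega> j) \<in> borel_measurable M"
  using measurable_compose[OF design_measurable entry_measurable[of i j]] by (simp add: design_rv_def)

lemma noise_zero: assumes "sd = 0" shows "AE \<omega> in M. \<forall>i\<in>{..<n}. w i \<omega> = 0"
proof (rule AE_finite_allI)
  fix i assume "i \<in> {..<n}"
  then have i: "i < n" by simp
  have "AE y in distr M borel (w i). y = 0"
    unfolding w_law[OF i] assms normal_law_def by (simp add: AE_return)
  then show "AE \<omega> in M. w i \<omega> = 0"
    by (subst (asm) AE_distr_iff) (auto intro: noise_measurable[OF i])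
qed simp

lemma theta_design_law:
  "distr M (euc N \<Otimes>\<^sub>M PD) (\<lambda>\<omega>. (theta \<omega>, D \<omega>)) = distr M (euc N) theta \<Otimes>\<^sub>M distr M PD D"
proof (rule pair_measure_eqI[symmetric])
  note m = theta_measurable design_measurable
  show "sigma_finite_measure (distr M (euc N) theta)" "sigma_finite_measure (distr M PD D)"
    using prob_space_distr[OF m(1)] prob_space_distr[OF m(2)]
    by (simp_all add: prob_space.axioms(1) finite_measure.axioms(1) prob_space_imp_sigma_finite)
  show "sets (distr M (euc N) theta \<Otimes>\<^sub>M distr M PD D) = sets (distr M (euc N \<Otimes>\<^sub>M PD) (\<lambda>\<omega>. (theta \<omega>, D \<omega>)))"
    by (auto intro!: sets_pair_measure_cong)
  fix A B assume "A \<in> sets (distr M (euc N) theta)" "B \<in> sets (distr M PD D)"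
  then have A: "A \<in> sets (euc N)" and B: "B \<in> sets PD" by auto
  let ?W = "Pi\<^sub>M {..<n} (\<lambda>_. borel) :: (nat \<Rightarrow> real) measure"
  have I: "indep_set {theta -` A \<inter> space M | A. A \<in> sets (euc N)}
      {(\<lambda>\<omega>. (D \<omega>, noise_rv n w \<omega>)) -` B \<inter> space M | B. B \<in> sets (PD \<Otimes>\<^sub>M ?W)}"
    and dm: "(\<lambda>\<omega>. (D \<omega>, noise_rv n w \<omega>)) \<in> M \<rightarrow>\<^sub>M PD \<Otimes>\<^sub>M ?W"
    using theta_indep by (auto simp: indep_pair_def)
  have "noise_rv n w \<omega> \<in> space ?W" if "\<omega> \<in> space M" for \<omega>
    by (auto simp: noise_rv_def space_PiM)
  \<comment> \<open>Independence is given for the pair of design and noise, so an event of the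
    design is written as a cylinder.\<close>
  then have e: "D -` B \<inter> space M = (\<lambda>\<omega>. (D \<omega>, noise_rv n w \<omega>)) -` (B \<times> space ?W) \<inter> space M" by auto
  have BW: "B \<times> space ?W \<in> sets (PD \<Otimes>\<^sub>M ?W)" using B by auto
  have "prob ((theta -` A \<inter> space M) \<inter> (D -` B \<inter> space M)) = prob (theta -` A \<inter> space M) * prob (D -` B \<inter> space M)"
    by (rule indep_setD[OF I]) (use A BW e in blast)+
  moreover have "(\<lambda>\<omega>. (theta \<omega>, D \<omega>)) -` (A \<times> B) \<inter> space M = (theta -` A \<inter> space M) \<inter> (D -` B \<inter> space M)" by auto
  ultimately show "emeasure (distr M (euc N) theta) A * emeasure (distr M PD D) B
      = emeasure (distr M (euc N \<Otimes>\<^sub>M PD) (\<lambda>\<omega>. (theta \<omega>, D \<omega>))) (A \<times> B)"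
    using A B m by (simp add: emeasure_distr emeasure_eq_measure ennreal_mult')
qed

text \<open>Second moments of \<open>\<theta>\<close> determine the mean of a quadratic form; the
  integrand is nonnegative, so the Bochner integral is also the extended one.\<close>

lemma theta_quadratic:
  "(\<integral>\<^sup>+\<omega>. ennreal (\<Sum>j<N. lam j * (\<Sum>l<N. L j l * theta \<omega> l)\<^sup>2) \<partial>M) = ennreal (\<Sum>j<N. lam j * (\<Sum>l<N. (L j l)\<^sup>2))"
proof -
  have sq: "(\<Sum>l<N. L j l * theta \<omega> l)\<^sup>2 = (\<Sum>l<N. \<Sum>m<N. L j l * L j m * (theta \<omega> l * theta \<omega> m))" for j \<omega>
    by (simp add: power2_eq_square sum_product mult_ac)
  have "has_bochner_integral M (\<lambda>\<omega>. \<Sum>j<N. lam j * (\<Sum>l<N. \<Sum>m<N. L j l * L j m * (theta \<omega> l * theta \<omega> m)))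
    (\<Sum>j<N. lam j * (\<Sum>l<N. \<Sum>m<N. L j l * L j m * (if l = m then 1 else 0)))"
    by (intro has_bochner_integral_sum has_bochner_integral_mult_right theta_cov) auto
  moreover have "(\<Sum>m<N. L j l * L j m * (if l = m then 1 else 0)) = (L j l)\<^sup>2" if "l < N" for j l
    using that by (simp add: if_distrib sum.delta power2_eq_square cong: if_cong)
  ultimately have h: "has_bochner_integral M (\<lambda>\<omega>. \<Sum>j<N. lam j * (\<Sum>l<N. L j l * theta \<omega> l)\<^sup>2) (\<Sum>j<N. lam j * (\<Sum>l<N. (L j l)\<^sup>2))"
    unfolding sq by simp
  have "0 \<le> (\<Sum>j<N. lam j * (\<Sum>l<N. L j l * theta \<omega> l)\<^sup>2)" for \<omega>
    using lam_pos by (intro sum_nonneg mult_nonneg_nonneg) (auto intro: less_imp_le)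
  then show ?thesis
    using h nn_integral_eq_integral[of M "\<lambda>\<omega>. \<Sum>j<N. lam j * (\<Sum>l<N. L j l * theta \<omega> l)\<^sup>2"]
    by (auto simp: has_bochner_integral_iff)
qed

context
  fixes p :: nat
  assumes np: "n < p" and pN: "p \<le> N" and sd0: "sd = 0"
begin

lemma N_pos: "0 < N" using np pN by simp

text \<open>The noise is kept: it vanishes almost surely, while measurability is a statement about
  all points.\<close>

lemma pcr_error_sum:
  "pcr_error N n p lam sd x w theta \<omega> =
    (\<Sum>j<N. lam j * (theta \<omega> j - (if j < p then \<Sum>i<n. (\<Sum>a<n. x a \<omega> j * gram_inv n p (\<lambda>i. x i \<omega>) a i)
      * (ip N (x i \<omega>) (theta \<omega>) + w i \<omega>) else 0))\<^sup>2)"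
  unfolding pcr_error_def sd0 estimator_eq[OF np] response_def
  by (rule prediction_error_eq[OF N_pos lam_pos])

lemma pcr_error_measurable: "pcr_error N n p lam sd x w theta \<in> borel_measurable M"
proof -
  have g: "(\<lambda>\<omega>. gram_inv n p (\<lambda>i. x i \<omega>) a i) \<in> borel_measurable M" for a i
    by (rule gram_inv_measurable[where X="\<lambda>\<omega> i. x i \<omega>"]) (use design_entry pN in auto)
  have r: "(\<lambda>\<omega>. ip N (x i \<omega>) (theta \<omega>) + w i \<omega>) \<in> borel_measurable M" if "i < n" for i
    unfolding inner_N_def using that
    by (intro borel_measurable_add borel_measurable_sum borel_measurable_times design_entry theta_entry noise_measurable) auto
  have e: "(\<lambda>\<omega>. if j < p then \<Sum>i<n. (\<Sum>a<n. x a \<omega> j * gram_inv n p (\<lambda>i. x i \<omega>) a i) * (ip N (x i \<omega>) (theta \<omega>) + w i \<omega>) else 0)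
    \<in> borel_measurable M" for j
  proof (cases "j < p")
    case True
    then show ?thesis using pN
      by simp (intro borel_measurable_sum borel_measurable_times g r design_entry; simp)
  qed simp
  show ?thesis unfolding pcr_error_sum[abs_def]
    by (intro borel_measurable_sum borel_measurable_times borel_measurable_const borel_measurable_power
        borel_measurable_diff theta_entry e) simp
qed

lemma pcr_error_noiseless:
  assumes w0: "\<forall>i\<in>{..<n}. w i \<omega> = 0"
  shows "pcr_error N n p lam sd x w theta \<omega> = (\<Sum>j<N. lam j * (\<Sum>l<N. resid n p (D \<omega>) j l * theta \<omega> l)\<^sup>2)"
proof -
  have g: "gram_inv n p (D \<omega>) = gram_inv n p (\<lambda>i. x i \<omega>)" by (rule gram_inv_cong) (simp add: design_rv_def)
  have "theta \<omega> j - (if j < p then \<Sum>i<n. (\<Sum>a<n. x a \<omega> j * gram_inv n p (\<lambda>i. x i \<omega>) a i) * (ip N (x i \<omega>) (theta \<omega>) + w i \<omega>) else 0)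
    = (\<Sum>l<N. resid n p (D \<omega>) j l * theta \<omega> l)" if j: "j < N" for j
    unfolding noiseless_residual[OF np j, symmetric] estimator_eq[OF np] g using w0
    by (simp add: design_rv_def)
  then show ?thesis unfolding pcr_error_sum by simp
qed

lemma resid_measurable: "l < N \<Longrightarrow> (\<lambda>X. resid n p X j l) \<in> borel_measurable PD"
proof (cases "j < p")
  case True
  assume l: "l < N"
  have g: "(\<lambda>X. gram_inv n p X a i) \<in> borel_measurable PD" for a i
    by (rule gram_inv_measurable[where X="\<lambda>X. X"]) (use entry_measurable pN in auto)
  have "(\<lambda>X. ip n (xcol X j) (mv n (gram_inv n p X) (xcol X l))) \<in> borel_measurable PD"
    unfolding inner_N_def mv_def using True pN l
    by (intro borel_measurable_sum borel_measurable_times g entry_measurable; simp)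
  then show ?thesis unfolding resid_def using True by simp
next
  case False
  then show ?thesis by (simp add: resid_def)
qed

lemma design_risk_measurable: "design_risk n p N lam \<in> borel_measurable PD"
  unfolding design_risk_def[abs_def]
  by (intro borel_measurable_sum borel_measurable_times borel_measurable_const borel_measurable_power resid_measurable) simp

lemma design_risk_nonneg: "0 \<le> design_risk n p N lam X"
  unfolding design_risk_def using lam_pos by (intro sum_nonneg mult_nonneg_nonneg) (auto intro: less_imp_le)

text \<open>By independence, \<open>\<theta>\<close> can be integrated out first with the design
  held fixed. The conditional expectation is identified by its integrals over events of the
  design.\<close>

lemma expected_error_eq:
  "AE \<omega> in M. expected_error M N n p lam sd x w theta \<omega> = design_risk n p N lam (D \<omega>)"
proof -
  define Fa where "Fa = vimage_algebra (space M) D PD"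
  let ?e = "pcr_error N n p lam sd x w theta"
  have DF: "D \<in> Fa \<rightarrow>\<^sub>M PD" unfolding Fa_def
    by (rule measurable_vimage_algebra1) (use measurable_space[OF design_measurable] in auto)
  have sub: "subalgebra M Fa"
    unfolding subalgebra_def Fa_def using measurable_space[OF design_measurable] measurable_sets[OF design_measurable]
    by (auto simp: sets_vimage_algebra2)
  interpret finite_measure_subalgebra M Fa by unfold_locales (rule sub)
  note m = theta_measurable design_measurable
  define g where "g t X = ennreal (\<Sum>j<N. lam j * (\<Sum>l<N. resid n p X j l * t l)\<^sup>2)" for t X
  have gm: "(\<lambda>z. g (fst z) (snd z)) \<in> borel_measurable (euc N \<Otimes>\<^sub>M PD)"
  proof -
    have "(\<lambda>z. fst z l) \<in> borel_measurable (euc N \<Otimes>\<^sub>M PD)" if "l < N" for l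
      by (rule measurable_compose[OF measurable_fst measurable_component_singleton]) (use that in simp)
    moreover have "(\<lambda>z. resid n p (snd z) j l) \<in> borel_measurable (euc N \<Otimes>\<^sub>M PD)" if "l < N" for j l
      by (rule measurable_compose[OF measurable_snd resid_measurable[OF that]])
    ultimately show ?thesis unfolding g_def
      by (intro measurable_compose[OF _ measurable_ennreal] borel_measurable_sum borel_measurable_times borel_measurable_const borel_measurable_power) auto
  qed
  have em: "?e \<in> borel_measurable M" by (rule pcr_error_measurable)
  have 1: "AE \<omega> in M. ennreal (design_risk n p N lam (D \<omega>)) = nn_cond_exp M Fa (\<lambda>\<omega>. ennreal (?e \<omega>)) \<omega>"
  proof (rule nn_cond_exp_charact)
    show "(\<lambda>\<omega>. ennreal (?e \<omega>)) \<in> borel_measurable M" using em by simp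
    show "(\<lambda>\<omega>. ennreal (design_risk n p N lam (D \<omega>))) \<in> borel_measurable Fa"
      using measurable_compose[OF DF design_risk_measurable] by simp
    fix A assume "A \<in> sets Fa"
    then obtain S where S: "S \<in> sets PD" "A = D -` S \<inter> space M"
      unfolding Fa_def using measurable_space[OF design_measurable] by (auto simp: sets_vimage_algebra2)
    define G where "G z = g (fst z) (snd z) * indicator S (snd z)" for z
    have Gm: "G \<in> borel_measurable (euc N \<Otimes>\<^sub>M PD)" unfolding G_def[abs_def]
      by (intro borel_measurable_times_ennreal gm measurable_compose[OF measurable_snd] borel_measurable_indicator S)
    \<comment> \<open>The noise vanishes almost surely, so the error becomes a function of
      \<open>\<theta>\<close> and the design, whose joint law is a product.\<close>
    have "(\<integral>\<^sup>+\<omega>\<in>A. ennreal (?e \<omega>) \<partial>M) = (\<integral>\<^sup>+\<omega>. G (theta \<omega>, D \<omega>) \<partial>M)"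
    proof (rule nn_integral_cong_AE)
      show "AE \<omega> in M. ennreal (?e \<omega>) * indicator A \<omega> = G (theta \<omega>, D \<omega>)"
        using noise_zero[OF sd0] AE_space
      proof eventually_elim
        case (elim \<omega>)
        then show ?case by (simp add: G_def g_def pcr_error_noiseless S indicator_def)
      qed
    qed
    also have "\<dots> = (\<integral>\<^sup>+z. G z \<partial>distr M (euc N \<Otimes>\<^sub>M PD) (\<lambda>\<omega>. (theta \<omega>, D \<omega>)))"
      using m Gm by (subst nn_integral_distr) auto
    also have "\<dots> = (\<integral>\<^sup>+z. G z \<partial>(distr M (euc N) theta \<Otimes>\<^sub>M distr M PD D))" by (simp only: theta_design_law)
    also have "\<dots> = (\<integral>\<^sup>+X. \<integral>\<^sup>+t. G (t, X) \<partial>distr M (euc N) theta \<partial>distr M PD D)"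
    proof -
      interpret a: prob_space "distr M (euc N) theta" by (rule prob_space_distr[OF m(1)])
      interpret b: prob_space "distr M PD D" by (rule prob_space_distr[OF m(2)])
      interpret ab: pair_sigma_finite "distr M (euc N) theta" "distr M PD D" by unfold_locales
      have "G \<in> borel_measurable (distr M (euc N) theta \<Otimes>\<^sub>M distr M PD D)"
        using Gm by (simp cong: measurable_cong_sets sets_pair_measure_cong)
      from ab.nn_integral_snd[OF this] show ?thesis by simp
    qed
    also have "\<dots> = (\<integral>\<^sup>+X. ennreal (design_risk n p N lam X) * indicator S X \<partial>distr M PD D)"
    proof (rule nn_integral_cong)
      fix X assume "X \<in> space (distr M PD D)"
      then have X: "X \<in> space PD" by simp
      have gX: "(\<lambda>t. g t X) \<in> borel_measurable (euc N)"
        using measurable_compose[OF measurable_Pair2'[OF X] gm] by simp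
      have "(\<integral>\<^sup>+t. G (t, X) \<partial>distr M (euc N) theta) = (\<integral>\<^sup>+t. g t X \<partial>distr M (euc N) theta) * indicator S X"
        unfolding G_def using gX by (simp add: nn_integral_multc)
      also have "(\<integral>\<^sup>+t. g t X \<partial>distr M (euc N) theta) = (\<integral>\<^sup>+\<omega>. g (theta \<omega>) X \<partial>M)"
        by (rule nn_integral_distr[OF m(1)]) (use gX in simp)
      also have "\<dots> = ennreal (design_risk n p N lam X)"
        unfolding g_def design_risk_def by (rule theta_quadratic)
      finally show "(\<integral>\<^sup>+t. G (t, X) \<partial>distr M (euc N) theta) = ennreal (design_risk n p N lam X) * indicator S X" .
    qed
    also have "\<dots> = (\<integral>\<^sup>+\<omega>. ennreal (design_risk n p N lam (D \<omega>)) * indicator S (D \<omega>) \<partial>M)"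
      using m design_risk_measurable S by (subst nn_integral_distr) auto
    also have "\<dots> = (\<integral>\<^sup>+\<omega>\<in>A. ennreal (design_risk n p N lam (D \<omega>)) \<partial>M)"
      by (rule nn_integral_cong) (simp add: S indicator_def)
    finally show "(\<integral>\<^sup>+\<omega>\<in>A. ennreal (?e \<omega>) \<partial>M) = (\<integral>\<^sup>+\<omega>\<in>A. ennreal (design_risk n p N lam (D \<omega>)) \<partial>M)" .
  qed
  \<comment> \<open>\<open>real_cond_exp\<close> is the difference of the conditional expectations
    of positive and negative part; the latter is 0.\<close>
  have en: "ennreal (- ?e \<omega>) = 0" for \<omega>
  proof -
    have "0 \<le> ?e \<omega>" unfolding pcr_error_sum using lam_pos
      by (intro sum_nonneg mult_nonneg_nonneg) (auto intro: less_imp_le)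
    then show ?thesis by (simp add: ennreal_neg)
  qed
  have 2: "AE \<omega> in M. 0 = nn_cond_exp M Fa (\<lambda>\<omega>. ennreal (- ?e \<omega>)) \<omega>"
    by (rule nn_cond_exp_charact) (auto simp: en)
  show ?thesis
    using 1 2
  proof eventually_elim
    case (elim \<omega>)
    then show ?case unfolding expected_error_def real_cond_exp_def Fa_def[symmetric]
      using design_risk_nonneg by (simp flip: elim)
  qed
qed

end

end

context pcr_model
begin

lemma design_law:
  assumes n: "0 < n" and N: "0 < N"
  shows "distr M PD D = distr (gpm (flat N n)) PD (rows n N lam)"
proof -
  have ne: "{..<n} \<noteq> {}" using n by auto
  have m: "x i \<in> M \<rightarrow>\<^sub>M euc N" if "i \<in> {..<n}" for i using x_indep that by (auto simp: indep_vars_def)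
  have "distr M PD D = distr M PD (\<lambda>\<omega>. \<lambda>i\<in>{..<n}. x i \<omega>)" by (simp add: design_rv_def[abs_def])
  also have "\<dots> = Pi\<^sub>M {..<n} (\<lambda>i. distr M (euc N) (x i))"
    by (rule indep_vars_iff_distr_eq_PiM'[where X=x and M'="\<lambda>_. euc N", OF ne m, THEN iffD1, OF _ x_indep])
  also have "\<dots> = Pi\<^sub>M {..<n} (\<lambda>_. gauss_diag N lam)" by (rule PiM_cong) (auto simp: x_law)
  also have "\<dots> = distr (gpm (flat N n)) PD (rows n N lam)" by (rule distr_rows[OF n N lam_pos, symmetric])
  finally show ?thesis .
qed

end

section \<open>The risk as a function of the Gaussian array\<close>

lemma rows_measurable: "rows n N lam \<in> gpm (flat N n) \<rightarrow>\<^sub>M Pi\<^sub>M {..<n} (\<lambda>_. euc N)"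
  unfolding rows_def[abs_def]
  by (intro measurable_restrict borel_measurable_times borel_measurable_const pb_measurable'[OF pb_coord]) auto

text \<open>Only for \<open>R\<close> the inverse Gram matrix, without ridge, is this the scaled risk of the estimator.\<close>

definition qrisk :: "real \<Rightarrow> nat \<Rightarrow> nat \<Rightarrow> nat \<Rightarrow> (nat \<Rightarrow> nat \<Rightarrow> real) \<Rightarrow> (nat \<times> nat \<Rightarrow> real) \<Rightarrow> real" where
  "qrisk \<kappa> p n N R f = (let w = (\<lambda>j. (real (j + 1) / real N) powr (- \<kappa>)) in
     (\<Sum>j<p. w j * (1 - w j * ip n (col f j) (mv n R (col f j)))) / N
     + (\<Sum>j\<in>{p..<N}. w j * (1 + (\<Sum>i<p. (w i)\<^sup>2 * (ip n (col f j) (mv n R (col f i)))\<^sup>2))) / N)"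

text \<open>A weight can be moved into the column as its square root; this passes from weighted
  columns to the unit weights of the Gram matrix.\<close>

lemma is_res_scale:
  assumes "\<And>j. j \<in> J \<Longrightarrow> 0 \<le> w j"
  shows "is_res n \<rho> (\<lambda>_. 1) J (\<lambda>j a. sqrt (w j) * z j a) R \<longleftrightarrow> is_res n \<rho> w J z R"
proof -
  have "(\<Sum>j\<in>J. 1 * (sqrt (w j) * z j a) * mv n R (\<lambda>a. sqrt (w j) * z j a) b) = (\<Sum>j\<in>J. w j * z j a * mv n R (z j) b)" for a b
  proof (intro sum.cong refl)
    fix j assume "j \<in> J"
    then have "sqrt (w j) * sqrt (w j) = w j" using assms by simp
    then show "1 * (sqrt (w j) * z j a) * mv n R (\<lambda>a. sqrt (w j) * z j a) b = w j * z j a * mv n R (z j) b"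
      unfolding mv_scale by (metis (no_types, opaque_lifting) mult.assoc mult.left_commute mult_1)
  qed
  then show ?thesis unfolding is_res_def by simp
qed

lemma singular_trace:
  assumes "\<And>j. j < p \<Longrightarrow> 0 \<le> w j" and none: "\<And>R. \<not> is_res n 0 w {..<p} (col f) R" and \<rho>: "0 < \<rho>"
  shows "1 / \<rho> \<le> trc n (res n \<rho> w {..<p} (col f))"
proof -
  define X where "X a j = sqrt (w j) * col f j a" for a j
  have i: "is_res n r (\<lambda>_. 1) {..<p} (xcol X) R \<longleftrightarrow> is_res n r w {..<p} (col f) R" for r R
    unfolding X_def by (rule is_res_scale) (use assms in auto)
  have "1 / \<rho> \<le> trc n (res n \<rho> (\<lambda>_. 1) {..<p} (xcol X))"
    by (rule trc_res_singular[OF _ \<rho>]) (use none i in auto)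
  then show ?thesis unfolding res_def i .
qed

text \<open>For a singular array the trace at ridge \<open>1 / Suc m\<close> is at least
  \<open>Suc m\<close>, while its mean is bounded independently of the ridge. Markov's inequality
  for all \<open>m\<close> leaves probability 0.\<close>

lemma AE_nonsingular:
  assumes dims: "n + 3 < p" "p \<le> N" and w: "\<And>j. j < N \<Longrightarrow> 1 \<le> w j"
  shows "AE f in gpm (flat N n). \<exists>R. is_res n 0 w {..<p} (col f) R"
proof -
  interpret P: prob_space "gpm (flat N n)" by (rule prob_space_gpm)
  define r where "r m = 1 / real (Suc m)" for m
  define Tm where "Tm m f = trc n (res n (r m) w {..<p} (col f))" for m f
  define d where "d = real p - real n - 3"
  have d: "0 < d" using dims by (simp add: d_def)
  have sub: "{..<p} \<subseteq> {..<N}" using dims by auto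
  have wnn: "0 \<le> w j" if "j < p" for j using w[of j] that dims by simp
  have W: "weighted N (r m) w" for m
    by unfold_locales (use w in \<open>auto simp: r_def intro: order_trans[of 0 1]\<close>)
  have pbT: "pb (flat N n) (Tm m)" for m
    unfolding Tm_def[abs_def] by (rule weighted.pb_quantities(1)[OF W sub])
  note [measurable] = pb_measurable'[OF pbT]
  define B where "B = {f \<in> space (gpm (flat N n)). \<forall>m. real (Suc m) \<le> Tm m f}"
  have Bs: "B \<in> sets (gpm (flat N n))" unfolding B_def by measurable
  have b: "measure (gpm (flat N n)) B \<le> (real n / d * 2) / real (Suc m)" for m
  proof -
    have "integral\<^sup>L (gpm (flat N n)) (Tm m) \<le> real n / (1 * d)"
      unfolding Tm_def[abs_def] by (rule weighted.moment_bounds(1)[OF W sub]) (use w dims d in \<open>auto simp: d_def\<close>)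
    then have ET: "integral\<^sup>L (gpm (flat N n)) (Tm m) \<le> real n / d" by simp
    have iT: "integrable (gpm (flat N n)) (Tm m)" by (rule pb_integrable[OF _ pbT]) simp
    \<comment> \<open>The threshold is halved because \<open>prob_markov\<close> bounds the
      probability of a strict inequality.\<close>
    have "measure (gpm (flat N n)) B \<le> measure (gpm (flat N n)) {f \<in> space (gpm (flat N n)). real (Suc m) / 2 < Tm m f}"
    proof (rule P.finite_measure_mono)
      show "B \<subseteq> {f \<in> space (gpm (flat N n)). real (Suc m) / 2 < Tm m f}"
      proof
        fix f assume "f \<in> B"
        then have "f \<in> space (gpm (flat N n))" "real (Suc m) \<le> Tm m f" by (auto simp: B_def)
        then show "f \<in> {f \<in> space (gpm (flat N n)). real (Suc m) / 2 < Tm m f}" by simp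
      qed
    qed measurable
    also have "\<dots> \<le> integral\<^sup>L (gpm (flat N n)) (Tm m) / (real (Suc m) / 2)"
      by (rule prob_markov[OF prob_space_gpm iT]) (auto simp: Tm_def intro: weighted.T_nonneg[OF W sub])
    also have "\<dots> \<le> (real n / d) / (real (Suc m) / 2)" using ET by (intro divide_right_mono) auto
    finally show ?thesis by simp
  qed
  have "(\<lambda>m. (real n / d * 2) / real (Suc m)) \<longlonglongrightarrow> 0"
    by (rule LIMSEQ_Suc[OF lim_const_over_n])
  then have "measure (gpm (flat N n)) B \<le> 0" by (rule LIMSEQ_le_const) (use b in auto)
  then have B0: "B \<in> null_sets (gpm (flat N n))"
    using Bs by (auto simp: P.emeasure_eq_measure null_sets_def measure_le_0_iff)
  show ?thesis
  proof (rule AE_I'[OF B0])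
    show "{f \<in> space (gpm (flat N n)). \<not> (\<exists>R. is_res n 0 w {..<p} (col f) R)} \<subseteq> B"
    proof safe
      fix f assume f: "f \<in> space (gpm (flat N n))" and none: "\<not> (\<exists>R. is_res n 0 w {..<p} (col f) R)"
      have "real (Suc m) \<le> Tm m f" for m
        unfolding Tm_def using singular_trace[of p w n f "r m", OF wnn] none by (auto simp: r_def)
      then show "f \<in> B" using f by (simp add: B_def)
    qed
  qed
qed

lemma design_risk_qrisk:
  assumes N: "0 < N" and p: "p \<le> N" and lam: "\<And>j. j < N \<Longrightarrow> lam j = real (j + 1) powr (- \<kappa>)"
    and R: "is_res n 0 (\<lambda>j. (real (j + 1) / real N) powr (- \<kappa>)) {..<p} (col f) R"
  shows "design_risk n p N lam (rows n N lam f) = real N powr (1 - \<kappa>) * qrisk \<kappa> p n N R f"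
proof -
  define w where "w j = (real (j + 1) / real N) powr (- \<kappa>)" for j :: nat
  \<comment> \<open>\<open>c * lam j\<close> is the weight \<open>w j\<close>, hence the inverse
    Gram matrix of the design is \<open>c\<close> times \<open>R\<close>.\<close>
  define c where "c = real N powr \<kappa>"
  let ?z = "col f" and ?X = "rows n N lam f"
  have Nr: "0 < real N" using N by simp
  have c: "0 < c" using Nr by (simp add: c_def)
  have w0: "0 < w j" for j using N by (simp add: w_def)
  have wl: "w j = c * lam j" if "j < N" for j
    using that Nr unfolding w_def c_def lam[OF that] by (simp add: powr_divide powr_minus field_simps)
  have l0: "0 < lam j" if "j < N" for j using lam[OF that] by simp
  have R': "is_res n 0 w {..<p} ?z R" using R by (simp add: w_def[abs_def])
  have xc: "xcol ?X j a = sqrt (lam j) * ?z j a" if "j < N" "a < n" for j a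
    using that by (simp add: rows_def col_def)
  define S where "S a b = c * R a b" for a b
  have mvS: "mv n S v b = c * mv n R v b" for v b by (simp add: mv_def S_def sum_distrib_left mult.assoc)
  have S: "is_ginv n p ?X S" unfolding is_res_def
  proof (intro conjI allI impI)
    fix a b assume ab: "a < n" "b < n"
    show "S a b = S b a" using is_res_sym[OF R' ab] by (simp add: S_def)
    have "(\<Sum>j<p. 1 * xcol ?X j a * mv n S (xcol ?X j) b) = (\<Sum>j<p. w j * ?z j a * mv n R (?z j) b)"
    proof (intro sum.cong refl)
      fix j assume "j \<in> {..<p}"
      then have j: "j < N" using p by simp
      have "mv n R (xcol ?X j) b = sqrt (lam j) * mv n R (?z j) b"
        using mv_cong[of n "xcol ?X j" "\<lambda>a. sqrt (lam j) * ?z j a" R] xc[OF j] by (simp add: mv_scale)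
      moreover have "sqrt (lam j) * sqrt (lam j) = lam j" using l0[OF j] by simp
      then have "1 * (sqrt (lam j) * u) * (c * (sqrt (lam j) * v)) = w j * u * v" for u v
        unfolding wl[OF j] by (metis (no_types, opaque_lifting) mult.assoc mult.left_commute mult_1)
      ultimately show "1 * xcol ?X j a * mv n S (xcol ?X j) b = w j * ?z j a * mv n R (?z j) b"
        using xc[OF j ab(1)] by (simp only: mvS)
    qed
    moreover have "0 * R a b + (\<Sum>j<p. w j * ?z j a * mv n R (?z j) b) = (if a = b then 1 else 0)"
      using R' ab unfolding is_res_def by blast
    ultimately show "0 * S a b + (\<Sum>j<p. 1 * xcol ?X j a * mv n S (xcol ?X j) b) = (if a = b then 1 else 0)" by simp
  next
    fix a b assume "a \<ge> n \<or> b \<ge> n"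
    then show "S a b = 0" using R' by (auto simp: S_def is_res_def)
  qed
  have g: "gram_inv n p ?X = S" by (rule gram_inv_ginv[OF S])
  define y where "y j l = ip n (?z j) (mv n R (?z l))" for j l
  have ysym: "y j l = y l j" for j l
    unfolding y_def using ip_mv_sym[of n R] is_res_sym[OF R'] by (metis ip_commute)
  have Pi: "ip n (xcol ?X j) (mv n (gram_inv n p ?X) (xcol ?X l)) = sqrt (lam j) * sqrt (lam l) * c * y j l"
    if "j < N" "l < N" for j l
  proof -
    have "ip n (xcol ?X j) (mv n S (xcol ?X l)) = ip n (\<lambda>a. sqrt (lam j) * ?z j a) (\<lambda>b. c * (sqrt (lam l) * mv n R (?z l) b))"
    proof (rule ip_cong)
      fix b
      show "mv n S (xcol ?X l) b = c * (sqrt (lam l) * mv n R (?z l) b)"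
        unfolding mvS using mv_cong[of n "xcol ?X l" "\<lambda>a. sqrt (lam l) * ?z l a" R] xc[OF that(2)] by (simp add: mv_scale)
    qed (use xc[OF that(1)] in auto)
    then show ?thesis unfolding g by (simp only: ip_scale_left ip_scale_right y_def mult_ac)
  qed
  have Pi2: "(sqrt (lam j) * sqrt (lam l) * c * y j l)\<^sup>2 = w j * w l * (y j l)\<^sup>2" if "j < N" "l < N" for j l
    unfolding wl[OF that(1)] wl[OF that(2)] using l0[OF that(1)] l0[OF that(2)]
    by (simp add: power_mult_distrib) (simp add: power2_eq_square[of c] mult_ac)
  have Pjj: "sqrt (lam j) * sqrt (lam j) * c * y j j = w j * y j j" if "j < N" for j
    unfolding wl[OF that] using l0[OF that] by simp
  \<comment> \<open>On the regression columns \<open>\<Pi>\<close> is an orthogonal projection: the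
    squares in row \<open>j\<close> sum to the diagonal entry. This uses that \<open>R\<close> is an
    exact inverse; a ridge would spoil it.\<close>
  have proj: "(\<Sum>l<p. w l * (y j l)\<^sup>2) = y j j" for j
  proof -
    have "gform n 0 w {..<p} ?z (mv n R (?z j)) (mv n R (?z j)) = ip n (mv n R (?z j)) (?z j)" by (rule gform_res[OF R'])
    moreover have "ip n (?z l) (mv n R (?z j)) = y j l" for l unfolding y_def[symmetric] by (rule ysym)
    moreover have "ip n (mv n R (?z j)) (?z j) = y j j" unfolding y_def by (rule ip_commute)
    ultimately show ?thesis by (simp add: gform_def power2_eq_square mult.assoc)
  qed
  have low: "lam j * (\<Sum>l<N. (resid n p ?X j l)\<^sup>2)
     = lam j * (1 - w j * y j j) + lam j * (\<Sum>l\<in>{p..<N}. w j * w l * (y j l)\<^sup>2)" if j: "j < p" for j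
  proof -
    have jN: "j < N" using j p by simp
    have sq: "(resid n p ?X j l)\<^sup>2 = (if j = l then 1 - 2 * (w j * y j j) else 0) + w j * w l * (y j l)\<^sup>2" if "l < N" for l
    proof (cases "j = l")
      case True
      have "(1 - u)\<^sup>2 = 1 - 2 * u + u\<^sup>2" for u :: real by (simp add: power2_eq_square algebra_simps)
      note e = this
      have "resid n p ?X j j = 1 - w j * y j j"
        using j Pi[OF jN jN, unfolded Pjj[OF jN]] by (simp add: resid_def)
      then have "(resid n p ?X j j)\<^sup>2 = 1 - 2 * (w j * y j j) + (w j * y j j)\<^sup>2" by (simp only: e)
      moreover have "(w j * y j j)\<^sup>2 = w j * w j * (y j j)\<^sup>2" by (simp add: power2_eq_square mult_ac)
      ultimately show ?thesis using True by simp
    next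
      case False
      then show ?thesis using j Pi[OF jN that] Pi2[OF jN that] by (simp add: resid_def)
    qed
    have "(\<Sum>l<N. (resid n p ?X j l)\<^sup>2) = (\<Sum>l<N. (if j = l then 1 - 2 * (w j * y j j) else 0)) + (\<Sum>l<N. w j * w l * (y j l)\<^sup>2)"
      by (simp add: sq sum.distrib)
    also have "(\<Sum>l<N. (if j = l then 1 - 2 * (w j * y j j) else 0)) = 1 - 2 * (w j * y j j)" using jN by simp
    also have "(\<Sum>l<N. w j * w l * (y j l)\<^sup>2) = (\<Sum>l<p. w j * w l * (y j l)\<^sup>2) + (\<Sum>l\<in>{p..<N}. w j * w l * (y j l)\<^sup>2)"
      unfolding lessThan_atLeast0 using p by (intro sum.atLeastLessThan_concat[symmetric]) auto
    also have "(\<Sum>l<p. w j * w l * (y j l)\<^sup>2) = w j * y j j"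
      unfolding proj[of j, symmetric] by (simp add: sum_distrib_left mult.assoc)
    finally have e: "(\<Sum>l<N. (resid n p ?X j l)\<^sup>2) = (1 - w j * y j j) + (\<Sum>l\<in>{p..<N}. w j * w l * (y j l)\<^sup>2)" by linarith
    show ?thesis unfolding e by (rule distrib_left)
  qed
  \<comment> \<open>Beyond the regression the estimator is 0, so this row of
    \<open>I - \<Pi>\<close> is a unit vector.\<close>
  have high: "lam j * (\<Sum>l<N. (resid n p ?X j l)\<^sup>2) = lam j" if "p \<le> j" "j < N" for j
  proof -
    have "(\<Sum>l<N. (resid n p ?X j l)\<^sup>2) = (\<Sum>l<N. if j = l then 1 else 0)"
      using that by (intro sum.cong refl) (simp add: resid_def)
    then show ?thesis using that by simp
  qed
  have lw: "lam j = w j / c" if "j < N" for j using wl[OF that] c by simp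
  have "design_risk n p N lam ?X = (\<Sum>j<p. lam j * (\<Sum>l<N. (resid n p ?X j l)\<^sup>2)) + (\<Sum>j\<in>{p..<N}. lam j * (\<Sum>l<N. (resid n p ?X j l)\<^sup>2))"
    unfolding design_risk_def lessThan_atLeast0 using p by (intro sum.atLeastLessThan_concat[symmetric]) auto
  also have "\<dots> = (\<Sum>j<p. w j / c * (1 - w j * y j j) + w j / c * (\<Sum>l\<in>{p..<N}. w j * w l * (y j l)\<^sup>2)) + (\<Sum>j\<in>{p..<N}. w j / c)"
  proof (intro arg_cong2[where f="(+)"] sum.cong refl)
    fix j assume "j \<in> {..<p}"
    then have "j < p" "j < N" using p by auto
    then show "lam j * (\<Sum>l<N. (resid n p ?X j l)\<^sup>2) = w j / c * (1 - w j * y j j) + w j / c * (\<Sum>l\<in>{p..<N}. w j * w l * (y j l)\<^sup>2)"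
      unfolding low[OF \<open>j < p\<close>] by (simp add: lw)
  next
    fix j assume "j \<in> {p..<N}"
    then show "lam j * (\<Sum>l<N. (resid n p ?X j l)\<^sup>2) = w j / c" using high[of j] lw[of j] by simp
  qed
  \<comment> \<open>By symmetry of \<open>y\<close> the cross terms are assigned to the outer column
    \<open>l\<close>, as in \<open>qrisk\<close>.\<close>
  also have "\<dots> = ((\<Sum>j<p. w j * (1 - w j * y j j)) + (\<Sum>j<p. \<Sum>l\<in>{p..<N}. w l * ((w j)\<^sup>2 * (y l j)\<^sup>2)) + (\<Sum>j\<in>{p..<N}. w j)) / c"
    by (simp add: sum.distrib add_divide_distrib sum_divide_distrib sum_distrib_left power2_eq_square ysym mult_ac)
  also have "(\<Sum>j<p. \<Sum>l\<in>{p..<N}. w l * ((w j)\<^sup>2 * (y l j)\<^sup>2)) = (\<Sum>l\<in>{p..<N}. w l * (\<Sum>j<p. (w j)\<^sup>2 * (y l j)\<^sup>2))"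
    by (subst sum.swap) (simp add: sum_distrib_left)
  also have "((\<Sum>j<p. w j * (1 - w j * y j j)) + (\<Sum>l\<in>{p..<N}. w l * (\<Sum>j<p. (w j)\<^sup>2 * (y l j)\<^sup>2)) + (\<Sum>j\<in>{p..<N}. w j)) / c
    = real N / c * ((\<Sum>j<p. w j * (1 - w j * y j j)) / N + (\<Sum>l\<in>{p..<N}. w l * (1 + (\<Sum>j<p. (w j)\<^sup>2 * (y l j)\<^sup>2))) / N)"
    using Nr c by (simp add: distrib_left sum.distrib add_divide_distrib)
  also have "\<dots> = real N powr (1 - \<kappa>) * qrisk \<kappa> p n N R f"
    using Nr by (simp add: qrisk_def Let_def w_def y_def c_def powr_diff)
  finally show ?thesis .
qed

section \<open>Letting the ridge vanish\<close>

lemma qrisk_tendsto: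
  assumes "\<And>a b. (\<lambda>m. R m a b) \<longlonglongrightarrow> R0 a b"
  shows "(\<lambda>m. qrisk \<kappa> p n N (R m) f) \<longlonglongrightarrow> qrisk \<kappa> p n N R0 f"
  unfolding qrisk_def Let_def inner_N_def mv_def divide_inverse
  by (intro tendsto_intros assms)

text \<open>Where the Gram matrix is invertible, the ridge resolvents converge entrywise to its
  inverse, and \<open>qrisk\<close> is a polynomial in these entries.\<close>

lemma qrisk_limit:
  assumes dims: "n + 3 < p" "p \<le> N" and \<kappa>: "0 < \<kappa>" and lam: "\<And>j. j < N \<Longrightarrow> lam j = real (j + 1) powr (- \<kappa>)"
  shows "AE f in gpm (flat N n). (\<lambda>m. qrisk \<kappa> p n N (res n (1 / real (Suc m)) (\<lambda>j. (real (j + 1) / real N) powr (- \<kappa>)) {..<p} (col f)) f)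
    \<longlonglongrightarrow> design_risk n p N lam (rows n N lam f) / real N powr (1 - \<kappa>)"
proof -
  have N: "0 < N" using dims by simp
  let ?w = "\<lambda>j. (real (j + 1) / real N) powr (- \<kappa>)"
  have w: "1 \<le> ?w j" if "j < N" for j
  proof -
    have "(real (j + 1) / real N) powr \<kappa> \<le> 1" using that \<kappa> by (intro powr_le1) auto
    then show ?thesis using that by (simp add: powr_minus one_le_inverse_iff)
  qed
  have "AE f in gpm (flat N n). \<exists>R. is_res n 0 ?w {..<p} (col f) R" by (rule AE_nonsingular[OF dims w])
  then show ?thesis
  proof eventually_elim
    case (elim f)
    then obtain R where R: "is_res n 0 ?w {..<p} (col f) R" by blast
    have Rm: "is_res n (1 / real (Suc m)) ?w {..<p} (col f) (res n (1 / real (Suc m)) ?w {..<p} (col f))" for m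
      by (rule res_is_res) auto
    have "design_risk n p N lam (rows n N lam f) / real N powr (1 - \<kappa>) = qrisk \<kappa> p n N R f"
      using design_risk_qrisk[OF N dims(2) lam R] N by simp
    moreover have "(\<lambda>m. qrisk \<kappa> p n N (res n (1 / real (Suc m)) ?w {..<p} (col f)) f) \<longlonglongrightarrow> qrisk \<kappa> p n N R f"
      by (intro qrisk_tendsto res_tendsto0[OF Rm R _ LIMSEQ_Suc[OF lim_1_over_n]]) auto
    ultimately show ?case by simp
  qed
qed

text \<open>The strict inequality is an open condition, so on that event the approximants satisfy it
  eventually, and dominated convergence makes the exceptional part small. Some \<open>m\<close> is
  obtained, without a rate.\<close>

lemma prob_AE_limit:
  fixes X :: "nat \<Rightarrow> 'a \<Rightarrow> real" and Y :: "'a \<Rightarrow> real"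
  assumes P: "prob_space M" and X: "\<And>m::nat. X m \<in> borel_measurable M" and Y: "Y \<in> borel_measurable M"
    and lim: "AE f in M. (\<lambda>m. X m f) \<longlonglongrightarrow> Y f" and d: "0 < (d::real)"
  shows "\<exists>m. measure M {f \<in> space M. c < \<bar>Y f - l\<bar>} \<le> measure M {f \<in> space M. c < \<bar>X m f - l\<bar>} + (d::real)"
proof -
  interpret prob_space M by (rule P)
  note [measurable] = X Y
  define A where "A = {f \<in> space M. c < \<bar>Y f - l\<bar>}"
  define B where "B m = {f \<in> space M. c < \<bar>X m f - l\<bar>}" for m
  have [measurable]: "A \<in> sets M" "\<And>m. B m \<in> sets M" unfolding A_def B_def by measurable
  have "(\<lambda>m. integral\<^sup>L M (indicat_real (A - B m))) \<longlonglongrightarrow> integral\<^sup>L M (\<lambda>_. 0::real)"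
  proof (rule integral_dominated_convergence[where w="\<lambda>_. 1"])
    show "AE f in M. (\<lambda>m. indicat_real (A - B m) f) \<longlonglongrightarrow> 0"
      using lim AE_space
    proof eventually_elim
      case (elim f)
      have "eventually (\<lambda>m. indicat_real (A - B m) f = 0) sequentially"
      proof (cases "f \<in> A")
        case True
        have "(\<lambda>m. \<bar>X m f - l\<bar>) \<longlonglongrightarrow> \<bar>Y f - l\<bar>" by (intro tendsto_intros elim)
        then have "eventually (\<lambda>m. c < \<bar>X m f - l\<bar>) sequentially"
          by (rule order_tendstoD(1)) (use True in \<open>simp add: A_def\<close>)
        then show ?thesis by eventually_elim (use elim in \<open>simp add: B_def\<close>)
      qed simp
      then show ?case by (simp add: tendsto_eventually)
    qed
    show "AE f in M. norm (indicat_real (A - B m) f) \<le> 1" for m by (auto simp: indicator_def)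
  qed auto
  then have "(\<lambda>m. measure M (A - B m)) \<longlonglongrightarrow> 0" by simp
  from eventually_happens[OF order_tendstoD(2)[OF this d]] obtain m where m: "measure M (A - B m) < d" by auto
  have "measure M A \<le> measure M (B m \<union> (A - B m))" by (rule finite_measure_mono) auto
  also have "\<dots> \<le> measure M (B m) + measure M (A - B m)" by (rule measure_Un_le) auto
  finally show ?thesis using m unfolding A_def B_def by (intro exI[of _ m]) simp
qed

context asymptotic
begin

lemma Q_qrisk: "Q k f = qrisk \<kappa> (p k) (n k) (N k)
    (res (n k) (\<rho> k) (\<lambda>j. (real (j + 1) / real (N k)) powr (- \<kappa>)) {..<p k} (col f)) f"
  by (simp add: Q_def T1_def Rb_def pt_def qrisk_def Let_def)

end

text \<open>The ratio \<open>\<beta> / (\<beta> - S2)\<close> is split as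
  \<open>1 + S2 / (\<beta> - S2)\<close>: the 1 is the direct loss by the omitted columns, the rest
  is the limit of \<open>trB\<close>, by which they disturb the fit.\<close>

lemma (in power_spectrum) risk_limit_eq:
  "risk_limit \<kappa> \<alpha> \<beta> N = real N powr (1 - \<kappa>) * (\<beta> / \<mu> + integral {\<alpha>..1} (\<lambda>s. s powr (- \<kappa>)) * (1 + S2 / (\<beta> - S2)))"
proof -
  have c: "continuous_on {\<alpha>..1} (\<lambda>s. s powr (- \<kappa>))" using \<alpha>_pos by (intro continuous_intros) auto
  have "(LINT t:{\<alpha>..1}|lborel. t powr (- \<kappa>)) = integral {\<alpha>..1} (\<lambda>s. s powr (- \<kappa>))"
    by (rule set_borel_integral_eq_integral(2)[OF borel_integrable_atLeastAtMost'[OF c]])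
  moreover have "m_kappa_deriv \<kappa> \<alpha> \<beta> 0 / (m_kappa \<kappa> \<alpha> \<beta> 0)\<^sup>2 = 1 + S2 / (\<beta> - S2)"
    unfolding m_kappa_deriv_0 \<mu>_def[symmetric] using \<mu>(1) S2_less by (simp add: field_simps)
  ultimately show ?thesis by (simp add: risk_limit_def \<mu>_def[symmetric])
qed

lemma tendsto_zero_squeeze:
  fixes a b :: "nat \<Rightarrow> real"
  assumes "b \<longlonglongrightarrow> 0" "\<And>k. 0 \<le> a k" "eventually (\<lambda>k. a k \<le> b k + 1 / real (Suc k)) sequentially"
  shows "a \<longlonglongrightarrow> 0"
proof (rule tendsto_sandwich[OF _ assms(3) tendsto_const])
  show "(\<lambda>k. b k + 1 / real (Suc k)) \<longlonglongrightarrow> 0"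
    using tendsto_add[OF assms(1) LIMSEQ_Suc[OF lim_1_over_n[where 'a=real]]] by simp
qed (simp add: assms(2))

text \<open>Up to a null set the averaged error is a function of the design, whose law is that of
  \<open>rows\<close>; so its tail is a probability for the Gaussian array.\<close>

lemma (in pcr_model) expected_error_law:
  assumes np: "n < p" and pN: "p \<le> N" and n0: "0 < n" and sd0: "sd = 0"
    and S: "0 < S" and L: "0 < L"
  shows "measure M {\<omega> \<in> space M. \<bar>expected_error M N n p lam sd x w theta \<omega> / (S * L) - 1\<bar> > e}
    = measure (gpm (flat N n)) {f \<in> space (gpm (flat N n)). e * L < \<bar>design_risk n p N lam (rows n N lam f) / S - L\<bar>}"
proof -
  have N0: "0 < N" using np pN by simp
  let ?g = "\<lambda>v. \<bar>v / (S * L) - 1\<bar>"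
  let ?dr = "design_risk n p N lam"
  note [measurable] = design_measurable design_risk_measurable[OF np pN sd0] rows_measurable
  \<comment> \<open>A relative deviation \<open>e\<close> from \<open>S * L\<close> is an absolute
    deviation \<open>e * L\<close> after division by the scale \<open>S\<close>.\<close>
  have eqv: "e < ?g v \<longleftrightarrow> e * L < \<bar>v / S - L\<bar>" for v
  proof -
    have "v / S - L = (v / (S * L) - 1) * L" using S L by (simp add: field_simps)
    then have "\<bar>v / S - L\<bar> = ?g v * L" using L by (simp add: abs_mult)
    then show ?thesis using L by simp
  qed
  have A: "{X \<in> space PD. e < ?g (?dr X)} \<in> sets PD" by measurable
  have m: "expected_error M N n p lam sd x w theta \<in> borel_measurable M"
    unfolding expected_error_def by (rule borel_measurable_cond_exp2)
  note [measurable] = m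
  have "measure M {\<omega> \<in> space M. e < ?g (expected_error M N n p lam sd x w theta \<omega>)}
      = measure M {\<omega> \<in> space M. e < ?g (?dr (D \<omega>))}"
  proof (rule finite_measure_eq_AE)
    show "AE \<omega> in M. (\<omega> \<in> {\<omega> \<in> space M. e < ?g (expected_error M N n p lam sd x w theta \<omega>)})
      = (\<omega> \<in> {\<omega> \<in> space M. e < ?g (?dr (D \<omega>))})"
      using expected_error_eq[OF np pN sd0] by eventually_elim auto
  qed measurable
  also have "{\<omega> \<in> space M. e < ?g (?dr (D \<omega>))} = D -` {X \<in> space PD. e < ?g (?dr X)} \<inter> space M"
    using measurable_space[OF design_measurable] by auto
  also have "measure M \<dots> = measure (distr M PD D) {X \<in> space PD. e < ?g (?dr X)}"
    by (rule measure_distr[OF design_measurable A, symmetric])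
  also have "\<dots> = measure (gpm (flat N n)) (rows n N lam -` {X \<in> space PD. e < ?g (?dr X)} \<inter> space (gpm (flat N n)))"
    unfolding design_law[OF n0 N0] by (rule measure_distr[OF rows_measurable A])
  also have "rows n N lam -` {X \<in> space PD. e < ?g (?dr X)} \<inter> space (gpm (flat N n))
      = {f \<in> space (gpm (flat N n)). e * L < \<bar>?dr (rows n N lam f) / S - L\<bar>}"
    using measurable_space[OF rows_measurable[of n N lam]] by (auto simp: eqv)
  finally show ?thesis .
qed

context power_spectrum
begin

text \<open>A positive constant turns convergence of the scaled risk into convergence of the
  quotient to 1.\<close>

lemma risk_limit_const_pos:
  "0 < \<beta> / \<mu> + integral {\<alpha>..1} (\<lambda>s. s powr (- \<kappa>)) * (1 + S2 / (\<beta> - S2))"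
proof -
  have "0 \<le> integral {\<alpha>..1} (\<lambda>s. s powr (- \<kappa>))" by (rule Henstock_Kurzweil_Integration.integral_nonneg)
    (use \<alpha>_pos in \<open>auto intro!: integrable_continuous_interval continuous_intros\<close>)
  then show ?thesis using \<mu>(1) \<beta> S2_less S2_nonneg by (intro add_pos_nonneg mult_nonneg_nonneg divide_pos_pos) auto
qed

end

theorem theorem2:
  fixes \<kappa> \<alpha> \<beta> \<sigma> :: real
    and p n N :: "nat \<Rightarrow> nat"
    and lam :: "nat \<Rightarrow> nat \<Rightarrow> real"
    and M :: "nat \<Rightarrow> 'a measure"
    and x :: "nat \<Rightarrow> nat \<Rightarrow> 'a \<Rightarrow> nat \<Rightarrow> real"
    and w :: "nat \<Rightarrow> nat \<Rightarrow> 'a \<Rightarrow> real"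
    and \<theta> :: "nat \<Rightarrow> 'a \<Rightarrow> nat \<Rightarrow> real"
  assumes "\<kappa> > 0" and "0 < \<beta>" and "\<beta> < 1" and "\<beta> < \<alpha>" and "\<alpha> \<le> 1"
    and model: "\<And>k. pcr_model (M k) (N k) (n k) (lam k) \<sigma> (x k) (w k) (\<theta> k)"
    and eigenvalues: "\<And>k j. j < N k \<Longrightarrow> lam k j = real (j + 1) powr (- \<kappa>)"
    and no_noise: "\<sigma>\<^sup>2 = 0"
    and "\<And>k. p k \<le> N k"
    and "filterlim p at_top sequentially"
    and "filterlim n at_top sequentially"
    and "filterlim N at_top sequentially"
    and "(\<lambda>k. real (p k) / real (N k)) \<longlonglongrightarrow> \<alpha>"
    and "(\<lambda>k. real (n k) / real (N k)) \<longlonglongrightarrow> \<beta>"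
  shows "(\<forall>z\<le>0. \<exists>!m. is_m_kappa \<kappa> \<alpha> \<beta> z m)
    \<and> m_kappa \<kappa> \<alpha> \<beta> 0 > 0
    \<and> m_kappa \<kappa> \<alpha> \<beta> differentiable (at 0 within {..0})
    \<and> m_kappa_deriv \<kappa> \<alpha> \<beta> 0 > 0
    \<and> equiv_in_prob M
        (\<lambda>k. expected_error (M k) (N k) (n k) (p k) (lam k) \<sigma> (x k) (w k) (\<theta> k))
        (\<lambda>k. risk_limit \<kappa> \<alpha> \<beta> (N k))"
proof -
  have s0: "\<sigma> = 0" using no_noise by simp
  interpret power_spectrum \<kappa> \<alpha> \<beta> by unfold_locales (use assms in auto)
  define L where "L = \<beta> / \<mu> + integral {\<alpha>..1} (\<lambda>s. s powr (- \<kappa>)) * (1 + S2 / (\<beta> - S2))"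
  have L: "0 < L" unfolding L_def by (rule risk_limit_const_pos)
  have asy: "asymptotic \<kappa> \<alpha> \<beta> p n N \<rho>" if "\<And>k. 0 < \<rho> k" "\<And>k. \<rho> k \<le> 1" for \<rho>
    by unfold_locales (use assms that in auto)
  define Qm where "Qm k m f = qrisk \<kappa> (p k) (n k) (N k)
    (res (n k) (1 / real (Suc m)) (\<lambda>j. (real (j + 1) / real (N k)) powr (- \<kappa>)) {..<p k} (col f)) f" for k m f
  let ?G = "\<lambda>k. gpm (flat (N k) (n k))"
  \<comment> \<open>The index \<open>c\<close> of the ridge is free; it is fixed below, after the
    quality of the approximation at each \<open>k\<close> is known.\<close>
  have conv: "conv_prob ?G (\<lambda>k. Qm k (c k)) L" for c
  proof -
    interpret a: asymptotic \<kappa> \<alpha> \<beta> p n N "\<lambda>k. 1 / real (Suc (c k))" by (rule asy) auto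
    have "a.Q = (\<lambda>k. Qm k (c k))" by (intro ext) (simp only: a.Q_qrisk Qm_def)
    then show ?thesis using a.Q_conv unfolding a.V_def a.bb_def L_def by (simp only:)
  qed
  have Qmeas: "Qm k m \<in> borel_measurable (?G k)" for k m
    by (rule conv_prob_measurable[OF conv[of "\<lambda>_. m"]])
  \<comment> \<open>The facts about the dimensions do not involve the ridge; the constant sequence 1
    gives access to them.\<close>
  interpret a1: asymptotic \<kappa> \<alpha> \<beta> p n N "\<lambda>_. 1" by (rule asy) auto
  have "eventually (\<lambda>k. 0 < n k) sequentially" by (rule eventually_compose_filterlim[OF eventually_gt_at_top assms(11)])
  with a1.eventually_dims have good: "eventually (\<lambda>k. 0 < n k \<and> n k + 3 < p k) sequentially"
  proof eventually_elim
    case (elim k)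
    moreover have "0 < (\<alpha> - \<beta>) / 2 * real (N k)" using elim \<beta> by simp
    ultimately have "0 < real (p k) - 1 - real (n k) - 3" by linarith
    then show ?case using elim by linarith
  qed
  have "equiv_in_prob M
        (\<lambda>k. expected_error (M k) (N k) (n k) (p k) (lam k) \<sigma> (x k) (w k) (\<theta> k))
        (\<lambda>k. risk_limit \<kappa> \<alpha> \<beta> (N k))"
    unfolding equiv_in_prob_def
  proof (intro allI impI)
    fix \<epsilon> :: real assume \<epsilon>: "0 < \<epsilon>"
    \<comment> \<open>At stage \<open>k\<close> the ridge is so small that the tail without ridge
      exceeds the one with ridge by at most \<open>1 / Suc k\<close>. Such an index exists for all
      \<open>k\<close> in \<open>good\<close>, and the choice is evaluated only there.\<close>
    define c where "c k = (SOME m. measure (?G k) {f \<in> space (?G k). \<epsilon> * L < \<bar>design_risk (n k) (p k) (N k) (lam k) (rows (n k) (N k) (lam k) f) / real (N k) powr (1 - \<kappa>) - L\<bar>}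
        \<le> measure (?G k) {f \<in> space (?G k). \<epsilon> * L < \<bar>Qm k m f - L\<bar>} + 1 / real (Suc k))" for k
    have lim: "(\<lambda>k. measure (?G k) {f \<in> space (?G k). \<epsilon> * L < \<bar>Qm k (c k) f - L\<bar>}) \<longlonglongrightarrow> 0"
      using conv[of c] \<epsilon> L by (simp add: conv_prob_def)
    show "(\<lambda>k. measure (M k) {\<omega> \<in> space (M k).
        \<bar>expected_error (M k) (N k) (n k) (p k) (lam k) \<sigma> (x k) (w k) (\<theta> k) \<omega> / risk_limit \<kappa> \<alpha> \<beta> (N k) - 1\<bar> > \<epsilon>}) \<longlonglongrightarrow> 0"
    proof (rule tendsto_zero_squeeze[OF lim])
      show "eventually (\<lambda>k. measure (M k) {\<omega> \<in> space (M k).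
        \<bar>expected_error (M k) (N k) (n k) (p k) (lam k) \<sigma> (x k) (w k) (\<theta> k) \<omega> / risk_limit \<kappa> \<alpha> \<beta> (N k) - 1\<bar> > \<epsilon>}
        \<le> measure (?G k) {f \<in> space (?G k). \<epsilon> * L < \<bar>Qm k (c k) f - L\<bar>} + 1 / real (Suc k)) sequentially"
        using good
      proof eventually_elim
        case (elim k)
        interpret pcr_model "M k" "N k" "n k" "lam k" \<sigma> "x k" "w k" "\<theta> k" by (rule model)
        have np: "n k < p k" and n0: "0 < n k" and n3: "n k + 3 < p k" using elim by auto
        have pN: "p k \<le> N k" by (rule assms(9))
        have S: "0 < real (N k) powr (1 - \<kappa>)" using np pN by simp
        have Y: "(\<lambda>f. design_risk (n k) (p k) (N k) (lam k) (rows (n k) (N k) (lam k) f) / real (N k) powr (1 - \<kappa>)) \<in> borel_measurable (?G k)"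
          by (intro borel_measurable_divide borel_measurable_const measurable_compose[OF rows_measurable design_risk_measurable[OF np pN s0]])
        have "AE f in ?G k. (\<lambda>m. Qm k m f) \<longlonglongrightarrow> design_risk (n k) (p k) (N k) (lam k) (rows (n k) (N k) (lam k) f) / real (N k) powr (1 - \<kappa>)"
          unfolding Qm_def by (rule qrisk_limit[OF n3 pN assms(1) eigenvalues])
        from prob_AE_limit[OF prob_space_gpm Qmeas Y this, of "1 / real (Suc k)" "\<epsilon> * L" L]
        have "\<exists>m. measure (?G k) {f \<in> space (?G k). \<epsilon> * L < \<bar>design_risk (n k) (p k) (N k) (lam k) (rows (n k) (N k) (lam k) f) / real (N k) powr (1 - \<kappa>) - L\<bar>}
          \<le> measure (?G k) {f \<in> space (?G k). \<epsilon> * L < \<bar>Qm k m f - L\<bar>} + 1 / real (Suc k)" by simp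
        from someI_ex[OF this] show ?case
          unfolding risk_limit_eq L_def[symmetric] c_def[symmetric] expected_error_law[OF np pN n0 s0 S L] .
      qed
    qed simp
  qed
  moreover have "m_kappa \<kappa> \<alpha> \<beta> differentiable (at 0 within {..0})"
    by (rule m_kappa_has_derivative[unfolded has_field_derivative_def, THEN differentiableI])
  moreover have "0 < m_kappa_deriv \<kappa> \<alpha> \<beta> 0"
    unfolding m_kappa_deriv_0 using \<mu>(1) \<beta> S2_less by simp
  moreover have "0 < m_kappa \<kappa> \<alpha> \<beta> 0" using \<mu>(1) by (simp add: \<mu>_def)
  moreover have "\<forall>z\<le>0. \<exists>!m. is_m_kappa \<kappa> \<alpha> \<beta> z m" using is_m_kappa_ex1 by blast
  ultimately show ?thesis by blast
qed

end
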